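(* Let $\Bbbk$ be a field and let $(\mathscr{P},\le)$ be a Koszul poset (in particular finite and graded). Let $A=\Bbbk^a[\mathscr{P}]$ be its incidence $R$-ring and $C=\Bbbk^c[\mathscr{P}]$ its incidence $R$-coring, where $R=\Bbbk^{\#\mathscr{P}}$. Then there is an isomorphism of graded $R$-rings $$\mathscr{E}(\Bbbk^a[\mathscr{P}])\;\simeq\;\Bbbk^c[\mathscr{P}]^!,$$ where $\mathscr{E}(\Bbbk^a[\mathscr{P}])=\mathrm{Ext}^\bullet_{\Bbbk^a[\mathscr{P}]}(R,R)$ and $\Bbbk^c[\mathscr{P}]^!$ is the shriek ring associated to the incidence $R$-coring of $\mathscr{P}$.
   Context: An $R$-ring (resp. $R$-coring) is an algebra (resp. coalgebra) in the tensor category of $R$-bimodules; tensor products are over $R$. A graded $R$-ring $A=\bigoplus_{n\ge 0} A^n$ is connected if $A^0=R$; a graded $R$-coring $C=\bigoplus_{n\ge 0} C_n$ is connected if $C_0=R$. A finite poset $\mathscr{P}$ is graded if all its maximal chains have the same length; for $x\le y$, $l([x,y])$ is the length (number of steps) of a maximal chain in the interval $[x,y]$. The incidence ring $\Bbbk^a[\mathscr{P}]$ has $\Bbbk$-basis $\{e_{x,y}: x\le y\}$ with $e_{x,y}e_{z,u}=\delta_{y,z}e_{x,u}$; it is a connected graded $R$-ring with $e_{x,y}$ of degree $l([x,y])$, where $R=\bigoplus_x\Bbbk e_{x,x}\cong\Bbbk^{\#\mathscr{P}}$. The incidence coring $\Bbbk^c[\mathscr{P}]$ has the same basis, grading and $R$-bimodule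 structure, and comultiplication $\Delta(e_{x,y})=\sum_{x\le z\le y}e_{x,z}\otimes e_{z,y}$. Koszul: a connected graded $R$-ring $A$ ($R$ semisimple) is Koszul if the left $A$-module $R=A/\bigoplus_{n>0}A^n$ has a resolution by graded projective left $A$-modules $P_n$, with $P_n$ generated by its component of degree $n$ for every $n\ge 0$. The finite graded poset $\mathscr{P}$ is Koszul if $\Bbbk^a[\mathscr{P}]$ is a Koszul $R$-ring. $\mathscr{E}(A)=\mathrm{Ext}^\bullet_A(R,R)$ (Ext of left $A$-modules) is the cohomology of $\mathrm{Hom}_R(\Omega_\bullet(A),R)$ (left $R$-linear maps), where $A_+=\bigoplus_{n>0}A^n$, $\Omega_n(A)=A_+^{(n)}$ ($n$-fold tensor power over $R$, with $A_+^{(0)}=R$), $d_1=0$, $d_n(a_1\otimes\cdots\otimes a_n)=\sum_{i=1}^{n-1}(-1)^{i-1}a_1\otimes\cdots\otimes a_ia_{i+1}\otimes\cdots\otimes a_n$; its cup product is induced by $(f\cup g)(a_1\otimes\cdots\otimes a_{n+m})=f\big(a_1\otimes\cdots\otimes a_n\,g(a_{n+1}\otimes\cdots\otimes a_{n+m})\big)$. With this product it is an $R^{op}$-ring, and $R^{op}=R$ since $R$ is commutative: the left $R$-action is $(r\cdot f)(v)=f(v)r$ and the right one is $(f\cdot r)(v)=f(vr)$. Shriek ring: for a connected graded $R$-coring $C$, $C^!=T_R(C_1)/\langle\mathrm{Im}\,\Delta_{1,1}\rangle$, the quotient of the tensor $R$-ring of the bimodule $C_1$ by the two-sided ideal generated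 by the image of the component $\Delta_{1,1}:C_2\to C_1\otimes C_1$ of the comultiplication. *)

theory Defs
  imports "HOL-Algebra.QuotRing" "HOL-Algebra.Module" "HOL-Algebra.Generated_Groups" "HOL-Library.Poly_Mapping"
begin

section \<open>Graded bimodules, \<open>R\<close>-rings and \<open>R\<close>-corings\<close>

text \<open>
  As for the record \<open>module\<close> of \<open>HOL-Algebra\<close>, the fields \<open>mult\<close> and \<open>one\<close> of a bimodule
  carry no information. In an \<open>R\<close>-ring they are the product and the unit, and the structure
  map is \<open>R \<rightarrow> A, r \<mapsto> r \<cdot> 1\<close>. The homogeneous component of degree \<open>n\<close> is \<open>hcomp A n\<close>.
\<close>

record ('r, 'm) bimodule = "'m ring" +
  lact :: "'r \<Rightarrow> 'm \<Rightarrow> 'm"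
  ract :: "'m \<Rightarrow> 'r \<Rightarrow> 'm"

record ('r, 'm) graded_bimodule = "('r, 'm) bimodule" +
  hcomp :: "nat \<Rightarrow> 'm set"

text \<open>
  All the maps out of quotients below are given on representatives: \<open>descend h U\<close> is
  the value of \<open>h\<close> on the class \<open>U\<close>, for \<open>h\<close> constant on \<open>U\<close>.
\<close>

definition descend :: "('a \<Rightarrow> 'b) \<Rightarrow> 'a set \<Rightarrow> 'b" where
  "descend h U = the_elem (h ` U)"

definition quotient_rring ::
  "('r, 'm, 'x) graded_bimodule_scheme \<Rightarrow> 'm set \<Rightarrow> ('r, 'm set) graded_bimodule" where
  "quotient_rring A I =
    \<lparr>carrier = carrier (A Quot I), mult = (\<otimes>\<^bsub>A Quot I\<^esub>), one = \<one>\<^bsub>A Quot I\<^esub>,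
     zero = \<zero>\<^bsub>A Quot I\<^esub>, add = (\<oplus>\<^bsub>A Quot I\<^esub>),
     lact = (\<lambda>r. descend (\<lambda>x. I +>\<^bsub>A\<^esub> lact A r x)),
     ract = (\<lambda>U r. descend (\<lambda>x. I +>\<^bsub>A\<^esub> ract A x r) U),
     hcomp = (\<lambda>n. (\<lambda>x. I +>\<^bsub>A\<^esub> x) ` hcomp A n)\<rparr>"

definition graded_rring_iso ::
  "('r, 'w) ring_scheme \<Rightarrow> ('r, 'm, 'x) graded_bimodule_scheme \<Rightarrow>
   ('r, 'n, 'y) graded_bimodule_scheme \<Rightarrow> ('m \<Rightarrow> 'n) set" where
  "graded_rring_iso R E F =
    {\<phi> \<in> ring_iso E F.
       (\<forall>r\<in>carrier R. \<forall>x\<in>carrier E.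
          \<phi> (lact E r x) = lact F r (\<phi> x) \<and> \<phi> (ract E x r) = ract F (\<phi> x) r) \<and>
       (\<forall>n. \<phi> ` hcomp E n = hcomp F n)}"

definition homogeneous_decomposition ::
  "('m, 'x) ring_scheme \<Rightarrow> (nat \<Rightarrow> 'm set) \<Rightarrow> 'm \<Rightarrow> (nat \<Rightarrow> 'm) \<Rightarrow> bool" where
  "homogeneous_decomposition M G x c \<longleftrightarrow>
     (\<forall>n. c n \<in> G n) \<and> finite {n. c n \<noteq> \<zero>\<^bsub>M\<^esub>} \<and> x = finsum M c {n. c n \<noteq> \<zero>\<^bsub>M\<^esub>}"

definition internal_direct_sum :: "('m, 'x) ring_scheme \<Rightarrow> (nat \<Rightarrow> 'm set) \<Rightarrow> bool" where
  "internal_direct_sum M G \<longleftrightarrow>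
     (\<forall>n. subgroup (G n) (add_monoid M)) \<and>
     (\<forall>x\<in>carrier M. \<exists>!c. homogeneous_decomposition M G x c)"

definition homogeneous_part ::
  "('r, 'm, 'x) graded_bimodule_scheme \<Rightarrow> nat \<Rightarrow> 'm \<Rightarrow> 'm" where
  "homogeneous_part M n x = (THE c. homogeneous_decomposition M (hcomp M) x c) n"

definition augmentation_ideal :: "('r, 'm, 'x) graded_bimodule_scheme \<Rightarrow> 'm set" where
  "augmentation_ideal A = generate (add_monoid A) (\<Union>n\<in>{0<..}. hcomp A n)"


section \<open>The tensor ring of a bimodule\<close>

text \<open>
  The word \<open>(r, [m\<^sub>1, \<dots>, m\<^sub>n])\<close> stands for \<open>r \<otimes> m\<^sub>1 \<otimes> \<dots> \<otimes> m\<^sub>n\<close> in \<open>R \<otimes>\<^sub>R M \<otimes>\<^sub>R \<dots> \<otimes>\<^sub>R M\<close>, which is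
  canonically the \<open>n\<close>-fold tensor power of \<open>M\<close>. The leading \<open>R\<close> makes the definition uniform
  in \<open>n\<close>: the tensor power with \<open>n = 0\<close> is \<open>R\<close>, and otherwise the word equals
  \<open>(r \<cdot> m\<^sub>1) \<otimes> \<dots> \<otimes> m\<^sub>n\<close>. The tensor product over \<open>R\<close> is the usual quotient of the
  free abelian group on the words by the additivity and balancing relations; since the
  relations are homogeneous in the length of words, the quotient for all lengths at once is
  the direct sum of all the tensor powers.
\<close>

type_synonym ('r, 'm) word_group = "('r \<times> 'm list) \<Rightarrow>\<^sub>0 int"

definition word_ract ::
  "('r, 'w) ring_scheme \<Rightarrow> ('r, 'm, 'x) bimodule_scheme \<Rightarrow> 'r \<times> 'm list \<Rightarrow> 'r \<Rightarrow> 'r \<times> 'm list" where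
  "word_ract R M w s =
     (if snd w = [] then (fst w \<otimes>\<^bsub>R\<^esub> s, [])
      else (fst w, butlast (snd w) @ [ract M (last (snd w)) s]))"

definition word_mult ::
  "('r, 'w) ring_scheme \<Rightarrow> ('r, 'm, 'x) bimodule_scheme \<Rightarrow>
   'r \<times> 'm list \<Rightarrow> 'r \<times> 'm list \<Rightarrow> 'r \<times> 'm list" where
  "word_mult R M v w =
     (fst (word_ract R M v (fst w)), snd (word_ract R M v (fst w)) @ snd w)"

definition word_ring ::
  "('r, 'w) ring_scheme \<Rightarrow> ('r, 'm, 'x) bimodule_scheme \<Rightarrow>
   ('r, ('r, 'm) word_group) graded_bimodule" where
  "word_ring R M =
    \<lparr>carrier = {c. Poly_Mapping.keys c \<subseteq> carrier R \<times> lists (carrier M)},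
     mult = (\<lambda>c d. frag_extend (\<lambda>v. frag_extend (\<lambda>w. frag_of (word_mult R M v w)) d) c),
     one = frag_of (\<one>\<^bsub>R\<^esub>, []), zero = 0, add = (+),
     lact = (\<lambda>s. frag_extend (\<lambda>(r, ms). frag_of (s \<otimes>\<^bsub>R\<^esub> r, ms))),
     ract = (\<lambda>c s. frag_extend (\<lambda>w. frag_of (word_ract R M w s)) c),
     hcomp = (\<lambda>n. {c. Poly_Mapping.keys c \<subseteq>
                       carrier R \<times> {ms \<in> lists (carrier M). length ms = n}})\<rparr>"

definition tensor_relators ::
  "('r, 'w) ring_scheme \<Rightarrow> ('r, 'm, 'x) bimodule_scheme \<Rightarrow> ('r, 'm) word_group set" where
  "tensor_relators R M =
     {frag_of (r \<oplus>\<^bsub>R\<^esub> s, us) - frag_of (r, us) - frag_of (s, us) | r s us.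
        r \<in> carrier R \<and> s \<in> carrier R \<and> us \<in> lists (carrier M)} \<union>
     {frag_of (r, us @ [x \<oplus>\<^bsub>M\<^esub> y] @ vs) - frag_of (r, us @ [x] @ vs) - frag_of (r, us @ [y] @ vs)
        | r us x y vs. r \<in> carrier R \<and> x \<in> carrier M \<and> y \<in> carrier M \<and>
            us \<in> lists (carrier M) \<and> vs \<in> lists (carrier M)} \<union>
     {frag_of (r \<otimes>\<^bsub>R\<^esub> s, x # vs) - frag_of (r, lact M s x # vs) | r s x vs.
        r \<in> carrier R \<and> s \<in> carrier R \<and> x \<in> carrier M \<and> vs \<in> lists (carrier M)} \<union>
     {frag_of (r, us @ [ract M x s, y] @ vs) - frag_of (r, us @ [x, lact M s y] @ vs)
        | r us x s y vs. r \<in> carrier R \<and> s \<in> carrier R \<and> x \<in> carrier M \<and> y \<in> carrier M \<and>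
            us \<in> lists (carrier M) \<and> vs \<in> lists (carrier M)}"

definition tensor_relations ::
  "('r, 'w) ring_scheme \<Rightarrow> ('r, 'm, 'x) bimodule_scheme \<Rightarrow> ('r, 'm) word_group set" where
  "tensor_relations R M = generate (add_monoid (word_ring R M)) (tensor_relators R M)"

definition tensor_ring ::
  "('r, 'w) ring_scheme \<Rightarrow> ('r, 'm, 'x) bimodule_scheme \<Rightarrow>
   ('r, ('r, 'm) word_group set) graded_bimodule" where
  "tensor_ring R M = quotient_rring (word_ring R M) (tensor_relations R M)"

definition tensor_class ::
  "('r, 'w) ring_scheme \<Rightarrow> ('r, 'm, 'x) bimodule_scheme \<Rightarrow>
   ('r, 'm) word_group \<Rightarrow> ('r, 'm) word_group set" where
  "tensor_class R M c = tensor_relations R M +>\<^bsub>word_ring R M\<^esub> c"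


section \<open>The cohomology ring \<open>Ext\<^sub>A(R, R)\<close>\<close>

text \<open>
  \<open>A\<close> is a connected graded \<open>R\<close>-ring. The complex \<open>\<Omega>(A)\<close> is the tensor ring of the bimodule
  \<open>A\<^sub>+\<close>, with its length grading.
\<close>

definition positive_part ::
  "('r, 'm, 'x) graded_bimodule_scheme \<Rightarrow> ('r, 'm, 'x) graded_bimodule_scheme" where
  "positive_part A = A\<lparr>carrier := augmentation_ideal A\<rparr>"

abbreviation bar ::
  "('r, 'w) ring_scheme \<Rightarrow> ('r, 'm, 'x) graded_bimodule_scheme \<Rightarrow>
   ('r, ('r, 'm) word_group set) graded_bimodule" where
  "bar R A \<equiv> tensor_ring R (positive_part A)"

text \<open>
  Positions in lists are counted from \<open>0\<close>, whence the sign \<open>(-1)\<^sup>i\<close> in place of \<open>(-1)\<^sup>i\<^sup>-\<^sup>1\<close>.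
\<close>

definition bar_diff_word ::
  "('r, 'm, 'x) graded_bimodule_scheme \<Rightarrow> 'r \<times> 'm list \<Rightarrow> ('r, 'm) word_group" where
  "bar_diff_word A w =
     (case w of (r, us) \<Rightarrow>
        \<Sum>i<length us - 1. frag_cmul ((-1) ^ i)
          (frag_of (r, take i us @ [us ! i \<otimes>\<^bsub>A\<^esub> us ! Suc i] @ drop (i + 2) us)))"

definition bar_diff ::
  "('r, 'w) ring_scheme \<Rightarrow> ('r, 'm, 'x) graded_bimodule_scheme \<Rightarrow>
   ('r, 'm) word_group set \<Rightarrow> ('r, 'm) word_group set" where
  "bar_diff R A =
     descend (\<lambda>c. tensor_class R (positive_part A) (frag_extend (bar_diff_word A) c))"

text \<open>
  \<open>\<Oplus>\<^sub>n Hom\<^sub>R(\<Omega>\<^sub>n(A), R)\<close>, realised as the left \<open>R\<close>-linear maps \<open>\<Oplus>\<^sub>n \<Omega>\<^sub>n(A) \<rightarrow> R\<close> that vanish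
  on \<open>\<Omega>\<^sub>n(A)\<close> for all large \<open>n\<close>.
\<close>

definition cochains ::
  "('r, 'w) ring_scheme \<Rightarrow> ('r, 'm, 'x) graded_bimodule_scheme \<Rightarrow>
   (('r, 'm) word_group set \<Rightarrow> 'r) set" where
  "cochains R A =
     {f \<in> carrier (bar R A) \<rightarrow>\<^sub>E carrier R.
        (\<forall>u\<in>carrier (bar R A). \<forall>v\<in>carrier (bar R A). f (u \<oplus>\<^bsub>bar R A\<^esub> v) = f u \<oplus>\<^bsub>R\<^esub> f v) \<and>
        (\<forall>s\<in>carrier R. \<forall>v\<in>carrier (bar R A). f (lact (bar R A) s v) = s \<otimes>\<^bsub>R\<^esub> f v) \<and>
        (\<exists>N. \<forall>n>N. \<forall>v\<in>hcomp (bar R A) n. f v = \<zero>\<^bsub>R\<^esub>)}"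

definition extend_words ::
  "('r, 'w) ring_scheme \<Rightarrow> ('r, 'm, 'x) graded_bimodule_scheme \<Rightarrow>
   ('r \<times> 'm list \<Rightarrow> 'r) \<Rightarrow> ('r, 'm) word_group set \<Rightarrow> 'r" where
  "extend_words R A h =
     (\<lambda>v\<in>carrier (bar R A).
        descend (\<lambda>c. \<Oplus>\<^bsub>R\<^esub>w\<in>Poly_Mapping.keys c. [Poly_Mapping.lookup c w] \<cdot>\<^bsub>R\<^esub> h w) v)"

text \<open>
  On \<open>r \<otimes> a\<^sub>1 \<otimes> \<dots> \<otimes> a\<^sub>k\<close> the cup product is the sum, over all \<open>n \<le> k\<close>, of the products of the
  component of \<open>f\<close> in degree \<open>n\<close> and of that of \<open>g\<close> in degree \<open>k - n\<close>.
\<close>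

definition cup ::
  "('r, 'w) ring_scheme \<Rightarrow> ('r, 'm, 'x) graded_bimodule_scheme \<Rightarrow>
   (('r, 'm) word_group set \<Rightarrow> 'r) \<Rightarrow> (('r, 'm) word_group set \<Rightarrow> 'r) \<Rightarrow>
   (('r, 'm) word_group set \<Rightarrow> 'r)" where
  "cup R A f g =
     extend_words R A (\<lambda>(r, us). \<Oplus>\<^bsub>R\<^esub>n\<in>{..length us}.
       f (ract (bar R A)
            (tensor_class R (positive_part A) (frag_of (r, take n us)))
            (g (tensor_class R (positive_part A) (frag_of (\<one>\<^bsub>R\<^esub>, drop n us))))))"

text \<open>
  The unit is the identity of \<open>\<Omega>\<^sub>0(A) = R\<close>. The actions make this an \<open>R\<^sup>o\<^sup>p\<close>-ring, that is, an
  \<open>R\<close>-ring when \<open>R\<close> is commutative.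
\<close>

definition cochain_ring ::
  "('r, 'w) ring_scheme \<Rightarrow> ('r, 'm, 'x) graded_bimodule_scheme \<Rightarrow>
   ('r, ('r, 'm) word_group set \<Rightarrow> 'r) graded_bimodule" where
  "cochain_ring R A =
    \<lparr>carrier = cochains R A, mult = cup R A,
     one = extend_words R A (\<lambda>(r, us). if us = [] then r else \<zero>\<^bsub>R\<^esub>),
     zero = (\<lambda>v\<in>carrier (bar R A). \<zero>\<^bsub>R\<^esub>),
     add = (\<lambda>f g. \<lambda>v\<in>carrier (bar R A). f v \<oplus>\<^bsub>R\<^esub> g v),
     lact = (\<lambda>r f. \<lambda>v\<in>carrier (bar R A). f v \<otimes>\<^bsub>R\<^esub> r),
     ract = (\<lambda>f r. \<lambda>v\<in>carrier (bar R A). f (ract (bar R A) v r)),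
     hcomp = (\<lambda>n. {f \<in> cochains R A. \<forall>m. m \<noteq> n \<longrightarrow> (\<forall>v\<in>hcomp (bar R A) m. f v = \<zero>\<^bsub>R\<^esub>)})\<rparr>"

definition coboundary ::
  "('r, 'w) ring_scheme \<Rightarrow> ('r, 'm, 'x) graded_bimodule_scheme \<Rightarrow>
   (('r, 'm) word_group set \<Rightarrow> 'r) \<Rightarrow> (('r, 'm) word_group set \<Rightarrow> 'r)" where
  "coboundary R A f = (\<lambda>v\<in>carrier (bar R A). f (bar_diff R A v))"

definition cocycles ::
  "('r, 'w) ring_scheme \<Rightarrow> ('r, 'm, 'x) graded_bimodule_scheme \<Rightarrow>
   (('r, 'm) word_group set \<Rightarrow> 'r) set" where
  "cocycles R A = {f \<in> cochains R A. coboundary R A f = \<zero>\<^bsub>cochain_ring R A\<^esub>}"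

definition ext_ring ::
  "('r, 'w) ring_scheme \<Rightarrow> ('r, 'm, 'x) graded_bimodule_scheme \<Rightarrow>
   ('r, (('r, 'm) word_group set \<Rightarrow> 'r) set) graded_bimodule" where
  "ext_ring R A =
     quotient_rring
       ((cochain_ring R A)\<lparr>carrier := cocycles R A,
          hcomp := (\<lambda>n. hcomp (cochain_ring R A) n \<inter> cocycles R A)\<rparr>)
       (coboundary R A ` cochains R A)"


section \<open>The shriek ring of a graded coring\<close>

text \<open>
  The target of \<open>comult\<close> is the tensor power \<open>C \<otimes>\<^sub>R C\<close>, the component of degree \<open>2\<close> of
  \<open>tensor_ring R C\<close>.
\<close>

record ('r, 'm) graded_coring = "('r, 'm) graded_bimodule" +
  comult :: "'m \<Rightarrow> ('r, 'm) word_group set"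
  counit :: "'m \<Rightarrow> 'r"

definition degree_one_part ::
  "('r, 'm, 'x) graded_bimodule_scheme \<Rightarrow> ('r, 'm, 'x) graded_bimodule_scheme" where
  "degree_one_part C = C\<lparr>carrier := hcomp C 1\<rparr>"

text \<open>\<open>\<Delta>\<^sub>1\<^sub>,\<^sub>1 = (p \<otimes> p) \<circ> \<Delta>\<close>, where \<open>p : C \<rightarrow> C\<^sub>1\<close> is the projection.\<close>

definition comult11 ::
  "('r, 'w) ring_scheme \<Rightarrow> ('r, 'm, 'x) graded_coring_scheme \<Rightarrow> 'm \<Rightarrow> ('r, 'm) word_group set" where
  "comult11 R C c =
     descend
       (\<lambda>t. tensor_class R (degree_one_part C)
              (frag_extend (\<lambda>(r, us). frag_of (r, map (homogeneous_part C 1) us)) t))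
       (comult C c)"

definition shriek_ring ::
  "('r, 'w) ring_scheme \<Rightarrow> ('r, 'm, 'x) graded_coring_scheme \<Rightarrow>
   ('r, ('r, 'm) word_group set set) graded_bimodule" where
  "shriek_ring R C =
     quotient_rring (tensor_ring R (degree_one_part C))
       (Idl\<^bsub>tensor_ring R (degree_one_part C)\<^esub> (comult11 R C ` hcomp C 2))"


section \<open>Koszul rings\<close>

text \<open>The locale \<open>module\<close> of \<open>HOL-Algebra\<close> requires a commutative ring of scalars.\<close>

locale left_module = A?: ring A + M?: abelian_group M
  for A (structure) and M (structure) +
  assumes smult_closed:
      "\<lbrakk>a \<in> carrier A; x \<in> carrier M\<rbrakk> \<Longrightarrow> a \<odot>\<^bsub>M\<^esub> x \<in> carrier M"
    and smult_l_distr: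
      "\<lbrakk>a \<in> carrier A; b \<in> carrier A; x \<in> carrier M\<rbrakk> \<Longrightarrow>
       (a \<oplus>\<^bsub>A\<^esub> b) \<odot>\<^bsub>M\<^esub> x = a \<odot>\<^bsub>M\<^esub> x \<oplus>\<^bsub>M\<^esub> b \<odot>\<^bsub>M\<^esub> x"
    and smult_r_distr:
      "\<lbrakk>a \<in> carrier A; x \<in> carrier M; y \<in> carrier M\<rbrakk> \<Longrightarrow>
       a \<odot>\<^bsub>M\<^esub> (x \<oplus>\<^bsub>M\<^esub> y) = a \<odot>\<^bsub>M\<^esub> x \<oplus>\<^bsub>M\<^esub> a \<odot>\<^bsub>M\<^esub> y"
    and smult_assoc:
      "\<lbrakk>a \<in> carrier A; b \<in> carrier A; x \<in> carrier M\<rbrakk> \<Longrightarrow>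
       (a \<otimes>\<^bsub>A\<^esub> b) \<odot>\<^bsub>M\<^esub> x = a \<odot>\<^bsub>M\<^esub> (b \<odot>\<^bsub>M\<^esub> x)"
    and smult_one:
      "x \<in> carrier M \<Longrightarrow> \<one>\<^bsub>A\<^esub> \<odot>\<^bsub>M\<^esub> x = x"

definition left_module_hom ::
  "('a, 'w) ring_scheme \<Rightarrow> ('a, 'm, 'x) module_scheme \<Rightarrow> ('a, 'n, 'y) module_scheme \<Rightarrow>
   ('m \<Rightarrow> 'n) set" where
  "left_module_hom A M N =
     {h \<in> carrier M \<rightarrow> carrier N.
        (\<forall>x\<in>carrier M. \<forall>y\<in>carrier M. h (x \<oplus>\<^bsub>M\<^esub> y) = h x \<oplus>\<^bsub>N\<^esub> h y) \<and>
        (\<forall>a\<in>carrier A. \<forall>x\<in>carrier M. h (a \<odot>\<^bsub>M\<^esub> x) = a \<odot>\<^bsub>N\<^esub> h x)}"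

text \<open>
  Lifting through the surjections \<open>p : N \<rightarrow> N'\<close>. The carrier types of \<open>N\<close> and \<open>N'\<close> have to be
  fixed; these are large enough, since they comprise the surjection onto \<open>M\<close> from the free
  module on the set of elements of \<open>M\<close>, so that \<open>M\<close> is a direct summand of a free module.
\<close>

definition projective_left_module ::
  "('a, 'w) ring_scheme \<Rightarrow> ('a, 'm, 'x) module_scheme \<Rightarrow> bool" where
  "projective_left_module A M \<longleftrightarrow>
     left_module A M \<and>
     (\<forall>(N :: ('a, 'm \<Rightarrow> 'a) module) (N' :: ('a, 'm) module) p f.
        left_module A N \<longrightarrow> left_module A N' \<longrightarrow>
        p \<in> left_module_hom A N N' \<longrightarrow> p ` carrier N = carrier N' \<longrightarrow>
        f \<in> left_module_hom A M N' \<longrightarrow>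
        (\<exists>g\<in>left_module_hom A M N. \<forall>x\<in>carrier M. p (g x) = f x))"

record ('a, 'm) graded_module = "('a, 'm) module" +
  mcomp :: "nat \<Rightarrow> 'm set"

definition graded_left_module ::
  "('r, 'a, 'w) graded_bimodule_scheme \<Rightarrow> ('a, 'm, 'x) graded_module_scheme \<Rightarrow> bool" where
  "graded_left_module A M \<longleftrightarrow>
     left_module A M \<and> internal_direct_sum M (mcomp M) \<and>
     (\<forall>i j. \<forall>a\<in>hcomp A i. \<forall>x\<in>mcomp M j. a \<odot>\<^bsub>M\<^esub> x \<in> mcomp M (i + j))"

definition graded_left_module_hom ::
  "('a, 'w) ring_scheme \<Rightarrow> ('a, 'm, 'x) graded_module_scheme \<Rightarrow>
   ('a, 'n, 'y) graded_module_scheme \<Rightarrow> ('m \<Rightarrow> 'n) set" where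
  "graded_left_module_hom A M N =
     {h \<in> left_module_hom A M N. \<forall>i. h ` mcomp M i \<subseteq> mcomp N i}"

definition generated_in_degree ::
  "('a, 'w) ring_scheme \<Rightarrow> ('a, 'm, 'x) graded_module_scheme \<Rightarrow> nat \<Rightarrow> bool" where
  "generated_in_degree A M n \<longleftrightarrow>
     carrier M = generate (add_monoid M) {a \<odot>\<^bsub>M\<^esub> x | a x. a \<in> carrier A \<and> x \<in> mcomp M n}"

definition residue_module ::
  "('r, 'a, 'w) graded_bimodule_scheme \<Rightarrow> ('a, 'a set) graded_module" where
  "residue_module A =
     (let I = augmentation_ideal A in
      \<lparr>carrier = carrier (A Quot I), mult = (\<otimes>\<^bsub>A Quot I\<^esub>), one = \<one>\<^bsub>A Quot I\<^esub>,
       zero = \<zero>\<^bsub>A Quot I\<^esub>, add = (\<oplus>\<^bsub>A Quot I\<^esub>),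
       smult = (\<lambda>a U. (I +>\<^bsub>A\<^esub> a) \<otimes>\<^bsub>A Quot I\<^esub> U),
       mcomp = (\<lambda>n. (\<lambda>x. I +>\<^bsub>A\<^esub> x) ` hcomp A n)\<rparr>)"

text \<open>
  The modules of the resolution have carriers in the type given by the first argument.
  A hypothesis \<open>koszul_ring TYPE('m) A\<close> with a type variable \<open>'m\<close> that does not occur
  elsewhere thus allows resolutions of any size.
\<close>

definition koszul_ring :: "'m itself \<Rightarrow> ('r, 'a, 'w) graded_bimodule_scheme \<Rightarrow> bool" where
  "koszul_ring (T :: 'm itself) A \<longleftrightarrow>
     (\<exists>(P :: nat \<Rightarrow> ('a, 'm) graded_module) \<delta> \<epsilon>.
        (\<forall>n. graded_left_module A (P n) \<and> projective_left_module A (P n) \<and>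
             generated_in_degree A (P n) n) \<and>
        (\<forall>n. \<delta> n \<in> graded_left_module_hom A (P (Suc n)) (P n)) \<and>
        \<epsilon> \<in> graded_left_module_hom A (P 0) (residue_module A) \<and>
        \<epsilon> ` carrier (P 0) = carrier (residue_module A) \<and>
        \<delta> 0 ` carrier (P 1) = {x \<in> carrier (P 0). \<epsilon> x = \<zero>\<^bsub>residue_module A\<^esub>} \<and>
        (\<forall>n. \<delta> (Suc n) ` carrier (P (Suc (Suc n))) =
             {x \<in> carrier (P (Suc n)). \<delta> n x = \<zero>\<^bsub>P n\<^esub>}))"


section \<open>Incidence rings and corings of posets\<close>

definition maximal_chains :: "'p rel \<Rightarrow> 'p set set" where
  "maximal_chains leq = {C \<in> Chains leq. \<forall>D\<in>Chains leq. C \<subseteq> D \<longrightarrow> D = C}"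

definition chain_length :: "'p set \<Rightarrow> nat" where
  "chain_length C = card C - 1"

definition interval :: "'p rel \<Rightarrow> 'p \<Rightarrow> 'p \<Rightarrow> 'p set" where
  "interval leq x y = {z. (x, z) \<in> leq \<and> (z, y) \<in> leq}"

definition finite_graded_poset :: "'p set \<Rightarrow> 'p rel \<Rightarrow> bool" where
  "finite_graded_poset P leq \<longleftrightarrow>
     finite P \<and> partial_order_on P leq \<and>
     (\<forall>C\<in>maximal_chains leq. \<forall>D\<in>maximal_chains leq. chain_length C = chain_length D)"

text \<open>
  In a graded poset all the maximal chains of an interval have the same length.
\<close>

definition interval_length :: "'p rel \<Rightarrow> 'p \<Rightarrow> 'p \<Rightarrow> nat" where
  "interval_length leq x y =
     the_elem (chain_length ` maximal_chains (Restr leq (interval leq x y)))"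

definition base_ring :: "'p set \<Rightarrow> ('p \<Rightarrow> 'k::field) ring" where
  "base_ring P =
    \<lparr>carrier = {r. \<forall>x. x \<notin> P \<longrightarrow> r x = 0}, mult = (\<lambda>r s x. r x * s x),
     one = (\<lambda>x. if x \<in> P then 1 else 0), zero = (\<lambda>x. 0), add = (\<lambda>r s x. r x + s x)\<rparr>"

text \<open>
  The function \<open>f\<close> stands for the combination of the basis elements \<open>e\<^sub>x\<^sub>,\<^sub>y\<close> with
  coefficients \<open>f x y\<close>; the element \<open>r\<close> of the base ring is identified with the combination
  of the \<open>e\<^sub>x\<^sub>,\<^sub>x\<close> with coefficients \<open>r x\<close>.
\<close>

definition incidence_ring ::
  "'p set \<Rightarrow> 'p rel \<Rightarrow> ('p \<Rightarrow> 'k::field, 'p \<Rightarrow> 'p \<Rightarrow> 'k) graded_bimodule" where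
  "incidence_ring P leq =
    \<lparr>carrier = {f. \<forall>x y. (x, y) \<notin> leq \<longrightarrow> f x y = 0},
     mult = (\<lambda>f g x y. \<Sum>z\<in>P. f x z * g z y),
     one = (\<lambda>x y. if x \<in> P \<and> x = y then 1 else 0),
     zero = (\<lambda>x y. 0), add = (\<lambda>f g x y. f x y + g x y),
     lact = (\<lambda>r f x y. r x * f x y), ract = (\<lambda>f r x y. f x y * r y),
     hcomp = (\<lambda>n. {f. \<forall>x y. f x y \<noteq> 0 \<longrightarrow> (x, y) \<in> leq \<and> interval_length leq x y = n})\<rparr>"

definition basis_elem :: "'k::field \<Rightarrow> 'p \<Rightarrow> 'p \<Rightarrow> ('p \<Rightarrow> 'p \<Rightarrow> 'k)" where
  "basis_elem c x y = (\<lambda>u v. if u = x \<and> v = y then c else 0)"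

text \<open>
  The coring shares the underlying graded bimodule of the incidence ring; its inherited
  product is not used.
\<close>

definition incidence_coring ::
  "'p set \<Rightarrow> 'p rel \<Rightarrow> ('p \<Rightarrow> 'k::field, 'p \<Rightarrow> 'p \<Rightarrow> 'k) graded_coring" where
  "incidence_coring P leq =
     graded_bimodule.extend (incidence_ring P leq)
       \<lparr>comult = (\<lambda>f. tensor_class (base_ring P) (incidence_ring P leq)
          (\<Sum>(x, y)\<in>leq. \<Sum>z\<in>interval leq x y.
             frag_of (\<one>\<^bsub>base_ring P\<^esub>, [basis_elem (f x y) x z, basis_elem 1 z y]))),
        counit = (\<lambda>f x. f x x)\<rparr>"

definition koszul_poset :: "'k::field itself \<Rightarrow> 'm itself \<Rightarrow> 'p set \<Rightarrow> 'p rel \<Rightarrow> bool" where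
  "koszul_poset (K :: 'k itself) T P leq \<longleftrightarrow>
     finite_graded_poset P leq \<and>
     koszul_ring T (incidence_ring P leq :: ('p \<Rightarrow> 'k, 'p \<Rightarrow> 'p \<Rightarrow> 'k) graded_bimodule)"

end

theory Submission
  imports Defs "HOL-Library.Function_Algebras" "HOL.Vector_Spaces"
begin

text \<open>
  The tensor ring of a bimodule spanned by basis elements \<open>e\<^sub>x\<^sub>,\<^sub>y\<close>, \<open>(x, y) \<in> S\<close>, is the ring of
  finitely supported functions on the walks of the relation \<open>S\<close>, with the concatenation product.
  Hence the cochains on the bar complex of the incidence ring are the functions \<open>F\<close> on the chains
  \<open>x\<^sub>0 < \<dots> < x\<^sub>n\<close>, with the differential that sums \<open>F\<close> over the deletions of inner points with
  alternating signs, and the tensor ring of \<open>C\<^sub>1\<close> is the ring of the functions on the saturated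
  chains. Deleting an inner point never gives a saturated chain, so that the functions supported on
  saturated chains are cocycles.

  By the Koszul property \<open>Ext\<close> is concentrated on the diagonal: a cocycle that vanishes on all
  saturated chains is a coboundary. Therefore the restriction to saturated chains identifies the
  cohomology with the quotient of the tensor ring of \<open>C\<^sub>1\<close> by the coboundaries that are supported
  on saturated chains. For an interval \<open>[s, t]\<close> of length two, the differential of the chain
  \<open>s < t\<close> is the relation \<open>\<Delta>\<^sub>1\<^sub>,\<^sub>1(e\<^sub>s\<^sub>,\<^sub>t)\<close>; a general chain with a saturated one as coboundary
  term is saturated except for one such step, so by the Leibniz rule these coboundaries form
  exactly the ideal generated by the image of \<open>\<Delta>\<^sub>1\<^sub>,\<^sub>1\<close>.

  The vanishing off the diagonal is read off from the double complex that consists of the bar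
  complex with coefficients in the given resolution \<open>P\<^sub>n\<close>: its rows are exact because the \<open>P\<^sub>n\<close>
  are projective, its columns because the resolution is, and the grading forces a class of length
  \<open>n\<close> and degree \<open>m \<noteq> n\<close> to come from the radical of some \<open>P\<^sub>j\<close>, where it is a boundary.
\<close>


section \<open>Interval lengths in graded posets\<close>

text \<open>\<open>Ext\<close> is a cohomology, while a projective resolution speaks about homology.
  The double complex is therefore treated on the homology side, by an induction on the length of
  chains in place of a spectral sequence: a cycle of length n and degree m \<noteq> n is a boundary.
  The cohomological statement follows by duality over the field: a cocycle that vanishes on
  saturated chains is a functional that kills all cycles, so it factors through the boundary map.
  Left \<open>R\<close>-linearity separates chains by their first point, so homology is computed
  with a fixed base point. The modules of the resolution are carrier sets with operations of their
  own. A splitting of each one into its free cover moves them all into one type of functions, where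
  ordinary sums are available; the same splitting yields the contracting homotopy of the rows. The
  tensor rings, the residue module and \<open>Ext\<close> are quotients given by representatives,
  and all of them are handled by one first isomorphism theorem.\<close>

locale graded_poset =
  fixes P :: "'p set" and leq :: "'p rel"
  assumes finite_graded: "finite_graded_poset P leq"
begin

lemma finite_P: "finite P"
  and leq_carrier: "(x, y) \<in> leq \<Longrightarrow> x \<in> P \<and> y \<in> P"
  and leq_refl: "x \<in> P \<Longrightarrow> (x, x) \<in> leq"
  and leq_trans: "(x, y) \<in> leq \<Longrightarrow> (y, z) \<in> leq \<Longrightarrow> (x, z) \<in> leq"
  and leq_antisym: "(x, y) \<in> leq \<Longrightarrow> (y, x) \<in> leq \<Longrightarrow> x = y"
  and graded: "C \<in> maximal_chains leq \<Longrightarrow> D \<in> maximal_chains leq \<Longrightarrow> chain_length C = chain_length D"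
proof -
  have f: "finite P" "leq \<subseteq> P \<times> P" "\<forall>x\<in>P. (x, x) \<in> leq" "trans leq" "antisym leq"
    and g: "\<forall>C\<in>maximal_chains leq. \<forall>D\<in>maximal_chains leq. chain_length C = chain_length D"
    using finite_graded
    unfolding finite_graded_poset_def partial_order_on_def preorder_on_def refl_on_def by blast+
  show "finite P" using f by blast
  show "(x, y) \<in> leq \<Longrightarrow> x \<in> P \<and> y \<in> P" using f by blast
  show "x \<in> P \<Longrightarrow> (x, x) \<in> leq" using f by blast
  show "(x, y) \<in> leq \<Longrightarrow> (y, z) \<in> leq \<Longrightarrow> (x, z) \<in> leq" using f(4) by (rule transD)
  show "(x, y) \<in> leq \<Longrightarrow> (y, x) \<in> leq \<Longrightarrow> x = y" using f(5) by (rule antisymD)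
  show "C \<in> maximal_chains leq \<Longrightarrow> D \<in> maximal_chains leq \<Longrightarrow> chain_length C = chain_length D"
    using g by blast
qed

lemma leq_carrierD: "(x, y) \<in> leq \<Longrightarrow> x \<in> P" "(x, y) \<in> leq \<Longrightarrow> y \<in> P"
  using leq_carrier by auto

lemma finite_leq: "finite leq"
  using leq_carrier by (auto intro: finite_subset[OF _ finite_cartesian_product[OF finite_P finite_P]])

lemma Chains_subset: "C \<in> Chains leq \<Longrightarrow> C \<subseteq> P"
  unfolding Chains_def using leq_carrier by blast

lemma maximal_chain_exists:
  assumes "C \<in> Chains r" "\<And>D. D \<in> Chains r \<Longrightarrow> D \<subseteq> P"
  shows "\<exists>D\<in>maximal_chains r. C \<subseteq> D"
proof -
  have "finite {D \<in> Chains r. C \<subseteq> D}"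
    by (rule finite_subset[of _ "Pow P"]) (use assms finite_P in auto)
  moreover have "{D \<in> Chains r. C \<subseteq> D} \<noteq> {}"
    using assms(1) by blast
  ultimately obtain D where "D \<in> {D \<in> Chains r. C \<subseteq> D}"
    "\<forall>E\<in>{D \<in> Chains r. C \<subseteq> D}. D \<subseteq> E \<longrightarrow> D = E"
    using finite_has_maximal[of "{D \<in> Chains r. C \<subseteq> D}"] by blast
  then have "D \<in> Chains r" "C \<subseteq> D" "\<forall>E\<in>Chains r. D \<subseteq> E \<longrightarrow> E = D"
    by auto
  then show ?thesis
    unfolding maximal_chains_def by (intro bexI[of _ D]) simp_all
qed

abbreviation ichains :: "'p \<Rightarrow> 'p \<Rightarrow> 'p set set" where
  "ichains x y \<equiv> maximal_chains (Restr leq (interval leq x y))"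

lemma Chains_interval:
  "C \<in> Chains (Restr leq (interval leq x y)) \<longleftrightarrow> C \<in> Chains leq \<and> C \<subseteq> interval leq x y"
  unfolding Chains_def by blast

lemma ichains_iff:
  "C \<in> ichains x y \<longleftrightarrow> C \<in> Chains leq \<and> C \<subseteq> interval leq x y \<and>
     (\<forall>D\<in>Chains leq. D \<subseteq> interval leq x y \<longrightarrow> C \<subseteq> D \<longrightarrow> D = C)"
  unfolding maximal_chains_def mem_Collect_eq Ball_def Chains_interval by meson

lemma ichains_nonempty: "\<exists>C. C \<in> ichains x y"
proof -
  have "{} \<in> Chains (Restr leq (interval leq x y))" unfolding Chains_def by blast
  then show ?thesis
    using maximal_chain_exists[of "{}" "Restr leq (interval leq x y)"]
      Chains_subset Chains_interval by blast
qed

lemma Chains_insert: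
  assumes "C \<in> Chains leq" "x \<in> P" "\<And>z. z \<in> C \<Longrightarrow> (x, z) \<in> leq \<or> (z, x) \<in> leq"
  shows "insert x C \<in> Chains leq"
  using assms leq_refl unfolding Chains_def by blast

lemma maximal_chain_mem:
  assumes "C \<in> maximal_chains leq" "x \<in> P" "\<And>z. z \<in> C \<Longrightarrow> (x, z) \<in> leq \<or> (z, x) \<in> leq"
  shows "x \<in> C"
  using assms Chains_insert[of C x] unfolding maximal_chains_def by blast

lemma ichains_mem:
  assumes "C \<in> ichains x y" "w \<in> interval leq x y" "\<And>z. z \<in> C \<Longrightarrow> (w, z) \<in> leq \<or> (z, w) \<in> leq"
  shows "w \<in> C"
proof -
  have "w \<in> P" using assms(2) leq_carrier unfolding interval_def by blast
  moreover have "C \<in> Chains leq" "C \<subseteq> interval leq x y" using assms(1) ichains_iff by auto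
  ultimately have "insert w C \<in> Chains leq" "insert w C \<subseteq> interval leq x y"
    using Chains_insert[of C w] assms by auto
  then show ?thesis using assms(1) unfolding ichains_iff by blast
qed

lemma ichains_ends:
  assumes "C \<in> ichains x y" "(x, y) \<in> leq"
  shows "x \<in> C" "y \<in> C"
proof -
  have C: "C \<subseteq> interval leq x y" using assms(1) ichains_iff by auto
  have i: "x \<in> interval leq x y" "y \<in> interval leq x y"
    using assms(2) leq_refl leq_carrier unfolding interval_def by auto
  show "x \<in> C" "y \<in> C" using ichains_mem[OF assms(1) i(1)] ichains_mem[OF assms(1) i(2)] C
    unfolding interval_def by auto
qed

lemma finite_ichains: "C \<in> ichains x y \<Longrightarrow> finite C"
  using finite_subset[OF Chains_subset finite_P] by (simp add: ichains_iff)

text \<open>The part outside of the interval is common, so gradedness passes to the intervals.\<close>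

lemma ichains_extend:
  assumes xy: "(x, y) \<in> leq"
  shows "\<exists>B. finite B \<and> B \<inter> interval leq x y = {} \<and> (\<forall>C\<in>ichains x y. C \<union> B \<in> maximal_chains leq)"
proof -
  obtain C0 where C0: "C0 \<in> ichains x y" using ichains_nonempty by blast
  then have "C0 \<in> Chains leq" using ichains_iff by simp
  then obtain M where M: "M \<in> maximal_chains leq" "C0 \<subseteq> M"
    using maximal_chain_exists[OF _ Chains_subset] by blast
  have Mc: "M \<in> Chains leq" using M unfolding maximal_chains_def by blast
  have ends: "x \<in> M" "y \<in> M" using ichains_ends[OF C0 xy] M by auto
  define B where "B = M - interval leq x y"
  \<comment> \<open>A point of the chain \<open>M\<close> is comparable with \<open>x\<close> and
    with \<open>y\<close>; if it is not between them, it lies below \<open>x\<close> or above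
    \<open>y\<close>.\<close>
  have cmp: "(b, x) \<in> leq \<or> (y, b) \<in> leq" if "b \<in> B" for b
  proof -
    have "b \<in> M" "b \<notin> interval leq x y" using that B_def by auto
    moreover have "(b, x) \<in> leq \<or> (x, b) \<in> leq" "(b, y) \<in> leq \<or> (y, b) \<in> leq"
      using \<open>b \<in> M\<close> ends Mc unfolding Chains_def by blast+
    ultimately show ?thesis unfolding interval_def by blast
  qed
  have "C \<union> B \<in> maximal_chains leq" if C: "C \<in> ichains x y" for C
  proof -
    have Ci: "C \<in> Chains leq" "C \<subseteq> interval leq x y" using C ichains_iff by auto
    have cB: "(c, b) \<in> leq \<or> (b, c) \<in> leq" if "c \<in> interval leq x y" "b \<in> B" for c b
      using cmp[OF that(2)] that(1) leq_trans unfolding interval_def by blast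
    have "B \<in> Chains leq" using Mc unfolding B_def Chains_def by blast
    then have ch: "C \<union> B \<in> Chains leq" using Ci cB unfolding Chains_def by blast
    have "D = C \<union> B" if D: "D \<in> Chains leq" "C \<union> B \<subseteq> D" for D
    proof -
      have xyD: "x \<in> D" "y \<in> D" using ichains_ends[OF C xy] D by auto
      have "w \<in> C \<union> B" if w: "w \<in> D" for w
      proof (cases "w \<in> interval leq x y")
        case True
        then show ?thesis using ichains_mem[OF C True] D w unfolding Chains_def by blast
      next
        case False
        have "(w, x) \<in> leq \<or> (x, w) \<in> leq" "(w, y) \<in> leq \<or> (y, w) \<in> leq"
          using w xyD D unfolding Chains_def by blast+
        then have c: "(w, x) \<in> leq \<or> (y, w) \<in> leq" using False unfolding interval_def by blast
        \<comment> \<open>Since \<open>w\<close> lies below \<open>x\<close> or above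
          \<open>y\<close>, it is comparable with the part of \<open>M\<close> inside the interval;
          the rest of \<open>M\<close> belongs to the chain \<open>D\<close>.\<close>
        have "w \<in> M"
        proof (rule maximal_chain_mem[OF M(1)])
          show "w \<in> P" using Chains_subset D w by blast
          fix z assume z: "z \<in> M"
          show "(w, z) \<in> leq \<or> (z, w) \<in> leq"
          proof (cases "z \<in> interval leq x y")
            case True
            then show ?thesis using c leq_trans unfolding interval_def by blast
          next
            case False
            then have "z \<in> D" using z D unfolding B_def by blast
            then show ?thesis using w D unfolding Chains_def by blast
          qed
        qed
        then show ?thesis using False unfolding B_def by blast
      qed
      then show ?thesis using D by blast
    qed
    then show ?thesis using ch unfolding maximal_chains_def by blast
  qed
  moreover have "finite B"
    unfolding B_def using Chains_subset[OF Mc] finite_P by (meson finite_Diff finite_subset)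
  ultimately show ?thesis unfolding B_def by blast
qed

text \<open>Filling up two maximal chains of the interval with the same \<open>B\<close> gives
  maximal chains of the poset, which have equal length. Hence \<open>the_elem\<close> in
  \<open>interval_length\<close> is applied to a singleton.\<close>

lemma ichains_card:
  assumes xy: "(x, y) \<in> leq" and C: "C \<in> ichains x y"
  shows "card C = Suc (interval_length leq x y)"
proof -
  have len: "chain_length D = chain_length C" if D: "D \<in> ichains x y" for D
  proof -
    obtain B where B: "finite B" "B \<inter> interval leq x y = {}" "\<forall>C\<in>ichains x y. C \<union> B \<in> maximal_chains leq"
      using ichains_extend[OF xy] by blast
    have "card (C \<union> B) = card C + card B" "card (D \<union> B) = card D + card B"
      by (rule card_Un_disjoint; use C D B ichains_iff finite_ichains in blast)+
    moreover have "chain_length (C \<union> B) = chain_length (D \<union> B)" using graded B C D by blast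
    \<comment> \<open>\<open>chain_length\<close> is a truncated difference, so cardinalities can be
      compared only for nonempty chains.\<close>
    moreover have "card C > 0" "card D > 0"
      using C D ichains_ends[OF _ xy] finite_ichains by (auto simp: card_gt_0_iff)
    ultimately show ?thesis unfolding chain_length_def by linarith
  qed
  have "chain_length ` ichains x y = {chain_length C}" using len C by blast
  then have "interval_length leq x y = chain_length C"
    unfolding interval_length_def by (metis the_elem_eq)
  moreover have "card C > 0" using C ichains_ends[OF C xy] finite_ichains by (auto simp: card_gt_0_iff)
  ultimately show ?thesis unfolding chain_length_def by simp
qed

abbreviation il :: "'p \<Rightarrow> 'p \<Rightarrow> nat" where
  "il \<equiv> interval_length leq"

text \<open>Maximal chains of the two intervals meet only in \<open>y\<close>. Their union is
  maximal in the large interval because it contains \<open>y\<close>: whatever is comparable with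
  \<open>y\<close> lies in one of the two halves.\<close>

lemma il_add:
  assumes xy: "(x, y) \<in> leq" and yz: "(y, z) \<in> leq"
  shows "il x z = il x y + il y z"
proof -
  have xz: "(x, z) \<in> leq" using leq_trans xy yz by blast
  obtain C D where C: "C \<in> ichains x y" and D: "D \<in> ichains y z" using ichains_nonempty by metis
  have Ci: "C \<in> Chains leq" "C \<subseteq> interval leq x y" and Di: "D \<in> Chains leq" "D \<subseteq> interval leq y z"
    using C D ichains_iff by auto
  have CD: "C \<inter> D = {y}"
    using ichains_ends[OF C xy] ichains_ends[OF D yz] Ci Di leq_antisym unfolding interval_def by blast
  have "C \<union> D \<in> ichains x z"
    unfolding ichains_iff
  proof (intro conjI ballI impI)
    show "C \<union> D \<in> Chains leq"
      using Ci Di leq_trans unfolding Chains_def interval_def by blast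
    show "C \<union> D \<subseteq> interval leq x z"
      using Ci Di leq_trans xy yz unfolding interval_def by blast
    fix E assume E: "E \<in> Chains leq" "E \<subseteq> interval leq x z" "C \<union> D \<subseteq> E"
    have "w \<in> C \<union> D" if w: "w \<in> E" for w
    proof -
      have "y \<in> E" using CD E by blast
      then have "(w, y) \<in> leq \<or> (y, w) \<in> leq" using w E unfolding Chains_def by blast
      then show ?thesis
      proof
        assume "(w, y) \<in> leq"
        then have "w \<in> interval leq x y" using w E unfolding interval_def by blast
        then show ?thesis using ichains_mem[OF C] E w unfolding Chains_def by blast
      next
        assume "(y, w) \<in> leq"
        then have "w \<in> interval leq y z" using w E unfolding interval_def by blast
        then show ?thesis using ichains_mem[OF D] E w unfolding Chains_def by blast
      qed
    qed
    then show "E = C \<union> D" using E by blast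
  qed
  then have "card (C \<union> D) = Suc (il x z)" using ichains_card[OF xz] by blast
  moreover have "card (C \<union> D) + card (C \<inter> D) = card C + card D"
    using card_Un_Int[of C D] finite_ichains C D by metis
  ultimately show ?thesis using ichains_card[OF xy C] ichains_card[OF yz D] CD by simp
qed

lemma il_refl: "x \<in> P \<Longrightarrow> il x x = 0"
  using il_add[of x x x] leq_refl by auto

lemma il_pos:
  assumes "(x, y) \<in> leq" "x \<noteq> y"
  shows "il x y > 0"
proof -
  obtain C where C: "C \<in> ichains x y" using ichains_nonempty by blast
  have "{x, y} \<subseteq> C" using ichains_ends[OF C] assms by auto
  then have "card {x, y} \<le> card C" using finite_ichains C card_mono by blast
  then show ?thesis using ichains_card[OF assms(1) C] assms(2) by simp
qed

definition lt :: "'p rel" where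
  "lt = {(x, y) \<in> leq. x \<noteq> y}"

text \<open>The covering relation. Its pairs index the basis of the degree one part of the
  coring.\<close>

definition cov :: "'p rel" where
  "cov = {(x, y) \<in> leq. il x y = 1}"

lemma cov_lt: "cov \<subseteq> lt"
  unfolding cov_def lt_def using il_refl leq_carrier by fastforce

lemma ltD: "(x, y) \<in> lt \<Longrightarrow> (x, y) \<in> leq" "(x, y) \<in> lt \<Longrightarrow> x \<noteq> y"
  "(x, y) \<in> lt \<Longrightarrow> x \<in> P" "(x, y) \<in> lt \<Longrightarrow> y \<in> P"
  unfolding lt_def using leq_carrier by auto

lemma lt_trans: "(x, y) \<in> lt \<Longrightarrow> (y, z) \<in> lt \<Longrightarrow> (x, z) \<in> lt"
  unfolding lt_def using leq_trans leq_antisym by blast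

lemma lt_irrefl: "(x, x) \<notin> lt"
  unfolding lt_def by simp

text \<open>Lengths add up and are positive, so a step with a point strictly inside has length at
  least two. This is what prevents the deletion of an inner point from giving a saturated
  chain.\<close>

lemma cov_between: "(x, y) \<in> lt \<Longrightarrow> (y, z) \<in> lt \<Longrightarrow> (x, z) \<notin> cov"
  using il_add[of x y z] il_pos[of x y] il_pos[of y z] unfolding lt_def cov_def by auto

lemma il_2_iff:
  assumes "(x, z) \<in> leq" "il x z = 2"
  shows "(x, y) \<in> lt \<and> (y, z) \<in> lt \<longleftrightarrow> (x, y) \<in> cov \<and> (y, z) \<in> cov"
  using assms il_add[of x y z] il_pos[of x y] il_pos[of y z] cov_lt unfolding lt_def cov_def
  by (auto simp: subset_iff)

end


section \<open>Quotients of graded rings\<close>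

text \<open>The laws of a ring are equations, so they can be checked in \<open>Q\<close> after
  applying the injective \<open>h\<close>; only the existence of negatives has to be
  supplied.\<close>

lemma ring_of_inj_hom:
  assumes Q: "ring Q" and inj: "inj_on h (carrier E)"
    and closed: "\<And>a b. \<lbrakk>a \<in> carrier E; b \<in> carrier E\<rbrakk> \<Longrightarrow> a \<oplus>\<^bsub>E\<^esub> b \<in> carrier E"
      "\<And>a b. \<lbrakk>a \<in> carrier E; b \<in> carrier E\<rbrakk> \<Longrightarrow> a \<otimes>\<^bsub>E\<^esub> b \<in> carrier E"
      "\<zero>\<^bsub>E\<^esub> \<in> carrier E" "\<one>\<^bsub>E\<^esub> \<in> carrier E"
    and h: "\<And>a. a \<in> carrier E \<Longrightarrow> h a \<in> carrier Q"
      "\<And>a b. \<lbrakk>a \<in> carrier E; b \<in> carrier E\<rbrakk> \<Longrightarrow> h (a \<oplus>\<^bsub>E\<^esub> b) = h a \<oplus>\<^bsub>Q\<^esub> h b"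
      "\<And>a b. \<lbrakk>a \<in> carrier E; b \<in> carrier E\<rbrakk> \<Longrightarrow> h (a \<otimes>\<^bsub>E\<^esub> b) = h a \<otimes>\<^bsub>Q\<^esub> h b"
      "h \<zero>\<^bsub>E\<^esub> = \<zero>\<^bsub>Q\<^esub>" "h \<one>\<^bsub>E\<^esub> = \<one>\<^bsub>Q\<^esub>"
    and neg: "\<And>a. a \<in> carrier E \<Longrightarrow> \<exists>b\<in>carrier E. h b = \<ominus>\<^bsub>Q\<^esub> h a"
  shows "ring E"
proof -
  interpret Q: ring Q by fact
  have eqI: "a = b" if "a \<in> carrier E" "b \<in> carrier E" "h a = h b" for a b
    using inj that by (auto dest: inj_onD)
  have "abelian_group E"
  proof (rule abelian_groupI)
    fix x assume x: "x \<in> carrier E"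
    then obtain b where b: "b \<in> carrier E" "h b = \<ominus>\<^bsub>Q\<^esub> h x" using neg by blast
    then have "h (b \<oplus>\<^bsub>E\<^esub> x) = h \<zero>\<^bsub>E\<^esub>" using x by (simp add: h Q.l_neg)
    then show "\<exists>y\<in>carrier E. y \<oplus>\<^bsub>E\<^esub> x = \<zero>\<^bsub>E\<^esub>" using b x closed by (auto intro: eqI)
  next
    fix x assume "x \<in> carrier E"
    then show "\<zero>\<^bsub>E\<^esub> \<oplus>\<^bsub>E\<^esub> x = x" by (intro eqI) (simp_all add: closed h)
  next
    fix x y assume "x \<in> carrier E" "y \<in> carrier E"
    then show "x \<oplus>\<^bsub>E\<^esub> y = y \<oplus>\<^bsub>E\<^esub> x" by (intro eqI) (simp_all add: closed h Q.a_comm)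
  next
    fix x y z assume "x \<in> carrier E" "y \<in> carrier E" "z \<in> carrier E"
    then show "x \<oplus>\<^bsub>E\<^esub> y \<oplus>\<^bsub>E\<^esub> z = x \<oplus>\<^bsub>E\<^esub> (y \<oplus>\<^bsub>E\<^esub> z)"
      by (intro eqI) (simp_all add: closed h Q.a_assoc)
  qed (simp_all add: closed)
  moreover have "Group.monoid E"
  proof (rule monoidI)
    fix x y z assume "x \<in> carrier E" "y \<in> carrier E" "z \<in> carrier E"
    then show "x \<otimes>\<^bsub>E\<^esub> y \<otimes>\<^bsub>E\<^esub> z = x \<otimes>\<^bsub>E\<^esub> (y \<otimes>\<^bsub>E\<^esub> z)"
      by (intro eqI) (simp_all add: closed h Q.m_assoc)
  next
    fix x assume "x \<in> carrier E"
    note x = this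
    show "\<one>\<^bsub>E\<^esub> \<otimes>\<^bsub>E\<^esub> x = x" using x by (intro eqI) (simp_all add: closed h)
    show "x \<otimes>\<^bsub>E\<^esub> \<one>\<^bsub>E\<^esub> = x" using x by (intro eqI) (simp_all add: closed h)
  qed (simp_all add: closed)
  ultimately show ?thesis
  proof (rule ringI)
    fix x y z assume "x \<in> carrier E" "y \<in> carrier E" "z \<in> carrier E"
    note xyz = this
    show "(x \<oplus>\<^bsub>E\<^esub> y) \<otimes>\<^bsub>E\<^esub> z = x \<otimes>\<^bsub>E\<^esub> z \<oplus>\<^bsub>E\<^esub> y \<otimes>\<^bsub>E\<^esub> z"
      using xyz by (intro eqI) (simp_all add: closed h Q.l_distr)
    show "z \<otimes>\<^bsub>E\<^esub> (x \<oplus>\<^bsub>E\<^esub> y) = z \<otimes>\<^bsub>E\<^esub> x \<oplus>\<^bsub>E\<^esub> z \<otimes>\<^bsub>E\<^esub> y"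
      using xyz by (intro eqI) (simp_all add: closed h Q.r_distr)
  qed
qed

lemma descend_const:
  assumes "a \<in> U" "\<And>b. b \<in> U \<Longrightarrow> h b = h a"
  shows "descend h U = h a"
proof -
  have "h ` U = {h a}" using assms by blast
  then show ?thesis unfolding descend_def by simp
qed

text \<open>The setting of a first isomorphism theorem for \<open>quotient_rring\<close>. No ring
  law is assumed of \<open>W\<close> beyond its additive group; the laws of the quotient are
  inherited from \<open>Q\<close>. It serves for the tensor rings, for the residue module and for
  \<open>Ext\<close>.\<close>

locale graded_rring_quotient =
  fixes W :: "('r, 'm, 'x) graded_bimodule_scheme" and I :: "'m set"
    and Q :: "('r, 'n, 'y) graded_bimodule_scheme" and \<Phi> :: "'m \<Rightarrow> 'n"
    and R :: "('r, 'w) ring_scheme"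
  assumes W: "abelian_group W" and Q: "ring Q"
    and closed: "\<And>a b. \<lbrakk>a \<in> carrier W; b \<in> carrier W\<rbrakk> \<Longrightarrow> a \<otimes>\<^bsub>W\<^esub> b \<in> carrier W" "\<one>\<^bsub>W\<^esub> \<in> carrier W"
    and hom: "\<And>a b. \<lbrakk>a \<in> carrier W; b \<in> carrier W\<rbrakk> \<Longrightarrow> \<Phi> (a \<oplus>\<^bsub>W\<^esub> b) = \<Phi> a \<oplus>\<^bsub>Q\<^esub> \<Phi> b"
      "\<And>a b. \<lbrakk>a \<in> carrier W; b \<in> carrier W\<rbrakk> \<Longrightarrow> \<Phi> (a \<otimes>\<^bsub>W\<^esub> b) = \<Phi> a \<otimes>\<^bsub>Q\<^esub> \<Phi> b"
      "\<Phi> \<one>\<^bsub>W\<^esub> = \<one>\<^bsub>Q\<^esub>"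
    and surj: "\<Phi> ` carrier W = carrier Q"
    and ker: "I = {a \<in> carrier W. \<Phi> a = \<zero>\<^bsub>Q\<^esub>}"
    and act: "\<And>r a. \<lbrakk>r \<in> carrier R; a \<in> carrier W\<rbrakk> \<Longrightarrow> lact W r a \<in> carrier W"
      "\<And>r a. \<lbrakk>r \<in> carrier R; a \<in> carrier W\<rbrakk> \<Longrightarrow> ract W a r \<in> carrier W"
      "\<And>r a. \<lbrakk>r \<in> carrier R; a \<in> carrier W\<rbrakk> \<Longrightarrow> \<Phi> (lact W r a) = lact Q r (\<Phi> a)"
      "\<And>r a. \<lbrakk>r \<in> carrier R; a \<in> carrier W\<rbrakk> \<Longrightarrow> \<Phi> (ract W a r) = ract Q (\<Phi> a) r"
    and deg: "\<And>n. hcomp W n \<subseteq> carrier W" "\<And>n. \<Phi> ` hcomp W n = hcomp Q n"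
begin

interpretation W: abelian_group W by (rule W)
interpretation Q: ring Q by (rule Q)

lemma Phi_closed: "a \<in> carrier W \<Longrightarrow> \<Phi> a \<in> carrier Q"
  using surj by blast

lemma Phi_zero: "\<Phi> \<zero>\<^bsub>W\<^esub> = \<zero>\<^bsub>Q\<^esub>"
proof -
  have "\<Phi> \<zero>\<^bsub>W\<^esub> \<oplus>\<^bsub>Q\<^esub> \<Phi> \<zero>\<^bsub>W\<^esub> = \<Phi> \<zero>\<^bsub>W\<^esub>"
    using hom(1)[of "\<zero>\<^bsub>W\<^esub>" "\<zero>\<^bsub>W\<^esub>"] by simp
  then show ?thesis using Phi_closed[of "\<zero>\<^bsub>W\<^esub>"] Q.add.l_cancel_one by simp
qed

lemma Phi_neg: "a \<in> carrier W \<Longrightarrow> \<Phi> (\<ominus>\<^bsub>W\<^esub> a) = \<ominus>\<^bsub>Q\<^esub> \<Phi> a"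
  using hom(1)[of "\<ominus>\<^bsub>W\<^esub> a" a] Phi_closed Phi_zero
  by (metis Q.minus_equality W.a_inv_closed W.l_neg)

lemma coset_eq:
  assumes a: "a \<in> carrier W"
  shows "I +>\<^bsub>W\<^esub> a = {b \<in> carrier W. \<Phi> b = \<Phi> a}"
proof (intro equalityI subsetI)
  fix b assume "b \<in> I +>\<^bsub>W\<^esub> a"
  then obtain h where "h \<in> I" "b = h \<oplus>\<^bsub>W\<^esub> a" by (auto simp: a_r_coset_def')
  then show "b \<in> {b \<in> carrier W. \<Phi> b = \<Phi> a}" using a ker hom(1)[of h a] Phi_closed by auto
next
  fix b assume "b \<in> {b \<in> carrier W. \<Phi> b = \<Phi> a}"
  then have b: "b \<in> carrier W" "\<Phi> b = \<Phi> a" by auto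
  then have "\<Phi> (b \<oplus>\<^bsub>W\<^esub> \<ominus>\<^bsub>W\<^esub> a) = \<zero>\<^bsub>Q\<^esub>"
    using a by (simp add: hom Phi_neg Phi_closed Q.r_neg)
  then have "b \<oplus>\<^bsub>W\<^esub> \<ominus>\<^bsub>W\<^esub> a \<in> I" using ker a b by simp
  moreover have "b = (b \<oplus>\<^bsub>W\<^esub> \<ominus>\<^bsub>W\<^esub> a) \<oplus>\<^bsub>W\<^esub> a"
    using a b by (simp add: W.a_assoc W.l_neg)
  ultimately show "b \<in> I +>\<^bsub>W\<^esub> a" by (auto simp: a_r_coset_def')
qed

lemma coset_eq_iff:
  "\<lbrakk>a \<in> carrier W; b \<in> carrier W\<rbrakk> \<Longrightarrow> I +>\<^bsub>W\<^esub> a = I +>\<^bsub>W\<^esub> b \<longleftrightarrow> \<Phi> a = \<Phi> b"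
  by (auto simp: coset_eq)

lemma descend_coset:
  assumes "a \<in> carrier W" "\<And>b. b \<in> carrier W \<Longrightarrow> \<Phi> b = \<Phi> a \<Longrightarrow> h b = h a"
  shows "descend h (I +>\<^bsub>W\<^esub> a) = h a"
proof (rule descend_const)
  show "a \<in> I +>\<^bsub>W\<^esub> a" using assms(1) by (simp add: coset_eq)
  show "h b = h a" if "b \<in> I +>\<^bsub>W\<^esub> a" for b
    using that assms(1) by (intro assms(2)) (simp_all add: coset_eq)
qed

lemma descend_Phi: "a \<in> carrier W \<Longrightarrow> descend \<Phi> (I +>\<^bsub>W\<^esub> a) = \<Phi> a"
  by (rule descend_coset[of a \<Phi>])

abbreviation QW where "QW \<equiv> quotient_rring W I"

lemma carrier_QW: "carrier QW = (\<lambda>a. I +>\<^bsub>W\<^esub> a) ` carrier W"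
  unfolding quotient_rring_def FactRing_def by (auto simp: A_RCOSETS_def' a_r_coset_def')

lemma add_QW:
  assumes a: "a \<in> carrier W" and b: "b \<in> carrier W"
  shows "(I +>\<^bsub>W\<^esub> a) \<oplus>\<^bsub>QW\<^esub> (I +>\<^bsub>W\<^esub> b) = I +>\<^bsub>W\<^esub> (a \<oplus>\<^bsub>W\<^esub> b)"
proof -
  have "(I +>\<^bsub>W\<^esub> a) \<oplus>\<^bsub>QW\<^esub> (I +>\<^bsub>W\<^esub> b) = {u \<oplus>\<^bsub>W\<^esub> v | u v. u \<in> I +>\<^bsub>W\<^esub> a \<and> v \<in> I +>\<^bsub>W\<^esub> b}"
    unfolding quotient_rring_def FactRing_def by (auto simp: set_add_defs)
  also have "\<dots> = I +>\<^bsub>W\<^esub> (a \<oplus>\<^bsub>W\<^esub> b)"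
  proof (intro equalityI subsetI)
    fix c assume "c \<in> {u \<oplus>\<^bsub>W\<^esub> v | u v. u \<in> I +>\<^bsub>W\<^esub> a \<and> v \<in> I +>\<^bsub>W\<^esub> b}"
    then show "c \<in> I +>\<^bsub>W\<^esub> (a \<oplus>\<^bsub>W\<^esub> b)" using a b by (auto simp: coset_eq hom)
  next
    fix c assume "c \<in> I +>\<^bsub>W\<^esub> (a \<oplus>\<^bsub>W\<^esub> b)"
    then have c: "c \<in> carrier W" "\<Phi> c = \<Phi> a \<oplus>\<^bsub>Q\<^esub> \<Phi> b" using a b by (auto simp: coset_eq hom)
    \<comment> \<open>An element of the class of the sum is split into \<open>a\<close> and a
      remainder, which lies in the class of \<open>b\<close>.\<close>
    have "c = a \<oplus>\<^bsub>W\<^esub> (\<ominus>\<^bsub>W\<^esub> a \<oplus>\<^bsub>W\<^esub> c)" using a c by (simp add: W.r_neg2)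
    moreover have "\<ominus>\<^bsub>W\<^esub> a \<oplus>\<^bsub>W\<^esub> c \<in> I +>\<^bsub>W\<^esub> b"
      using a b c by (simp add: coset_eq hom Phi_neg Phi_closed Q.r_neg1)
    moreover have "a \<in> I +>\<^bsub>W\<^esub> a" using a by (simp add: coset_eq)
    ultimately show "c \<in> {u \<oplus>\<^bsub>W\<^esub> v | u v. u \<in> I +>\<^bsub>W\<^esub> a \<and> v \<in> I +>\<^bsub>W\<^esub> b}" by blast
  qed
  finally show ?thesis .
qed

lemma mult_QW:
  assumes a: "a \<in> carrier W" and b: "b \<in> carrier W"
  shows "(I +>\<^bsub>W\<^esub> a) \<otimes>\<^bsub>QW\<^esub> (I +>\<^bsub>W\<^esub> b) = I +>\<^bsub>W\<^esub> (a \<otimes>\<^bsub>W\<^esub> b)"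
proof -
  have "(I +>\<^bsub>W\<^esub> a) \<otimes>\<^bsub>QW\<^esub> (I +>\<^bsub>W\<^esub> b) = (\<Union>u\<in>I +>\<^bsub>W\<^esub> a. \<Union>v\<in>I +>\<^bsub>W\<^esub> b. I +>\<^bsub>W\<^esub> (u \<otimes>\<^bsub>W\<^esub> v))"
    unfolding quotient_rring_def FactRing_def by (simp add: rcoset_mult_def)
  moreover have "I +>\<^bsub>W\<^esub> (u \<otimes>\<^bsub>W\<^esub> v) = I +>\<^bsub>W\<^esub> (a \<otimes>\<^bsub>W\<^esub> b)"
    if "u \<in> I +>\<^bsub>W\<^esub> a" "v \<in> I +>\<^bsub>W\<^esub> b" for u v
    using that a b by (simp add: coset_eq_iff closed hom coset_eq)
  moreover have "a \<in> I +>\<^bsub>W\<^esub> a" "b \<in> I +>\<^bsub>W\<^esub> b" using a b by (auto simp: coset_eq)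
  ultimately show ?thesis by blast
qed

lemma one_QW: "\<one>\<^bsub>QW\<^esub> = I +>\<^bsub>W\<^esub> \<one>\<^bsub>W\<^esub>"
  unfolding quotient_rring_def FactRing_def by simp

lemma zero_QW: "\<zero>\<^bsub>QW\<^esub> = I +>\<^bsub>W\<^esub> \<zero>\<^bsub>W\<^esub>"
proof -
  have "I = I +>\<^bsub>W\<^esub> \<zero>\<^bsub>W\<^esub>" by (subst coset_eq) (simp_all add: ker Phi_zero)
  then show ?thesis unfolding quotient_rring_def FactRing_def by simp
qed

lemma lact_QW: "\<lbrakk>r \<in> carrier R; a \<in> carrier W\<rbrakk> \<Longrightarrow> lact QW r (I +>\<^bsub>W\<^esub> a) = I +>\<^bsub>W\<^esub> lact W r a"
  unfolding quotient_rring_def by simp (rule descend_coset; simp add: coset_eq_iff act)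

lemma ract_QW: "\<lbrakk>r \<in> carrier R; a \<in> carrier W\<rbrakk> \<Longrightarrow> ract QW (I +>\<^bsub>W\<^esub> a) r = I +>\<^bsub>W\<^esub> ract W a r"
  unfolding quotient_rring_def by simp (rule descend_coset; simp add: coset_eq_iff act)

lemma hcomp_QW: "hcomp QW n = (\<lambda>a. I +>\<^bsub>W\<^esub> a) ` hcomp W n"
  unfolding quotient_rring_def by simp

lemma inj_descend: "inj_on (descend \<Phi>) (carrier QW)"
proof (rule inj_onI)
  fix U V assume "U \<in> carrier QW" "V \<in> carrier QW" and eq: "descend \<Phi> U = descend \<Phi> V"
  then obtain a b where ab: "a \<in> carrier W" "b \<in> carrier W" "U = I +>\<^bsub>W\<^esub> a" "V = I +>\<^bsub>W\<^esub> b"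
    by (auto simp: carrier_QW)
  then show "U = V" using eq by (simp add: descend_Phi coset_eq_iff)
qed

lemma descend_iso: "descend \<Phi> \<in> graded_rring_iso R QW Q"
proof -
  have "descend \<Phi> ` carrier QW = carrier Q"
    unfolding carrier_QW image_image surj[symmetric] by (intro image_cong) (simp_all add: descend_Phi)
  then have bij: "bij_betw (descend \<Phi>) (carrier QW) (carrier Q)"
    using inj_descend by (simp add: bij_betw_def)
  moreover have "descend \<Phi> \<in> ring_hom QW Q"
    by (rule ring_hom_memI)
      (auto simp: carrier_QW add_QW mult_QW one_QW descend_Phi Phi_closed hom closed)
  moreover have "descend \<Phi> ` hcomp QW n = hcomp Q n" for n
  proof -
    have "descend \<Phi> ` hcomp QW n = \<Phi> ` hcomp W n"
      unfolding hcomp_QW image_image using deg(1)[of n] by (intro image_cong) (auto simp: descend_Phi)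
    then show ?thesis using deg(2) by simp
  qed
  moreover have "descend \<Phi> (lact QW r x) = lact Q r (descend \<Phi> x) \<and>
      descend \<Phi> (ract QW x r) = ract Q (descend \<Phi> x) r"
    if "r \<in> carrier R" "x \<in> carrier QW" for r x
    using that by (auto simp: carrier_QW lact_QW ract_QW descend_Phi act)
  ultimately show ?thesis unfolding graded_rring_iso_def ring_iso_def by simp
qed

lemma ring_QW: "ring QW"
proof (rule ring_of_inj_hom[OF Q inj_descend])
  fix a assume "a \<in> carrier QW"
  then obtain x where "x \<in> carrier W" "a = I +>\<^bsub>W\<^esub> x" by (auto simp: carrier_QW)
  then show "\<exists>b\<in>carrier QW. descend \<Phi> b = \<ominus>\<^bsub>Q\<^esub> descend \<Phi> a"
    by (intro bexI[of _ "I +>\<^bsub>W\<^esub> (\<ominus>\<^bsub>W\<^esub> x)"]) (auto simp: carrier_QW descend_Phi Phi_neg)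
qed (auto simp: carrier_QW add_QW mult_QW one_QW zero_QW descend_Phi Phi_closed Phi_zero hom closed)

end


section \<open>Path rings\<close>

definition walks :: "'p rel \<Rightarrow> 'p list set" where
  "walks S = {c. c \<noteq> [] \<and> successively (\<lambda>x y. (x, y) \<in> S) c}"

text \<open>For a relation \<open>S\<close> on \<open>P\<close> the membership in \<open>P\<close>
  restricts only the one-point walks, which span degree 0.\<close>

definition pwalks :: "'p set \<Rightarrow> 'p rel \<Rightarrow> 'p list set" where
  "pwalks P S = {c \<in> walks S. set c \<subseteq> P}"

lemma pwalks_Cons_Cons [simp]: "x # y # c \<in> pwalks P S \<longleftrightarrow> x \<in> P \<and> (x, y) \<in> S \<and> y # c \<in> pwalks P S"
  and pwalks_single [simp]: "[x] \<in> pwalks P S \<longleftrightarrow> x \<in> P"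
  and pwalks_Nil [simp]: "[] \<notin> pwalks P S"
  by (auto simp: pwalks_def walks_def)

lemma pwalks_append:
  assumes "v \<noteq> []" "w \<noteq> []"
  shows "v @ w \<in> pwalks P S \<longleftrightarrow> v \<in> pwalks P S \<and> w \<in> pwalks P S \<and> (last v, hd w) \<in> S"
  using assms by (auto simp: pwalks_def walks_def successively_append_iff)

text \<open>The point at position \<open>k\<close> belongs to both pieces, so every step of
  \<open>c\<close> is a step of one of them and no further condition links the pieces.\<close>

lemma pwalks_glue:
  assumes "k < length c"
  shows "c \<in> pwalks P S \<longleftrightarrow> take (Suc k) c \<in> pwalks P S \<and> drop k c \<in> pwalks P S"
  using assms
proof (induction c arbitrary: k)
  case (Cons x c)
  show ?case
  proof (cases k)
    case 0
    then show ?thesis by (cases c) auto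
  next
    case (Suc j)
    then obtain y d where c: "c = y # d" using Cons.prems by (cases c) auto
    then show ?thesis using Cons.IH[of j] Cons.prems Suc by auto
  qed
qed simp

lemma finite_pwalks_length:
  assumes "finite P"
  shows "finite {c \<in> pwalks P S. length c = n}"
  by (rule finite_subset[OF _ finite_lists_length_eq[OF assms, of n]]) (auto simp: pwalks_def)

text \<open>The walks in the product overlap in one point, which is why \<open>take\<close> and \<open>drop\<close> both keep it.\<close>

definition path_ring :: "'p set \<Rightarrow> 'p rel \<Rightarrow> ('p \<Rightarrow> 'k::field, 'p list \<Rightarrow> 'k) graded_bimodule" where
  "path_ring P S =
    \<lparr>carrier = {F. finite {c. F c \<noteq> 0} \<and> (\<forall>c. F c \<noteq> 0 \<longrightarrow> c \<in> pwalks P S)},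
     mult = (\<lambda>F G c. \<Sum>k<length c. F (take (Suc k) c) * G (drop k c)),
     one = (\<lambda>c. if \<exists>x\<in>P. c = [x] then 1 else 0), zero = (\<lambda>c. 0), add = (\<lambda>F G c. F c + G c),
     lact = (\<lambda>r F c. r (hd c) * F c), ract = (\<lambda>F r c. F c * r (last c)),
     hcomp = (\<lambda>n. {F. finite {c. F c \<noteq> 0} \<and> (\<forall>c. F c \<noteq> 0 \<longrightarrow> c \<in> pwalks P S \<and> length c = Suc n)})\<rparr>"

lemma path_ring_sel:
  "carrier (path_ring P S) = {F. finite {c. F c \<noteq> 0} \<and> (\<forall>c. F c \<noteq> 0 \<longrightarrow> c \<in> pwalks P S)}"
  "F \<otimes>\<^bsub>path_ring P S\<^esub> G = (\<lambda>c. \<Sum>k<length c. F (take (Suc k) c) * G (drop k c))"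
  "\<one>\<^bsub>path_ring P S\<^esub> = (\<lambda>c. if \<exists>x\<in>P. c = [x] then 1 else 0)"
  "\<zero>\<^bsub>path_ring P S\<^esub> = (\<lambda>c. 0)"
  "F \<oplus>\<^bsub>path_ring P S\<^esub> G = (\<lambda>c. F c + G c)"
  "lact (path_ring P S) r F = (\<lambda>c. r (hd c) * F c)"
  "ract (path_ring P S) F r = (\<lambda>c. F c * r (last c))"
  "hcomp (path_ring P S) n =
     {F. finite {c. F c \<noteq> 0} \<and> (\<forall>c. F c \<noteq> 0 \<longrightarrow> c \<in> pwalks P S \<and> length c = Suc n)}"
  by (simp_all add: path_ring_def)

lemma path_ringI:
  assumes "finite A" "\<And>c. F c \<noteq> 0 \<Longrightarrow> c \<in> A" "\<And>c. F c \<noteq> 0 \<Longrightarrow> c \<in> pwalks P S"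
  shows "F \<in> carrier (path_ring P S)"
  using assms by (auto simp: path_ring_sel intro: finite_subset)

lemma path_ringD:
  assumes "F \<in> carrier (path_ring P S)"
  shows "finite {c. F c \<noteq> 0}" "F c \<noteq> 0 \<Longrightarrow> c \<in> pwalks P S"
  using assms by (auto simp: path_ring_sel)

lemma path_mult_closed:
  assumes F: "F \<in> carrier (path_ring P S)" and G: "G \<in> carrier (path_ring P S)"
  shows "F \<otimes>\<^bsub>path_ring P S\<^esub> G \<in> carrier (path_ring P S)"
proof -
  have ex: "\<exists>k<length c. F (take (Suc k) c) \<noteq> 0 \<and> G (drop k c) \<noteq> 0"
    if "(F \<otimes>\<^bsub>path_ring P S\<^esub> G) c \<noteq> 0" for c
  proof -
    have "(\<Sum>k<length c. F (take (Suc k) c) * G (drop k c)) \<noteq> 0"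
      using that by (simp add: path_ring_sel)
    then show ?thesis by (metis (mono_tags, lifting) lessThan_iff mult_eq_0_iff sum.neutral)
  qed
  show ?thesis
  proof (rule path_ringI)
    \<comment> \<open>A walk in the support of the product is determined by its two factors, which
      overlap in one point.\<close>
    show "finite ((\<lambda>(a, b). a @ tl b) ` ({c. F c \<noteq> 0} \<times> {c. G c \<noteq> 0}))"
      using path_ringD(1)[OF F] path_ringD(1)[OF G] by simp
    fix c assume "(F \<otimes>\<^bsub>path_ring P S\<^esub> G) c \<noteq> 0"
    then obtain k where k: "k < length c" "F (take (Suc k) c) \<noteq> 0" "G (drop k c) \<noteq> 0"
      using ex by blast
    have "c = take (Suc k) c @ tl (drop k c)" by (metis append_take_drop_id drop_Suc tl_drop)
    then show "c \<in> (\<lambda>(a, b). a @ tl b) ` ({c. F c \<noteq> 0} \<times> {c. G c \<noteq> 0})" using k by force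
    show "c \<in> pwalks P S"
      using k path_ringD(2)[OF F] path_ringD(2)[OF G] pwalks_glue by blast
  qed
qed

text \<open>Both sides sum over two cut positions \<open>i \<le> k\<close> of the walk. On the right
  the second cut is counted from the first, whence the substitution
  \<open>j = k - i\<close>.\<close>

lemma path_mult_assoc:
  "(F \<otimes>\<^bsub>path_ring P S\<^esub> G) \<otimes>\<^bsub>path_ring P S\<^esub> H = F \<otimes>\<^bsub>path_ring P S\<^esub> (G \<otimes>\<^bsub>path_ring P S\<^esub> H)"
proof
  fix c :: "'a list"
  let ?t = "\<lambda>i k. F (take (Suc i) c) * G (drop i (take (Suc k) c)) * H (drop k c)"
  have "((F \<otimes>\<^bsub>path_ring P S\<^esub> G) \<otimes>\<^bsub>path_ring P S\<^esub> H) c = (\<Sum>k<length c. \<Sum>i<Suc k. ?t i k)"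
    unfolding path_ring_sel sum_distrib_right
    by (intro sum.cong) (auto simp: min_def)
  also have "\<dots> = (\<Sum>(k, i)\<in>(SIGMA k:{..<length c}. {..<Suc k}). ?t i k)"
    by (simp add: sum.Sigma del: sum.lessThan_Suc)
  also have "\<dots> = (\<Sum>(i, j)\<in>(SIGMA i:{..<length c}. {..<length c - i}). ?t i (i + j))"
    by (rule sum.reindex_bij_witness[where i = "\<lambda>(i, j). (i + j, i)" and j = "\<lambda>(k, i). (i, k - i)"])
      auto
  also have "\<dots> = (\<Sum>i<length c. \<Sum>j<length c - i. ?t i (i + j))"
    by (simp add: sum.Sigma)
  also have "\<dots> = (F \<otimes>\<^bsub>path_ring P S\<^esub> (G \<otimes>\<^bsub>path_ring P S\<^esub> H)) c"
    unfolding path_ring_sel sum_distrib_left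
    by (intro sum.cong) (auto simp: drop_take mult.assoc add.commute)
  finally show "((F \<otimes>\<^bsub>path_ring P S\<^esub> G) \<otimes>\<^bsub>path_ring P S\<^esub> H) c = (F \<otimes>\<^bsub>path_ring P S\<^esub> (G \<otimes>\<^bsub>path_ring P S\<^esub> H)) c" .
qed

lemma path_one_mult:
  assumes F: "F \<in> carrier (path_ring P S)"
  shows "\<one>\<^bsub>path_ring P S\<^esub> \<otimes>\<^bsub>path_ring P S\<^esub> F = F" "F \<otimes>\<^bsub>path_ring P S\<^esub> \<one>\<^bsub>path_ring P S\<^esub> = F"
proof -
  have P: "set c \<subseteq> P" if "F c \<noteq> 0" for c
    using path_ringD(2)[OF F that] by (simp add: pwalks_def)
  have F0: "F [] = 0"
    using path_ringD(2)[OF F, of "[]"] by auto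
  show "\<one>\<^bsub>path_ring P S\<^esub> \<otimes>\<^bsub>path_ring P S\<^esub> F = F"
  proof
    fix c show "(\<one>\<^bsub>path_ring P S\<^esub> \<otimes>\<^bsub>path_ring P S\<^esub> F) c = F c"
    proof (cases c)
      case (Cons x d)
      have "(\<one>\<^bsub>path_ring P S\<^esub> \<otimes>\<^bsub>path_ring P S\<^esub> F) c
          = (\<Sum>k<length c. if k = 0 then (if x \<in> P then F c else 0) else 0)"
        unfolding path_ring_sel
        by (intro sum.cong) (auto simp: Cons take_Suc_conv_app_nth neq_Nil_conv)
      also have "\<dots> = F c"
        using P[of c] Cons by (auto simp: sum.delta)
      finally show ?thesis .
    qed (simp add: path_ring_sel F0)
  qed
  show "F \<otimes>\<^bsub>path_ring P S\<^esub> \<one>\<^bsub>path_ring P S\<^esub> = F"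
  proof
    fix c show "(F \<otimes>\<^bsub>path_ring P S\<^esub> \<one>\<^bsub>path_ring P S\<^esub>) c = F c"
    proof (cases c rule: rev_cases)
      case (snoc d x)
      have "(F \<otimes>\<^bsub>path_ring P S\<^esub> \<one>\<^bsub>path_ring P S\<^esub>) c
          = (\<Sum>k<length c. if k = length d then (if x \<in> P then F c else 0) else 0)"
        unfolding path_ring_sel
      proof (intro sum.cong refl)
        fix k assume "k \<in> {..<length c}"
        then have "k \<le> length d" by (simp add: snoc)
        then show "F (take (Suc k) c) * (if \<exists>x\<in>P. drop k c = [x] then 1 else 0) =
          (if k = length d then if x \<in> P then F c else 0 else 0)"
          by (cases "k = length d") (auto simp: snoc append_eq_Cons_conv)
      qed
      also have "\<dots> = F c"
        using P[of c] snoc by (auto simp: sum.delta)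
      finally show ?thesis .
    qed (simp add: path_ring_sel F0)
  qed
qed

lemma path_add_closed:
  assumes "F \<in> carrier (path_ring P S)" "G \<in> carrier (path_ring P S)"
  shows "F \<oplus>\<^bsub>path_ring P S\<^esub> G \<in> carrier (path_ring P S)"
proof (rule path_ringI[where A = "{c. F c \<noteq> 0} \<union> {c. G c \<noteq> 0}"])
  fix c assume "(F \<oplus>\<^bsub>path_ring P S\<^esub> G) c \<noteq> 0"
  then have "F c \<noteq> 0 \<or> G c \<noteq> 0" by (auto simp: path_ring_sel)
  then show "c \<in> {c. F c \<noteq> 0} \<union> {c. G c \<noteq> 0}" "c \<in> pwalks P S"
    using path_ringD(2) assms by blast+
qed (use assms in \<open>simp add: path_ring_sel\<close>)

lemma path_neg_closed:
  "F \<in> carrier (path_ring P S) \<Longrightarrow> (\<lambda>c. - F c) \<in> carrier (path_ring P S)"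
  by (auto simp: path_ring_sel)

lemma path_one_closed: "finite P \<Longrightarrow> \<one>\<^bsub>path_ring P S\<^esub> \<in> carrier (path_ring P S)"
  by (rule path_ringI[where A = "(\<lambda>x. [x]) ` P"]) (auto simp: path_ring_sel split: if_splits)

lemma path_ring_ring:
  fixes P :: "'p set"
  assumes "finite P"
  shows "ring (path_ring P S :: ('p \<Rightarrow> 'k::field, 'p list \<Rightarrow> 'k) graded_bimodule)" (is "ring ?A")
proof (rule ringI)
  show "abelian_group ?A"
  proof (rule abelian_groupI)
    fix F :: "'p list \<Rightarrow> 'k" assume "F \<in> carrier ?A"
    then show "\<exists>G\<in>carrier ?A. G \<oplus>\<^bsub>?A\<^esub> F = \<zero>\<^bsub>?A\<^esub>"
      using path_neg_closed by (intro bexI[of _ "\<lambda>c. - F c"]) (auto simp: path_ring_sel)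
  next
    fix F G :: "'p list \<Rightarrow> 'k" assume "F \<in> carrier ?A" "G \<in> carrier ?A"
    then show "F \<oplus>\<^bsub>?A\<^esub> G \<in> carrier ?A" by (rule path_add_closed)
  qed (auto simp: path_ring_sel add.assoc add.commute)
  show "Group.monoid ?A"
    by (rule monoidI) (simp_all add: path_mult_closed path_mult_assoc path_one_mult path_one_closed assms)
qed (simp_all add: path_ring_sel algebra_simps sum.distrib)


section \<open>Tensor rings of incidence bimodules\<close>

definition frag_val :: "('a \<Rightarrow> 'k::comm_ring_1) \<Rightarrow> ('a \<Rightarrow>\<^sub>0 int) \<Rightarrow> 'k" where
  "frag_val g c = (\<Sum>w\<in>Poly_Mapping.keys c. of_int (Poly_Mapping.lookup c w) * g w)"

lemma frag_val_superset:
  assumes "finite A" "Poly_Mapping.keys c \<subseteq> A"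
  shows "frag_val g c = (\<Sum>w\<in>A. of_int (Poly_Mapping.lookup c w) * g w)"
  unfolding frag_val_def
  by (rule sum.mono_neutral_left) (use assms in \<open>auto simp: in_keys_iff\<close>)

lemma frag_val_0 [simp]: "frag_val g 0 = 0"
  by (simp add: frag_val_def)

lemma frag_val_of [simp]: "frag_val g (frag_of w) = g w"
  by (simp add: frag_val_def)

lemma frag_val_add: "frag_val g (a + b) = frag_val g a + frag_val g b"
proof -
  let ?A = "Poly_Mapping.keys a \<union> Poly_Mapping.keys b"
  have "frag_val g (a + b) = (\<Sum>w\<in>?A. of_int (Poly_Mapping.lookup (a + b) w) * g w)"
    by (rule frag_val_superset) (simp_all add: Poly_Mapping.keys_add)
  then show ?thesis
    by (simp add: frag_val_superset[of ?A] lookup_add algebra_simps sum.distrib)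
qed

lemma frag_val_minus: "frag_val g (- a) = - frag_val g a"
  by (simp add: frag_val_def sum_negf)

lemma frag_val_diff: "frag_val g (a - b) = frag_val g a - frag_val g b"
  using frag_val_add[of g a "- b"] by (simp add: frag_val_minus)

lemma frag_val_sum: "finite A \<Longrightarrow> frag_val g (sum h A) = (\<Sum>x\<in>A. frag_val g (h x))"
  by (induction A rule: finite_induct) (simp_all add: frag_val_add)

lemma frag_val_cmul: "frag_val g (frag_cmul k a) = of_int k * frag_val g a"
  by (subst frag_val_superset[of "Poly_Mapping.keys a"])
    (auto simp: frag_val_def sum_distrib_left mult.assoc)

lemma frag_val_extend: "frag_val g (frag_extend h c) = frag_val (\<lambda>w. frag_val g (h w)) c"
  unfolding frag_extend_def by (simp add: frag_val_sum frag_val_cmul) (simp add: frag_val_def)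

lemma frag_val_cong: "(\<And>w. w \<in> Poly_Mapping.keys c \<Longrightarrow> g w = h w) \<Longrightarrow> frag_val g c = frag_val h c"
  by (simp add: frag_val_def)

lemma frag_val_mult_left: "frag_val (\<lambda>w. a * g w) c = a * frag_val g c"
  by (simp add: frag_val_def sum_distrib_left mult.left_commute)

lemma frag_val_mult_right: "frag_val (\<lambda>w. g w * a) c = frag_val g c * a"
  by (simp add: frag_val_def sum_distrib_right mult.assoc)

lemma frag_val_sum_left: "finite A \<Longrightarrow> frag_val (\<lambda>w. \<Sum>x\<in>A. g x w) c = (\<Sum>x\<in>A. frag_val (g x) c)"
  by (simp add: frag_val_def sum_distrib_left) (subst sum.swap, simp)

text \<open>The coefficient of a walk in the tensor product of the listed elements: the product of
  their entries along the steps. It is 0 unless the walk has exactly as many steps as there are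
  factors.\<close>

fun steps :: "('p \<Rightarrow> 'p \<Rightarrow> 'k::field) list \<Rightarrow> 'p list \<Rightarrow> 'k" where
  "steps [] [x] = 1"
| "steps (u # us) (x # y # c) = u x y * steps us (y # c)"
| "steps _ _ = 0"

definition word_val :: "('p \<Rightarrow> 'k::field) \<times> ('p \<Rightarrow> 'p \<Rightarrow> 'k) list \<Rightarrow> 'p list \<Rightarrow> 'k" where
  "word_val w c = fst w (hd c) * steps (snd w) c"

lemma steps_length: "steps us c \<noteq> 0 \<Longrightarrow> length c = Suc (length us)"
  by (induction us c rule: steps.induct) auto

lemma steps_Nil [simp]: "steps us [] = 0"
  by (cases us) auto

lemma steps_single [simp]: "steps us [x] = (if us = [] then 1 else 0)"
  by (cases us) auto

lemma steps_append: "steps (us @ vs) c = steps us (take (Suc (length us)) c) * steps vs (drop (length us) c)"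
proof (induction us arbitrary: c)
  case Nil
  then show ?case by (cases c) (auto simp: steps_length)
next
  case (Cons u us)
  show ?case
  proof (cases c)
    case (Cons x d)
    then show ?thesis using Cons.IH[of d] by (cases d) auto
  qed simp
qed

lemma steps_ract_last:
  "us \<noteq> [] \<Longrightarrow> steps (butlast us @ [\<lambda>x y. last us x y * s y]) c = steps us c * s (last c)"
proof (induction us c rule: steps.induct)
  case (2 u us x y c)
  then show ?case by (cases "us = []"; cases c) auto
qed auto

lemma steps_lact: "steps ((\<lambda>x y. s x * u x y) # us) c = s (hd c) * steps (u # us) c"
  by (cases c; cases "tl c") auto

lemma steps_slot_add:
  "steps (us @ (\<lambda>x y. u x y + v x y) # vs) c = steps (us @ u # vs) c + steps (us @ v # vs) c"
proof (induction us arbitrary: c)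
  case Nil
  then show ?case by (cases c; cases "tl c") (auto simp: algebra_simps)
next
  case (Cons w us)
  then show ?case by (cases c; cases "tl c") (auto simp: algebra_simps)
qed

lemma steps_balance:
  "steps (us @ (\<lambda>x y. u x y * s y) # v # vs) c = steps (us @ u # (\<lambda>x y. s x * v x y) # vs) c"
proof (induction us arbitrary: c)
  case Nil
  then show ?case by (cases c; cases "tl c") (auto simp: steps_lact)
next
  case (Cons w us)
  then show ?case by (cases c; cases "tl c") auto
qed

section \<open>The word ring of an incidence bimodule\<close>

lemma base_ring_sel:
  "carrier (base_ring P) = {r. \<forall>x. x \<notin> P \<longrightarrow> r x = 0}"
  "r \<otimes>\<^bsub>base_ring P\<^esub> s = (\<lambda>x. r x * s x)"
  "\<one>\<^bsub>base_ring P\<^esub> = (\<lambda>x. if x \<in> P then 1 else 0)"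
  "\<zero>\<^bsub>base_ring P\<^esub> = (\<lambda>x. 0)"
  "r \<oplus>\<^bsub>base_ring P\<^esub> s = (\<lambda>x. r x + s x)"
  by (simp_all add: base_ring_def)

text \<open>The bimodule with basis \<open>e\<^sub>x\<^sub>,\<^sub>y\<close> for
  \<open>(x, y) \<in> S\<close>. It occurs for \<open>lt\<close> (the bimodule
  \<open>A\<^sub>+\<close> of the bar complex), for \<open>cov\<close> (the degree one part of the
  coring) and for \<open>leq\<close> (whose tensor ring contains the values of the
  comultiplication).\<close>

locale incidence_bimodule =
  fixes P :: "'p set" and S :: "'p rel"
    and M :: "('p \<Rightarrow> 'k::field, 'p \<Rightarrow> 'p \<Rightarrow> 'k, 'x) bimodule_scheme"
  assumes finite_P: "finite P" and S_subset: "S \<subseteq> P \<times> P"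
    and carrier_M: "carrier M = {f. \<forall>x y. (x, y) \<notin> S \<longrightarrow> f x y = 0}"
    and add_M: "\<And>f g. f \<oplus>\<^bsub>M\<^esub> g = (\<lambda>x y. f x y + g x y)"
    and lact_M: "\<And>r f. lact M r f = (\<lambda>x y. r x * f x y)"
    and ract_M: "\<And>r f. ract M f r = (\<lambda>x y. f x y * r y)"
begin

abbreviation R where "R \<equiv> base_ring P :: ('p \<Rightarrow> 'k) ring"
abbreviation W where "W \<equiv> word_ring R M"
abbreviation T where "T \<equiv> tensor_relations R M"
abbreviation A where "A \<equiv> path_ring P S :: ('p \<Rightarrow> 'k, 'p list \<Rightarrow> 'k) graded_bimodule"
abbreviation words where "words \<equiv> carrier R \<times> lists (carrier M)"

lemma finite_S: "finite S"
  using finite_subset[OF S_subset] finite_P by blast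

lemma W_sel:
  "carrier W = {c. Poly_Mapping.keys c \<subseteq> words}"
  "c \<otimes>\<^bsub>W\<^esub> d = frag_extend (\<lambda>v. frag_extend (\<lambda>w. frag_of (word_mult R M v w)) d) c"
  "\<one>\<^bsub>W\<^esub> = frag_of (\<one>\<^bsub>R\<^esub>, [])" "\<zero>\<^bsub>W\<^esub> = 0" "c \<oplus>\<^bsub>W\<^esub> d = c + d"
  "lact W s c = frag_extend (\<lambda>(r, ms). frag_of (s \<otimes>\<^bsub>R\<^esub> r, ms)) c"
  "ract W c s = frag_extend (\<lambda>w. frag_of (word_ract R M w s)) c"
  "hcomp W n = {c. Poly_Mapping.keys c \<subseteq> carrier R \<times> {ms \<in> lists (carrier M). length ms = n}}"
  by (simp_all add: word_ring_def)

lemma W_add_closed: "a \<in> carrier W \<Longrightarrow> b \<in> carrier W \<Longrightarrow> a + b \<in> carrier W"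
  and W_neg_closed: "a \<in> carrier W \<Longrightarrow> - a \<in> carrier W"
  and W_diff_closed: "a \<in> carrier W \<Longrightarrow> b \<in> carrier W \<Longrightarrow> a - b \<in> carrier W"
  and W_0_closed: "0 \<in> carrier W"
  using Poly_Mapping.keys_add[of a b] keys_diff[of a b] by (auto simp: W_sel keys_minus)

lemma W_of_closed: "w \<in> words \<Longrightarrow> frag_of w \<in> carrier W"
  by (simp add: W_sel)

lemma W_extend_closed:
  assumes "c \<in> carrier W" "\<And>w. w \<in> words \<Longrightarrow> h w \<in> carrier W"
  shows "frag_extend h c \<in> carrier W"
  using keys_frag_extend[of h c] assms by (fastforce simp: W_sel)

lemma W_group: "abelian_group W"
proof (rule abelian_groupI)
  fix x assume "x \<in> carrier W"
  then show "\<exists>y\<in>carrier W. y \<oplus>\<^bsub>W\<^esub> x = \<zero>\<^bsub>W\<^esub>"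
    using W_neg_closed by (intro bexI[of _ "- x"]) (auto simp: W_sel)
next
  fix x y assume "x \<in> carrier W" "y \<in> carrier W"
  then show "x \<oplus>\<^bsub>W\<^esub> y \<in> carrier W" using W_add_closed by (simp add: W_sel(5))
qed (auto simp: W_sel add.assoc add.commute)

lemma word_ract_closed:
  assumes "w \<in> words" "s \<in> carrier R"
  shows "word_ract R M w s \<in> words"
proof (cases "snd w = []")
  case False
  then have "snd w = butlast (snd w) @ [last (snd w)]" by simp
  moreover have "snd w \<in> lists (carrier M)" using assms by auto
  ultimately have "butlast (snd w) \<in> lists (carrier M)" "last (snd w) \<in> carrier M"
    by (metis append_in_lists_conv, metis append_in_lists_conv lists.cases list.inject not_Cons_self2)
  then show ?thesis using assms False by (auto simp: word_ract_def carrier_M ract_M)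
qed (use assms in \<open>auto simp: word_ract_def base_ring_sel\<close>)

lemma word_mult_closed: "v \<in> words \<Longrightarrow> w \<in> words \<Longrightarrow> word_mult R M v w \<in> words"
  using word_ract_closed[of v "fst w"] by (auto simp: word_mult_def mem_Times_iff)

lemma W_mult_closed: "a \<in> carrier W \<Longrightarrow> b \<in> carrier W \<Longrightarrow> a \<otimes>\<^bsub>W\<^esub> b \<in> carrier W"
  unfolding W_sel(2) by (intro W_extend_closed W_of_closed word_mult_closed)

lemma word_val_ract:
  assumes "w \<in> words"
  shows "word_val (word_ract R M w s) c = word_val w c * s (last c)"
proof (cases "snd w = []")
  case True
  then show ?thesis by (cases c; cases "tl c") (auto simp: word_val_def word_ract_def base_ring_sel)
next
  case False
  then show ?thesis by (simp add: word_val_def word_ract_def ract_M steps_ract_last mult.assoc)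
qed

lemma word_val_mult:
  assumes v: "v \<in> words" and w: "w \<in> words"
  shows "word_val (word_mult R M v w) c = (\<Sum>k<length c. word_val v (take (Suc k) c) * word_val w (drop k c))"
proof -
  let ?n = "length (snd v)"
  have len: "length (snd (word_ract R M v (fst w))) = ?n"
    by (simp add: word_ract_def)
  \<comment> \<open>Only the cut after the letters of \<open>v\<close> contributes, since
    \<open>steps\<close> fixes the length; the scalar of \<open>w\<close> is evaluated at the point
    where the two walks meet.\<close>
  have *: "word_val (word_mult R M v w) c = word_val v (take (Suc ?n) c) * word_val w (drop ?n c)"
  proof (cases "?n < length c")
    case True
    then have last: "last (take (Suc ?n) c) = hd (drop ?n c)"
      by (simp add: take_Suc_conv_app_nth hd_drop_conv_nth)
    have hd: "hd (take (Suc ?n) c) = hd c" by (cases c) auto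
    have "word_val (word_mult R M v w) c
        = fst (word_ract R M v (fst w)) (hd c) * steps (snd (word_ract R M v (fst w))) (take (Suc ?n) c)
          * steps (snd w) (drop ?n c)"
      by (simp add: word_val_def word_mult_def steps_append len)
    also have "\<dots> = word_val (word_ract R M v (fst w)) (take (Suc ?n) c) * steps (snd w) (drop ?n c)"
      by (simp add: word_val_def hd)
    finally show ?thesis
      unfolding word_val_ract[OF v] last by (simp add: word_val_def[of w] mult.assoc)
  next
    case False
    then show ?thesis by (simp add: word_val_def word_mult_def steps_append len)
  qed
  show ?thesis
  proof (cases "?n < length c")
    case True
    have "(\<Sum>k<length c. word_val v (take (Suc k) c) * word_val w (drop k c))
       = (\<Sum>k<length c. if k = ?n then word_val v (take (Suc k) c) * word_val w (drop k c) else 0)"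
    proof (intro sum.cong refl)
      fix k assume "k \<in> {..<length c}"
      then have "length (take (Suc k) c) = Suc k" by simp
      then have "steps (snd v) (take (Suc k) c) = 0" if "k \<noteq> ?n"
        using steps_length[of "snd v" "take (Suc k) c"] that by fastforce
      then show "word_val v (take (Suc k) c) * word_val w (drop k c)
          = (if k = ?n then word_val v (take (Suc k) c) * word_val w (drop k c) else 0)"
        by (simp add: word_val_def)
    qed
    also have "\<dots> = word_val v (take (Suc ?n) c) * word_val w (drop ?n c)"
      by (subst sum.delta) (use True in auto)
    finally show ?thesis using * by (simp only:)
  next
    case False
    have "steps (snd v) (take (Suc k) c) = 0" if "k < length c" for k
      using steps_length[of "snd v" "take (Suc k) c"] False that by fastforce
    then have "word_val v (take (Suc k) c) = 0" if "k < length c" for k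
      using that by (simp add: word_val_def)
    then have "(\<Sum>k<length c. word_val v (take (Suc k) c) * word_val w (drop k c)) = 0" by simp
    moreover have "word_val w (drop ?n c) = 0" using False by (simp add: word_val_def)
    ultimately show ?thesis using * by simp
  qed
qed

text \<open>The comparison map from words to functions on walks. Its kernel turns out to be the
  tensor relations and its image the path ring, which identifies the tensor ring with the path
  ring.\<close>

definition \<Phi> :: "('p \<Rightarrow> 'k, 'p \<Rightarrow> 'p \<Rightarrow> 'k) word_group \<Rightarrow> 'p list \<Rightarrow> 'k" where
  "\<Phi> c = (\<lambda>ch. frag_val (\<lambda>w. word_val w ch) c)"

lemma Phi_simps [simp]:
  "\<Phi> 0 = (\<lambda>ch. 0)" "\<Phi> (a + b) = (\<lambda>ch. \<Phi> a ch + \<Phi> b ch)" "\<Phi> (a - b) = (\<lambda>ch. \<Phi> a ch - \<Phi> b ch)"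
  "\<Phi> (- a) = (\<lambda>ch. - \<Phi> a ch)" "\<Phi> (frag_of w) = word_val w"
  by (simp_all add: \<Phi>_def frag_val_add frag_val_diff frag_val_minus)

lemma steps_support: "us \<in> lists (carrier M) \<Longrightarrow> steps us c \<noteq> 0 \<Longrightarrow> length us \<noteq> 0 \<Longrightarrow> c \<in> pwalks P S"
proof (induction us c rule: steps.induct)
  case (2 u us x y c)
  then have xy: "(x, y) \<in> S" by (auto simp: carrier_M)
  show ?case
  proof (cases us)
    case Nil
    then show ?thesis using 2 xy S_subset steps_length[of us "y # c"] by auto
  next
    case (Cons v vs)
    then show ?thesis using 2 xy S_subset by auto
  qed
qed auto

lemma word_val_support:
  assumes w: "w \<in> words" and nz: "word_val w c \<noteq> 0"
  shows "c \<in> pwalks P S" "length c = Suc (length (snd w))"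
proof -
  show l: "length c = Suc (length (snd w))" using nz steps_length by (auto simp: word_val_def)
  show "c \<in> pwalks P S"
  proof (cases "snd w = []")
    case True
    then obtain x where "c = [x]" using l by (metis length_0_conv length_Suc_conv)
    then show ?thesis using w nz by (auto simp: word_val_def base_ring_sel)
  next
    case False
    have "snd w \<in> lists (carrier M)" using w by (simp only: mem_Times_iff)
    then show ?thesis using steps_support[of "snd w" c] False nz by (simp add: word_val_def)
  qed
qed

lemma Phi_nonzero:
  assumes c: "c \<in> carrier W" and nz: "\<Phi> c ch \<noteq> 0"
  obtains w where "w \<in> Poly_Mapping.keys c" "w \<in> words" "word_val w ch \<noteq> 0"
proof -
  obtain w where "w \<in> Poly_Mapping.keys c" "word_val w ch \<noteq> 0"
    using nz unfolding \<Phi>_def frag_val_def by (metis (mono_tags, lifting) mult_not_zero sum.neutral)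
  moreover from this(1) have "w \<in> words" using c by (auto simp only: W_sel mem_Collect_eq subset_iff)
  ultimately show thesis using that by blast
qed

lemma Phi_closed:
  assumes c: "c \<in> carrier W"
  shows "\<Phi> c \<in> carrier A"
proof (rule path_ringI)
  let ?N = "\<Union>w\<in>Poly_Mapping.keys c. {ch \<in> pwalks P S. length ch = Suc (length (snd w))}"
  show "finite ?N" using finite_pwalks_length[OF finite_P] by auto
  fix ch assume nz: "\<Phi> c ch \<noteq> 0"
  then obtain w where "w \<in> Poly_Mapping.keys c" "w \<in> words" "word_val w ch \<noteq> 0"
    using Phi_nonzero[OF c] by blast
  then show "ch \<in> ?N" "ch \<in> pwalks P S" using word_val_support by blast+
qed

lemma frag_extend_closed_cong:
  assumes "c \<in> carrier W" "\<And>w. w \<in> words \<Longrightarrow> frag_val g (h w) = k w"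
  shows "frag_val g (frag_extend h c) = frag_val k c"
proof -
  have "Poly_Mapping.keys c \<subseteq> words" using assms(1) by (simp only: W_sel mem_Collect_eq)
  then show ?thesis unfolding frag_val_extend by (intro frag_val_cong assms(2)) blast
qed

lemma Phi_mult:
  assumes c: "c \<in> carrier W" and d: "d \<in> carrier W"
  shows "\<Phi> (c \<otimes>\<^bsub>W\<^esub> d) = \<Phi> c \<otimes>\<^bsub>A\<^esub> \<Phi> d"
proof
  fix ch
  have 1: "\<Phi> (frag_extend (\<lambda>w. frag_of (word_mult R M v w)) d) ch
      = (\<Sum>k<length ch. word_val v (take (Suc k) ch) * \<Phi> d (drop k ch))" if "v \<in> words" for v
  proof -
    have "\<Phi> (frag_extend (\<lambda>w. frag_of (word_mult R M v w)) d) ch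
       = frag_val (\<lambda>w. \<Sum>k<length ch. word_val v (take (Suc k) ch) * word_val w (drop k ch)) d"
      unfolding \<Phi>_def by (rule frag_extend_closed_cong[OF d]) (simp add: word_val_mult that)
    then show ?thesis by (simp add: frag_val_sum_left frag_val_mult_left \<Phi>_def)
  qed
  have "\<Phi> (c \<otimes>\<^bsub>W\<^esub> d) ch = frag_val (\<lambda>v. \<Sum>k<length ch. word_val v (take (Suc k) ch) * \<Phi> d (drop k ch)) c"
    unfolding W_sel(2) \<Phi>_def
    by (rule frag_extend_closed_cong[OF c]) (use 1 in \<open>simp add: \<Phi>_def\<close>)
  also have "\<dots> = (\<Phi> c \<otimes>\<^bsub>A\<^esub> \<Phi> d) ch"
    by (simp add: frag_val_sum_left frag_val_mult_right path_ring_sel \<Phi>_def)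
  finally show "\<Phi> (c \<otimes>\<^bsub>W\<^esub> d) ch = (\<Phi> c \<otimes>\<^bsub>A\<^esub> \<Phi> d) ch" .
qed

lemma Phi_one: "\<Phi> \<one>\<^bsub>W\<^esub> = \<one>\<^bsub>A\<^esub>"
proof
  fix c show "\<Phi> \<one>\<^bsub>W\<^esub> c = \<one>\<^bsub>A\<^esub> c"
    by (cases c; cases "tl c") (auto simp: W_sel word_val_def base_ring_sel path_ring_sel)
qed

lemma W_one_closed: "\<one>\<^bsub>W\<^esub> \<in> carrier W"
  by (simp add: W_sel base_ring_sel)

lemma W_lact_closed: "s \<in> carrier R \<Longrightarrow> c \<in> carrier W \<Longrightarrow> lact W s c \<in> carrier W"
  unfolding W_sel(6) by (erule W_extend_closed) (auto intro!: W_of_closed simp: base_ring_sel)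

lemma W_ract_closed: "s \<in> carrier R \<Longrightarrow> c \<in> carrier W \<Longrightarrow> ract W c s \<in> carrier W"
  unfolding W_sel(7) by (erule W_extend_closed) (intro W_of_closed word_ract_closed)

lemma Phi_lact: "c \<in> carrier W \<Longrightarrow> \<Phi> (lact W s c) = lact A s (\<Phi> c)"
proof
  fix ch assume c: "c \<in> carrier W"
  have "\<Phi> (lact W s c) ch = frag_val (\<lambda>w. s (hd ch) * word_val w ch) c"
    unfolding W_sel(6) \<Phi>_def
    by (rule frag_extend_closed_cong[OF c]) (auto simp: word_val_def base_ring_sel mult.assoc)
  then show "\<Phi> (lact W s c) ch = lact A s (\<Phi> c) ch"
    by (simp add: frag_val_mult_left path_ring_sel \<Phi>_def)
qed

lemma Phi_ract: "c \<in> carrier W \<Longrightarrow> \<Phi> (ract W c s) = ract A (\<Phi> c) s"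
proof
  fix ch assume c: "c \<in> carrier W"
  have "\<Phi> (ract W c s) ch = frag_val (\<lambda>w. word_val w ch * s (last ch)) c"
    unfolding W_sel(7) \<Phi>_def
    by (rule frag_extend_closed_cong[OF c]) (use word_val_ract in simp)
  then show "\<Phi> (ract W c s) ch = ract A (\<Phi> c) s ch"
    by (simp add: frag_val_mult_right path_ring_sel \<Phi>_def)
qed

lemma base_add_closed: "r \<in> carrier R \<Longrightarrow> s \<in> carrier R \<Longrightarrow> (\<lambda>x. r x + s x) \<in> carrier R"
  and base_mult_closed: "r \<in> carrier R \<Longrightarrow> (\<lambda>x. r x * t x) \<in> carrier R"
  by (simp_all add: base_ring_sel)

lemma M_closed:
  "f \<in> carrier M \<Longrightarrow> g \<in> carrier M \<Longrightarrow> (\<lambda>x y. f x y + g x y) \<in> carrier M"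
  "f \<in> carrier M \<Longrightarrow> (\<lambda>x y. r x * f x y) \<in> carrier M"
  "f \<in> carrier M \<Longrightarrow> (\<lambda>x y. f x y * r y) \<in> carrier M"
  by (simp_all add: carrier_M)

lemma relators_closed: "tensor_relators R M \<subseteq> carrier W"
  unfolding tensor_relators_def base_ring_sel(2,5) add_M lact_M ract_M
  by (auto intro!: W_diff_closed W_of_closed base_add_closed base_mult_closed M_closed)

lemma T_group: "subgroup T (add_monoid W)"
  unfolding tensor_relations_def
  by (rule group.generate_is_subgroup) (use relators_closed abelian_group.a_group[OF W_group] in auto)

lemma T_closed:
  shows "T \<subseteq> carrier W" "0 \<in> T" "a \<in> T \<Longrightarrow> b \<in> T \<Longrightarrow> a + b \<in> T" "a \<in> T \<Longrightarrow> - a \<in> T"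
    "a \<in> T \<Longrightarrow> b \<in> T \<Longrightarrow> a - b \<in> T" "tensor_relators R M \<subseteq> T"
proof -
  interpret W: abelian_group W by (rule W_group)
  show 1: "T \<subseteq> carrier W" using subgroup.subset[OF T_group] by simp
  show "0 \<in> T" using subgroup.one_closed[OF T_group] by (simp add: W_sel)
  show add: "a \<in> T \<Longrightarrow> b \<in> T \<Longrightarrow> a + b \<in> T" for a b
    using subgroup.m_closed[OF T_group, of a b] by (simp add: W_sel(4,5))
  show neg: "- a \<in> T" if a: "a \<in> T" for a
  proof -
    have "a \<in> carrier W" using a 1 by blast
    then have "\<ominus>\<^bsub>W\<^esub> a = - a"
      using W.minus_equality[of "- a" a] W_neg_closed by (simp add: W_sel(4,5))
    then show ?thesis using subgroup.m_inv_closed[OF T_group a] by (simp add: a_inv_def)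
  qed
  show "a \<in> T \<Longrightarrow> b \<in> T \<Longrightarrow> a - b \<in> T" using add[of a "- b"] neg by simp
  show "tensor_relators R M \<subseteq> T"
    unfolding tensor_relations_def by (rule subsetI) (rule generate.incl)
qed

text \<open>Starting from 0, differences produce negatives and sums, so a single closure condition
  suffices.\<close>

lemma T_induct [consumes 1, case_names relator zero diff]:
  assumes "a \<in> T" "\<And>\<rho>. \<rho> \<in> tensor_relators R M \<Longrightarrow> p \<rho>" "p 0"
    "\<And>a b. p a \<Longrightarrow> p b \<Longrightarrow> p (a - b)"
  shows "p a"
proof -
  interpret W: abelian_group W by (rule W_group)
  have neg: "p (- a)" if "p a" for a using assms(4)[OF assms(3) that] by simp
  have "p a \<and> a \<in> carrier W" if "a \<in> generate (add_monoid W) (tensor_relators R M)" for a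
    using that
  proof (induction a rule: generate.induct)
    case one
    then show ?case using assms(3) W_0_closed by (simp add: W_sel(4))
  next
    case (incl h)
    then show ?case using assms(2) relators_closed by blast
  next
    case (inv h)
    then have h: "h \<in> carrier W" "p h" using assms(2) relators_closed by auto
    then have "\<ominus>\<^bsub>W\<^esub> h = - h"
      using W.minus_equality[of "- h" h] W_neg_closed by (simp add: W_sel(4,5))
    then show ?case using neg[OF h(2)] W_neg_closed[OF h(1)] by (simp add: a_inv_def)
  next
    case (eng h1 h2)
    then show ?case
      using assms(4)[of h1 "- h2"] neg[of h2] W_add_closed[of h1 h2] by (simp add: W_sel(5))
  qed
  then show ?thesis using assms(1) unfolding tensor_relations_def by blast
qed

lemma Phi_relations: "a \<in> T \<Longrightarrow> \<Phi> a = (\<lambda>c. 0)"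
proof (induction rule: T_induct)
  case (relator \<rho>)
  then show ?case
    unfolding tensor_relators_def base_ring_sel(2,5) add_M lact_M ract_M
    by (elim UnE CollectE exE conjE)
      (simp_all add: word_val_def steps_slot_add steps_balance steps_lact fun_eq_iff ring_distribs mult.assoc)
qed simp_all

section \<open>Normal forms modulo the tensor relations\<close>

definition equiv (infix "\<sim>" 50) where "a \<sim> b \<longleftrightarrow> a - b \<in> T"

lemma equiv_refl [simp]: "a \<sim> a"
  by (simp add: equiv_def T_closed)

lemma equiv_sym: "a \<sim> b \<Longrightarrow> b \<sim> a"
  unfolding equiv_def using T_closed(4)[of "a - b"] by simp

lemma equiv_trans [trans]: "a \<sim> b \<Longrightarrow> b \<sim> c \<Longrightarrow> a \<sim> c"
  unfolding equiv_def using T_closed(3)[of "a - b" "b - c"] by simp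

lemma equiv_diff: "a \<sim> b \<Longrightarrow> c \<sim> d \<Longrightarrow> a - c \<sim> b - d"
  unfolding equiv_def using T_closed(5)[of "a - b" "c - d"] by (simp add: algebra_simps)

lemma equiv_add: "a \<sim> b \<Longrightarrow> c \<sim> d \<Longrightarrow> a + c \<sim> b + d"
  unfolding equiv_def using T_closed(3)[of "a - b" "c - d"] by (simp add: algebra_simps)

lemma equiv_sum: "(\<And>x. x \<in> B \<Longrightarrow> f x \<sim> g x) \<Longrightarrow> sum f B \<sim> sum g B"
  by (induction B rule: infinite_finite_induct) (auto intro: equiv_add)

lemma equiv_relator: "a - b \<in> tensor_relators R M \<Longrightarrow> a \<sim> b"
  unfolding equiv_def using T_closed(6) by blast

lemma equiv_scalar_add:
  assumes "r \<in> carrier R" "s \<in> carrier R" "us \<in> lists (carrier M)"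
  shows "frag_of (\<lambda>x. r x + s x, us) \<sim> frag_of (r, us) + frag_of (s, us)"
proof (rule equiv_relator)
  have "frag_of (r \<oplus>\<^bsub>R\<^esub> s, us) - frag_of (r, us) - frag_of (s, us) \<in> tensor_relators R M"
    unfolding tensor_relators_def using assms by blast
  then show "frag_of (\<lambda>x. r x + s x, us) - (frag_of (r, us) + frag_of (s, us)) \<in> tensor_relators R M"
    by (simp add: base_ring_sel(5) diff_diff_eq)
qed

lemma equiv_slot_add:
  assumes "r \<in> carrier R" "u \<in> carrier M" "v \<in> carrier M" "us \<in> lists (carrier M)" "vs \<in> lists (carrier M)"
  shows "frag_of (r, us @ (\<lambda>x y. u x y + v x y) # vs) \<sim> frag_of (r, us @ u # vs) + frag_of (r, us @ v # vs)"
proof (rule equiv_relator)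
  have "frag_of (r, us @ [u \<oplus>\<^bsub>M\<^esub> v] @ vs) - frag_of (r, us @ [u] @ vs) - frag_of (r, us @ [v] @ vs)
      \<in> tensor_relators R M"
    unfolding tensor_relators_def using assms by blast
  then show "frag_of (r, us @ (\<lambda>x y. u x y + v x y) # vs) - (frag_of (r, us @ u # vs) + frag_of (r, us @ v # vs))
      \<in> tensor_relators R M"
    by (simp add: add_M diff_diff_eq)
qed

lemma equiv_scalar_move:
  assumes "r \<in> carrier R" "s \<in> carrier R" "u \<in> carrier M" "vs \<in> lists (carrier M)"
  shows "frag_of (\<lambda>x. r x * s x, u # vs) \<sim> frag_of (r, (\<lambda>x y. s x * u x y) # vs)"
proof (rule equiv_relator)
  have "frag_of (r \<otimes>\<^bsub>R\<^esub> s, u # vs) - frag_of (r, lact M s u # vs) \<in> tensor_relators R M"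
    unfolding tensor_relators_def using assms by blast
  then show "frag_of (\<lambda>x. r x * s x, u # vs) - frag_of (r, (\<lambda>x y. s x * u x y) # vs) \<in> tensor_relators R M"
    by (simp add: lact_M base_ring_sel)
qed

text \<open>Serves both for sums of leading scalars and for sums in the first letter:
  \<open>pl\<close> is the addition, \<open>s\<close> the finite sum, \<open>h\<close> the word as a
  function of the summand. As \<open>z\<close> is idempotent, \<open>h z \<sim> h z + h z\<close>,
  so \<open>h z\<close> vanishes modulo the relations.\<close>

lemma equiv_additive_sum:
  assumes add: "\<And>f g. f \<in> C \<Longrightarrow> g \<in> C \<Longrightarrow> h (pl f g) \<sim> h f + h g"
    and C: "z \<in> C" "\<And>f g. f \<in> C \<Longrightarrow> g \<in> C \<Longrightarrow> pl f g \<in> C" and z: "pl z z = z"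
    and fin: "finite B"
    and s: "s {} = z" "\<And>B x. finite B \<Longrightarrow> x \<notin> B \<Longrightarrow> s (insert x B) = pl (f x) (s B)"
    and f: "\<And>x. x \<in> B \<Longrightarrow> f x \<in> C"
  shows "h (s B) \<sim> (\<Sum>x\<in>B. h (f x))"
proof -
  have "h z \<sim> h z + h z" using add[of z z] C z by simp
  from equiv_diff[OF this equiv_refl[of "h z"]] have h0: "h z \<sim> 0" using equiv_sym by simp
  have "s B \<in> C \<and> h (s B) \<sim> (\<Sum>x\<in>B. h (f x))"
    using fin f
  proof (induction B rule: finite_induct)
    case empty
    then show ?case using h0 s C by simp
  next
    case (insert x B)
    then have "h (s (insert x B)) \<sim> h (f x) + h (s B)" using add s(2) by simp
    also have "\<dots> \<sim> h (f x) + (\<Sum>x\<in>B. h (f x))" using insert by (intro equiv_add) auto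
    finally show ?case using insert C s(2) by simp
  qed
  then show ?thesis by simp
qed

lemma equiv_scalar_sum:
  assumes "finite B" "\<And>x. x \<in> B \<Longrightarrow> f x \<in> carrier R" "us \<in> lists (carrier M)"
  shows "frag_of (\<lambda>z. \<Sum>x\<in>B. f x z, us) \<sim> (\<Sum>x\<in>B. frag_of (f x, us))"
  by (rule equiv_additive_sum[where C = "carrier R" and pl = "\<lambda>f g z. f z + g z" and z = "\<lambda>z. 0"
        and h = "\<lambda>f. frag_of (f, us)" and s = "\<lambda>B z. \<Sum>x\<in>B. f x z" and f = f])
    (use assms equiv_scalar_add in \<open>auto simp: base_ring_sel\<close>)

lemma equiv_slot_sum:
  assumes "finite B" "\<And>x. x \<in> B \<Longrightarrow> f x \<in> carrier M" "r \<in> carrier R" "us \<in> lists (carrier M)"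
  shows "frag_of (r, (\<lambda>y z. \<Sum>x\<in>B. f x y z) # us) \<sim> (\<Sum>x\<in>B. frag_of (r, f x # us))"
  by (rule equiv_additive_sum[where C = "carrier M" and pl = "\<lambda>f g y z. f y z + g y z" and z = "\<lambda>y z. 0"
        and h = "\<lambda>f. frag_of (r, f # us)" and s = "\<lambda>B y z. \<Sum>x\<in>B. f x y z" and f = f])
    (use assms equiv_slot_add[of r _ _ "[]" us] in \<open>auto simp: carrier_M\<close>)

fun edges :: "'p list \<Rightarrow> ('p \<Rightarrow> 'p \<Rightarrow> 'k) list" where
  "edges (x # y # c) = basis_elem 1 x y # edges (y # c)"
| "edges _ = []"

definition scalar :: "'k \<Rightarrow> 'p \<Rightarrow> 'p \<Rightarrow> 'k" where
  "scalar a x = (\<lambda>z. if z = x then a else 0)"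

text \<open>A representative of \<open>a\<close> times the walk \<open>c\<close>. The coefficient
  sits in the leading scalar at the starting point, which also covers one-point walks, where there
  is no letter to carry it.\<close>

definition path_word :: "'k \<Rightarrow> 'p list \<Rightarrow> ('p \<Rightarrow> 'k, 'p \<Rightarrow> 'p \<Rightarrow> 'k) word_group" where
  "path_word a c = frag_of (scalar a (hd c), edges c)"

lemma scalar_closed: "x \<in> P \<Longrightarrow> scalar a x \<in> carrier R"
  by (auto simp: base_ring_sel scalar_def)

lemma basis_elem_closed: "(x, y) \<in> S \<Longrightarrow> basis_elem a x y \<in> carrier M"
  by (auto simp: carrier_M basis_elem_def)

lemma pwalks_edges: "c \<in> pwalks P S \<Longrightarrow> edges c \<in> lists (carrier M)"
  by (induction c rule: edges.induct) (auto simp: basis_elem_closed)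

lemma length_edges: "c \<noteq> [] \<Longrightarrow> Suc (length (edges c)) = length c"
  by (induction c rule: edges.induct) auto

lemma pwalks_hd: "c \<in> pwalks P S \<Longrightarrow> hd c \<in> P"
  by (cases c) (auto simp: pwalks_def walks_def)

lemma path_word_words:
  assumes "c \<in> pwalks P S" shows "(scalar a (hd c), edges c) \<in> words"
  using pwalks_edges[OF assms] scalar_closed[OF pwalks_hd[OF assms]] by (simp only: mem_Times_iff fst_conv snd_conv)

lemma path_word_closed: "c \<in> pwalks P S \<Longrightarrow> path_word a c \<in> carrier W"
  unfolding path_word_def by (intro W_of_closed path_word_words)

lemma steps_edges: "c \<noteq> [] \<Longrightarrow> hd d = hd c \<Longrightarrow> steps (edges c) d = (if d = c then 1 else 0)"
proof (induction c arbitrary: d rule: edges.induct)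
  case (1 x y c)
  show ?case
  proof (cases "tl d")
    case (Cons z e)
    then have "d = x # z # e" using 1 by (cases d) auto
    then show ?thesis using 1(1)[of "z # e"] by (auto simp: basis_elem_def)
  qed (cases d; simp)
next
  case ("2_2" x)
  then show ?case by (cases d; cases "tl d") auto
qed simp

lemma Phi_path_word: "c \<noteq> [] \<Longrightarrow> \<Phi> (path_word a c) d = (if d = c then a else 0)"
  by (auto simp: path_word_def word_val_def steps_edges scalar_def)

lemma path_word_add:
  assumes "c \<in> pwalks P S"
  shows "path_word (a + b) c \<sim> path_word a c + path_word b c"
proof -
  have "scalar (a + b) (hd c) = (\<lambda>z. scalar a (hd c) z + scalar b (hd c) z)"
    by (auto simp: scalar_def)
  then show ?thesis
    unfolding path_word_def
    using equiv_scalar_add[OF scalar_closed scalar_closed pwalks_edges[OF assms]] pwalks_hd[OF assms] by simp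
qed

lemma path_word_0: assumes "c \<in> pwalks P S" shows "path_word 0 c \<sim> 0"
proof -
  have "path_word 0 c \<sim> path_word 0 c + path_word 0 c" using path_word_add[OF assms, of 0 0] by simp
  from equiv_diff[OF this equiv_refl[of "path_word 0 c"]] show ?thesis using equiv_sym by simp
qed

lemma path_word_diff:
  assumes "c \<in> pwalks P S" shows "path_word (a - b) c \<sim> path_word a c - path_word b c"
  using equiv_diff[OF path_word_add[OF assms, of "a - b" b] equiv_refl[of "path_word b c"]] equiv_sym
  by simp

text \<open>Left multiplication by \<open>b\<close> on words: the leading scalar of the old word is
  absorbed into the new first letter.\<close>

definition prepend where
  "prepend b = frag_extend (\<lambda>(r, us). frag_of (\<one>\<^bsub>R\<^esub>, (\<lambda>x y. b x y * r y) # us :: ('p \<Rightarrow> 'p \<Rightarrow> 'k) list))"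

text \<open>Each relator goes to a relator: additivity and balancing of the leading scalar become
  those of the new first letter, and the other relators are merely shifted by one letter.\<close>

lemma prepend_relations:
  assumes b: "b \<in> carrier M" and a: "a \<in> T"
  shows "prepend b a \<in> T"
  using a
proof (induction rule: T_induct)
  case (relator \<rho>)
  have one: "\<one>\<^bsub>R\<^esub> \<in> carrier R" by (simp add: base_ring_sel)
  have br: "(\<lambda>x y. b x y * r y) \<in> carrier M" for r using M_closed(3)[OF b] .
  from relator consider
    (1) r s us where "\<rho> = frag_of (r \<oplus>\<^bsub>R\<^esub> s, us) - frag_of (r, us) - frag_of (s, us)"
      "r \<in> carrier R" "s \<in> carrier R" "us \<in> lists (carrier M)"
  | (2) r us x y vs where "\<rho> = frag_of (r, us @ [x \<oplus>\<^bsub>M\<^esub> y] @ vs) - frag_of (r, us @ [x] @ vs)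
        - frag_of (r, us @ [y] @ vs)"
      "r \<in> carrier R" "x \<in> carrier M" "y \<in> carrier M" "us \<in> lists (carrier M)" "vs \<in> lists (carrier M)"
  | (3) r s x vs where "\<rho> = frag_of (r \<otimes>\<^bsub>R\<^esub> s, x # vs) - frag_of (r, lact M s x # vs)"
      "r \<in> carrier R" "s \<in> carrier R" "x \<in> carrier M" "vs \<in> lists (carrier M)"
  | (4) r us x s y vs where
      "\<rho> = frag_of (r, us @ [ract M x s, y] @ vs) - frag_of (r, us @ [x, lact M s y] @ vs)"
      "r \<in> carrier R" "s \<in> carrier R" "x \<in> carrier M" "y \<in> carrier M" "us \<in> lists (carrier M)"
      "vs \<in> lists (carrier M)"
    unfolding tensor_relators_def by blast
  then have "prepend b \<rho> \<in> tensor_relators R M"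
  proof cases
    case 1
    have "prepend b \<rho> = frag_of (\<one>\<^bsub>R\<^esub>, [] @ [(\<lambda>x y. b x y * r y) \<oplus>\<^bsub>M\<^esub> (\<lambda>x y. b x y * s y)] @ us)
        - frag_of (\<one>\<^bsub>R\<^esub>, [] @ [\<lambda>x y. b x y * r y] @ us) - frag_of (\<one>\<^bsub>R\<^esub>, [] @ [\<lambda>x y. b x y * s y] @ us)"
      unfolding 1(1) prepend_def by (simp add: frag_extend_diff add_M base_ring_sel(5) distrib_left)
    then show ?thesis unfolding tensor_relators_def using 1 one br[of r] br[of s] by blast
  next
    case 2
    have "prepend b \<rho> = frag_of (\<one>\<^bsub>R\<^esub>, ((\<lambda>x y. b x y * r y) # us) @ [x \<oplus>\<^bsub>M\<^esub> y] @ vs)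
        - frag_of (\<one>\<^bsub>R\<^esub>, ((\<lambda>x y. b x y * r y) # us) @ [x] @ vs)
        - frag_of (\<one>\<^bsub>R\<^esub>, ((\<lambda>x y. b x y * r y) # us) @ [y] @ vs)"
      unfolding 2(1) prepend_def by (simp add: frag_extend_diff)
    moreover have "(\<lambda>x y. b x y * r y) # us \<in> lists (carrier M)" using 2 br[of r] by simp
    ultimately show ?thesis unfolding tensor_relators_def using 2 one by blast
  next
    case 3
    have "prepend b \<rho> = frag_of (\<one>\<^bsub>R\<^esub>, [] @ [ract M (\<lambda>x y. b x y * r y) s, x] @ vs)
        - frag_of (\<one>\<^bsub>R\<^esub>, [] @ [\<lambda>x y. b x y * r y, lact M s x] @ vs)"
      unfolding 3(1) prepend_def by (simp add: frag_extend_diff ract_M base_ring_sel(2) mult.assoc)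
    then show ?thesis unfolding tensor_relators_def using 3 one br[of r] by blast
  next
    case 4
    have "prepend b \<rho> = frag_of (\<one>\<^bsub>R\<^esub>, ((\<lambda>x y. b x y * r y) # us) @ [ract M x s, y] @ vs)
        - frag_of (\<one>\<^bsub>R\<^esub>, ((\<lambda>x y. b x y * r y) # us) @ [x, lact M s y] @ vs)"
      unfolding 4(1) prepend_def by (simp add: frag_extend_diff)
    moreover have "(\<lambda>x y. b x y * r y) # us \<in> lists (carrier M)" using 4 br[of r] by simp
    ultimately show ?thesis unfolding tensor_relators_def using 4 one by blast
  qed
  then show ?case using T_closed(6) by blast
next
  case (diff a c)
  then show ?case unfolding prepend_def frag_extend_diff by (rule T_closed(5))
qed (simp add: prepend_def T_closed)

lemma prepend_equiv: "b \<in> carrier M \<Longrightarrow> a \<sim> c \<Longrightarrow> prepend b a \<sim> prepend b c"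
  unfolding equiv_def using prepend_relations[of b "a - c"] by (simp add: prepend_def frag_extend_diff)

lemma prepend_path_word:
  assumes xy: "(x, y) \<in> S" and c: "c \<in> pwalks P S"
  shows "prepend (basis_elem 1 x y) (path_word a c) \<sim> (if hd c = y then path_word a (x # c) else 0)"
proof -
  have x: "x \<in> P" using xy S_subset by blast
  obtain d where d: "hd c = y \<Longrightarrow> c = y # d" using c by (cases c) auto
  let ?b = "basis_elem 1 x y :: 'p \<Rightarrow> 'p \<Rightarrow> 'k"
  let ?a = "if hd c = y then a else 0"
  have b: "?b \<in> carrier M" using basis_elem_closed[OF xy] .
  have e: "edges c \<in> lists (carrier M)" using pwalks_edges[OF c] .
  have "prepend ?b (path_word a c) = frag_of (\<one>\<^bsub>R\<^esub>, (\<lambda>u v. scalar ?a x u * ?b u v) # edges c)"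
    by (auto simp: prepend_def path_word_def scalar_def basis_elem_def fun_eq_iff frag_of_eq)
  also have "\<dots> \<sim> frag_of (\<lambda>z. \<one>\<^bsub>R\<^esub> z * scalar ?a x z, ?b # edges c)"
    by (rule equiv_sym, rule equiv_scalar_move) (use b e x in \<open>auto simp: base_ring_sel scalar_def\<close>)
  also have "(\<lambda>z. \<one>\<^bsub>R\<^esub> z * scalar ?a x z) = scalar ?a x"
    using x by (auto simp: base_ring_sel scalar_def)
  finally have *: "prepend ?b (path_word a c) \<sim> frag_of (scalar ?a x, ?b # edges c)" .
  show ?thesis
  proof (cases "hd c = y")
    case True
    then show ?thesis using * d by (auto simp: path_word_def)
  next
    case False
    have "frag_of (scalar 0 x, ?b # edges c) \<sim> frag_of (scalar 0 x, ?b # edges c) + frag_of (scalar 0 x, ?b # edges c)"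
      using equiv_scalar_add[OF scalar_closed[OF x, of 0] scalar_closed[OF x, of 0], of "?b # edges c"] b e
      by (simp add: scalar_def)
    from equiv_diff[OF this equiv_refl[of "frag_of (scalar 0 x, ?b # edges c)"]]
    have "frag_of (scalar 0 x, ?b # edges c) \<sim> 0" using equiv_sym by simp
    then show ?thesis using * False equiv_trans by auto
  qed
qed

text \<open>Induction on the word: the first letter is expanded in the basis
  \<open>e\<^sub>x\<^sub>,\<^sub>y\<close>, and each basis letter is put by \<open>prepend\<close>
  in front of the normal form of the rest.\<close>

lemma word_normal_form:
  assumes "us \<in> lists (carrier M)" "r \<in> carrier R"
  shows "frag_of (r, us) \<sim> (\<Sum>c\<in>{c \<in> pwalks P S. length c = Suc (length us)}. path_word (word_val (r, us) c) c)"
  using assms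
proof (induction us arbitrary: r rule: list.induct)
  case Nil
  have "r = (\<lambda>z. \<Sum>x\<in>P. scalar (r x) x z)"
    using Nil finite_P by (auto simp: scalar_def base_ring_sel sum.delta fun_eq_iff)
  then have "frag_of (r, []) = frag_of (\<lambda>z. \<Sum>x\<in>P. scalar (r x) x z, [] :: ('p \<Rightarrow> 'p \<Rightarrow> 'k) list)" by simp
  also have "\<dots> \<sim> (\<Sum>x\<in>P. frag_of (scalar (r x) x, []))"
    by (rule equiv_scalar_sum) (use finite_P scalar_closed in auto)
  also have "\<dots> = (\<Sum>c\<in>{c \<in> pwalks P S. length c = Suc 0}. path_word (word_val (r, []) c) c)"
    by (rule sum.reindex_bij_witness[where i = hd and j = "\<lambda>x. [x]"])
      (auto simp: path_word_def word_val_def length_Suc_conv)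
  finally show ?case by simp
next
  case (Cons u us)
  let ?w = "\<lambda>n. {c \<in> pwalks P S. length c = Suc n}"
  let ?n = "length us"
  have u: "u \<in> carrier M" and us: "us \<in> lists (carrier M)" using Cons.prems by auto
  have one: "\<one>\<^bsub>R\<^esub> \<in> carrier R" by (simp add: base_ring_sel)
  have fw: "finite (?w n)" for n by (rule finite_pwalks_length[OF finite_P])
  let ?b = "\<lambda>p. basis_elem (r (fst p) * u (fst p) (snd p)) (fst p) (snd p)"
  have "r = (\<lambda>z. \<one>\<^bsub>R\<^esub> z * r z)"
    using Cons.prems by (auto simp: base_ring_sel)
  then have "frag_of (r, u # us) = frag_of (\<lambda>z. \<one>\<^bsub>R\<^esub> z * r z, u # us)" by simp
  also have "\<dots> \<sim> frag_of (\<one>\<^bsub>R\<^esub>, (\<lambda>x y. r x * u x y) # us)"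
    by (rule equiv_scalar_move) (use one u us Cons.prems in auto)
  also have "(\<lambda>x y. r x * u x y) = (\<lambda>x y. \<Sum>p\<in>S. ?b p x y)"
  proof (intro ext)
    fix x y
    have "(\<Sum>p\<in>S. ?b p x y) = (\<Sum>p\<in>S. if p = (x, y) then r x * u x y else 0)"
      by (rule sum.cong) (auto simp: basis_elem_def)
    then show "r x * u x y = (\<Sum>p\<in>S. ?b p x y)"
      using u finite_S by (auto simp: sum.delta carrier_M)
  qed
  also have "frag_of (\<one>\<^bsub>R\<^esub>, (\<lambda>x y. \<Sum>p\<in>S. ?b p x y) # us) \<sim> (\<Sum>p\<in>S. frag_of (\<one>\<^bsub>R\<^esub>, ?b p # us))"
    by (rule equiv_slot_sum) (use finite_S basis_elem_closed one us in auto)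
  also have "\<dots> \<sim> (\<Sum>p\<in>S. \<Sum>c\<in>?w ?n. if hd c = snd p then path_word (word_val (r, u # us) (fst p # c)) (fst p # c) else 0)"
  proof (rule equiv_sum)
    fix p assume "p \<in> S"
    then obtain x y where p: "p = (x, y)" and xy: "(x, y) \<in> S" by (cases p) auto
    let ?a = "r x * u x y"
    let ?e = "basis_elem 1 x y :: 'p \<Rightarrow> 'p \<Rightarrow> 'k"
    have e: "?e \<in> carrier M" using basis_elem_closed[OF xy] .
    have y: "y \<in> P" using xy S_subset by blast
    \<comment> \<open>The coefficient of \<open>e\<^sub>x\<^sub>,\<^sub>y\<close> moves to the far
      end \<open>y\<close>, where it is the leading scalar of the shorter word; this is why the
      induction is over arbitrary scalars.\<close>
    have "frag_of (\<one>\<^bsub>R\<^esub>, ?b p # us) = prepend ?e (frag_of (scalar ?a y, us))"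
      by (auto simp: p prepend_def basis_elem_def scalar_def fun_eq_iff frag_of_eq)
    also have "\<dots> \<sim> prepend ?e (\<Sum>c\<in>?w ?n. path_word (word_val (scalar ?a y, us) c) c)"
      by (rule prepend_equiv[OF e], rule Cons.IH) (use us scalar_closed[OF y] in auto)
    also have "\<dots> = (\<Sum>c\<in>?w ?n. prepend ?e (path_word (word_val (scalar ?a y, us) c) c))"
      unfolding prepend_def by (simp add: frag_extend_sum fw o_def)
    also have "\<dots> \<sim> (\<Sum>c\<in>?w ?n. if hd c = y then path_word (word_val (scalar ?a y, us) c) (x # c) else 0)"
      by (rule equiv_sum, rule prepend_path_word) (use xy in auto)
    also have "\<dots> = (\<Sum>c\<in>?w ?n. if hd c = snd p then path_word (word_val (r, u # us) (fst p # c)) (fst p # c) else 0)"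
    proof (rule sum.cong, rule refl)
      fix c assume "c \<in> ?w ?n"
      then obtain z d where "c = z # d" by (cases c) auto
      then show "(if hd c = y then path_word (word_val (scalar ?a y, us) c) (x # c) else 0)
        = (if hd c = snd p then path_word (word_val (r, u # us) (fst p # c)) (fst p # c) else 0)"
        by (simp add: p word_val_def scalar_def mult.assoc)
    qed
    finally show "frag_of (\<one>\<^bsub>R\<^esub>, ?b p # us) \<sim>
      (\<Sum>c\<in>?w ?n. if hd c = snd p then path_word (word_val (r, u # us) (fst p # c)) (fst p # c) else 0)" .
  qed
  also have "\<dots> = (\<Sum>(p, c)\<in>{(p, c) \<in> S \<times> ?w ?n. hd c = snd p}. path_word (word_val (r, u # us) (fst p # c)) (fst p # c))"
    unfolding sum.cartesian_product
    by (rule sum.mono_neutral_cong_right) (use finite_S fw in \<open>auto split: if_splits\<close>)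
  also have "\<dots> = (\<Sum>c\<in>?w (Suc ?n). path_word (word_val (r, u # us) c) c)"
    by (rule sum.reindex_bij_witness[where i = "\<lambda>c. ((hd c, hd (tl c)), tl c)" and j = "\<lambda>(p, c). fst p # c"])
      (use S_subset in \<open>auto simp: length_Suc_conv\<close>)
  finally show ?case by simp
qed

text \<open>The set \<open>L\<close> may exceed the support: to subtract two normal forms, both have
  to be written over a common set of walks first.\<close>

lemma normal_form:
  assumes "c \<in> carrier W"
  shows "\<And>L. \<lbrakk>finite L; L \<subseteq> pwalks P S; \<And>ch. \<Phi> c ch \<noteq> 0 \<Longrightarrow> ch \<in> L\<rbrakk> \<Longrightarrow> c \<sim> (\<Sum>ch\<in>L. path_word (\<Phi> c ch) ch)"
proof -
  have shrink: "(\<Sum>ch\<in>L. path_word (F ch) ch) \<sim> (\<Sum>ch\<in>L'. path_word (F ch) ch)"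
    if "finite L'" "L \<subseteq> L'" "L' \<subseteq> pwalks P S" "\<And>ch. F ch \<noteq> 0 \<Longrightarrow> ch \<in> L" for L L' F
  proof -
    have "(\<Sum>ch\<in>L' - L. path_word (F ch) ch) \<sim> (\<Sum>ch\<in>L' - L. 0)"
    proof (rule equiv_sum)
      fix ch assume "ch \<in> L' - L"
      then show "path_word (F ch) ch \<sim> 0" using that path_word_0[of ch] by (metis DiffD1 DiffD2 subsetD)
    qed
    from equiv_add[OF this equiv_refl] show ?thesis
      using sum.subset_diff[OF that(2,1), of "\<lambda>ch. path_word (F ch) ch"] equiv_sym by simp
  qed
  have "c \<in> carrier W \<and> (\<forall>L. finite L \<longrightarrow> L \<subseteq> pwalks P S \<longrightarrow> (\<forall>ch. \<Phi> c ch \<noteq> 0 \<longrightarrow> ch \<in> L) \<longrightarrow>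
      c \<sim> (\<Sum>ch\<in>L. path_word (\<Phi> c ch) ch))" (is "?Q c")
  proof (rule frag_induction[of c words])
    show "Poly_Mapping.keys c \<subseteq> words" using assms by (simp only: W_sel mem_Collect_eq)
    have "(\<Sum>ch\<in>L. path_word 0 ch) \<sim> (\<Sum>ch\<in>L. 0)" if "L \<subseteq> pwalks P S" for L
      by (rule equiv_sum) (use that path_word_0 in auto)
    then show "?Q 0" using W_0_closed equiv_sym by auto
  next
    fix w assume w: "w \<in> words"
    then obtain r us where ru: "w = (r, us)" "r \<in> carrier R" "us \<in> lists (carrier M)" by blast
    let ?w = "{c \<in> pwalks P S. length c = Suc (length us)}"
    have fw: "finite ?w" by (rule finite_pwalks_length[OF finite_P])
    have "frag_of w \<sim> (\<Sum>ch\<in>L. path_word (\<Phi> (frag_of w) ch) ch)"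
      if L: "finite L" "L \<subseteq> pwalks P S" "\<forall>ch. \<Phi> (frag_of w) ch \<noteq> 0 \<longrightarrow> ch \<in> L" for L
    proof -
      have "frag_of w \<sim> (\<Sum>ch\<in>?w. path_word (\<Phi> (frag_of w) ch) ch)"
        using word_normal_form[OF ru(3,2)] ru(1) by simp
      also have "\<dots> \<sim> (\<Sum>ch\<in>?w \<union> L. path_word (\<Phi> (frag_of w) ch) ch)"
        by (rule shrink) (use fw L word_val_support[OF w] ru(1) in auto)
      also have "\<dots> \<sim> (\<Sum>ch\<in>L. path_word (\<Phi> (frag_of w) ch) ch)"
        by (rule equiv_sym, rule shrink) (use fw L in auto)
      finally show ?thesis .
    qed
    note * = this
    show "?Q (frag_of w)"
      by (intro conjI allI impI) (rule W_of_closed[OF w], rule *)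
  next
    fix a b assume a: "?Q a" and b: "?Q b"
    have "a - b \<sim> (\<Sum>ch\<in>L. path_word (\<Phi> (a - b) ch) ch)"
      if L: "finite L" "L \<subseteq> pwalks P S" "\<forall>ch. \<Phi> (a - b) ch \<noteq> 0 \<longrightarrow> ch \<in> L" for L
    proof -
      define L' where "L' = L \<union> {ch. \<Phi> a ch \<noteq> 0} \<union> {ch. \<Phi> b ch \<noteq> 0}"
      have L': "finite L'" "L' \<subseteq> pwalks P S"
        unfolding L'_def using L path_ringD[OF Phi_closed, of a] path_ringD[OF Phi_closed, of b] a b by auto
      have "a \<sim> (\<Sum>ch\<in>L'. path_word (\<Phi> a ch) ch)" "b \<sim> (\<Sum>ch\<in>L'. path_word (\<Phi> b ch) ch)"
        using a b L' by (auto simp: L'_def)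
      then have "a - b \<sim> (\<Sum>ch\<in>L'. path_word (\<Phi> a ch) ch) - (\<Sum>ch\<in>L'. path_word (\<Phi> b ch) ch)"
        by (rule equiv_diff)
      also have "\<dots> = (\<Sum>ch\<in>L'. path_word (\<Phi> a ch) ch - path_word (\<Phi> b ch) ch)"
        by (simp add: sum_subtractf)
      also have "\<dots> \<sim> (\<Sum>ch\<in>L'. path_word (\<Phi> (a - b) ch) ch)"
      proof (rule equiv_sum)
        fix ch assume "ch \<in> L'"
        then show "path_word (\<Phi> a ch) ch - path_word (\<Phi> b ch) ch \<sim> path_word (\<Phi> (a - b) ch) ch"
          using equiv_sym[OF path_word_diff] L'(2) by auto
      qed
      also have "\<dots> \<sim> (\<Sum>ch\<in>L. path_word (\<Phi> (a - b) ch) ch)"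
        by (rule equiv_sym, rule shrink) (use L L' in \<open>auto simp: L'_def\<close>)
      finally show ?thesis .
    qed
    note * = this
    show "?Q (a - b)"
      by (intro conjI allI impI) (rule W_diff_closed, use a in simp, use b in simp, rule *)
  qed
  then show "\<And>L. \<lbrakk>finite L; L \<subseteq> pwalks P S; \<And>ch. \<Phi> c ch \<noteq> 0 \<Longrightarrow> ch \<in> L\<rbrakk> \<Longrightarrow> c \<sim> (\<Sum>ch\<in>L. path_word (\<Phi> c ch) ch)"
    by blast
qed

text \<open>An element killed by \<open>\<Phi>\<close> has the empty sum as a normal form, so it
  lies in \<open>T\<close>.\<close>

lemma relations_kernel: "T = {a \<in> carrier W. \<Phi> a = \<zero>\<^bsub>A\<^esub>}"
proof -
  have "a \<in> T" if "a \<in> carrier W" "\<Phi> a = (\<lambda>c. 0)" for a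
    using normal_form[OF that(1), of "{}"] that(2) by (simp add: equiv_def)
  then show ?thesis using Phi_relations T_closed(1) by (auto simp: path_ring_sel)
qed

definition path_frag :: "('p list \<Rightarrow> 'k) \<Rightarrow> ('p \<Rightarrow> 'k, 'p \<Rightarrow> 'p \<Rightarrow> 'k) word_group" where
  "path_frag F = (\<Sum>c\<in>{c. F c \<noteq> 0}. path_word (F c) c)"

lemma path_frag_closed:
  assumes "F \<in> carrier A" shows "path_frag F \<in> carrier W"
proof -
  have "sum (\<lambda>c. path_word (F c) c) B \<in> carrier W" if "finite B" "B \<subseteq> pwalks P S" for B
    using that by (induction B rule: finite_induct) (auto simp: W_0_closed W_add_closed path_word_closed)
  then show ?thesis unfolding path_frag_def using path_ringD[OF assms] by blast
qed

lemma Phi_sum: "finite B \<Longrightarrow> \<Phi> (sum f B) = (\<lambda>c. \<Sum>x\<in>B. \<Phi> (f x) c)"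
  by (simp add: \<Phi>_def frag_val_sum)

lemma Phi_path_frag:
  assumes "F \<in> carrier A" shows "\<Phi> (path_frag F) = F"
proof
  fix d
  have "\<Phi> (path_frag F) d = (\<Sum>c\<in>{c. F c \<noteq> 0}. \<Phi> (path_word (F c) c) d)"
    unfolding path_frag_def using path_ringD(1)[OF assms] by (simp add: Phi_sum)
  also have "\<dots> = (\<Sum>c\<in>{c. F c \<noteq> 0}. if d = c then F c else 0)"
    by (intro sum.cong refl Phi_path_word) (use path_ringD(2)[OF assms] pwalks_Nil in \<open>metis mem_Collect_eq\<close>)
  also have "\<dots> = F d" using path_ringD(1)[OF assms] by simp
  finally show "\<Phi> (path_frag F) d = F d" .
qed

lemma Phi_surj: "\<Phi> ` carrier W = carrier A"
  using Phi_closed path_frag_closed Phi_path_frag by (auto simp: image_iff) metis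

lemma Phi_hcomp: "\<Phi> ` hcomp W n = hcomp A n"
proof (intro equalityI subsetI)
  fix F assume "F \<in> \<Phi> ` hcomp W n"
  then obtain c where c: "Poly_Mapping.keys c \<subseteq> carrier R \<times> {ms \<in> lists (carrier M). length ms = n}"
    and F: "F = \<Phi> c" by (auto simp: W_sel)
  then have cW: "c \<in> carrier W" by (auto simp: W_sel)
  have "length ch = Suc n" if "\<Phi> c ch \<noteq> 0" for ch
  proof -
    obtain w where w: "w \<in> Poly_Mapping.keys c" "w \<in> words" "word_val w ch \<noteq> 0"
      using Phi_nonzero[OF cW \<open>\<Phi> c ch \<noteq> 0\<close>] .
    then show ?thesis using word_val_support(2)[OF w(2,3)] c by fastforce
  qed
  then show "F \<in> hcomp A n" using path_ringD[OF Phi_closed[OF cW]] F by (simp add: path_ring_sel)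
next
  fix F assume F: "F \<in> hcomp A n"
  then have FA: "F \<in> carrier A" by (auto simp: path_ring_sel)
  have "Poly_Mapping.keys (path_frag F) \<subseteq> carrier R \<times> {ms \<in> lists (carrier M). length ms = n}"
  proof -
    have "Poly_Mapping.keys (path_frag F) \<subseteq> (\<Union>c\<in>{c. F c \<noteq> 0}. Poly_Mapping.keys (path_word (F c) c))"
      unfolding path_frag_def by (rule keys_sum)
    also have "\<dots> \<subseteq> carrier R \<times> {ms \<in> lists (carrier M). length ms = n}"
    proof (rule UN_least)
      fix c assume "c \<in> {c. F c \<noteq> 0}"
      then have c: "c \<in> pwalks P S" "length c = Suc n" using F by (auto simp: path_ring_sel)
      then have "c \<noteq> []" by auto
      then have "length (edges c) = n" using length_edges[of c] c(2) by simp
      then show "Poly_Mapping.keys (path_word (F c) c) \<subseteq> carrier R \<times> {ms \<in> lists (carrier M). length ms = n}"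
        using scalar_closed[OF pwalks_hd[OF c(1)]] pwalks_edges[OF c(1)]
        by (simp only: path_word_def keys_frag_of) (simp del: in_lists_conv_set)
    qed
    finally show ?thesis .
  qed
  then have "path_frag F \<in> hcomp W n" by (simp only: W_sel mem_Collect_eq)
  then show "F \<in> \<Phi> ` hcomp W n" using Phi_path_frag[OF FA] by (metis image_eqI)
qed

sublocale tensor: graded_rring_quotient W T A \<Phi> R
proof (rule graded_rring_quotient.intro)
  show "\<Phi> (a \<oplus>\<^bsub>W\<^esub> b) = \<Phi> a \<oplus>\<^bsub>A\<^esub> \<Phi> b" for a b by (simp add: W_sel path_ring_sel)
  show "hcomp W n \<subseteq> carrier W" for n by (auto simp: W_sel)
qed (simp_all add: W_group path_ring_ring finite_P W_mult_closed W_one_closed Phi_mult Phi_one Phi_surj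
    relations_kernel W_lact_closed W_ract_closed Phi_lact Phi_ract Phi_hcomp)

end


section \<open>The differential on chains\<close>

text \<open>The point removed is at position \<open>i + 1\<close>: the index counts the inner points
  from 0 and so agrees with the exponent of the sign in \<open>bar_diff_word\<close>.\<close>

definition del :: "nat \<Rightarrow> 'p list \<Rightarrow> 'p list" where
  "del i c = take (Suc i) c @ drop (i + 2) c"

definition ins :: "nat \<Rightarrow> 'p \<Rightarrow> 'p list \<Rightarrow> 'p list" where
  "ins i z c = take (Suc i) c @ z # drop (Suc i) c"

definition (in graded_poset) chains :: "'p list set" where
  "chains = pwalks P lt"

definition (in graded_poset) dif :: "('p list \<Rightarrow> 'k::field) \<Rightarrow> 'p list \<Rightarrow> 'k" where
  "dif F c = (if c \<in> chains then \<Sum>i<length c - 2. (-1) ^ i * F (del i c) else 0)"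

text \<open>The bar differential in coordinates. Multiplying two neighbouring letters sums over the
  point where they met, so the value on a shorter walk is a sum over inserted points.\<close>

definition (in graded_poset) boundary :: "('p list \<Rightarrow> 'k::field) \<Rightarrow> 'p list \<Rightarrow> 'k" where
  "boundary G c = (\<Sum>i<length c - 1. (-1) ^ i * (\<Sum>z\<in>P. G (ins i z c)))"

lemma length_del: "i + 2 < length c \<Longrightarrow> length (del i c) = length c - 1"
  by (simp add: del_def)

lemma hd_del: "hd (del i c) = hd c"
  by (cases c) (auto simp: del_def)

lemma last_del: "i + 2 < length c \<Longrightarrow> last (del i c) = last c"
  by (auto simp: del_def last_append)

lemma hd_ins: "c \<noteq> [] \<Longrightarrow> hd (ins i z c) = hd c"
  by (cases c) (auto simp: ins_def)

lemma del_ins: "i + 1 < length c \<Longrightarrow> del i (ins i z c) = c"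
  by (auto simp: del_def ins_def)

lemma ins_del: "i + 2 < length c \<Longrightarrow> ins i (c ! Suc i) (del i c) = c"
  by (simp add: del_def ins_def id_take_nth_drop[symmetric] Cons_nth_drop_Suc)

lemma ins_Suc_Cons: "ins (Suc i) z (x # c) = x # ins i z c"
  by (simp add: ins_def)

text \<open>The simplicial identity for deletions, responsible for \<open>dif_dif\<close>.\<close>

lemma del_del:
  assumes "i \<le> j" "j + 3 < length c"
  shows "del j (del i c) = del i (del (Suc j) c)"
  using assms
proof (induction i arbitrary: j c)
  case 0
  obtain x d where c: "c = x # d" using 0 by (cases c) auto
  obtain y e where d: "d = y # e" using 0 c by (cases d) auto
  show ?case by (cases j) (simp_all add: c d del_def)
next
  case (Suc i)
  obtain x d where c: "c = x # d" using Suc by (cases c) auto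
  obtain k where j: "j = Suc k" using Suc by (cases j) auto
  have "del (Suc m) (x # e) = x # del m e" for m and e :: "'a list" by (simp add: del_def)
  then show ?case using Suc.IH[of k d] Suc.prems by (simp add: c j)
qed

context graded_poset begin

lemma chains_iff: "c \<in> chains \<longleftrightarrow> c \<noteq> [] \<and> sorted_wrt (\<lambda>x y. (x, y) \<in> lt) c \<and> set c \<subseteq> P"
proof -
  have "transp (\<lambda>x y. (x, y) \<in> lt)" using lt_trans by (blast intro: transpI)
  then show ?thesis
    by (auto simp: chains_def pwalks_def walks_def successively_conv_sorted_wrt)
qed

lemma chains_distinct: "c \<in> chains \<Longrightarrow> distinct c"
proof -
  have "sorted_wrt (\<lambda>x y. (x, y) \<in> lt) c \<Longrightarrow> distinct c"
    by (induction c) (auto simp: lt_irrefl)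
  then show "c \<in> chains \<Longrightarrow> distinct c" by (simp add: chains_iff)
qed

lemma finite_chains: "finite chains"
  by (rule finite_subset[OF _ finite_subset_distinct[OF finite_P]])
    (auto simp: chains_distinct dest: chains_iff[THEN iffD1])

lemma chains_sublist:
  assumes "a @ b @ d \<in> chains" "a @ d \<noteq> []" shows "a @ d \<in> chains"
  using assms by (auto simp: chains_iff sorted_wrt_append)

lemma del_chains: "c \<in> chains \<Longrightarrow> i + 2 < length c \<Longrightarrow> del i c \<in> chains"
proof -
  assume c: "c \<in> chains" and i: "i + 2 < length c"
  have "c = take (Suc i) c @ [c ! Suc i] @ drop (i + 2) c"
    using i by (simp add: Cons_nth_drop_Suc)
  then show "del i c \<in> chains" using chains_sublist c i unfolding del_def
    by (metis append_is_Nil_conv drop_eq_Nil leD)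
qed

lemma chains_glue:
  "k < length c \<Longrightarrow> c \<in> chains \<longleftrightarrow> take (Suc k) c \<in> chains \<and> drop k c \<in> chains"
  unfolding chains_def by (rule pwalks_glue)

text \<open>A chain with a point that fits into one of its gaps is the same as a longer chain with a
  chosen inner point, so both sides run over the same pairs.\<close>

lemma boundary_adjoint:
  assumes G: "\<And>c. c \<notin> chains \<Longrightarrow> G c = 0"
  shows "(\<Sum>c\<in>chains. F c * boundary G c) = (\<Sum>c\<in>chains. dif F c * G c)"
proof -
  have G': "c \<in> chains" if "G c \<noteq> 0" for c using G that by blast
  let ?t = "\<lambda>c i z. (-1) ^ i * F c * G (ins i z c)"
  have "(\<Sum>c\<in>chains. F c * boundary G c) = (\<Sum>c\<in>chains. \<Sum>i<length c - 1. \<Sum>z\<in>P. ?t c i z)"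
    by (simp add: boundary_def sum_distrib_left mult_ac)
  also have "\<dots> = (\<Sum>(c, i, z)\<in>(SIGMA c:chains. {..<length c - 1} \<times> P). ?t c i z)"
    by (simp add: sum.cartesian_product sum.Sigma finite_chains finite_P)
  also have "\<dots> = (\<Sum>(c, i, z)\<in>{(c, i, z). c \<in> chains \<and> i < length c - 1 \<and> z \<in> P \<and> ins i z c \<in> chains}. ?t c i z)"
    by (rule sum.mono_neutral_right) (auto simp: finite_chains finite_P intro: G')
  also have "\<dots> = (\<Sum>(c, i)\<in>(SIGMA c:chains. {..<length c - 2}). (-1) ^ i * F (del i c) * G c)"
  proof (rule sum.reindex_bij_witness[where i = "\<lambda>(c, i). (del i c, i, c ! Suc i)" and j = "\<lambda>(c, i, z). (ins i z c, i)"])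
    fix a assume "a \<in> {(c, i, z). c \<in> chains \<and> i < length c - 1 \<and> z \<in> P \<and> ins i z c \<in> chains}"
    then obtain c i z where a: "a = (c, i, z)" "c \<in> chains" "i < length c - 1" "ins i z c \<in> chains" by blast
    then have "ins i z c ! Suc i = z" by (simp add: ins_def nth_append)
    then show "(case case a of (c, i, z) \<Rightarrow> (ins i z c, i) of (c, i) \<Rightarrow> (del i c, i, c ! Suc i)) = a"
      "(case a of (c, i, z) \<Rightarrow> (ins i z c, i)) \<in> (SIGMA c:chains. {..<length c - 2})"
      "(case case a of (c, i, z) \<Rightarrow> (ins i z c, i) of (c, i) \<Rightarrow> (- 1) ^ i * F (del i c) * G c) =
         (case a of (c, i, z) \<Rightarrow> (- 1) ^ i * F c * G (ins i z c))"
      using a by (auto simp: del_ins) (simp add: ins_def)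
  next
    fix b assume "b \<in> (SIGMA c:chains. {..<length c - 2})"
    then obtain c i where b: "b = (c, i)" "c \<in> chains" "i + 2 < length c" by auto
    moreover have "c ! Suc i \<in> P" using b chains_iff nth_mem[of "Suc i" c] by auto
    ultimately show "(case case b of (c, i) \<Rightarrow> (del i c, i, c ! Suc i) of (c, i, z) \<Rightarrow> (ins i z c, i)) = b"
      "(case b of (c, i) \<Rightarrow> (del i c, i, c ! Suc i))
        \<in> {(c, i, z). c \<in> chains \<and> i < length c - 1 \<and> z \<in> P \<and> ins i z c \<in> chains}"
      by (auto simp: ins_del del_chains length_del)
  qed
  also have "\<dots> = (\<Sum>c\<in>chains. \<Sum>i<length c - 2. (-1) ^ i * F (del i c) * G c)"
    by (simp add: sum.Sigma finite_chains)
  also have "\<dots> = (\<Sum>c\<in>chains. dif F c * G c)"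
    by (intro sum.cong) (simp_all add: dif_def sum_distrib_right)
  finally show ?thesis .
qed

abbreviation chain_ring :: "('p \<Rightarrow> 'k::field, 'p list \<Rightarrow> 'k) graded_bimodule" where
  "chain_ring \<equiv> path_ring P lt"

lemma chain_ring_carrier: "carrier chain_ring = {F. \<forall>c. F c \<noteq> 0 \<longrightarrow> c \<in> chains}"
  using finite_chains by (auto simp: path_ring_sel chains_def intro: finite_subset)

lemma chain_ringD: "F \<in> carrier chain_ring \<Longrightarrow> c \<notin> chains \<Longrightarrow> F c = 0"
  by (auto simp: chain_ring_carrier)

lemma dif_closed: "dif F \<in> carrier chain_ring"
  by (auto simp: chain_ring_carrier dif_def)

lemma dif_add: "dif (\<lambda>c. F c + G c) = (\<lambda>c. dif F c + dif G c)"
  by (auto simp: dif_def fun_eq_iff algebra_simps sum.distrib)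

lemma dif_scale: "dif (\<lambda>c. a * F c) = (\<lambda>c. a * dif F c)"
  by (auto simp: dif_def fun_eq_iff sum_distrib_left mult.left_commute)

lemma dif_uminus: "dif (\<lambda>c. - F c) = (\<lambda>c. - dif F c)"
  using dif_scale[of "-1" F] by simp

lemma dif_zero: "dif (\<lambda>c. 0) = (\<lambda>c. 0)"
  by (simp add: dif_def fun_eq_iff)

lemma dif_sum: "finite B \<Longrightarrow> dif (\<lambda>c. \<Sum>x\<in>B. f x c) = (\<lambda>c. \<Sum>x\<in>B. dif (f x) c)"
  by (induction B rule: finite_induct) (simp_all add: dif_zero dif_add)

lemma dif_dif: "dif (dif F) = (\<lambda>c. 0)"
proof
  fix c
  show "dif (dif F) c = 0"
  proof (cases "c \<in> chains")
    case True
    let ?n = "length c"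
    let ?t = "\<lambda>(i, j). (-1) ^ (i + j) * F (del j (del i c))"
    let ?A = "{(i, j). i \<le> j \<and> j < ?n - 3}" and ?B = "{(i, j). j < i \<and> i < ?n - 2}"
    have fin: "finite ?A" "finite ?B"
      by (rule finite_subset[of _ "{..?n} \<times> {..?n}"], auto)+
    have "dif (dif F) c = (\<Sum>i<?n - 2. \<Sum>j<?n - 3. ?t (i, j))"
      unfolding dif_def[of "dif F"] using True
      by (auto simp: dif_def del_chains length_del sum_distrib_left power_add mult.assoc intro!: sum.cong)
    also have "\<dots> = sum ?t ({..<?n - 2} \<times> {..<?n - 3})"
      by (simp add: sum.cartesian_product)
    also have "{..<?n - 2} \<times> {..<?n - 3} = ?A \<union> ?B" by auto
    also have "sum ?t (?A \<union> ?B) = sum ?t ?A + sum ?t ?B"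
      by (rule sum.union_disjoint) (use fin in auto)
    \<comment> \<open>By \<open>del_del\<close> the two points can be deleted in either order; the
      exchange shifts one index by one, which reverses the sign.\<close>
    also have "sum ?t ?B = (\<Sum>p\<in>?A. - ?t p)"
    proof (rule sum.reindex_bij_witness[where i = "\<lambda>(i, j). (Suc j, i)" and j = "\<lambda>(i, j). (j, i - 1)"])
      fix b assume "b \<in> ?B"
      then obtain i j where b: "b = (Suc i, j)" "j \<le> i" "Suc i < ?n - 2"
        by (cases b; cases "fst b") auto
      then have "del j (del (Suc i) c) = del i (del j c)" using del_del[of j i c] by simp
      then show "- ?t (case b of (i, j) \<Rightarrow> (j, i - 1)) = ?t b" using b by (simp add: add.commute)
    qed auto
    finally show ?thesis by (simp add: sum_negf)
  qed (simp add: dif_def)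
qed

text \<open>The Koszul sign; a chain of \<open>length c\<close> points has degree
  \<open>length c - 1\<close>.\<close>

definition twist :: "('p list \<Rightarrow> 'k::field) \<Rightarrow> 'p list \<Rightarrow> 'k" where
  "twist F c = (-1) ^ (length c - 1) * F c"

lemma twist_closed: "F \<in> carrier chain_ring \<Longrightarrow> twist F \<in> carrier chain_ring"
  by (auto simp: chain_ring_carrier twist_def)

lemma take_del: "k \<le> i \<Longrightarrow> take (Suc k) (del i c) = take (Suc k) c"
  by (simp add: del_def min_def)

lemma drop_del: "k \<le> i \<Longrightarrow> i + 2 < length c \<Longrightarrow> drop k (del i c) = del (i - k) (drop k c)"
  by (simp add: del_def drop_take Suc_diff_le add.commute)

lemma take_del': "i < k \<Longrightarrow> Suc k < length c \<Longrightarrow> take (Suc k) (del i c) = del i (take (Suc (Suc k)) c)"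
  by (auto simp: del_def min_def drop_take)

lemma drop_del': "i < k \<Longrightarrow> Suc k < length c \<Longrightarrow> drop k (del i c) = drop (Suc k) c"
  by (simp add: del_def)

text \<open>The deleted point is never the one where the walk is cut, so it is an inner point of one
  of the factors. In the second factor its index is shifted by the degree of the first, which
  produces \<open>twist\<close>.\<close>

lemma dif_mult:
  assumes F: "F \<in> carrier chain_ring" and G: "G \<in> carrier chain_ring"
  shows "dif (F \<otimes>\<^bsub>chain_ring\<^esub> G) =
    (\<lambda>c. (dif F \<otimes>\<^bsub>chain_ring\<^esub> G) c + (twist F \<otimes>\<^bsub>chain_ring\<^esub> dif G) c)"
proof
  fix c
  show "dif (F \<otimes>\<^bsub>chain_ring\<^esub> G) c = (dif F \<otimes>\<^bsub>chain_ring\<^esub> G) c + (twist F \<otimes>\<^bsub>chain_ring\<^esub> dif G) c"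
  proof (cases "c \<in> chains")
    case False
    then show ?thesis
      using chain_ringD[OF dif_closed False, of "F \<otimes>\<^bsub>chain_ring\<^esub> G"]
        chain_ringD[OF path_mult_closed[OF dif_closed[of F] G] False]
        chain_ringD[OF path_mult_closed[OF twist_closed[OF F] dif_closed[of G]] False] by simp
  next
    case True
    define n where "n = length c"
    let ?t = "\<lambda>(i, k). (-1) ^ i * (F (take (Suc k) (del i c)) * G (drop k (del i c)))"
    let ?A = "{(i, k). k \<le> i \<and> i < n - 2}" and ?B = "{(i, k). i < k \<and> k < n - 1}"
    have fin: "finite ?A" "finite ?B"
      by (rule finite_subset[of _ "{..n} \<times> {..n}"], auto)+
    have "dif (F \<otimes>\<^bsub>chain_ring\<^esub> G) c = (\<Sum>i<n - 2. \<Sum>k<n - 1. ?t (i, k))"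
      using True unfolding dif_def path_ring_sel n_def
      by (auto simp: length_del sum_distrib_left intro!: sum.cong)
    also have "\<dots> = sum ?t ({..<n - 2} \<times> {..<n - 1})"
      by (simp add: sum.cartesian_product)
    also have "{..<n - 2} \<times> {..<n - 1} = ?A \<union> ?B" by auto
    also have "sum ?t (?A \<union> ?B) = sum ?t ?B + sum ?t ?A"
      by (subst sum.union_disjoint) (use fin in auto)
    also have "sum ?t ?B = (\<Sum>(k, i)\<in>(SIGMA k:{..<n}. {..<k - 1}). (-1) ^ i * F (del i (take (Suc k) c)) * G (drop k c))"
      by (rule sum.reindex_bij_witness[where i = "\<lambda>(k, i). (i, k - 1)" and j = "\<lambda>(i, k). (Suc k, i)"])
        (auto simp: n_def take_del' drop_del')
    also have "\<dots> = (\<Sum>k<n. \<Sum>i<k - 1. (-1) ^ i * F (del i (take (Suc k) c)) * G (drop k c))"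
      by (simp add: sum.Sigma)
    also have "\<dots> = (dif F \<otimes>\<^bsub>chain_ring\<^esub> G) c"
      unfolding path_ring_sel n_def
      using True chains_glue[of _ c] by (intro sum.cong) (auto simp: dif_def sum_distrib_right min.absorb2 Suc_le_eq)
    also have "sum ?t ?A = (\<Sum>(k, i)\<in>(SIGMA k:{..<n}. {..<n - k - 2}). (-1) ^ k * F (take (Suc k) c) * ((-1) ^ i * G (del i (drop k c))))"
      by (rule sum.reindex_bij_witness[where i = "\<lambda>(k, i). (i + k, k)" and j = "\<lambda>(i, k). (k, i - k)"])
        (auto simp: n_def take_del drop_del power_add[symmetric])
    also have "\<dots> = (\<Sum>k<n. \<Sum>i<n - k - 2. (-1) ^ k * F (take (Suc k) c) * ((-1) ^ i * G (del i (drop k c))))"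
      by (simp add: sum.Sigma)
    also have "\<dots> = (twist F \<otimes>\<^bsub>chain_ring\<^esub> dif G) c"
      unfolding path_ring_sel n_def
      using True chains_glue[of _ c] by (intro sum.cong) (auto simp: dif_def twist_def sum_distrib_left min.absorb2 Suc_le_eq)
    finally show ?thesis .
  qed
qed

end


section \<open>Comparison of the bar complex with a linear resolution\<close>

text \<open>The sign \<open>(-1)^n\<close> on a mere abelian group, where there are no scalars to
  multiply with.\<close>

definition sg :: "nat \<Rightarrow> 'v::ab_group_add \<Rightarrow> 'v" where
  "sg n v = (if even n then v else - v)"

lemma sg_simps [simp]:
  "sg (Suc n) v = - sg n v" "sg n (sg n v) = v" "sg n (a + b) = sg n a + sg n b"
  "sg n (a - b) = sg n a - sg n b" "sg n (- a) = - sg n a" "sg n 0 = 0" "sg 0 v = v"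
  by (simp_all add: sg_def)

lemma sg_sum: "sg n (sum f B) = (\<Sum>x\<in>B. sg n (f x))"
  by (simp add: sg_def sum_negf)

section \<open>The bar differential on decreasing chains\<close>

context graded_poset begin

text \<open>Chains that start at a fixed base point are listed in decreasing order.\<close>

fun rchain :: "'p list \<Rightarrow> bool" where
  "rchain [] = False"
| "rchain [x] = (x \<in> P)"
| "rchain (x # y # c) = ((y, x) \<in> lt \<and> rchain (y # c))"

text \<open>The sign of a gap is counted from the base point at the end of the list. It does not
  change when a point is added at the head, which makes the recursion from the head
  possible.\<close>

fun insertions :: "('p list \<Rightarrow> 'v::ab_group_add) \<Rightarrow> 'p list \<Rightarrow> 'v" where
  "insertions F (x # y # c) =
     sg (length c) (\<Sum>z\<in>{z. (y, z) \<in> lt \<and> (z, x) \<in> lt}. F (x # z # y # c)) +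
     insertions (\<lambda>l. F (x # l)) (y # c)"
| "insertions F _ = 0"

lemma finite_between: "finite {z. (y, z) \<in> lt \<and> (z, x) \<in> lt}" "finite {z. (y, z) \<in> lt}"
  by (rule finite_subset[OF _ finite_P]; use ltD in blast)+

lemma rchain_leq: "rchain l \<Longrightarrow> (last l, hd l) \<in> leq"
proof (induction l rule: rchain.induct)
  case (3 x y c)
  then show ?case using leq_trans ltD(1) by auto
qed (auto simp: leq_refl)

lemma rchain_hd: "rchain l \<Longrightarrow> hd l \<in> P"
  using rchain_leq leq_carrierD by blast

lemma rchain_ConsI: "rchain l \<Longrightarrow> (hd l, z) \<in> lt \<Longrightarrow> rchain (z # l) \<and> last (z # l) = last l"
  by (cases l) auto

lemma insertions_cong_hd:
  assumes "\<And>l. \<lbrakk>l \<noteq> []; hd l = hd c; length l = Suc (length c)\<rbrakk> \<Longrightarrow> F l = G l"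
  shows "insertions F c = insertions G c"
  using assms
proof (induction F c arbitrary: G rule: insertions.induct)
  case (1 F x y c)
  have "insertions (\<lambda>l. F (x # l)) (y # c) = insertions (\<lambda>l. G (x # l)) (y # c)"
    by (rule 1(1)) (use 1(2) in auto)
  then show ?case using 1(2) by simp
qed auto

text \<open>Two facts in one induction, for values in a set \<open>B\<close> closed under
  differences: the sum stays in \<open>B\<close>, and it commutes with a map \<open>T\<close> that
  is additive only on \<open>B\<close>. The choice \<open>B = {0}\<close> and \<open>T = id\<close>
  shows that a sum vanishes.\<close>

lemma insertions_induct:
  assumes "rchain c" "\<And>l. \<lbrakk>rchain l; last l = last c; hd l = hd c; length l = Suc (length c)\<rbrakk> \<Longrightarrow> F l \<in> B"
    and B: "0 \<in> B" "\<And>a b. a \<in> B \<Longrightarrow> b \<in> B \<Longrightarrow> a - b \<in> B"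
    and T: "T 0 = 0" "\<And>a b. a \<in> B \<Longrightarrow> b \<in> B \<Longrightarrow> T (a - b) = T a - T b"
  shows "insertions F c \<in> B \<and> insertions (\<lambda>l. T (F l)) c = T (insertions F c)"
  using assms(1,2)
proof (induction F c rule: insertions.induct)
  case (1 F x y c)
  have neg: "- a \<in> B" "T (- a) = - T a" if "a \<in> B" for a using B T that diff_0 by metis+
  have add: "a + b \<in> B" "T (a + b) = T a + T b" if "a \<in> B" "b \<in> B" for a b
    using B(2)[OF that(1) neg(1)[OF that(2)]] T(2)[OF that(1) neg(1)[OF that(2)]] neg(2)[OF that(2)] by auto
  have sgB: "sg n a \<in> B" "T (sg n a) = sg n (T a)" if "a \<in> B" for a n using that neg by (auto simp: sg_def)
  let ?Z = "{z. (y, z) \<in> lt \<and> (z, x) \<in> lt}"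
  have F: "F (x # z # y # c) \<in> B" if "z \<in> ?Z" for z using 1(2,3) that by auto
  have "sum (\<lambda>z. F (x # z # y # c)) Z \<in> B \<and>
      (\<Sum>z\<in>Z. T (F (x # z # y # c))) = T (sum (\<lambda>z. F (x # z # y # c)) Z)" if "finite Z" "Z \<subseteq> ?Z" for Z
    using that by (induction Z rule: finite_induct) (auto simp: B T add F)
  then have S: "sum (\<lambda>z. F (x # z # y # c)) ?Z \<in> B"
      "(\<Sum>z\<in>?Z. T (F (x # z # y # c))) = T (sum (\<lambda>z. F (x # z # y # c)) ?Z)"
    using finite_between by auto
  have "insertions (\<lambda>l. F (x # l)) (y # c) \<in> B \<and>
      insertions (\<lambda>l. T (F (x # l))) (y # c) = T (insertions (\<lambda>l. F (x # l)) (y # c))"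
  proof (rule 1(1))
    show "rchain (y # c)" using 1(2) by simp
    fix l assume l: "rchain l" "last l = last (y # c)" "hd l = hd (y # c)" "length l = Suc (length (y # c))"
    then obtain d where "l = y # d" by (cases l) auto
    then show "F (x # l) \<in> B" using l 1(2,3) by auto
  qed
  then show ?case using S by (simp add: add sgB)
qed (auto simp: B T)

lemma insertions_add: "insertions (\<lambda>l. F l + G l) c = insertions F c + insertions G c"
proof (induction F c arbitrary: G rule: insertions.induct)
  case (1 F x y c)
  show ?case using 1[of "\<lambda>l. G (x # l)"] by (simp add: sum.distrib algebra_simps)
qed simp_all

lemma insertions_uminus: "insertions (\<lambda>l. - F l) c = - insertions F c"
  by (induction F c rule: insertions.induct) (simp_all add: sum_negf algebra_simps)

lemma insertions_zero: "insertions (\<lambda>l. 0) c = 0"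
  using insertions_add[of "\<lambda>l. 0" "\<lambda>l. 0" c] by simp

lemma insertions_sg: "insertions (\<lambda>l. sg n (F l)) c = sg n (insertions F c)"
  by (simp add: sg_def insertions_uminus)

lemma insertions_sum: "insertions (\<lambda>l. \<Sum>z\<in>Z. F z l) c = (\<Sum>z\<in>Z. insertions (F z) c)"
  by (induction Z rule: infinite_finite_induct) (simp_all add: insertions_zero insertions_add)

definition base_chains :: "'p \<Rightarrow> nat \<Rightarrow> 'p list set" where
  "base_chains p n = {l. rchain l \<and> last l = p \<and> length l = n}"

lemma base_chains_Cons: "l \<in> base_chains p n \<Longrightarrow> (hd l, z) \<in> lt \<Longrightarrow> z # l \<in> base_chains p (Suc n)"
  using rchain_ConsI unfolding base_chains_def by auto

lemma insertions_cong:
  assumes "rchain c"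
    and "\<And>l. \<lbrakk>rchain l; last l = last c; hd l = hd c; length l = Suc (length c)\<rbrakk> \<Longrightarrow> F l = G l"
  shows "insertions F c = insertions G c"
proof -
  have "insertions (\<lambda>l. F l + - G l) c \<in> {0} \<and>
      insertions (\<lambda>l. id (F l + - G l)) c = id (insertions (\<lambda>l. F l + - G l) c)"
    by (rule insertions_induct[OF assms(1)]) (use assms(2) in auto)
  then show ?thesis using insertions_add[of F "\<lambda>l. - G l" c] insertions_uminus[of G c] by simp
qed

text \<open>Two points put into the top gap arise in both orders with opposite signs. If just one of
  the points goes into the top gap, the two orders cancel as well, and the remaining terms are the
  induction hypothesis.\<close>

lemma insertions_insertions: "insertions (insertions F) c = 0"
proof (induction F c rule: insertions.induct)
  case (1 F x y c)
  let ?Z = "\<lambda>y x. {z. (y, z) \<in> lt \<and> (z, x) \<in> lt}"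
  let ?n = "length c"
  have "insertions (\<lambda>l. insertions F (x # l)) (y # c)
      = insertions (\<lambda>l. - sg ?n (\<Sum>z\<in>?Z y x. F (x # z # l)) + insertions (\<lambda>l. F (x # l)) l) (y # c)"
  proof (rule insertions_cong_hd)
    fix l assume "l \<noteq> []" "hd l = hd (y # c)" "length l = Suc (length (y # c))"
    then obtain d where "l = y # d" "length d = Suc ?n" by (cases l) auto
    then show "insertions F (x # l) = - sg ?n (\<Sum>z\<in>?Z y x. F (x # z # l)) + insertions (\<lambda>l. F (x # l)) l"
      by simp
  qed
  also have "\<dots> = - sg ?n (\<Sum>z\<in>?Z y x. insertions (\<lambda>l. F (x # z # l)) (y # c))"
    using 1 by (simp only: insertions_add insertions_uminus insertions_sg insertions_sum add_0_right)
  finally have second: "insertions (\<lambda>l. insertions F (x # l)) (y # c)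
      = - sg ?n (\<Sum>z\<in>?Z y x. insertions (\<lambda>l. F (x # z # l)) (y # c))" .
  have "(\<Sum>z\<in>?Z y x. \<Sum>w\<in>?Z z x. F (x # w # z # y # c))
      = (\<Sum>(z, w)\<in>(SIGMA z:?Z y x. ?Z z x). F (x # w # z # y # c))"
    by (simp add: sum.Sigma finite_between)
  also have "\<dots> = (\<Sum>(z, w)\<in>(SIGMA z:?Z y x. ?Z y z). F (x # z # w # y # c))"
    by (rule sum.reindex_bij_witness[where i = "\<lambda>(a, b). (b, a)" and j = "\<lambda>(a, b). (b, a)"])
      (auto intro: lt_trans)
  also have "\<dots> = (\<Sum>z\<in>?Z y x. \<Sum>w\<in>?Z y z. F (x # z # w # y # c))"
    by (simp add: sum.Sigma finite_between)
  finally have swap: "(\<Sum>z\<in>?Z y x. \<Sum>w\<in>?Z z x. F (x # w # z # y # c))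
      = (\<Sum>z\<in>?Z y x. \<Sum>w\<in>?Z y z. F (x # z # w # y # c))" .
  have "(\<Sum>z\<in>?Z y x. insertions F (x # z # y # c))
      = (\<Sum>z\<in>?Z y x. insertions (\<lambda>l. F (x # z # l)) (y # c))"
    by (simp add: sum.distrib sum_subtractf sg_sum[symmetric] swap)
  then show ?case using second by simp
qed (simp_all add: insertions_zero)

end

text \<open>
  The modules \<open>X j\<close> of a resolution inside one type, with the multiplication \<open>E x y\<close> by
  \<open>e\<^sub>x\<^sub>,\<^sub>y\<close> and the components \<open>Gr j d\<close> of degree \<open>d\<close>. The map \<open>\<tau> j x y\<close> extracts the
  coefficients of \<open>e\<^sub>x\<^sub>,\<^sub>y\<close> in the coordinates with respect to a free module.
\<close>

locale koszul_chase = graded_poset P leq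
  for P :: "'p set" and leq :: "'p rel" +
  fixes E :: "'p \<Rightarrow> 'p \<Rightarrow> 'v::ab_group_add \<Rightarrow> 'v"
    and X :: "nat \<Rightarrow> 'v set" and Gr :: "nat \<Rightarrow> nat \<Rightarrow> 'v set"
    and \<delta> :: "nat \<Rightarrow> 'v \<Rightarrow> 'v" and \<tau> :: "nat \<Rightarrow> 'p \<Rightarrow> 'p \<Rightarrow> 'v \<Rightarrow> 'v"
  assumes X_zero: "0 \<in> X j" and X_diff: "\<lbrakk>a \<in> X j; b \<in> X j\<rbrakk> \<Longrightarrow> a - b \<in> X j"
    and E_X: "\<lbrakk>(x, y) \<in> leq; v \<in> X j\<rbrakk> \<Longrightarrow> E x y v \<in> X j"
    and E_diff: "E x y (a - b) = E x y a - E x y b"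
    and E_E: "E x y (E y z v) = E x z v"
    and \<tau>_X: "\<lbrakk>(x, y) \<in> leq; v \<in> X j\<rbrakk> \<Longrightarrow> \<tau> j x y v \<in> X j"
    and \<tau>_diff: "\<lbrakk>(x, y) \<in> leq; a \<in> X j; b \<in> X j\<rbrakk> \<Longrightarrow> \<tau> j x y (a - b) = \<tau> j x y a - \<tau> j x y b"
    and \<tau>_fix: "\<lbrakk>(x, y) \<in> leq; v \<in> X j\<rbrakk> \<Longrightarrow> E y y (\<tau> j x y v) = \<tau> j x y v"
    and \<tau>_E: "\<lbrakk>(x, z) \<in> leq; (x, y) \<in> leq; v \<in> X j\<rbrakk> \<Longrightarrow>
        \<tau> j x y (E x z v) = (if (z, y) \<in> leq then \<tau> j z y v else 0)"
    and \<tau>_split: "\<lbrakk>x \<in> P; v \<in> X j; E x x v = v\<rbrakk> \<Longrightarrow> (\<Sum>y\<in>{y. (x, y) \<in> leq}. E x y (\<tau> j x y v)) = v"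
    and \<delta>_X: "v \<in> X (Suc j) \<Longrightarrow> \<delta> j v \<in> X j"
    and \<delta>_diff: "\<lbrakk>a \<in> X (Suc j); b \<in> X (Suc j)\<rbrakk> \<Longrightarrow> \<delta> j (a - b) = \<delta> j a - \<delta> j b"
    and \<delta>_E: "\<lbrakk>(x, y) \<in> leq; v \<in> X (Suc j)\<rbrakk> \<Longrightarrow> \<delta> j (E x y v) = E x y (\<delta> j v)"
    and exact: "\<lbrakk>v \<in> X (Suc j); \<delta> j v = 0\<rbrakk> \<Longrightarrow> v \<in> \<delta> (Suc j) ` X (Suc (Suc j))"
    and \<delta>_\<delta>: "v \<in> X (Suc (Suc j)) \<Longrightarrow> \<delta> j (\<delta> (Suc j) v) = 0"
    and Gr_X: "Gr j d \<subseteq> X j"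
    and Gr_zero: "0 \<in> Gr j d" and Gr_diff: "\<lbrakk>a \<in> Gr j d; b \<in> Gr j d\<rbrakk> \<Longrightarrow> a - b \<in> Gr j d"
    and E_Gr: "\<lbrakk>(x, y) \<in> leq; v \<in> Gr j d\<rbrakk> \<Longrightarrow> E x y v \<in> Gr j (il x y + d)"
    and lift: "\<lbrakk>x \<in> P; v \<in> Gr j d; E x x v = v; v \<in> \<delta> j ` X (Suc j)\<rbrakk> \<Longrightarrow>
        \<exists>w\<in>Gr (Suc j) d. E x x w = w \<and> \<delta> j w = v"
    and gen: "\<lbrakk>x \<in> P; v \<in> Gr j d; d \<noteq> j; E x x v = v\<rbrakk> \<Longrightarrow>
        \<exists>f. (\<forall>y. (x, y) \<in> lt \<longrightarrow> f y \<in> X j \<and> E y y (f y) = f y) \<and> v = (\<Sum>y\<in>{y. (x, y) \<in> lt}. E x y (f y))"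
begin

section \<open>The bar complex with coefficients in the modules of a resolution\<close>

lemma E_zero [simp]: "E x y 0 = 0"
  using E_diff[of x y 0 0] by simp

lemma E_uminus: "E x y (- a) = - E x y a"
  using E_diff[of x y 0 a] by simp

lemma E_add: "E x y (a + b) = E x y a + E x y b"
  using E_diff[of x y a "- b"] by (simp add: E_uminus)

lemma E_sg: "E x y (sg n a) = sg n (E x y a)"
  by (simp add: sg_def E_uminus)

lemma E_sum: "E x y (sum f Z) = (\<Sum>z\<in>Z. E x y (f z))"
  by (induction Z rule: infinite_finite_induct) (simp_all add: E_add)

text \<open>The differential of the bar complex with coefficients: \<open>u\<close> attaches an
  element of the module to each chain, at its top point. The second summand is the last face, in
  which the last letter acts on the coefficient.\<close>

definition bd :: "('p list \<Rightarrow> 'v) \<Rightarrow> 'p list \<Rightarrow> 'v" where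
  "bd u c = insertions u c + sg (length c - 1) (\<Sum>y\<in>{y. (hd c, y) \<in> lt}. E (hd c) y (u (y # c)))"

lemma bd_add: "bd (\<lambda>l. u l + v l) c = bd u c + bd v c"
  by (simp add: bd_def insertions_add E_add sum.distrib algebra_simps)

lemma bd_uminus: "bd (\<lambda>l. - u l) c = - bd u c"
  by (simp add: bd_def insertions_uminus E_uminus sum_negf)

lemma bd_diff: "bd (\<lambda>l. u l - v l) c = bd u c - bd v c"
  using bd_add[of u "\<lambda>l. - v l" c] by (simp add: bd_uminus)

lemma bd_sg: "bd (\<lambda>l. sg n (u l)) c = sg n (bd u c)"
  by (simp add: sg_def bd_uminus)

text \<open>Beyond the insertions there remain the terms that act twice:
  \<open>E x y (E y w v) = E x w v\<close> cancels the term in which \<open>y\<close> is inserted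
  into the gap between \<open>x\<close> and \<open>w\<close>.\<close>

lemma bd_bd: "c \<noteq> [] \<Longrightarrow> bd (bd u) c = 0"
proof -
  assume "c \<noteq> []"
  then obtain x d where c: "c = x # d" by (cases c) auto
  let ?n = "length d"
  let ?U = "{y. (x, y) \<in> lt}"
  have 1: "insertions (bd u) (x # d) = - sg ?n (\<Sum>y\<in>?U. E x y (insertions (\<lambda>l. u (y # l)) (x # d)))"
  proof -
    have comm: "insertions (\<lambda>l. E a b (F l)) e = E a b (insertions F e)" for F e a b
      by (induction F e rule: insertions.induct) (simp_all add: E_add E_sg E_sum)
    have "insertions (bd u) (x # d) = insertions (\<lambda>l. insertions u l + - sg ?n (\<Sum>y\<in>?U. E x y (u (y # l)))) (x # d)"
    proof (rule insertions_cong_hd)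
      fix l assume "l \<noteq> []" "hd l = hd (x # d)" "length l = Suc (length (x # d))"
      then obtain e where "l = x # e" "length e = Suc ?n" by (cases l) auto
      then show "bd u l = insertions u l + - sg ?n (\<Sum>y\<in>?U. E x y (u (y # l)))" by (simp add: bd_def)
    qed
    also have "\<dots> = - sg ?n (\<Sum>y\<in>?U. insertions (\<lambda>l. E x y (u (y # l))) (x # d))"
      by (simp only: insertions_add insertions_uminus insertions_sg insertions_sum insertions_insertions add_0_left)
    also have "\<dots> = - sg ?n (\<Sum>y\<in>?U. E x y (insertions (\<lambda>l. u (y # l)) (x # d)))"
      by (simp only: comm)
    finally show ?thesis .
  qed
  have 2: "bd u (y # x # d) = sg ?n (\<Sum>z\<in>{z. (x, z) \<in> lt \<and> (z, y) \<in> lt}. u (y # z # x # d))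
      + insertions (\<lambda>l. u (y # l)) (x # d) - sg ?n (\<Sum>w\<in>{w. (y, w) \<in> lt}. E y w (u (w # y # x # d)))" for y
    by (simp add: bd_def)
  have "(\<Sum>y\<in>?U. \<Sum>z\<in>{z. (x, z) \<in> lt \<and> (z, y) \<in> lt}. E x y (u (y # z # x # d)))
      = (\<Sum>(y, z)\<in>(SIGMA y:?U. {z. (x, z) \<in> lt \<and> (z, y) \<in> lt}). E x y (u (y # z # x # d)))"
    by (simp add: sum.Sigma finite_between)
  also have "\<dots> = (\<Sum>(y, w)\<in>(SIGMA y:?U. {w. (y, w) \<in> lt}). E x w (u (w # y # x # d)))"
    by (rule sum.reindex_bij_witness[where i = "\<lambda>(a, b). (b, a)" and j = "\<lambda>(a, b). (b, a)"])
      (auto intro: lt_trans)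
  also have "\<dots> = (\<Sum>y\<in>?U. \<Sum>w\<in>{w. (y, w) \<in> lt}. E x w (u (w # y # x # d)))"
    by (simp add: sum.Sigma finite_between)
  finally have swap: "(\<Sum>y\<in>?U. \<Sum>z\<in>{z. (x, z) \<in> lt \<and> (z, y) \<in> lt}. E x y (u (y # z # x # d)))
      = (\<Sum>y\<in>?U. \<Sum>w\<in>{w. (y, w) \<in> lt}. E x w (u (w # y # x # d)))" .
  have "(\<Sum>y\<in>?U. E x y (bd u (y # x # d))) = (\<Sum>y\<in>?U. E x y (insertions (\<lambda>l. u (y # l)) (x # d)))"
    unfolding 2 by (simp add: E_add E_diff E_sg E_sum E_E sum.distrib sum_subtractf sg_sum[symmetric] swap)
  then show ?thesis using 1 unfolding c by (simp add: bd_def[of "bd u"])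
qed

lemma bd_induct:
  assumes l: "l \<in> base_chains p n" and u: "\<And>l. l \<in> base_chains p (Suc n) \<Longrightarrow> u l \<in> B (hd l)"
    and B: "\<And>x. 0 \<in> B x" "\<And>a b x. a \<in> B x \<Longrightarrow> b \<in> B x \<Longrightarrow> a - b \<in> B x"
    and BE: "\<And>x y v. \<lbrakk>(p, x) \<in> leq; (x, y) \<in> lt; v \<in> B y\<rbrakk> \<Longrightarrow> E x y v \<in> B x"
  shows "bd u l \<in> B (hd l)"
proof -
  have neg: "- a \<in> B x" if "a \<in> B x" for a x using B that diff_0 by metis
  have add: "a + b \<in> B x" if "a \<in> B x" "b \<in> B x" for a b x using B(2)[OF that(1) neg[OF that(2)]] by simp
  have sum: "sum f Z \<in> B x" if "\<And>z. z \<in> Z \<Longrightarrow> f z \<in> B x" for f and Z :: "'p set" and x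
    using that by (induction Z rule: infinite_finite_induct) (auto simp: B add)
  have px: "(p, hd l) \<in> leq" using l rchain_leq unfolding base_chains_def by blast
  have "insertions u l \<in> B (hd l) \<and> insertions (\<lambda>l. id (u l)) l = id (insertions u l)"
  proof (rule insertions_induct)
    show "rchain l" using l by (simp add: base_chains_def)
    fix k assume "rchain k" "last k = last l" "hd k = hd l" "length k = Suc (length l)"
    then show "u k \<in> B (hd l)" using u[of k] l by (simp add: base_chains_def)
  qed (simp_all add: B)
  moreover have "E (hd l) y (u (y # l)) \<in> B (hd l)" if "(hd l, y) \<in> lt" for y
    using BE[OF px that] u[OF base_chains_Cons[OF l that]] by simp
  then have "sg k (\<Sum>y\<in>{y. (hd l, y) \<in> lt}. E (hd l) y (u (y # l))) \<in> B (hd l)" for k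
    using neg sum[of "{y. (hd l, y) \<in> lt}" "\<lambda>y. E (hd l) y (u (y # l))"] by (auto simp: sg_def)
  ultimately show ?thesis unfolding bd_def using add by blast
qed

lemma bd_cong:
  assumes l: "l \<in> base_chains p n" and u: "\<And>l. l \<in> base_chains p (Suc n) \<Longrightarrow> u l = v l"
  shows "bd u l = bd v l"
proof -
  have "bd (\<lambda>l. u l - v l) l \<in> {0}"
    by (rule bd_induct[OF l, where B = "\<lambda>x. {0}"]) (use u in auto)
  then show ?thesis by (simp add: bd_diff)
qed

text \<open>The coefficients allowed on a chain with top point \<open>x\<close>: a tensor product
  over \<open>R\<close> sees only \<open>e\<^sub>x\<^sub>,\<^sub>x X\<^sub>j\<close> there.\<close>

definition XE :: "nat \<Rightarrow> 'p \<Rightarrow> 'v set" where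
  "XE j x = {v \<in> X j. E x x v = v}"

lemma XE_closed:
  "0 \<in> XE j x" "a \<in> XE j x \<Longrightarrow> b \<in> XE j x \<Longrightarrow> a - b \<in> XE j x"
  "(x, y) \<in> leq \<Longrightarrow> v \<in> X j \<Longrightarrow> E x y v \<in> XE j x"
  by (auto simp: XE_def X_zero X_diff E_diff E_X E_E)

lemma bd_XE:
  assumes "l \<in> base_chains p n" "\<And>l. l \<in> base_chains p (Suc n) \<Longrightarrow> u l \<in> XE j (hd l)"
  shows "bd u l \<in> XE j (hd l)"
proof (rule bd_induct[where B = "XE j", OF assms])
  show "E x y v \<in> XE j x" if "(x, y) \<in> lt" "v \<in> XE j y" for x y v
    using that XE_closed(3) ltD(1) by (auto simp: XE_def[of j y])
qed (simp_all add: XE_closed)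

lemma X_closed: "a \<in> X j \<Longrightarrow> - a \<in> X j" "a \<in> X j \<Longrightarrow> b \<in> X j \<Longrightarrow> a + b \<in> X j"
proof -
  show neg: "a \<in> X j \<Longrightarrow> - a \<in> X j" for a using X_diff[OF X_zero] by simp
  show "a \<in> X j \<Longrightarrow> b \<in> X j \<Longrightarrow> a + b \<in> X j" using X_diff[of a j "- b"] neg by simp
qed

lemma \<tau>_zero: "(x, y) \<in> leq \<Longrightarrow> \<tau> j x y 0 = 0"
  using \<tau>_diff[of x y 0 j 0] X_zero by simp

lemma \<tau>_uminus: "(x, y) \<in> leq \<Longrightarrow> a \<in> X j \<Longrightarrow> \<tau> j x y (- a) = - \<tau> j x y a"
  using \<tau>_diff[of x y 0 j a] X_zero \<tau>_zero by simp

lemma \<tau>_add: "(x, y) \<in> leq \<Longrightarrow> a \<in> X j \<Longrightarrow> b \<in> X j \<Longrightarrow> \<tau> j x y (a + b) = \<tau> j x y a + \<tau> j x y b"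
  using \<tau>_diff[of x y a j "- b"] \<tau>_uminus X_closed by simp

lemma \<tau>_sum:
  assumes "(x, y) \<in> leq" "finite Z" "\<And>z. z \<in> Z \<Longrightarrow> f z \<in> X j"
  shows "sum f Z \<in> X j \<and> \<tau> j x y (sum f Z) = (\<Sum>z\<in>Z. \<tau> j x y (f z))"
  using assms(2,3) by (induction Z rule: finite_induct) (auto simp: assms(1) \<tau>_zero \<tau>_add X_zero X_closed)

text \<open>The contracting homotopy of the bar construction of a projective module.\<close>

definition homotopy :: "nat \<Rightarrow> ('p list \<Rightarrow> 'v) \<Rightarrow> 'p list \<Rightarrow> 'v" where
  "homotopy j u l = \<tau> j (hd (tl l)) (hd l) (u (tl l))"

lemma homotopy_XE:
  assumes "l \<in> base_chains p (Suc (Suc n))" "\<And>l. l \<in> base_chains p (Suc n) \<Longrightarrow> u l \<in> XE j (hd l)"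
  shows "homotopy j u l \<in> XE j (hd l)"
proof -
  obtain x y c where l: "l = x # y # c" using assms(1) by (cases l; cases "tl l") (auto simp: base_chains_def)
  then have "(y, x) \<in> leq" "y # c \<in> base_chains p (Suc n)" using assms(1) ltD(1) by (auto simp: base_chains_def)
  then show ?thesis using assms(2)[of "y # c"] by (simp add: l homotopy_def XE_def \<tau>_X \<tau>_fix)
qed

text \<open>The map \<open>\<tau>\<close> turns the action term into one term for each
  \<open>z\<close> with \<open>y < z \<le> x\<close>. Those with \<open>z < x\<close> are the
  insertions into the top gap; the one with \<open>z = x\<close> completes the sum over
  \<open>w > x\<close> to the decomposition of \<open>u\<close> by
  \<open>\<tau>_split\<close>.\<close>

lemma bd_homotopy:
  assumes l: "x # y # c \<in> base_chains p (Suc n)"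
    and u: "\<And>l. l \<in> base_chains p (Suc n) \<Longrightarrow> u l \<in> XE j (hd l)"
  shows "bd (homotopy j u) (x # y # c) = \<tau> j y x (bd u (y # c)) - sg (length c) (u (x # y # c))"
proof -
  let ?n = "length c"
  have yx: "(y, x) \<in> lt" "(y, x) \<in> leq" and yc: "y # c \<in> base_chains p n" and n: "n = Suc ?n"
    using l ltD(1) by (auto simp: base_chains_def)
  have U: "u (z # y # c) \<in> X j" "E z z (u (z # y # c)) = u (z # y # c)" if "(y, z) \<in> lt" for z
    using u[OF base_chains_Cons[OF yc, of z]] that by (auto simp: XE_def)
  have ins: "insertions (\<lambda>l. homotopy j u (x # l)) (y # c) = \<tau> j y x (insertions u (y # c)) \<and>
      insertions u (y # c) \<in> X j"
  proof -
    have "insertions (\<lambda>l. homotopy j u (x # l)) (y # c) = insertions (\<lambda>l. \<tau> j y x (u l)) (y # c)"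
      by (rule insertions_cong_hd) (simp add: homotopy_def)
    moreover have "insertions u (y # c) \<in> X j \<and> insertions (\<lambda>l. \<tau> j y x (u l)) (y # c) = \<tau> j y x (insertions u (y # c))"
      by (rule insertions_induct)
        (use yc u yx(2) in \<open>auto simp: base_chains_def XE_def X_zero X_diff \<tau>_zero \<tau>_diff\<close>)
    ultimately show ?thesis by simp
  qed
  let ?Y = "{z. (y, z) \<in> lt}" and ?Z = "{z. (y, z) \<in> lt \<and> (z, x) \<in> lt}"
  have EU: "E y z (u (z # y # c)) \<in> X j" if "(y, z) \<in> lt" for z
    using E_X[OF ltD(1)[OF that] U(1)[OF that]] .
  have "\<tau> j y x (\<Sum>z\<in>?Y. E y z (u (z # y # c))) = (\<Sum>z\<in>?Y. \<tau> j y x (E y z (u (z # y # c))))"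
    using \<tau>_sum[OF yx(2) finite_between(2), of y "\<lambda>z. E y z (u (z # y # c))" j] EU by simp
  also have "\<dots> = (\<Sum>z\<in>?Y. if (z, x) \<in> leq then \<tau> j z x (u (z # y # c)) else 0)"
    by (rule sum.cong[OF refl]) (use \<tau>_E U(1) yx(2) ltD(1) in simp)
  also have "\<dots> = (\<Sum>z\<in>insert x ?Z. \<tau> j z x (u (z # y # c)))"
  proof (rule sum.mono_neutral_cong_right)
    show "insert x ?Z \<subseteq> ?Y" using yx by auto
    show "\<forall>z\<in>?Y - insert x ?Z. (if (z, x) \<in> leq then \<tau> j z x (u (z # y # c)) else 0) = 0"
      by (auto simp: lt_def)
    show "(if (z, x) \<in> leq then \<tau> j z x (u (z # y # c)) else 0) = \<tau> j z x (u (z # y # c))"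
      if "z \<in> insert x ?Z" for z using that ltD(1) leq_refl ltD(4)[OF yx(1)] by auto
  qed (rule finite_between)
  also have "\<dots> = \<tau> j x x (u (x # y # c)) + (\<Sum>z\<in>?Z. \<tau> j z x (u (z # y # c)))"
    by (rule sum.insert) (use finite_between lt_irrefl in auto)
  finally have A: "\<tau> j y x (\<Sum>z\<in>?Y. E y z (u (z # y # c)))
      = \<tau> j x x (u (x # y # c)) + (\<Sum>z\<in>?Z. \<tau> j z x (u (z # y # c)))" .
  have xP: "x \<in> P" using ltD(4)[OF yx(1)] .
  have "{w. (x, w) \<in> leq} = insert x {w. (x, w) \<in> lt}" using leq_refl[OF xP] by (auto simp: lt_def)
  then have "u (x # y # c) = (\<Sum>w\<in>insert x {w. (x, w) \<in> lt}. E x w (\<tau> j x w (u (x # y # c))))"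
    using \<tau>_split[OF xP U[OF yx(1)]] by simp
  also have "\<dots> = \<tau> j x x (u (x # y # c)) + (\<Sum>w\<in>{w. (x, w) \<in> lt}. E x w (\<tau> j x w (u (x # y # c))))"
    by (subst sum.insert) (use finite_between lt_irrefl \<tau>_fix[OF leq_refl[OF xP] U(1)[OF yx(1)]] in auto)
  finally have C: "(\<Sum>w\<in>{w. (x, w) \<in> lt}. E x w (\<tau> j x w (u (x # y # c))))
      = u (x # y # c) - \<tau> j x x (u (x # y # c))" by (simp add: algebra_simps)
  have sgX: "sg ?n (\<Sum>z\<in>?Y. E y z (u (z # y # c))) \<in> X j"
    "\<tau> j y x (sg ?n (\<Sum>z\<in>?Y. E y z (u (z # y # c)))) = sg ?n (\<tau> j y x (\<Sum>z\<in>?Y. E y z (u (z # y # c))))"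
    using \<tau>_sum[OF yx(2) finite_between(2), of y "\<lambda>z. E y z (u (z # y # c))" j] EU X_closed \<tau>_uminus[OF yx(2)]
    by (auto simp: sg_def)
  have "\<tau> j y x (bd u (y # c)) = \<tau> j y x (insertions u (y # c))
      + sg ?n (\<tau> j x x (u (x # y # c)) + (\<Sum>z\<in>?Z. \<tau> j z x (u (z # y # c))))"
    unfolding bd_def using \<tau>_add[OF yx(2) conjunct2[OF ins] sgX(1)] sgX(2) A by simp
  moreover have "bd (homotopy j u) (x # y # c) = sg ?n (\<Sum>z\<in>?Z. \<tau> j z x (u (z # y # c)))
      + \<tau> j y x (insertions u (y # c)) - sg ?n (u (x # y # c) - \<tau> j x x (u (x # y # c)))"
    using ins C by (simp add: bd_def) (simp add: homotopy_def)
  ultimately show ?thesis by (simp add: algebra_simps)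
qed

lemma bar_exact:
  assumes u: "\<And>l. l \<in> base_chains p (Suc (Suc n)) \<Longrightarrow> u l \<in> XE j (hd l)"
    and cyc: "\<And>l. l \<in> base_chains p (Suc n) \<Longrightarrow> bd u l = 0"
  shows "\<exists>w. (\<forall>l\<in>base_chains p (Suc (Suc (Suc n))). w l \<in> XE j (hd l)) \<and>
    (\<forall>l\<in>base_chains p (Suc (Suc n)). u l = bd w l)"
proof (intro exI conjI ballI)
  \<comment> \<open>The sign undoes the one in \<open>bd_homotopy\<close>, where \<open>n\<close>
    points lie below the two top ones and the last term carries an additional minus.\<close>
  let ?w = "\<lambda>l. sg (Suc n) (homotopy j u l)"
  fix l assume "l \<in> base_chains p (Suc (Suc (Suc n)))"
  then have "homotopy j u l \<in> XE j (hd l)" using homotopy_XE u by blast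
  then show "?w l \<in> XE j (hd l)" using XE_closed(1,2) diff_0 by (metis sg_def)
next
  fix l assume l: "l \<in> base_chains p (Suc (Suc n))"
  then obtain x y c where c: "l = x # y # c" by (cases l; cases "tl l") (auto simp: base_chains_def)
  then have yc: "y # c \<in> base_chains p (Suc n)" "length c = n" "(y, x) \<in> leq"
    using l ltD(1) by (auto simp: base_chains_def)
  then show "u l = bd (\<lambda>l. sg (Suc n) (homotopy j u l)) l"
    using bd_homotopy[OF l[unfolded c] u] cyc[OF yc(1)] \<tau>_zero by (simp add: bd_sg c del: sg_simps(1)) simp
qed

text \<open>The part of internal degree \<open>m\<close>: a chain from \<open>p\<close> to
  \<open>x\<close> contributes \<open>il p x\<close>, and the coefficient carries the rest. If
  nothing is left, the truncated difference would give a wrong degree, so the coefficient is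
  required to be 0.\<close>

definition GX :: "'p \<Rightarrow> nat \<Rightarrow> nat \<Rightarrow> 'p \<Rightarrow> 'v set" where
  "GX p m j x = {v \<in> X j. E x x v = v \<and> (if il p x \<le> m then v \<in> Gr j (m - il p x) else v = 0)}"

lemma bd_GX:
  assumes "l \<in> base_chains p n" "\<And>l. l \<in> base_chains p (Suc n) \<Longrightarrow> u l \<in> GX p m j (hd l)"
  shows "bd u l \<in> GX p m j (hd l)"
proof (rule bd_induct[where B = "GX p m j", OF assms])
  show "0 \<in> GX p m j x" for x by (simp add: GX_def X_zero Gr_zero)
  show "a - b \<in> GX p m j x" if "a \<in> GX p m j x" "b \<in> GX p m j x" for a b x
    using that by (auto simp: GX_def X_diff Gr_diff E_diff split: if_splits)
  fix x y v assume *: "(p, x) \<in> leq" "(x, y) \<in> lt" "v \<in> GX p m j y"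
  have xy: "(x, y) \<in> leq" using *(2) ltD by blast
  have il: "il p y = il p x + il x y" using il_add[OF *(1) xy] .
  have v: "E x y v \<in> X j" "E x x (E x y v) = E x y v" using * xy by (auto simp: GX_def E_X E_E)
  show "E x y v \<in> GX p m j x"
  proof (cases "il p y \<le> m")
    case True
    then have "v \<in> Gr j (m - il p y)" using *(3) by (simp add: GX_def)
    then have "E x y v \<in> Gr j (il x y + (m - il p y))" using E_Gr[OF xy] by blast
    moreover have "il x y + (m - il p y) = m - il p x" using il True by simp
    ultimately show ?thesis using v True il by (simp add: GX_def)
  next
    case False
    then have "v = 0" using *(3) by (simp add: GX_def)
    then show ?thesis by (simp add: GX_def X_zero Gr_zero)
  qed
qed

lemma GX_lift:
  assumes "x \<in> P" "v \<in> GX p m j x" "v \<in> \<delta> j ` X (Suc j)"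
  shows "\<exists>w\<in>GX p m (Suc j) x. \<delta> j w = v"
proof (cases "il p x \<le> m")
  case True
  then obtain w where "w \<in> Gr (Suc j) (m - il p x)" "E x x w = w" "\<delta> j w = v"
    using lift[OF assms(1) _ _ assms(3)] assms(2) by (auto simp: GX_def)
  then show ?thesis using True Gr_X by (auto simp: GX_def)
next
  case False
  then have "v = 0" using assms(2) by (simp add: GX_def)
  then show ?thesis
    using \<delta>_diff[of 0 j 0] by (intro bexI[of _ 0]) (simp_all add: GX_def X_zero Gr_zero)
qed

lemma bd_\<delta>:
  assumes l: "l \<in> base_chains p n" and u: "\<And>l. l \<in> base_chains p (Suc n) \<Longrightarrow> u l \<in> X (Suc j)"
  shows "bd (\<lambda>l. \<delta> j (u l)) l = \<delta> j (bd u l)"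
proof -
  have \<delta>0: "\<delta> j 0 = 0" using \<delta>_diff[of 0 j 0] X_zero by simp
  have \<delta>u: "\<delta> j (- a) = - \<delta> j a" if "a \<in> X (Suc j)" for a using \<delta>_diff[of 0 j a] X_zero \<delta>0 that by simp
  have \<delta>a: "\<delta> j (a + b) = \<delta> j a + \<delta> j b" if "a \<in> X (Suc j)" "b \<in> X (Suc j)" for a b
    using \<delta>_diff[of a j "- b"] \<delta>u X_closed that by simp
  have 1: "insertions u l \<in> X (Suc j) \<and> insertions (\<lambda>l. \<delta> j (u l)) l = \<delta> j (insertions u l)"
    by (rule insertions_induct) (use l u in \<open>auto simp: base_chains_def X_zero X_diff \<delta>0 \<delta>_diff\<close>)
  let ?f = "\<lambda>y. E (hd l) y (u (y # l))"
  let ?U = "{y. (hd l, y) \<in> lt}"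
  have f: "?f y \<in> X (Suc j)" "\<delta> j (?f y) = E (hd l) y (\<delta> j (u (y # l)))" if "(hd l, y) \<in> lt" for y
    using ltD(1)[OF that] u[OF base_chains_Cons[OF l that]] by (auto simp: E_X \<delta>_E)
  have "sum ?f Z \<in> X (Suc j) \<and> \<delta> j (sum ?f Z) = (\<Sum>y\<in>Z. E (hd l) y (\<delta> j (u (y # l))))"
    if "finite Z" "Z \<subseteq> ?U" for Z
    using that by (induction Z rule: finite_induct) (auto simp: X_zero \<delta>0 X_closed \<delta>a f)
  then have 2: "sum ?f ?U \<in> X (Suc j)" "\<delta> j (sum ?f ?U) = (\<Sum>y\<in>?U. E (hd l) y (\<delta> j (u (y # l))))"
    using finite_between by auto
  then have 3: "sg k (sum ?f ?U) \<in> X (Suc j)" "\<delta> j (sg k (sum ?f ?U)) = sg k (\<delta> j (sum ?f ?U))" for k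
    by (auto simp: sg_def X_closed \<delta>u)
  show ?thesis unfolding bd_def using 1 3 2(2) \<delta>a by simp
qed

text \<open>A zigzag through the double complex along which \<open>i + j\<close> is constant:
  \<open>bd u\<close> is lifted along \<open>\<delta>\<close> within its degree, the lift is treated
  by induction, and the correction so obtained turns \<open>u\<close> into a cycle of its row, which
  bounds by \<open>bar_exact\<close>. At \<open>i = 0\<close> the coefficient has degree
  \<open>m \<noteq> j\<close> and lies in the radical.\<close>

lemma chase:
  assumes "p \<in> P" "i + j \<noteq> m"
    and "\<And>l. l \<in> base_chains p (Suc i) \<Longrightarrow> u l \<in> GX p m j (hd l)"
    and "\<And>l. l \<in> base_chains p i \<Longrightarrow> bd u l \<in> \<delta> j ` X (Suc j)"
  shows "\<exists>y. (\<forall>l\<in>base_chains p (Suc (Suc i)). y l \<in> XE j (hd l)) \<and>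
    (\<forall>l\<in>base_chains p (Suc i). u l - bd y l \<in> \<delta> j ` X (Suc j))"
  using assms(2-)
proof (induction i arbitrary: j u)
  case 0
  have p: "[p] \<in> base_chains p (Suc 0)" using assms(1) by (simp add: base_chains_def)
  have single: "l = [p]" if "l \<in> base_chains p (Suc 0)" for l
    using that by (cases l) (auto simp: base_chains_def)
  have "u [p] \<in> Gr j m" "E p p (u [p]) = u [p]"
    using 0(2)[OF p] il_refl[OF assms(1)] by (auto simp: GX_def)
  \<comment> \<open>An element outside of the generating degree is a combination of proper multiples
    \<open>E p y (f y)\<close>; this combination is the \<open>bd\<close> of a function on one-step
    chains.\<close>
  then obtain f where f: "\<And>y. (p, y) \<in> lt \<Longrightarrow> f y \<in> X j \<and> E y y (f y) = f y"
    and up: "u [p] = (\<Sum>y\<in>{y. (p, y) \<in> lt}. E p y (f y))"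
    using gen[OF assms(1), of "u [p]" j m] 0(1) by auto
  have "\<delta> j 0 = 0" using \<delta>_diff[of 0 j 0] X_zero by simp
  then have K0: "0 \<in> \<delta> j ` X (Suc j)" using X_zero by (metis image_eqI)
  show ?case
  proof (intro exI[of _ "\<lambda>l. f (hd l)"] conjI ballI)
    fix l assume l: "l \<in> base_chains p (Suc (Suc 0))"
    then obtain x y where "l = [x, y]" by (cases l; cases "tl l") (auto simp: base_chains_def)
    then show "f (hd l) \<in> XE j (hd l)" using l f by (auto simp: base_chains_def XE_def)
  next
    fix l assume "l \<in> base_chains p (Suc 0)"
    then have "l = [p]" by (rule single)
    then show "u l - bd (\<lambda>l. f (hd l)) l \<in> \<delta> j ` X (Suc j)"
      using K0 by (simp add: bd_def up)
  qed
next
  case (Suc i)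
  have "\<exists>w\<in>GX p m (Suc j) (hd l). \<delta> j w = bd u l" if l: "l \<in> base_chains p (Suc i)" for l
    using GX_lift[OF _ bd_GX[OF l Suc(3)] Suc(4)[OF l]] rchain_hd l unfolding base_chains_def by blast
  then obtain w where w: "\<And>l. l \<in> base_chains p (Suc i) \<Longrightarrow> w l \<in> GX p m (Suc j) (hd l)"
    "\<And>l. l \<in> base_chains p (Suc i) \<Longrightarrow> \<delta> j (w l) = bd u l" by metis
  have wX: "w l \<in> X (Suc j)" if "l \<in> base_chains p (Suc i)" for l using w(1)[OF that] by (simp add: GX_def)
  have "bd w l \<in> \<delta> (Suc j) ` X (Suc (Suc j))" if l: "l \<in> base_chains p i" for l
  proof (rule exact)
    show "bd w l \<in> X (Suc j)" using bd_GX[OF l w(1)] by (simp add: GX_def)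
    have "\<delta> j (bd w l) = bd (bd u) l"
      using bd_\<delta>[OF l wX] bd_cong[OF l w(2)] by simp
    also have "\<dots> = 0" using bd_bd[of l u] l by (cases l) (auto simp: base_chains_def)
    finally show "\<delta> j (bd w l) = 0" .
  qed
  then have "\<exists>y. (\<forall>l\<in>base_chains p (Suc (Suc i)). y l \<in> XE (Suc j) (hd l)) \<and>
    (\<forall>l\<in>base_chains p (Suc i). w l - bd y l \<in> \<delta> (Suc j) ` X (Suc (Suc j)))"
    using Suc(2) w(1) by (intro Suc.IH) auto
  then obtain y where y: "\<And>l. l \<in> base_chains p (Suc (Suc i)) \<Longrightarrow> y l \<in> XE (Suc j) (hd l)"
    "\<And>l. l \<in> base_chains p (Suc i) \<Longrightarrow> w l - bd y l \<in> \<delta> (Suc j) ` X (Suc (Suc j))"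
    by blast
  have yX: "y l \<in> X (Suc j)" if "l \<in> base_chains p (Suc (Suc i))" for l using y(1)[OF that] by (simp add: XE_def)
  \<comment> \<open>\<open>w\<close> and \<open>bd y\<close> differ by an element of the image of
    the next \<open>\<delta>\<close>. Applying \<open>\<delta> j\<close> removes the difference, so
    that \<open>u\<close> and the correction by \<open>\<delta> j (y l)\<close> have the same
    boundary.\<close>
  have bdu: "bd u l = bd (\<lambda>l. \<delta> j (y l)) l" if l: "l \<in> base_chains p (Suc i)" for l
  proof -
    have "\<delta> j (w l - bd y l) = 0" using y(2)[OF l] \<delta>_\<delta> by auto
    moreover have "bd y l \<in> X (Suc j)" using bd_XE[OF l y(1)] by (simp add: XE_def)
    ultimately show ?thesis using \<delta>_diff[OF wX[OF l]] w(2)[OF l] bd_\<delta>[OF l yX] by simp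
  qed
  have "\<exists>w. (\<forall>l\<in>base_chains p (Suc (Suc (Suc i))). w l \<in> XE j (hd l)) \<and>
    (\<forall>l\<in>base_chains p (Suc (Suc i)). u l - \<delta> j (y l) = bd w l)"
  proof (rule bar_exact)
    fix l assume l: "l \<in> base_chains p (Suc (Suc i))"
    have "(hd l, hd l) \<in> leq" using l rchain_hd leq_refl by (auto simp: base_chains_def)
    then have "\<delta> j (y l) \<in> XE j (hd l)"
      using y(1)[OF l] \<delta>_E[of "hd l" "hd l" "y l" j] \<delta>_X by (auto simp: XE_def)
    moreover have "u l \<in> XE j (hd l)" using Suc(3)[OF l] by (simp add: GX_def XE_def)
    ultimately show "u l - \<delta> j (y l) \<in> XE j (hd l)" using XE_closed by blast
  next
    fix l assume "l \<in> base_chains p (Suc i)"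
    then show "bd (\<lambda>l. u l - \<delta> j (y l)) l = 0" using bdu by (simp add: bd_diff)
  qed
  then obtain v where v: "\<And>l. l \<in> base_chains p (Suc (Suc (Suc i))) \<Longrightarrow> v l \<in> XE j (hd l)"
    "\<And>l. l \<in> base_chains p (Suc (Suc i)) \<Longrightarrow> u l - \<delta> j (y l) = bd v l" by blast
  show ?case
  proof (intro exI[of _ v] conjI ballI)
    fix l assume l: "l \<in> base_chains p (Suc (Suc i))"
    then have "u l - bd v l = \<delta> j (y l)" using v(2)[OF l] by (simp add: algebra_simps)
    then show "u l - bd v l \<in> \<delta> j ` X (Suc j)" using yX[OF l] by blast
  qed (use v in blast)
qed

end


section \<open>Free and projective modules\<close>

lemma left_moduleD:
  assumes "left_module A M"
  shows "ring A" "abelian_group M"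
  using assms by (auto simp: left_module_def)

text \<open>Record extensions have different types; this permits replacing a module with further
  fields by the plain module underneath.\<close>

lemma left_module_transfer:
  assumes "left_module A M" "carrier N = carrier M" "add N = add M" "zero N = zero M" "smult N = smult M"
  shows "left_module A N"
proof -
  interpret left_module A M by fact
  have "abelian_group N"
  proof (rule abelian_groupI)
    show "\<exists>y\<in>carrier N. y \<oplus>\<^bsub>N\<^esub> x = \<zero>\<^bsub>N\<^esub>" if "x \<in> carrier N" for x
      using that assms(2-) by (intro bexI[of _ "\<ominus>\<^bsub>M\<^esub> x"]) (simp_all add: M.l_neg)
  qed (use assms(2-) in \<open>simp_all add: M.a_ac\<close>)
  moreover have "ring A" using left_moduleD(1)[OF assms(1)] .
  ultimately show ?thesis
    unfolding left_module_def left_module_axioms_def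
    using smult_closed smult_l_distr smult_r_distr smult_assoc smult_one assms(2-) by simp
qed

context left_module begin

lemma smult_zero: "a \<in> carrier A \<Longrightarrow> a \<odot>\<^bsub>M\<^esub> \<zero>\<^bsub>M\<^esub> = \<zero>\<^bsub>M\<^esub>"
  using smult_r_distr[of a "\<zero>\<^bsub>M\<^esub>" "\<zero>\<^bsub>M\<^esub>"] smult_closed[of a "\<zero>\<^bsub>M\<^esub>"]
  by (metis M.add.l_cancel_one M.zero_closed M.l_zero)

lemma zero_smult: "x \<in> carrier M \<Longrightarrow> \<zero>\<^bsub>A\<^esub> \<odot>\<^bsub>M\<^esub> x = \<zero>\<^bsub>M\<^esub>"
  using smult_l_distr[of "\<zero>\<^bsub>A\<^esub>" "\<zero>\<^bsub>A\<^esub>" x] smult_closed[of "\<zero>\<^bsub>A\<^esub>" x]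
  by (metis M.add.l_cancel_one A.zero_closed A.l_zero)

lemma smult_finsum:
  assumes "finite B" "a \<in> carrier A" "f \<in> B \<rightarrow> carrier M"
  shows "a \<odot>\<^bsub>M\<^esub> finsum M f B = finsum M (\<lambda>b. a \<odot>\<^bsub>M\<^esub> f b) B"
  using assms
proof (induction B rule: finite_induct)
  case (insert b B)
  then have "f b \<in> carrier M" "f \<in> B \<rightarrow> carrier M" by auto
  then show ?case using insert by (simp add: M.finsum_insert smult_r_distr smult_closed Pi_def)
qed (simp add: smult_zero)

end

definition free_module :: "('a, 'w) ring_scheme \<Rightarrow> 'm set \<Rightarrow> ('a, 'm \<Rightarrow> 'a) module" where
  "free_module A B =
    \<lparr>carrier = {F. finite {b. F b \<noteq> \<zero>\<^bsub>A\<^esub>} \<and> (\<forall>b. F b \<in> carrier A) \<and> (\<forall>b. b \<notin> B \<longrightarrow> F b = \<zero>\<^bsub>A\<^esub>)},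
     mult = (\<lambda>F G. F), one = (\<lambda>b. \<zero>\<^bsub>A\<^esub>), zero = (\<lambda>b. \<zero>\<^bsub>A\<^esub>),
     add = (\<lambda>F G b. F b \<oplus>\<^bsub>A\<^esub> G b), smult = (\<lambda>a F b. a \<otimes>\<^bsub>A\<^esub> F b)\<rparr>"

lemma free_module_sel:
  "carrier (free_module A B) =
    {F. finite {b. F b \<noteq> \<zero>\<^bsub>A\<^esub>} \<and> (\<forall>b. F b \<in> carrier A) \<and> (\<forall>b. b \<notin> B \<longrightarrow> F b = \<zero>\<^bsub>A\<^esub>)}"
  "\<zero>\<^bsub>free_module A B\<^esub> = (\<lambda>b. \<zero>\<^bsub>A\<^esub>)"
  "F \<oplus>\<^bsub>free_module A B\<^esub> G = (\<lambda>b. F b \<oplus>\<^bsub>A\<^esub> G b)"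
  "a \<odot>\<^bsub>free_module A B\<^esub> F = (\<lambda>b. a \<otimes>\<^bsub>A\<^esub> F b)"
  by (simp_all add: free_module_def)

lemma free_module_left_module:
  assumes "ring A"
  shows "left_module A (free_module A B)"
proof -
  interpret A: ring A by fact
  let ?N = "free_module A B"
  have add_closed: "F \<oplus>\<^bsub>?N\<^esub> G \<in> carrier ?N" if "F \<in> carrier ?N" "G \<in> carrier ?N" for F G
  proof -
    have "finite ({b. F b \<noteq> \<zero>\<^bsub>A\<^esub>} \<union> {b. G b \<noteq> \<zero>\<^bsub>A\<^esub>})" using that by (simp add: free_module_sel)
    then have "finite {b. F b \<oplus>\<^bsub>A\<^esub> G b \<noteq> \<zero>\<^bsub>A\<^esub>}"
      by (rule rev_finite_subset) auto
    then show ?thesis using that by (simp add: free_module_sel)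
  qed
  have smult_closed: "a \<odot>\<^bsub>?N\<^esub> F \<in> carrier ?N" if "F \<in> carrier ?N" "a \<in> carrier A" for F a
  proof -
    have "finite {b. F b \<noteq> \<zero>\<^bsub>A\<^esub>}" using that by (simp add: free_module_sel)
    then have "finite {b. a \<otimes>\<^bsub>A\<^esub> F b \<noteq> \<zero>\<^bsub>A\<^esub>}"
      by (rule rev_finite_subset) (use that in auto)
    then show ?thesis using that by (simp add: free_module_sel)
  qed
  have "abelian_group ?N"
  proof (rule abelian_groupI)
    fix F assume F: "F \<in> carrier ?N"
    have "{b. \<ominus>\<^bsub>A\<^esub> F b \<noteq> \<zero>\<^bsub>A\<^esub>} \<subseteq> {b. F b \<noteq> \<zero>\<^bsub>A\<^esub>}" by auto
    then have "(\<lambda>b. \<ominus>\<^bsub>A\<^esub> F b) \<in> carrier ?N"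
      using F by (auto simp: free_module_sel intro: finite_subset)
    then show "\<exists>G\<in>carrier ?N. G \<oplus>\<^bsub>?N\<^esub> F = \<zero>\<^bsub>?N\<^esub>"
      using F by (intro bexI[of _ "\<lambda>b. \<ominus>\<^bsub>A\<^esub> F b"]) (auto simp: free_module_sel A.l_neg)
  next
    fix F G assume "F \<in> carrier ?N" "G \<in> carrier ?N"
    then show "F \<oplus>\<^bsub>?N\<^esub> G = G \<oplus>\<^bsub>?N\<^esub> F"
      by (simp add: free_module_sel A.a_comm)
  qed (use add_closed in \<open>auto simp: free_module_sel A.a_assoc\<close>)
  then show ?thesis
    unfolding left_module_def left_module_axioms_def
    using assms smult_closed
    by (auto simp: free_module_sel A.l_distr A.r_distr A.m_assoc fun_eq_iff)
qed

text \<open>The canonical surjection onto \<open>M\<close> from the free module on all elements of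
  \<open>M\<close>. Its source has the type that \<open>projective_left_module\<close> tests
  against.\<close>

definition free_eval :: "('a, 'w) ring_scheme \<Rightarrow> ('a, 'm, 'x) module_scheme \<Rightarrow> ('m \<Rightarrow> 'a) \<Rightarrow> 'm" where
  "free_eval A M F = finsum M (\<lambda>b. F b \<odot>\<^bsub>M\<^esub> b) {b. F b \<noteq> \<zero>\<^bsub>A\<^esub>}"

context left_module begin

lemma free_eval_superset:
  assumes F: "F \<in> carrier (free_module A (carrier M))" and B: "finite B" "{b. F b \<noteq> \<zero>\<^bsub>A\<^esub>} \<subseteq> B" "B \<subseteq> carrier M"
  shows "free_eval A M F = finsum M (\<lambda>b. F b \<odot>\<^bsub>M\<^esub> b) B"
  unfolding free_eval_def
proof (rule M.add.finprod_mono_neutral_cong_left)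
  fix b assume "b \<in> B - {b. F b \<noteq> \<zero>\<^bsub>A\<^esub>}"
  then show "F b \<odot>\<^bsub>M\<^esub> b = \<zero>\<^bsub>M\<^esub>" using B zero_smult by auto
qed (use F B in \<open>auto simp: free_module_sel smult_closed\<close>)

lemma free_eval_hom: "free_eval A M \<in> left_module_hom A (free_module A (carrier M)) M"
  unfolding left_module_hom_def
proof (intro CollectI conjI ballI funcsetI)
  let ?N = "free_module A (carrier M)"
  interpret N: left_module A ?N using free_module_left_module[OF A.ring_axioms] .
  fix F assume F: "F \<in> carrier ?N"
  have supp: "{b. F b \<noteq> \<zero>\<^bsub>A\<^esub>} \<subseteq> carrier M" "finite {b. F b \<noteq> \<zero>\<^bsub>A\<^esub>}" if "F \<in> carrier ?N" for F
    using that by (auto simp: free_module_sel)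
  show "free_eval A M F \<in> carrier M"
    unfolding free_eval_def using F supp(1)[OF F]
    by (intro M.finsum_closed) (auto simp: free_module_sel intro!: smult_closed)
  {
    fix G assume G: "G \<in> carrier ?N"
    let ?B = "{b. F b \<noteq> \<zero>\<^bsub>A\<^esub>} \<union> {b. G b \<noteq> \<zero>\<^bsub>A\<^esub>}"
    have B: "finite ?B" "?B \<subseteq> carrier M" using supp F G by auto
    have FG: "F \<oplus>\<^bsub>?N\<^esub> G \<in> carrier ?N" using F G N.M.a_closed by blast
    have "free_eval A M (F \<oplus>\<^bsub>?N\<^esub> G) = finsum M (\<lambda>b. (F \<oplus>\<^bsub>?N\<^esub> G) b \<odot>\<^bsub>M\<^esub> b) ?B"
      by (rule free_eval_superset[OF FG B(1) _ B(2)]) (auto simp: free_module_sel)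
    also have "\<dots> = finsum M (\<lambda>b. F b \<odot>\<^bsub>M\<^esub> b \<oplus>\<^bsub>M\<^esub> G b \<odot>\<^bsub>M\<^esub> b) ?B"
      by (rule M.finsum_cong') (use F G B in \<open>auto simp: free_module_sel smult_l_distr smult_closed\<close>)
    also have "\<dots> = finsum M (\<lambda>b. F b \<odot>\<^bsub>M\<^esub> b) ?B \<oplus>\<^bsub>M\<^esub> finsum M (\<lambda>b. G b \<odot>\<^bsub>M\<^esub> b) ?B"
      by (rule M.finsum_addf) (use F G B in \<open>auto simp: free_module_sel smult_closed\<close>)
    also have "\<dots> = free_eval A M F \<oplus>\<^bsub>M\<^esub> free_eval A M G"
      using free_eval_superset[OF F B(1) _ B(2)] free_eval_superset[OF G B(1) _ B(2)] by simp
    finally show "free_eval A M (F \<oplus>\<^bsub>?N\<^esub> G) = free_eval A M F \<oplus>\<^bsub>M\<^esub> free_eval A M G" .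
  }
  fix a F assume a: "a \<in> carrier A" and F: "F \<in> carrier ?N"
  have aF: "a \<odot>\<^bsub>?N\<^esub> F \<in> carrier ?N" using a F N.smult_closed by blast
  have "free_eval A M (a \<odot>\<^bsub>?N\<^esub> F) = finsum M (\<lambda>b. (a \<odot>\<^bsub>?N\<^esub> F) b \<odot>\<^bsub>M\<^esub> b) {b. F b \<noteq> \<zero>\<^bsub>A\<^esub>}"
    by (rule free_eval_superset[OF aF supp(2)[OF F] _ supp(1)[OF F]]) (use a in \<open>auto simp: free_module_sel\<close>)
  also have "\<dots> = finsum M (\<lambda>b. a \<odot>\<^bsub>M\<^esub> (F b \<odot>\<^bsub>M\<^esub> b)) {b. F b \<noteq> \<zero>\<^bsub>A\<^esub>}"
    by (rule M.finsum_cong') (use F a supp(1)[OF F] in \<open>auto simp: free_module_sel smult_assoc smult_closed\<close>)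
  also have "\<dots> = a \<odot>\<^bsub>M\<^esub> free_eval A M F"
    unfolding free_eval_def
    by (rule smult_finsum[symmetric]) (use F a supp[OF F] in \<open>auto simp: free_module_sel smult_closed\<close>)
  finally show "free_eval A M (a \<odot>\<^bsub>?N\<^esub> F) = a \<odot>\<^bsub>M\<^esub> free_eval A M F" .
qed

lemma free_eval_surj: "free_eval A M ` carrier (free_module A (carrier M)) = carrier M"
proof (intro equalityI subsetI)
  fix x assume "x \<in> free_eval A M ` carrier (free_module A (carrier M))"
  then show "x \<in> carrier M" using free_eval_hom by (auto simp: left_module_hom_def)
next
  fix x assume x: "x \<in> carrier M"
  let ?F = "\<lambda>b. if b = x then \<one>\<^bsub>A\<^esub> else \<zero>\<^bsub>A\<^esub>"
  have F: "?F \<in> carrier (free_module A (carrier M))" using x by (auto simp: free_module_sel)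
  have "free_eval A M ?F = finsum M (\<lambda>b. ?F b \<odot>\<^bsub>M\<^esub> b) {x}"
    by (rule free_eval_superset[OF F]) (use x in auto)
  also have "\<dots> = x" using x by (simp add: smult_one)
  finally show "x \<in> free_eval A M ` carrier (free_module A (carrier M))" using F by (metis image_eqI)
qed

end

lemma projective_splitting:
  assumes "projective_left_module A M"
  obtains g where "g \<in> left_module_hom A M (free_module A (carrier M))"
    "\<And>x. x \<in> carrier M \<Longrightarrow> free_eval A M (g x) = x"
proof -
  have M: "left_module A M" using assms by (simp add: projective_left_module_def)
  interpret left_module A M by fact
  \<comment> \<open>\<open>M\<close> may carry further record fields, whereas the definition of
    projectivity speaks of targets of the plain type.\<close>
  let ?M = "\<lparr>carrier = carrier M, mult = mult M, one = one M, zero = zero M, add = add M, smult = smult M\<rparr>"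
  have "left_module A ?M" by (rule left_module_transfer[OF M]) simp_all
  moreover have "free_eval A M \<in> left_module_hom A (free_module A (carrier M)) ?M"
    using free_eval_hom by (simp add: left_module_hom_def)
  moreover have "id \<in> left_module_hom A M ?M" by (simp add: left_module_hom_def)
  ultimately have "\<exists>g\<in>left_module_hom A M (free_module A (carrier M)). \<forall>x\<in>carrier M. free_eval A M (g x) = id x"
    using assms free_eval_surj free_module_left_module[OF A.ring_axioms, of "carrier M"]
    unfolding projective_left_module_def by (metis partial_object.select_convs(1))
  then show thesis using that by auto
qed

text \<open>A homogeneous decomposition is summed over its exact support; here both families may be
  summed over any common finite set of degrees.\<close>

lemma internal_direct_sum_unique:
  assumes M: "abelian_group M" and ds: "internal_direct_sum M G"
    and B: "finite B" and c: "\<And>n. c n \<in> G n" "\<And>n. n \<notin> B \<Longrightarrow> c n = \<zero>\<^bsub>M\<^esub>"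
    and c': "\<And>n. c' n \<in> G n" "\<And>n. n \<notin> B \<Longrightarrow> c' n = \<zero>\<^bsub>M\<^esub>"
    and eq: "finsum M c B = finsum M c' B"
  shows "c = c'"
proof -
  interpret abelian_group M by fact
  have G: "G n \<subseteq> carrier M" for n
    using ds subgroup.subset by (fastforce simp: internal_direct_sum_def)
  have dec: "homogeneous_decomposition M G (finsum M c B) c"
    if c: "\<And>n. c n \<in> G n" "\<And>n. n \<notin> B \<Longrightarrow> c n = \<zero>\<^bsub>M\<^esub>" for c
  proof -
    have sub: "{n. c n \<noteq> \<zero>\<^bsub>M\<^esub>} \<subseteq> B" using c(2) by blast
    have "finsum M c {n. c n \<noteq> \<zero>\<^bsub>M\<^esub>} = finsum M c B"
      by (rule add.finprod_mono_neutral_cong_left) (use B sub c(1) G in auto)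
    then show ?thesis using c(1) finite_subset[OF sub B] by (simp add: homogeneous_decomposition_def)
  qed
  have "finsum M c B \<in> carrier M" using c(1) G by (intro finsum_closed) auto
  then have "\<exists>!d. homogeneous_decomposition M G (finsum M c B) d"
    using ds by (simp add: internal_direct_sum_def)
  then show ?thesis using dec[of c] dec[of c'] c c' eq by metis
qed

lemma internal_direct_sum_decompose:
  assumes "internal_direct_sum M G" "x \<in> carrier M"
  obtains c where "\<And>n. c n \<in> G n" "finite {n. c n \<noteq> \<zero>\<^bsub>M\<^esub>}" "x = finsum M c {n. c n \<noteq> \<zero>\<^bsub>M\<^esub>}"
  using assms unfolding internal_direct_sum_def homogeneous_decomposition_def by metis


section \<open>Koszul resolutions of the incidence ring\<close>

text \<open>An additive map into a type of class \<open>ab_group_add\<close> translates sums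
  relative to a carrier into ordinary sums.\<close>

lemma finsum_additive:
  fixes h :: "'m \<Rightarrow> 'v::ab_group_add"
  assumes "abelian_group M" "finite B" "\<And>b. b \<in> B \<Longrightarrow> c b \<in> carrier M"
    and h: "\<And>u v. u \<in> carrier M \<Longrightarrow> v \<in> carrier M \<Longrightarrow> h (u \<oplus>\<^bsub>M\<^esub> v) = h u + h v"
  shows "h (finsum M c B) = (\<Sum>b\<in>B. h (c b))"
proof -
  interpret abelian_group M by fact
  have h0: "h \<zero>\<^bsub>M\<^esub> = 0" using h[of "\<zero>\<^bsub>M\<^esub>" "\<zero>\<^bsub>M\<^esub>"] by simp
  show ?thesis
    using assms(2,3)
  proof (induction B rule: finite_induct)
    case (insert b B)
    then have "finsum M c (insert b B) = c b \<oplus>\<^bsub>M\<^esub> finsum M c B" "finsum M c B \<in> carrier M"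
      by (auto intro!: finsum_insert finsum_closed)
    then show ?case using insert h by simp
  qed (simp add: h0)
qed

lemma incidence_ring_sel:
  "carrier (incidence_ring P leq) = {f. \<forall>x y. (x, y) \<notin> leq \<longrightarrow> f x y = 0}"
  "f \<otimes>\<^bsub>incidence_ring P leq\<^esub> g = (\<lambda>x y. \<Sum>z\<in>P. f x z * g z y)"
  "\<one>\<^bsub>incidence_ring P leq\<^esub> = (\<lambda>x y. if x \<in> P \<and> x = y then 1 else 0)"
  "\<zero>\<^bsub>incidence_ring P leq\<^esub> = (\<lambda>x y. 0)"
  "f \<oplus>\<^bsub>incidence_ring P leq\<^esub> g = (\<lambda>x y. f x y + g x y)"
  "lact (incidence_ring P leq) r f = (\<lambda>x y. r x * f x y)"
  "ract (incidence_ring P leq) f r = (\<lambda>x y. f x y * r y)"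
  "hcomp (incidence_ring P leq) n = {f. \<forall>x y. f x y \<noteq> 0 \<longrightarrow> (x, y) \<in> leq \<and> interval_length leq x y = n}"
  by (simp_all add: incidence_ring_def)

section \<open>The incidence ring, its residue module and coordinates for projective modules\<close>

context graded_poset begin

abbreviation IA :: "('p \<Rightarrow> 'k::field, 'p \<Rightarrow> 'p \<Rightarrow> 'k) graded_bimodule" where
  "IA \<equiv> incidence_ring P leq"

lemma IA_abelian_group: "abelian_group (IA :: ('p \<Rightarrow> 'k::field, _) graded_bimodule)"
proof (rule abelian_groupI)
  fix f :: "'p \<Rightarrow> 'p \<Rightarrow> 'k" assume "f \<in> carrier IA"
  then show "\<exists>g\<in>carrier IA. g \<oplus>\<^bsub>IA\<^esub> f = \<zero>\<^bsub>IA\<^esub>"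
    by (intro bexI[of _ "\<lambda>x y. - f x y"]) (auto simp: incidence_ring_sel)
qed (auto simp: incidence_ring_sel ac_simps)

lemma IA_a_inv: "f \<in> carrier IA \<Longrightarrow> \<ominus>\<^bsub>IA\<^esub> f = (\<lambda>x y. - f x y :: 'k::field)"
  by (rule abelian_group.minus_equality[OF IA_abelian_group]) (auto simp: incidence_ring_sel)

lemma basis_elem_IA: "(x, y) \<in> leq \<Longrightarrow> basis_elem a x y \<in> carrier IA"
  by (auto simp: incidence_ring_sel basis_elem_def)

lemma IA_mult_closed:
  assumes "f \<in> carrier IA" "g \<in> carrier IA"
  shows "f \<otimes>\<^bsub>IA\<^esub> g \<in> carrier IA"
proof -
  have "f x z * g z y = 0" if "(x, y) \<notin> leq" for x y z
    using that assms leq_trans[of x z y] by (auto simp: incidence_ring_sel)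
  then have "\<forall>x y. (x, y) \<notin> leq \<longrightarrow> (\<Sum>z\<in>P. f x z * g z y) = 0"
    by (intro allI impI sum.neutral ballI)
  then show ?thesis by (simp only: incidence_ring_sel mem_Collect_eq)
qed

text \<open>Length 0 occurs on the diagonal only, so components of positive degree are off the
  diagonal. Conversely, \<open>lt\<close> is finite and each entry there is a homogeneous basis
  element.\<close>

lemma augmentation_ideal_eq:
  "augmentation_ideal (IA :: ('p \<Rightarrow> 'k::field, _) graded_bimodule) = {f. \<forall>x y. (x, y) \<notin> lt \<longrightarrow> f x y = 0}"
    (is "?I = ?L")
proof (intro equalityI subsetI)
  fix f assume "f \<in> ?I"
  then show "f \<in> ?L"
    unfolding augmentation_ideal_def
  proof (induction f rule: generate.induct)
    case (incl h)
    then show ?case by (fastforce simp: incidence_ring_sel lt_def il_refl dest: leq_carrierD)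
  next
    case (inv h)
    then have h: "h \<in> ?L" by (fastforce simp: incidence_ring_sel lt_def il_refl dest: leq_carrierD)
    then have "h \<in> carrier IA" by (auto simp: incidence_ring_sel lt_def)
    then have "\<ominus>\<^bsub>IA\<^esub> h \<in> ?L" using h by (simp add: IA_a_inv)
    then show ?case by (simp add: a_inv_def)
  qed (auto simp: incidence_ring_sel)
next
  fix f :: "'p \<Rightarrow> 'p \<Rightarrow> 'k" assume f: "f \<in> ?L"
  have fin: "finite lt" using finite_leq by (rule rev_finite_subset) (auto simp: lt_def)
  have "(\<lambda>x y. if (x, y) \<in> B then f x y else 0) \<in> ?I" if "finite B" "B \<subseteq> lt" for B
    using that
  proof (induction B rule: finite_induct)
    case empty
    then show ?case
      using generate.one[of "add_monoid (IA :: ('p \<Rightarrow> 'k, _) graded_bimodule)"]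
      unfolding augmentation_ideal_def by (simp add: incidence_ring_sel)
  next
    case (insert p B)
    obtain a b where p: "p = (a, b)" by (cases p)
    then have ab: "(a, b) \<in> leq" "a \<noteq> b" using insert by (auto simp: lt_def)
    then have "basis_elem (f a b) a b \<in> hcomp IA (il a b)" "il a b > 0"
      using il_pos by (auto simp: incidence_ring_sel basis_elem_def)
    then have "basis_elem (f a b) a b \<in> ?I"
      unfolding augmentation_ideal_def by (intro generate.incl) auto
    moreover have "(\<lambda>x y. if (x, y) \<in> insert p B then f x y else 0)
        = basis_elem (f a b) a b \<otimes>\<^bsub>add_monoid IA\<^esub> (\<lambda>x y. if (x, y) \<in> B then f x y else 0)"
      using insert(2) p by (auto simp: incidence_ring_sel basis_elem_def fun_eq_iff)
    ultimately show ?case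
      using insert generate.eng unfolding augmentation_ideal_def by fastforce
  qed
  from this[OF fin order_refl] have "(\<lambda>x y. if (x, y) \<in> lt then f x y else 0) \<in> ?I" .
  moreover have "(\<lambda>x y. if (x, y) \<in> lt then f x y else 0) = f" using f by (auto simp: fun_eq_iff)
  ultimately show "f \<in> ?I" by simp
qed

definition diagonal :: "('p \<Rightarrow> 'p \<Rightarrow> 'k::field) \<Rightarrow> 'p \<Rightarrow> 'k" where
  "diagonal f x = f x x"

text \<open>The base ring as a model of \<open>A/A\<^sub>+\<close>. Its components are defined as
  images, so that the grading condition of the quotient locale holds by construction.\<close>

definition diagonal_ring :: "('p \<Rightarrow> 'k::field, 'p \<Rightarrow> 'k) graded_bimodule" where
  "diagonal_ring =
    \<lparr>carrier = carrier (base_ring P), mult = mult (base_ring P), one = one (base_ring P),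
     zero = zero (base_ring P), add = add (base_ring P), lact = mult (base_ring P), ract = mult (base_ring P),
     hcomp = (\<lambda>n. diagonal ` hcomp IA n)\<rparr>"

lemma base_ring_ring: "ring (base_ring Q :: ('p \<Rightarrow> 'k::field) ring)"
proof (rule ringI)
  show "abelian_group (base_ring Q :: ('p \<Rightarrow> 'k) ring)"
  proof (rule abelian_groupI)
    fix f :: "'p \<Rightarrow> 'k" assume "f \<in> carrier (base_ring Q)"
    then show "\<exists>g\<in>carrier (base_ring Q). g \<oplus>\<^bsub>base_ring Q\<^esub> f = \<zero>\<^bsub>base_ring Q\<^esub>"
      by (intro bexI[of _ "\<lambda>x. - f x"]) (auto simp: base_ring_sel)
  qed (auto simp: base_ring_sel add.assoc add.commute)
  show "Group.monoid (base_ring Q :: ('p \<Rightarrow> 'k) ring)"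
    by (rule monoidI) (auto simp: base_ring_sel mult.assoc fun_eq_iff)
qed (auto simp: base_ring_sel distrib_left distrib_right)

text \<open>By antisymmetry \<open>z = x\<close> is the only intermediate point between
  \<open>x\<close> and itself.\<close>

lemma diagonal_mult:
  assumes "f \<in> carrier IA" "g \<in> carrier IA" "x \<in> P"
  shows "diagonal (f \<otimes>\<^bsub>IA\<^esub> g) x = diagonal f x * diagonal g x"
proof -
  have "(\<Sum>z\<in>P. f x z * g z x) = (\<Sum>z\<in>P. if z = x then f x x * g x x else 0)"
  proof (intro sum.cong refl)
    fix z
    have "(x, z) \<notin> leq \<or> (z, x) \<notin> leq" if "z \<noteq> x" using leq_antisym that by blast
    then show "f x z * g z x = (if z = x then f x x * g x x else 0)"
      using assms by (auto simp: incidence_ring_sel)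
  qed
  then show ?thesis using assms finite_P by (simp add: diagonal_def incidence_ring_sel)
qed

lemma residue_quotient:
  "graded_rring_quotient (IA :: ('p \<Rightarrow> 'k::field, _) graded_bimodule) (augmentation_ideal IA)
     diagonal_ring diagonal (base_ring P)"
proof (rule graded_rring_quotient.intro)
  let ?Q = "diagonal_ring :: ('p \<Rightarrow> 'k, _) graded_bimodule"
  have out: "f x x = 0" if "x \<notin> P" "f \<in> carrier IA" for f :: "'p \<Rightarrow> 'p \<Rightarrow> 'k" and x
    using that leq_carrierD[of x x] by (auto simp: incidence_ring_sel)
  show "abelian_group (IA :: ('p \<Rightarrow> 'k, _) graded_bimodule)" by (rule IA_abelian_group)
  show "ring ?Q"
    by (rule ring_of_inj_hom[OF base_ring_ring[of P], of id])
      (auto simp: diagonal_ring_def ring.ring_simprules[OF base_ring_ring] intro!: bexI[of _ "\<ominus>\<^bsub>base_ring P\<^esub> _"])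
  show "a \<otimes>\<^bsub>IA\<^esub> b \<in> carrier IA" if "a \<in> carrier IA" "b \<in> carrier IA" for a b :: "'p \<Rightarrow> 'p \<Rightarrow> 'k"
    using IA_mult_closed that .
  show "\<one>\<^bsub>IA\<^esub> \<in> carrier (IA :: ('p \<Rightarrow> 'k, _) graded_bimodule)" using leq_refl by (auto simp: incidence_ring_sel)
  show "diagonal (a \<oplus>\<^bsub>IA\<^esub> b) = diagonal a \<oplus>\<^bsub>?Q\<^esub> diagonal b" for a b
    by (simp add: diagonal_def diagonal_ring_def base_ring_sel incidence_ring_sel fun_eq_iff)
  show "diagonal (a \<otimes>\<^bsub>IA\<^esub> b) = diagonal a \<otimes>\<^bsub>?Q\<^esub> diagonal b"
    if ab: "a \<in> carrier IA" "b \<in> carrier IA" for a b :: "'p \<Rightarrow> 'p \<Rightarrow> 'k"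
  proof
    fix x show "diagonal (a \<otimes>\<^bsub>IA\<^esub> b) x = (diagonal a \<otimes>\<^bsub>?Q\<^esub> diagonal b) x"
      using diagonal_mult[OF ab, of x] out[OF _ ab(1), of x] out[OF _ IA_mult_closed[OF ab], of x]
      by (cases "x \<in> P") (auto simp: diagonal_ring_def base_ring_sel diagonal_def)
  qed
  show "diagonal \<one>\<^bsub>IA\<^esub> = \<one>\<^bsub>?Q\<^esub>"
    by (auto simp: diagonal_def diagonal_ring_def base_ring_sel incidence_ring_sel fun_eq_iff)
  show "diagonal ` carrier IA = carrier ?Q"
  proof (intro equalityI subsetI)
    fix r assume "r \<in> carrier ?Q"
    then have r: "\<forall>x. x \<notin> P \<longrightarrow> r x = 0" by (simp add: diagonal_ring_def base_ring_sel)
    have "(\<lambda>x y. if x = y then r x else 0) \<in> carrier IA"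
      using r leq_refl by (auto simp: incidence_ring_sel)
    moreover have "r = diagonal (\<lambda>x y. if x = y then r x else 0)" by (simp add: diagonal_def fun_eq_iff)
    ultimately show "r \<in> diagonal ` carrier IA" by blast
  qed (auto simp: diagonal_ring_def base_ring_sel diagonal_def intro: out)
  show "augmentation_ideal IA = {a \<in> carrier IA. diagonal a = \<zero>\<^bsub>?Q\<^esub>}"
  proof -
    have "(\<forall>x y. (x, y) \<notin> lt \<longrightarrow> f x y = 0) \<longleftrightarrow> (\<forall>x y. (x, y) \<notin> leq \<longrightarrow> f x y = 0) \<and> (\<forall>x. f x x = 0)"
      for f :: "'p \<Rightarrow> 'p \<Rightarrow> 'k"
      by (auto simp: lt_def)
    then show ?thesis
      by (auto simp: augmentation_ideal_eq diagonal_ring_def base_ring_sel incidence_ring_sel diagonal_def fun_eq_iff)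
  qed
  fix r :: "'p \<Rightarrow> 'k" and a assume "r \<in> carrier (base_ring P)" "a \<in> carrier (IA :: ('p \<Rightarrow> 'k, _) graded_bimodule)"
  then show "lact IA r a \<in> carrier IA" "ract IA a r \<in> carrier IA"
    "diagonal (lact IA r a) = lact ?Q r (diagonal a)" "diagonal (ract IA a r) = ract ?Q (diagonal a) r"
    by (auto simp: incidence_ring_sel diagonal_def diagonal_ring_def base_ring_sel)
next
  fix n show "hcomp IA n \<subseteq> carrier IA" "diagonal ` hcomp IA n = hcomp diagonal_ring n"
    by (auto simp: incidence_ring_sel diagonal_ring_def)
qed

text \<open>\<open>g\<close> is a splitting of the canonical presentation \<open>p\<close> of a projective module by a free module.\<close>

definition act :: "('p \<Rightarrow> 'p \<Rightarrow> 'k::field) \<Rightarrow> ('m \<Rightarrow> 'p \<Rightarrow> 'p \<Rightarrow> 'k) \<Rightarrow> 'm \<Rightarrow> 'p \<Rightarrow> 'p \<Rightarrow> 'k" where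
  "act a F = (\<lambda>b. a \<otimes>\<^bsub>IA\<^esub> F b)"

text \<open>Left multiplication by \<open>e\<^sub>x\<^sub>,\<^sub>y\<close> moves row
  \<open>y\<close> to row \<open>x\<close>. Written without the sum over \<open>P\<close>, its
  identities hold for all indices.\<close>

definition unit_act :: "'p \<Rightarrow> 'p \<Rightarrow> ('m \<Rightarrow> 'p \<Rightarrow> 'p \<Rightarrow> 'k::field) \<Rightarrow> 'm \<Rightarrow> 'p \<Rightarrow> 'p \<Rightarrow> 'k" where
  "unit_act x y F = (\<lambda>b u w. if u = x then F b y w else 0)"

lemma act_unit: "y \<in> P \<Longrightarrow> act (basis_elem 1 x y) F = unit_act x y F"
  using finite_P by (auto simp: act_def unit_act_def incidence_ring_sel basis_elem_def fun_eq_iff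
      if_distrib[of "\<lambda>t. t * _"] sum.delta cong: if_cong)

definition coordinates where
  "coordinates M g p \<longleftrightarrow>
     (\<forall>u\<in>carrier M. g u \<in> carrier (free_module IA (carrier M)) \<and> p (g u) = u) \<and>
     (\<forall>u\<in>carrier M. \<forall>v\<in>carrier M. g (u \<oplus>\<^bsub>M\<^esub> v) = g u + g v) \<and>
     (\<forall>a\<in>carrier IA. \<forall>u\<in>carrier M. g (a \<odot>\<^bsub>M\<^esub> u) = act a (g u)) \<and>
     (\<forall>F\<in>carrier (free_module IA (carrier M)). p F \<in> carrier M) \<and>
     (\<forall>F\<in>carrier (free_module IA (carrier M)). \<forall>G\<in>carrier (free_module IA (carrier M)).
        p (F + G) = p F \<oplus>\<^bsub>M\<^esub> p G) \<and>
     (\<forall>a\<in>carrier IA. \<forall>F\<in>carrier (free_module IA (carrier M)). p (act a F) = a \<odot>\<^bsub>M\<^esub> p F)"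

lemma projective_coordinates:
  assumes "projective_left_module (IA :: ('p \<Rightarrow> 'k::field, _) graded_bimodule) M"
  shows "\<exists>g p. coordinates M g p"
proof -
  obtain g where g: "g \<in> left_module_hom IA M (free_module IA (carrier M))"
    "\<And>x. x \<in> carrier M \<Longrightarrow> free_eval IA M (g x) = x"
    using projective_splitting[OF assms] by blast
  have "left_module IA M" using assms by (simp add: projective_left_module_def)
  then have p: "free_eval IA M \<in> left_module_hom IA (free_module IA (carrier M)) M"
    by (rule left_module.free_eval_hom)
  have plus: "(\<lambda>b. F b \<oplus>\<^bsub>IA\<^esub> G b) = F + G" for F G :: "'a \<Rightarrow> 'p \<Rightarrow> 'p \<Rightarrow> 'k"
    by (simp add: incidence_ring_sel fun_eq_iff)
  have "coordinates M g (free_eval IA M)"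
    unfolding coordinates_def
    using g p by (auto simp: left_module_hom_def Pi_iff free_module_sel(3,4) act_def plus)
  then show ?thesis by blast
qed

end

text \<open>The data of a Koszul resolution together with coordinates \<open>g\<close> and
  presentations \<open>pr\<close> for its modules. Along \<open>g\<close> all modules are moved into
  one function type, in which the chase takes place.\<close>

locale koszul_resolution = graded_poset P leq
  for P :: "'p set" and leq :: "'p rel" +
  fixes Q :: "nat \<Rightarrow> ('p \<Rightarrow> 'p \<Rightarrow> 'k::field, 'm) graded_module"
    and d :: "nat \<Rightarrow> 'm \<Rightarrow> 'm" and eps :: "'m \<Rightarrow> ('p \<Rightarrow> 'p \<Rightarrow> 'k) set"
    and g :: "nat \<Rightarrow> 'm \<Rightarrow> 'm \<Rightarrow> 'p \<Rightarrow> 'p \<Rightarrow> 'k" and pr :: "nat \<Rightarrow> ('m \<Rightarrow> 'p \<Rightarrow> 'p \<Rightarrow> 'k) \<Rightarrow> 'm"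
  assumes graded_Q: "graded_left_module IA (Q j)"
    and generated_Q: "generated_in_degree IA (Q j) j"
    and d_hom: "d j \<in> graded_left_module_hom IA (Q (Suc j)) (Q j)"
    and eps_hom: "eps \<in> graded_left_module_hom IA (Q 0) (residue_module IA)"
    and eps_surj: "eps ` carrier (Q 0) = carrier (residue_module (IA :: ('p \<Rightarrow> 'k, _) graded_bimodule))"
    and exact_0: "d 0 ` carrier (Q 1) = {x \<in> carrier (Q 0). eps x = \<zero>\<^bsub>residue_module (IA :: ('p \<Rightarrow> 'k, _) graded_bimodule)\<^esub>}"
    and exact_Suc: "d (Suc j) ` carrier (Q (Suc (Suc j))) = {x \<in> carrier (Q (Suc j)). d j x = \<zero>\<^bsub>Q j\<^esub>}"
    and coords: "coordinates (Q j) (g j) (pr j)"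
begin

lemma Q_module: "left_module IA (Q j)"
  using graded_Q by (simp add: graded_left_module_def)

lemma Q_group: "abelian_group (Q j)"
  by (rule left_moduleD(2)[OF Q_module])

lemma Q_sum: "internal_direct_sum (Q j) (mcomp (Q j))"
  using graded_Q by (simp add: graded_left_module_def)

lemma mcomp_subgroup: "subgroup (mcomp (Q j) n) (add_monoid (Q j))"
  using Q_sum by (simp add: internal_direct_sum_def)

lemma mcomp_carrier: "u \<in> mcomp (Q j) n \<Longrightarrow> u \<in> carrier (Q j)"
  using subgroup.subset[OF mcomp_subgroup] by fastforce

lemma mcomp_smult: "a \<in> hcomp IA i \<Longrightarrow> u \<in> mcomp (Q j) n \<Longrightarrow> a \<odot>\<^bsub>Q j\<^esub> u \<in> mcomp (Q j) (i + n)"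
  using graded_Q by (simp add: graded_left_module_def)

lemma mcomp_zero: "\<zero>\<^bsub>Q j\<^esub> \<in> mcomp (Q j) n"
  using subgroup.one_closed[OF mcomp_subgroup] by simp

lemma mcomp_add: "u \<in> mcomp (Q j) n \<Longrightarrow> v \<in> mcomp (Q j) n \<Longrightarrow> u \<oplus>\<^bsub>Q j\<^esub> v \<in> mcomp (Q j) n"
  using subgroup.m_closed[OF mcomp_subgroup] by fastforce

lemma mcomp_neg: "u \<in> mcomp (Q j) n \<Longrightarrow> \<ominus>\<^bsub>Q j\<^esub> u \<in> mcomp (Q j) n"
  using subgroup.m_inv_closed[OF mcomp_subgroup] by (simp add: a_inv_def)

abbreviation Fr where "Fr j \<equiv> carrier (free_module (IA :: ('p \<Rightarrow> 'k, _) graded_bimodule) (carrier (Q j)))"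

lemma Fr_iff: "F \<in> Fr j \<longleftrightarrow>
  finite {b. F b \<noteq> 0} \<and> (\<forall>b x y. (x, y) \<notin> leq \<longrightarrow> F b x y = 0) \<and> (\<forall>b. b \<notin> carrier (Q j) \<longrightarrow> F b = 0)"
  by (auto simp: free_module_sel incidence_ring_sel zero_fun_def)

lemma Fr_subset:
  assumes "F \<in> Fr j" "\<And>b. F b = 0 \<Longrightarrow> G b = 0" "\<And>b x y. (x, y) \<notin> leq \<Longrightarrow> G b x y = 0"
  shows "G \<in> Fr j"
proof -
  have "{b. G b \<noteq> 0} \<subseteq> {b. F b \<noteq> 0}" using assms(2) by blast
  then show ?thesis using assms by (auto simp: Fr_iff intro: finite_subset)
qed

lemma Fr_zero: "0 \<in> Fr j"
  by (simp add: Fr_iff)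

lemma Fr_diff:
  assumes "F \<in> Fr j" "G \<in> Fr j" shows "F - G \<in> Fr j"
proof -
  have "{b. (F - G) b \<noteq> 0} \<subseteq> {b. F b \<noteq> 0} \<union> {b. G b \<noteq> 0}" by auto
  then show ?thesis using assms by (auto simp: Fr_iff intro: finite_subset)
qed

lemma Fr_add:
  assumes "F \<in> Fr j" "G \<in> Fr j" shows "F + G \<in> Fr j"
proof -
  have "{b. (F + G) b \<noteq> 0} \<subseteq> {b. F b \<noteq> 0} \<union> {b. G b \<noteq> 0}" by auto
  then show ?thesis using assms by (auto simp: Fr_iff intro: finite_subset)
qed

lemma unit_act_Fr:
  assumes F: "F \<in> Fr j" and xy: "(x, y) \<in> leq"
  shows "unit_act x y F \<in> Fr j"
proof (rule Fr_subset[OF F])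
  show "F b = 0 \<Longrightarrow> unit_act x y F b = 0" for b by (simp add: unit_act_def fun_eq_iff)
  fix b u w assume "(u, w) \<notin> leq"
  then have "(y, w) \<notin> leq" if "u = x" using leq_trans[OF xy] that by blast
  then show "unit_act x y F b u w = 0" using F by (auto simp: unit_act_def Fr_iff)
qed

lemma g_Fr: "u \<in> carrier (Q j) \<Longrightarrow> g j u \<in> Fr j"
  and pr_g: "u \<in> carrier (Q j) \<Longrightarrow> pr j (g j u) = u"
  and g_add: "u \<in> carrier (Q j) \<Longrightarrow> v \<in> carrier (Q j) \<Longrightarrow> g j (u \<oplus>\<^bsub>Q j\<^esub> v) = g j u + g j v"
  and g_smult: "a \<in> carrier IA \<Longrightarrow> u \<in> carrier (Q j) \<Longrightarrow> g j (a \<odot>\<^bsub>Q j\<^esub> u) = act a (g j u)"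
  and pr_closed: "F \<in> Fr j \<Longrightarrow> pr j F \<in> carrier (Q j)"
  and pr_add: "F \<in> Fr j \<Longrightarrow> G \<in> Fr j \<Longrightarrow> pr j (F + G) = pr j F \<oplus>\<^bsub>Q j\<^esub> pr j G"
  and pr_act: "a \<in> carrier IA \<Longrightarrow> F \<in> Fr j \<Longrightarrow> pr j (act a F) = a \<odot>\<^bsub>Q j\<^esub> pr j F"
  using coords[of j] unfolding coordinates_def by blast+

lemma smult_closed: "a \<in> carrier IA \<Longrightarrow> u \<in> carrier (Q j) \<Longrightarrow> a \<odot>\<^bsub>Q j\<^esub> u \<in> carrier (Q j)"
  by (rule left_module.smult_closed[OF Q_module])

lemma g_inj: "u \<in> carrier (Q j) \<Longrightarrow> v \<in> carrier (Q j) \<Longrightarrow> g j u = g j v \<Longrightarrow> u = v"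
  by (metis pr_g)

lemma g_zero: "g j \<zero>\<^bsub>Q j\<^esub> = 0"
proof -
  interpret M: abelian_group "Q j" by (rule Q_group)
  show ?thesis using g_add[of "\<zero>\<^bsub>Q j\<^esub>" j "\<zero>\<^bsub>Q j\<^esub>"] by simp
qed

lemma g_neg: "u \<in> carrier (Q j) \<Longrightarrow> g j (\<ominus>\<^bsub>Q j\<^esub> u) = - g j u"
proof -
  assume u: "u \<in> carrier (Q j)"
  interpret M: abelian_group "Q j" by (rule Q_group)
  have "g j (\<ominus>\<^bsub>Q j\<^esub> u) + g j u = 0" using g_add[of "\<ominus>\<^bsub>Q j\<^esub> u" j u] u g_zero by (simp add: M.l_neg)
  then show ?thesis by (simp add: eq_neg_iff_add_eq_0)
qed

lemma g_minus: "u \<in> carrier (Q j) \<Longrightarrow> v \<in> carrier (Q j) \<Longrightarrow> g j (u \<ominus>\<^bsub>Q j\<^esub> v) = g j u - g j v"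
proof -
  assume uv: "u \<in> carrier (Q j)" "v \<in> carrier (Q j)"
  interpret M: abelian_group "Q j" by (rule Q_group)
  show ?thesis using uv g_add[of u j "\<ominus>\<^bsub>Q j\<^esub> v"] g_neg by (simp add: a_minus_def)
qed

lemma g_finsum:
  assumes "finite B" "\<And>b. b \<in> B \<Longrightarrow> c b \<in> carrier (Q j)"
  shows "g j (finsum (Q j) c B) = (\<Sum>b\<in>B. g j (c b))"
  by (rule finsum_additive[OF Q_group assms]) (simp_all only: g_add)

section \<open>Transport of the resolution into coordinates\<close>

definition X :: "nat \<Rightarrow> ('m \<Rightarrow> 'p \<Rightarrow> 'p \<Rightarrow> 'k) set" where "X j = g j ` carrier (Q j)"
definition Gr :: "nat \<Rightarrow> nat \<Rightarrow> ('m \<Rightarrow> 'p \<Rightarrow> 'p \<Rightarrow> 'k) set" where "Gr j n = g j ` mcomp (Q j) n"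
definition retr where "retr j F = g j (pr j F)"
definition \<delta> where "\<delta> j F = g j (d j (pr (Suc j) F))"
definition entries :: "'p \<Rightarrow> 'p \<Rightarrow> ('m \<Rightarrow> 'p \<Rightarrow> 'p \<Rightarrow> 'k) \<Rightarrow> 'm \<Rightarrow> 'p \<Rightarrow> 'p \<Rightarrow> 'k" where
  "entries x y F = (\<lambda>b. basis_elem (F b x y) y y)"
text \<open>Reading off entries leads out of \<open>X j\<close> into the free module;
  \<open>retr\<close>, the projection of the free module onto \<open>X j\<close>, leads
  back.\<close>

definition \<tau> where "\<tau> j x y F = retr j (entries x y F)"

lemma X_Fr: "F \<in> X j \<Longrightarrow> F \<in> Fr j"
  using g_Fr by (auto simp: X_def)

lemma retr_X: "F \<in> Fr j \<Longrightarrow> retr j F \<in> X j"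
  using pr_closed by (simp add: X_def retr_def)

lemma retr_id: "F \<in> X j \<Longrightarrow> retr j F = F"
  using pr_g by (auto simp: X_def retr_def)

lemma retr_add: "F \<in> Fr j \<Longrightarrow> G \<in> Fr j \<Longrightarrow> retr j (F + G) = retr j F + retr j G"
  by (simp add: retr_def pr_add pr_closed g_add)

lemma retr_zero: "retr j 0 = 0"
  using retr_add[OF Fr_zero Fr_zero, of j] by simp

lemma retr_sum:
  assumes "finite B" "\<And>b. b \<in> B \<Longrightarrow> f b \<in> Fr j"
  shows "sum f B \<in> Fr j \<and> retr j (sum f B) = (\<Sum>b\<in>B. retr j (f b))"
  using assms by (induction B rule: finite_induct) (auto simp: Fr_zero Fr_add retr_add retr_zero)

lemma unit_closed: "(x, y) \<in> leq \<Longrightarrow> basis_elem 1 x y \<in> carrier IA"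
  by (rule basis_elem_IA)

lemma g_unit: "(x, y) \<in> leq \<Longrightarrow> u \<in> carrier (Q j) \<Longrightarrow> g j (basis_elem 1 x y \<odot>\<^bsub>Q j\<^esub> u) = unit_act x y (g j u)"
  using g_smult[OF unit_closed] act_unit leq_carrierD by metis

lemma pr_unit: "(x, y) \<in> leq \<Longrightarrow> F \<in> Fr j \<Longrightarrow> pr j (unit_act x y F) = basis_elem 1 x y \<odot>\<^bsub>Q j\<^esub> pr j F"
  using pr_act[OF unit_closed] act_unit leq_carrierD by metis

lemma retr_unit: "(x, y) \<in> leq \<Longrightarrow> F \<in> Fr j \<Longrightarrow> retr j (unit_act x y F) = unit_act x y (retr j F)"
  by (simp add: retr_def pr_unit g_unit pr_closed)

lemma unit_act_X: "(x, y) \<in> leq \<Longrightarrow> F \<in> X j \<Longrightarrow> unit_act x y F \<in> X j"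
  using retr_unit[OF _ X_Fr] retr_id retr_X unit_act_Fr X_Fr by metis

lemma unit_act_unit_act: "unit_act x y (unit_act z w F) = (if y = z then unit_act x w F else 0)"
  by (auto simp: unit_act_def fun_eq_iff)

lemma unit_act_diff: "unit_act x y (F - G) = unit_act x y F - unit_act x y G"
  by (auto simp: unit_act_def fun_eq_iff)

lemma entries_Fr:
  assumes "F \<in> Fr j" "y \<in> P"
  shows "entries x y F \<in> Fr j"
  by (rule Fr_subset[OF assms(1)])
    (use assms(2) leq_refl in \<open>auto simp: entries_def basis_elem_def fun_eq_iff\<close>)

lemma fun_sum_apply: "finite B \<Longrightarrow> (\<Sum>i\<in>B. h i) b u w = (\<Sum>i\<in>B. h i b u w)"
  for h :: "'i \<Rightarrow> 'm \<Rightarrow> 'p \<Rightarrow> 'p \<Rightarrow> 'k"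
  by (induction B rule: finite_induct) auto

text \<open>In the free module \<open>v\<close> is the sum over \<open>y\<close> of
  \<open>e\<^sub>x\<^sub>,\<^sub>y\<close> times its entries. The projection \<open>retr\<close> is
  linear over the ring and fixes \<open>v\<close>, so the identity persists in
  \<open>X j\<close>.\<close>

lemma \<tau>_split_aux:
  assumes x: "x \<in> P" and v: "v \<in> X j" "unit_act x x v = v"
  shows "(\<Sum>y\<in>{y. (x, y) \<in> leq}. unit_act x y (\<tau> j x y v)) = v"
proof -
  let ?U = "{y. (x, y) \<in> leq}"
  have fin: "finite ?U" by (rule finite_subset[OF _ finite_P]) (use leq_carrierD in auto)
  have vF: "v \<in> Fr j" using X_Fr v by blast
  have eF: "entries x y v \<in> Fr j" if "y \<in> ?U" for y using entries_Fr[OF vF] that leq_carrierD by blast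
  have "(\<Sum>y\<in>?U. unit_act x y (\<tau> j x y v)) = (\<Sum>y\<in>?U. retr j (unit_act x y (entries x y v)))"
    by (rule sum.cong) (use eF retr_unit in \<open>auto simp: \<tau>_def\<close>)
  also have "\<dots> = retr j (\<Sum>y\<in>?U. unit_act x y (entries x y v))"
    using retr_sum[OF fin, of "\<lambda>y. unit_act x y (entries x y v)" j] eF unit_act_Fr by auto
  also have "(\<Sum>y\<in>?U. unit_act x y (entries x y v)) = v"
  proof (intro ext)
    fix b u w
    have "(\<Sum>y\<in>?U. unit_act x y (entries x y v)) b u w = (\<Sum>y\<in>?U. if y = w then (if u = x then v b x w else 0) else 0)"
      unfolding fun_sum_apply[OF fin] by (rule sum.cong) (auto simp: unit_act_def entries_def basis_elem_def)
    also have "\<dots> = (if u = x then v b x w else 0)"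
      using fin vF by (auto simp: Fr_iff)
    also have "\<dots> = v b u w" using v(2) by (auto simp: unit_act_def fun_eq_iff split: if_splits)
    finally show "(\<Sum>y\<in>?U. unit_act x y (entries x y v)) b u w = v b u w" .
  qed
  finally show ?thesis using retr_id v(1) by simp
qed

lemma d_closed: "u \<in> carrier (Q (Suc j)) \<Longrightarrow> d j u \<in> carrier (Q j)"
  and d_add: "u \<in> carrier (Q (Suc j)) \<Longrightarrow> v \<in> carrier (Q (Suc j)) \<Longrightarrow>
    d j (u \<oplus>\<^bsub>Q (Suc j)\<^esub> v) = d j u \<oplus>\<^bsub>Q j\<^esub> d j v"
  and d_smult: "a \<in> carrier IA \<Longrightarrow> u \<in> carrier (Q (Suc j)) \<Longrightarrow> d j (a \<odot>\<^bsub>Q (Suc j)\<^esub> u) = a \<odot>\<^bsub>Q j\<^esub> d j u"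
  and d_mcomp: "u \<in> mcomp (Q (Suc j)) n \<Longrightarrow> d j u \<in> mcomp (Q j) n"
  using d_hom[of j] unfolding graded_left_module_hom_def left_module_hom_def by blast+

lemma \<delta>_g: "u \<in> carrier (Q (Suc j)) \<Longrightarrow> \<delta> j (g (Suc j) u) = g j (d j u)"
  by (simp add: \<delta>_def pr_g)

lemma \<delta>_add_aux: "F \<in> X (Suc j) \<Longrightarrow> G \<in> X (Suc j) \<Longrightarrow> \<delta> j (F + G) = \<delta> j F + \<delta> j G"
  using pr_add X_Fr pr_closed d_add d_closed g_add by (simp add: \<delta>_def)

lemma X_zero_aux: "0 \<in> X j"
  using g_zero abelian_monoid.zero_closed[OF abelian_group.axioms(1)[OF Q_group]] unfolding X_def by (metis image_eqI)

lemma X_diff_aux: "F \<in> X j \<Longrightarrow> G \<in> X j \<Longrightarrow> F - G \<in> X j"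
proof -
  assume "F \<in> X j" "G \<in> X j"
  then obtain u v where "u \<in> carrier (Q j)" "v \<in> carrier (Q j)" "F = g j u" "G = g j v" by (auto simp: X_def)
  then have "F - G = g j (u \<ominus>\<^bsub>Q j\<^esub> v)" "u \<ominus>\<^bsub>Q j\<^esub> v \<in> carrier (Q j)"
    using g_minus abelian_group.minus_closed[OF Q_group] by auto
  then show ?thesis by (auto simp: X_def)
qed

lemma finsum_d:
  assumes B: "finite B" and c: "\<And>n. c n \<in> carrier (Q (Suc j))"
  shows "d j (finsum (Q (Suc j)) c B) = finsum (Q j) (\<lambda>n. d j (c n)) B"
proof (rule g_inj)
  interpret M: abelian_group "Q (Suc j)" by (rule Q_group)
  interpret N: abelian_group "Q j" by (rule Q_group)
  show "d j (finsum (Q (Suc j)) c B) \<in> carrier (Q j)" using c by (intro d_closed M.finsum_closed) auto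
  show "finsum (Q j) (\<lambda>n. d j (c n)) B \<in> carrier (Q j)" using c d_closed by (intro N.finsum_closed) auto
  have "g j (d j (finsum (Q (Suc j)) c B)) = (\<Sum>n\<in>B. g j (d j (c n)))"
    by (rule finsum_additive[OF Q_group B, where h = "\<lambda>u. g j (d j u)"])
      (simp_all only: c d_add d_closed g_add)
  also have "\<dots> = g j (finsum (Q j) (\<lambda>n. d j (c n)) B)"
    by (rule g_finsum[OF B, symmetric]) (simp only: c d_closed)
  finally show "g j (d j (finsum (Q (Suc j)) c B)) = g j (finsum (Q j) (\<lambda>n. d j (c n)) B)" .
qed

lemma homogeneous_component_unique:
  assumes u: "u \<in> mcomp (Q j) k" and B: "finite B" "k \<in> B"
    and c: "\<And>n. c n \<in> mcomp (Q j) n" "\<And>n. n \<notin> B \<Longrightarrow> c n = \<zero>\<^bsub>Q j\<^esub>" "u = finsum (Q j) c B"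
  shows "c k = u"
proof -
  interpret M: abelian_group "Q j" by (rule Q_group)
  have "finsum (Q j) (\<lambda>n. if k = n then u else \<zero>\<^bsub>Q j\<^esub>) B = u"
    using M.add.finprod_singleton[OF B(2,1), of "\<lambda>_. u"] mcomp_carrier[OF u] by simp
  then have "c = (\<lambda>n. if k = n then u else \<zero>\<^bsub>Q j\<^esub>)"
    by (intro internal_direct_sum_unique[OF Q_group Q_sum B(1)]) (use c u B mcomp_zero in auto)
  then show ?thesis by (metis (full_types))
qed

text \<open>As \<open>d\<close> preserves degrees, the component of degree \<open>k\<close> of any
  preimage is again a preimage.\<close>

lemma lift_aux:
  assumes u: "u \<in> mcomp (Q j) k" and w: "w \<in> carrier (Q (Suc j))" "d j w = u"
  shows "\<exists>w\<in>mcomp (Q (Suc j)) k. d j w = u"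
proof -
  interpret M: abelian_group "Q (Suc j)" by (rule Q_group)
  obtain c where c: "\<And>n. c n \<in> mcomp (Q (Suc j)) n" "finite {n. c n \<noteq> \<zero>\<^bsub>Q (Suc j)\<^esub>}"
    "w = finsum (Q (Suc j)) c {n. c n \<noteq> \<zero>\<^bsub>Q (Suc j)\<^esub>}"
    using internal_direct_sum_decompose[OF Q_sum w(1)] by blast
  let ?B = "insert k {n. c n \<noteq> \<zero>\<^bsub>Q (Suc j)\<^esub>}"
  have cc: "c n \<in> carrier (Q (Suc j))" for n using c(1) mcomp_carrier by blast
  have d0: "d j \<zero>\<^bsub>Q (Suc j)\<^esub> = \<zero>\<^bsub>Q j\<^esub>"
  proof (rule g_inj[of _ j])
    show "\<zero>\<^bsub>Q j\<^esub> \<in> carrier (Q j)" using mcomp_carrier[OF mcomp_zero] .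
    show "g j (d j \<zero>\<^bsub>Q (Suc j)\<^esub>) = g j \<zero>\<^bsub>Q j\<^esub>"
      using \<delta>_add_aux[OF X_zero_aux X_zero_aux, of j] \<delta>_g[OF M.zero_closed] by (simp add: g_zero)
  qed (rule d_closed[OF M.zero_closed])
  have "w = finsum (Q (Suc j)) c ?B"
    unfolding c(3) by (rule M.add.finprod_mono_neutral_cong_left) (use c(2) cc in auto)
  then have "u = finsum (Q j) (\<lambda>n. d j (c n)) ?B"
    using w(2) finsum_d[of ?B c j] c(2) cc by auto
  then have "d j (c k) = u"
    by (intro homogeneous_component_unique[OF u, of ?B "\<lambda>n. d j (c n)"]) (use c d_mcomp d0 in auto)
  then show ?thesis using c(1) by blast
qed

section \<open>The radical \<open>A\<^sub>+ X\<^sub>j\<close> and the homogeneous elements outside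
  of the generating degree\<close>

definition Rad :: "nat \<Rightarrow> ('m \<Rightarrow> 'p \<Rightarrow> 'p \<Rightarrow> 'k) set" where
  "Rad j = {\<Sum>(y, z)\<in>lt. unit_act y z (h y z) | h. \<forall>y z. h y z \<in> X j}"

lemma Rad_diff:
  assumes "F \<in> Rad j" "G \<in> Rad j" shows "F - G \<in> Rad j"
proof -
  obtain h k where "F = (\<Sum>(y, z)\<in>lt. unit_act y z (h y z))" "\<forall>y z. h y z \<in> X j"
    "G = (\<Sum>(y, z)\<in>lt. unit_act y z (k y z))" "\<forall>y z. k y z \<in> X j"
    using assms by (auto simp: Rad_def)
  then have "F - G = (\<Sum>(y, z)\<in>lt. unit_act y z (h y z - k y z))" "\<forall>y z. h y z - k y z \<in> X j"
    by (auto simp: sum_subtractf[symmetric] unit_act_diff case_prod_unfold X_diff_aux)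
  then show ?thesis unfolding Rad_def by (intro CollectI exI[of _ "\<lambda>y z. h y z - k y z"] conjI)
qed

lemma Rad_zero: "0 \<in> Rad j"
proof -
  have "(0 :: 'm \<Rightarrow> 'p \<Rightarrow> 'p \<Rightarrow> 'k) = (\<Sum>(y, z)\<in>lt. unit_act y z 0)"
    by (rule sum.neutral[symmetric]) (auto simp: unit_act_def fun_eq_iff)
  then show ?thesis
    unfolding Rad_def using X_zero_aux by (intro CollectI exI[of _ "\<lambda>y z. 0"] conjI) simp_all
qed

lemma Rad_neg: "F \<in> Rad j \<Longrightarrow> - F \<in> Rad j"
  using Rad_diff[OF Rad_zero] by fastforce

lemma Rad_add: "F \<in> Rad j \<Longrightarrow> G \<in> Rad j \<Longrightarrow> F + G \<in> Rad j"
  using Rad_diff[OF _ Rad_neg] by fastforce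

definition part :: "('p \<Rightarrow> 'p \<Rightarrow> 'k) \<Rightarrow> nat \<Rightarrow> 'p \<Rightarrow> 'p \<Rightarrow> 'k" where
  "part a i = (\<lambda>x y. if il x y = i then a x y else 0)"

lemma part_hcomp: "a \<in> carrier IA \<Longrightarrow> part a i \<in> hcomp IA i"
  by (auto simp: incidence_ring_sel part_def)

lemma part_carrier: "a \<in> carrier IA \<Longrightarrow> part a i \<in> carrier IA"
  by (auto simp: incidence_ring_sel part_def)

lemma finite_lt: "finite lt"
  using finite_leq by (rule rev_finite_subset) (auto simp: lt_def)

lemma part_Rad:
  assumes a: "a \<in> carrier IA" and i: "i > 0" and u: "u \<in> carrier (Q j)"
  shows "g j (part a i \<odot>\<^bsub>Q j\<^esub> u) \<in> Rad j"
proof -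
  \<comment> \<open>The summand of \<open>a\<close> at \<open>(y, z)\<close> is
    \<open>e\<^sub>y\<^sub>,\<^sub>z\<close> times its coefficient at
    \<open>e\<^sub>z\<^sub>,\<^sub>z\<close>. The case distinction keeps the multiplier in the ring
    for every \<open>z\<close>, so that \<open>h y z\<close> always lies in
    \<open>X j\<close>.\<close>
  define h where "h y z = g j ((if z \<in> P then basis_elem (part a i y z) z z else \<zero>\<^bsub>IA\<^esub>) \<odot>\<^bsub>Q j\<^esub> u)" for y z
  have hc: "(if z \<in> P then basis_elem (part a i y z) z z else \<zero>\<^bsub>IA\<^esub>) \<in> carrier IA" for y z
    using leq_refl by (auto simp: basis_elem_IA) (simp add: incidence_ring_sel)
  have "g j (part a i \<odot>\<^bsub>Q j\<^esub> u) = (\<Sum>(y, z)\<in>lt. unit_act y z (h y z))"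
  proof (intro ext)
    fix b s w
    have h: "unit_act y z (h y z) b s w = (if s = y then part a i y z * g j u b z w else 0)" if "(y, z) \<in> lt" for y z
    proof -
      have "h y z b z w = (\<Sum>t\<in>P. basis_elem (part a i y z) z z z t * g j u b t w)"
        unfolding h_def g_smult[OF hc u] using ltD(4)[OF that] by (simp add: act_def incidence_ring_sel)
      also have "\<dots> = (\<Sum>t\<in>P. if t = z then part a i y z * g j u b z w else 0)"
        by (rule sum.cong) (auto simp: basis_elem_def)
      finally show ?thesis using ltD(4)[OF that] finite_P by (simp add: unit_act_def)
    qed
    have "(\<Sum>(y, z)\<in>lt. unit_act y z (h y z)) b s w = (\<Sum>p\<in>lt. if fst p = s then part a i s (snd p) * g j u b (snd p) w else 0)"
      unfolding fun_sum_apply[OF finite_lt] by (rule sum.cong) (use h in auto)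
    also have "\<dots> = (\<Sum>p\<in>{p \<in> lt. fst p = s}. part a i s (snd p) * g j u b (snd p) w)"
      using finite_lt by (simp add: sum.inter_filter)
    also have "\<dots> = (\<Sum>z\<in>{z. (s, z) \<in> lt}. part a i s z * g j u b z w)"
      by (rule sum.reindex_bij_witness[where i = "\<lambda>z. (s, z)" and j = snd]) auto
    also have "\<dots> = (\<Sum>z\<in>P. part a i s z * g j u b z w)"
    proof (rule sum.mono_neutral_left[OF finite_P])
      show "{z. (s, z) \<in> lt} \<subseteq> P" using ltD by blast
      show "\<forall>z\<in>P - {z. (s, z) \<in> lt}. part a i s z * g j u b z w = 0"
        using i a il_refl by (auto simp: part_def lt_def incidence_ring_sel)
    qed
    also have "\<dots> = g j (part a i \<odot>\<^bsub>Q j\<^esub> u) b s w"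
      using g_smult[OF part_carrier[OF a] u] by (simp add: act_def incidence_ring_sel)
    finally show "g j (part a i \<odot>\<^bsub>Q j\<^esub> u) b s w = (\<Sum>(y, z)\<in>lt. unit_act y z (h y z)) b s w" ..
  qed
  moreover have "h y z \<in> X j" for y z
    unfolding h_def X_def using smult_closed[OF hc u] by blast
  ultimately show ?thesis unfolding Rad_def by (intro CollectI exI[of _ h] conjI) simp_all
qed

text \<open>A homogeneous decomposition whose components outside of degree \<open>j\<close> lie in
  the radical. Existence for all elements, with uniqueness of decompositions, puts every homogeneous
  element of another degree into the radical.\<close>

definition radical_decomposition where
  "radical_decomposition j w c B \<longleftrightarrow> finite B \<and> (\<forall>n. c n \<in> mcomp (Q j) n) \<and>
     (\<forall>n. n \<notin> B \<longrightarrow> c n = \<zero>\<^bsub>Q j\<^esub>) \<and> w = finsum (Q j) c B \<and> (\<forall>n. n \<noteq> j \<longrightarrow> g j (c n) \<in> Rad j)"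

lemma radical_decomposition_smult:
  assumes a: "a \<in> carrier IA" and x: "x \<in> mcomp (Q j) j"
  shows "\<exists>c B. radical_decomposition j (a \<odot>\<^bsub>Q j\<^esub> x) c B"
proof -
  interpret M: abelian_group "Q j" by (rule Q_group)
  have xc: "x \<in> carrier (Q j)" using mcomp_carrier x by blast
  have "finite ((\<lambda>(x, y). il x y) ` leq)" using finite_leq by simp
  then obtain N where N: "\<And>x y. (x, y) \<in> leq \<Longrightarrow> il x y \<le> N"
    unfolding finite_nat_set_iff_bounded_le by fastforce
  \<comment> \<open>The generator \<open>x\<close> has degree \<open>j\<close>, so the component of
    degree \<open>n\<close> comes from the part of \<open>a\<close> in degree \<open>n - j\<close>;
    \<open>N\<close> bounds the degrees that occur in the ring.\<close>
  define c where "c n = (if j \<le> n \<and> n \<le> j + N then part a (n - j) \<odot>\<^bsub>Q j\<^esub> x else \<zero>\<^bsub>Q j\<^esub>)" for n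
  have c: "c n \<in> mcomp (Q j) n" for n
    using mcomp_smult[OF part_hcomp[OF a, of "n - j"] x] mcomp_zero by (auto simp: c_def)
  have cc: "c n \<in> carrier (Q j)" for n using mcomp_carrier[OF c] .
  have "finsum (Q j) c {j..j + N} = a \<odot>\<^bsub>Q j\<^esub> x"
  proof (rule g_inj)
    show "finsum (Q j) c {j..j + N} \<in> carrier (Q j)" using cc by (intro M.finsum_closed) auto
    show "a \<odot>\<^bsub>Q j\<^esub> x \<in> carrier (Q j)" using smult_closed[OF a xc] .
    have "g j (finsum (Q j) c {j..j + N}) = (\<Sum>n\<in>{j..j + N}. g j (c n))"
      by (rule g_finsum) (simp_all add: cc)
    also have "\<dots> = act a (g j x)"
    proof (intro ext)
      fix b u w
      have "(\<Sum>n\<in>{j..j + N}. g j (c n)) b u w = (\<Sum>n\<in>{j..j + N}. \<Sum>z\<in>P. part a (n - j) u z * g j x b z w)"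
        unfolding fun_sum_apply[OF finite_atLeastAtMost]
        by (rule sum.cong) (auto simp: c_def g_smult[OF part_carrier[OF a] xc] act_def incidence_ring_sel)
      also have "\<dots> = (\<Sum>z\<in>P. \<Sum>n\<in>{j..j + N}. part a (n - j) u z * g j x b z w)"
        by (rule sum.swap)
      also have "\<dots> = (\<Sum>z\<in>P. a u z * g j x b z w)"
      proof (rule sum.cong[OF refl])
        fix z
        have "(\<Sum>n\<in>{j..j + N}. part a (n - j) u z * g j x b z w)
            = (\<Sum>n\<in>{j..j + N}. if n = j + il u z then a u z * g j x b z w else 0)"
          by (rule sum.cong) (auto simp: part_def)
        also have "\<dots> = a u z * g j x b z w"
          using N[of u z] a by (auto simp: incidence_ring_sel)
        finally show "(\<Sum>n\<in>{j..j + N}. part a (n - j) u z * g j x b z w) = a u z * g j x b z w" .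
      qed
      finally show "(\<Sum>n\<in>{j..j + N}. g j (c n)) b u w = act a (g j x) b u w"
        by (simp add: act_def incidence_ring_sel)
    qed
    also have "\<dots> = g j (a \<odot>\<^bsub>Q j\<^esub> x)" using g_smult[OF a xc] by simp
    finally show "g j (finsum (Q j) c {j..j + N}) = g j (a \<odot>\<^bsub>Q j\<^esub> x)" .
  qed
  moreover have "g j (c n) \<in> Rad j" if "n \<noteq> j" for n
    using part_Rad[OF a _ xc, of "n - j"] that Rad_zero g_zero by (auto simp: c_def)
  ultimately have "radical_decomposition j (a \<odot>\<^bsub>Q j\<^esub> x) c {j..j + N}"
    unfolding radical_decomposition_def using c by (auto simp: c_def)
  then show ?thesis by blast
qed

lemma radical_decomposition_exists:
  assumes "w \<in> carrier (Q j)"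
  shows "\<exists>c B. radical_decomposition j w c B"
proof -
  interpret M: abelian_group "Q j" by (rule Q_group)
  have "w \<in> generate (add_monoid (Q j)) {a \<odot>\<^bsub>Q j\<^esub> x | a x. a \<in> carrier IA \<and> x \<in> mcomp (Q j) j}"
    using assms generated_Q unfolding generated_in_degree_def by blast
  then show ?thesis
  proof (induction w rule: generate.induct)
    case one
    have "radical_decomposition j \<zero>\<^bsub>Q j\<^esub> (\<lambda>n. \<zero>\<^bsub>Q j\<^esub>) {}"
      by (simp add: radical_decomposition_def mcomp_zero g_zero Rad_zero)
    then show ?case by auto
  next
    case (incl h)
    then show ?case using radical_decomposition_smult by blast
  next
    case (inv h)
    then obtain c B where c: "radical_decomposition j h c B" using radical_decomposition_smult by blast
    then have cc: "c n \<in> carrier (Q j)" for n using mcomp_carrier by (auto simp: radical_decomposition_def)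
    have hc: "h \<in> carrier (Q j)"
      using c cc M.finsum_closed[of c B] by (auto simp: radical_decomposition_def)
    have "\<ominus>\<^bsub>Q j\<^esub> h = finsum (Q j) (\<lambda>n. \<ominus>\<^bsub>Q j\<^esub> c n) B"
    proof (rule g_inj)
      have "g j (\<ominus>\<^bsub>Q j\<^esub> h) = - (\<Sum>n\<in>B. g j (c n))"
        using c cc hc g_finsum[of B c j] by (simp add: g_neg radical_decomposition_def)
      also have "\<dots> = (\<Sum>n\<in>B. g j (\<ominus>\<^bsub>Q j\<^esub> c n))" using g_neg cc by (simp add: sum_negf)
      also have "\<dots> = g j (finsum (Q j) (\<lambda>n. \<ominus>\<^bsub>Q j\<^esub> c n) B)"
        by (rule g_finsum[symmetric]) (use c cc in \<open>auto simp: radical_decomposition_def\<close>)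
      finally show "g j (\<ominus>\<^bsub>Q j\<^esub> h) = g j (finsum (Q j) (\<lambda>n. \<ominus>\<^bsub>Q j\<^esub> c n) B)" .
    qed (use hc cc in \<open>auto intro!: M.finsum_closed\<close>)
    then have "radical_decomposition j (\<ominus>\<^bsub>Q j\<^esub> h) (\<lambda>n. \<ominus>\<^bsub>Q j\<^esub> c n) B"
      using c cc mcomp_neg g_neg Rad_neg by (auto simp: radical_decomposition_def)
    then show ?case by (auto simp: a_inv_def)
  next
    case (eng h1 h2)
    then obtain c B c' B' where c: "radical_decomposition j h1 c B" "radical_decomposition j h2 c' B'" by blast
    then have cc: "c n \<in> carrier (Q j)" "c' n \<in> carrier (Q j)" for n
      using mcomp_carrier[of "c n" j n] mcomp_carrier[of "c' n" j n] by (simp_all add: radical_decomposition_def)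
    have "h1 = finsum (Q j) c (B \<union> B')" "h2 = finsum (Q j) c' (B \<union> B')"
      using c cc by (auto simp: radical_decomposition_def intro!: M.add.finprod_mono_neutral_cong_left)
    then have "h1 \<oplus>\<^bsub>Q j\<^esub> h2 = finsum (Q j) (\<lambda>n. c n \<oplus>\<^bsub>Q j\<^esub> c' n) (B \<union> B')"
      using cc by (simp add: M.finsum_addf)
    then have "radical_decomposition j (h1 \<oplus>\<^bsub>Q j\<^esub> h2) (\<lambda>n. c n \<oplus>\<^bsub>Q j\<^esub> c' n) (B \<union> B')"
      using c cc mcomp_add g_add Rad_add by (auto simp: radical_decomposition_def)
    then show ?case by auto
  qed
qed

text \<open>A homogeneous element of degree \<open>k\<close> is its own component of degree
  \<open>k\<close> in the radical decomposition.\<close>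

lemma mcomp_Rad:
  assumes u: "u \<in> mcomp (Q j) k" and k: "k \<noteq> j"
  shows "g j u \<in> Rad j"
proof -
  interpret M: abelian_group "Q j" by (rule Q_group)
  obtain c B where c: "radical_decomposition j u c B"
    using radical_decomposition_exists[OF mcomp_carrier[OF u]] by blast
  have cc: "c n \<in> carrier (Q j)" for n using c mcomp_carrier by (auto simp: radical_decomposition_def)
  have "u = finsum (Q j) c (insert k B)"
    using c cc by (auto simp: radical_decomposition_def intro!: M.add.finprod_mono_neutral_cong_left)
  then have "c k = u"
    by (intro homogeneous_component_unique[OF u, of "insert k B"]) (use c in \<open>auto simp: radical_decomposition_def\<close>)
  then show ?thesis using c k by (auto simp: radical_decomposition_def)
qed

lemma mcomp_diff: "u \<in> mcomp (Q j) n \<Longrightarrow> v \<in> mcomp (Q j) n \<Longrightarrow> u \<ominus>\<^bsub>Q j\<^esub> v \<in> mcomp (Q j) n"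
  unfolding a_minus_def by (intro mcomp_add mcomp_neg)

lemma unit_hcomp: "(x, y) \<in> leq \<Longrightarrow> basis_elem 1 x y \<in> hcomp IA (il x y)"
  by (auto simp: incidence_ring_sel basis_elem_def)

lemma \<delta>_X_aux: "v \<in> X (Suc j) \<Longrightarrow> \<delta> j v \<in> X j"
  using d_closed by (auto simp: X_def \<delta>_g)

lemma entries_diff: "entries x y (F - G) = entries x y F - entries x y G"
  by (auto simp: entries_def basis_elem_def fun_eq_iff)

lemma retr_diff:
  assumes "F \<in> Fr j" "G \<in> Fr j"
  shows "retr j (F - G) = retr j F - retr j G"
  using retr_add[OF Fr_diff[OF assms] assms(2)] by simp

lemma unit_act_zero: "unit_act x y 0 = 0"
  by (simp add: unit_act_def fun_eq_iff)

lemma unit_act_add: "unit_act x y (F + G) = unit_act x y F + unit_act x y G"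
  by (simp add: unit_act_def fun_eq_iff)

text \<open>Multiplication by \<open>e\<^sub>x\<^sub>,\<^sub>x\<close> keeps exactly the summands
  whose first index is \<open>x\<close>.\<close>

lemma Rad_row:
  assumes v: "v \<in> Rad j" "unit_act x x v = v"
  shows "\<exists>f. (\<forall>y. (x, y) \<in> lt \<longrightarrow> f y \<in> X j \<and> unit_act y y (f y) = f y) \<and>
    v = (\<Sum>y\<in>{y. (x, y) \<in> lt}. unit_act x y (f y))"
proof -
  obtain h where h: "v = (\<Sum>(y, z)\<in>lt. unit_act y z (h y z))" "\<And>y z. h y z \<in> X j"
    using v(1) by (auto simp: Rad_def)
  have sum: "unit_act x x (sum f B) = (\<Sum>b\<in>B. unit_act x x (f b))" if "finite B"
    for f and B :: "('p \<times> 'p) set"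
    using that by (induction B rule: finite_induct)
      (simp_all add: unit_act_zero unit_act_add del: zero_fun_apply plus_fun_apply)
  have "v = unit_act x x (\<Sum>p\<in>lt. unit_act (fst p) (snd p) (h (fst p) (snd p)))"
    using v(2) h(1) by (simp add: case_prod_unfold)
  also have "\<dots> = (\<Sum>p\<in>lt. if fst p = x then unit_act x (snd p) (h x (snd p)) else 0)"
    unfolding sum[OF finite_lt] unit_act_unit_act by (rule sum.cong) auto
  also have "\<dots> = (\<Sum>p\<in>{p \<in> lt. fst p = x}. unit_act x (snd p) (h x (snd p)))"
    using finite_lt by (simp add: sum.inter_filter)
  also have "\<dots> = (\<Sum>y\<in>{y. (x, y) \<in> lt}. unit_act x y (h x y))"
    by (rule sum.reindex_bij_witness[where i = "\<lambda>y. (x, y)" and j = snd]) auto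
  also have "\<dots> = (\<Sum>y\<in>{y. (x, y) \<in> lt}. unit_act x y (unit_act y y (h x y)))"
    by (simp add: unit_act_unit_act)
  finally show ?thesis
    using h(2) unit_act_X leq_refl ltD(4)
    by (intro exI[of _ "\<lambda>y. unit_act y y (h x y)"]) (auto simp: unit_act_unit_act)
qed

sublocale chase: koszul_chase P leq unit_act X Gr \<delta> \<tau>
proof unfold_locales
  fix j show "0 \<in> X j" by (rule X_zero_aux)
next
  fix a b j assume "a \<in> X j" "b \<in> X j" then show "a - b \<in> X j" by (rule X_diff_aux)
next
  fix x y v j assume "(x, y) \<in> leq" "v \<in> X j" then show "unit_act x y v \<in> X j" by (rule unit_act_X)
next
  fix x y a b show "unit_act x y (a - b) = unit_act x y a - unit_act x y b" by (rule unit_act_diff)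
next
  fix x y z v show "unit_act x y (unit_act y z v) = unit_act x z v" by (simp add: unit_act_unit_act)
next
  fix x y v j assume "(x, y) \<in> leq" "v \<in> X j"
  then show "\<tau> j x y v \<in> X j"
    unfolding \<tau>_def by (intro retr_X entries_Fr X_Fr) (use leq_carrierD in auto)
next
  fix x y a b j assume "(x, y) \<in> leq" "a \<in> X j" "b \<in> X j"
  then show "\<tau> j x y (a - b) = \<tau> j x y a - \<tau> j x y b"
    using retr_diff[OF entries_Fr entries_Fr] X_Fr leq_carrierD unfolding \<tau>_def entries_diff by blast
next
  fix x y v j assume xy: "(x, y) \<in> leq" and v: "v \<in> X j"
  have y: "y \<in> P" using xy leq_carrierD by blast
  have "unit_act y y (entries x y v) = entries x y v"
    by (auto simp: unit_act_def entries_def basis_elem_def fun_eq_iff)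
  then show "unit_act y y (\<tau> j x y v) = \<tau> j x y v"
    using retr_unit[OF leq_refl[OF y] entries_Fr[OF X_Fr[OF v] y], of x] unfolding \<tau>_def by simp
next
  fix x z y v j assume *: "(x, z) \<in> leq" "(x, y) \<in> leq" "v \<in> X j"
  have "entries x y (unit_act x z v) = entries z y v" by (simp add: entries_def unit_act_def)
  moreover have "entries z y v = 0" if "(z, y) \<notin> leq"
    using X_Fr[OF *(3)] that by (auto simp: Fr_iff entries_def basis_elem_def fun_eq_iff)
  ultimately show "\<tau> j x y (unit_act x z v) = (if (z, y) \<in> leq then \<tau> j z y v else 0)"
    by (simp add: \<tau>_def retr_zero)
next
  fix x v j assume "x \<in> P" "v \<in> X j" "unit_act x x v = v"
  then show "(\<Sum>y | (x, y) \<in> leq. unit_act x y (\<tau> j x y v)) = v" by (rule \<tau>_split_aux)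
next
  fix v j assume "v \<in> X (Suc j)" then show "\<delta> j v \<in> X j" by (rule \<delta>_X_aux)
next
  fix a b j assume ab: "a \<in> X (Suc j)" "b \<in> X (Suc j)"
  then show "\<delta> j (a - b) = \<delta> j a - \<delta> j b"
    using \<delta>_add_aux[OF X_diff_aux[OF ab] ab(2)] by simp
next
  fix x y v j assume xy: "(x, y) \<in> leq" and "v \<in> X (Suc j)"
  then obtain u where u: "u \<in> carrier (Q (Suc j))" "v = g (Suc j) u" by (auto simp: X_def)
  have "unit_act x y v = g (Suc j) (basis_elem 1 x y \<odot>\<^bsub>Q (Suc j)\<^esub> u)" using g_unit[OF xy u(1)] u by simp
  then have "\<delta> j (unit_act x y v) = g j (d j (basis_elem 1 x y \<odot>\<^bsub>Q (Suc j)\<^esub> u))"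
    by (simp only: \<delta>_g[OF smult_closed[OF unit_closed[OF xy] u(1)]])
  also have "\<dots> = unit_act x y (g j (d j u))"
    by (simp only: d_smult[OF unit_closed[OF xy] u(1)] g_unit[OF xy d_closed[OF u(1)]])
  finally show "\<delta> j (unit_act x y v) = unit_act x y (\<delta> j v)"
    by (simp only: u(2) \<delta>_g[OF u(1)])
next
  fix v j assume v: "v \<in> X (Suc j)" "\<delta> j v = 0"
  then obtain u where u: "u \<in> carrier (Q (Suc j))" "v = g (Suc j) u" by (auto simp: X_def)
  have "d j u = \<zero>\<^bsub>Q j\<^esub>"
    by (rule g_inj[of _ j]) (use v u d_closed g_zero mcomp_carrier[OF mcomp_zero] in \<open>auto simp: \<delta>_g\<close>)
  then obtain w where "w \<in> carrier (Q (Suc (Suc j)))" "u = d (Suc j) w" using exact_Suc[of j] u by blast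
  then show "v \<in> \<delta> (Suc j) ` X (Suc (Suc j))" using u by (auto simp: X_def image_image \<delta>_g)
next
  fix v j assume "v \<in> X (Suc (Suc j))"
  then obtain u where u: "u \<in> carrier (Q (Suc (Suc j)))" "v = g (Suc (Suc j)) u" by (auto simp: X_def)
  then have "d j (d (Suc j) u) = \<zero>\<^bsub>Q j\<^esub>" using exact_Suc[of j] by blast
  then show "\<delta> j (\<delta> (Suc j) v) = 0" using u by (simp add: \<delta>_g d_closed g_zero)
next
  fix j n show "Gr j n \<subseteq> X j" using mcomp_carrier by (auto simp: Gr_def X_def)
next
  fix j n show "0 \<in> Gr j n" unfolding Gr_def using mcomp_zero g_zero by (metis image_eqI)
next
  fix a b j n assume "a \<in> Gr j n" "b \<in> Gr j n"
  then show "a - b \<in> Gr j n"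
    using mcomp_diff mcomp_carrier by (auto simp: Gr_def g_minus[symmetric])
next
  fix x y v j n assume xy: "(x, y) \<in> leq" and "v \<in> Gr j n"
  then obtain u where u: "u \<in> mcomp (Q j) n" "v = g j u" by (auto simp: Gr_def)
  then show "unit_act x y v \<in> Gr j (il x y + n)"
    using g_unit[OF xy mcomp_carrier[OF u(1)]] mcomp_smult[OF unit_hcomp[OF xy] u(1)]
    unfolding Gr_def by (metis image_eqI)
next
  fix x v j n assume x: "x \<in> P" and v: "v \<in> Gr j n" "unit_act x x v = v" "v \<in> \<delta> j ` X (Suc j)"
  obtain u where u: "u \<in> mcomp (Q j) n" "v = g j u" using v by (auto simp: Gr_def)
  obtain w0 where w0: "w0 \<in> carrier (Q (Suc j))" "v = g j (d j w0)" using v(3) by (auto simp: X_def \<delta>_g)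
  have "d j w0 = u" using g_inj[OF d_closed[OF w0(1)] mcomp_carrier[OF u(1)]] u w0 by simp
  then obtain w1 where w1: "w1 \<in> mcomp (Q (Suc j)) n" "d j w1 = u" using lift_aux[OF u(1) w0(1)] by blast
  \<comment> \<open>Multiplication by \<open>e\<^sub>x\<^sub>,\<^sub>x\<close> has degree 0 and
    fixes \<open>v\<close>, so the homogeneous preimage can be cut down to row
    \<open>x\<close>.\<close>
  let ?e = "basis_elem 1 x x"
  have e: "(x, x) \<in> leq" using leq_refl[OF x] .
  have "?e \<odot>\<^bsub>Q (Suc j)\<^esub> w1 \<in> mcomp (Q (Suc j)) n"
    using mcomp_smult[OF unit_hcomp[OF e] w1(1)] il_refl[OF x] by simp
  moreover have "g (Suc j) (?e \<odot>\<^bsub>Q (Suc j)\<^esub> w1) = unit_act x x (g (Suc j) w1)"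
    using g_unit[OF e mcomp_carrier[OF w1(1)]] .
  moreover have "\<delta> j (unit_act x x (g (Suc j) w1)) = v"
    using g_unit[OF e mcomp_carrier[OF w1(1)]] w1 u v(2) mcomp_carrier[OF w1(1)] mcomp_carrier[OF u(1)] e
    by (metis \<delta>_g d_smult g_unit smult_closed unit_closed)
  moreover have "unit_act x x (unit_act x x (g (Suc j) w1)) = unit_act x x (g (Suc j) w1)"
    by (simp add: unit_act_unit_act)
  ultimately show "\<exists>w\<in>Gr (Suc j) n. unit_act x x w = w \<and> \<delta> j w = v"
    unfolding Gr_def by (metis image_eqI)
next
  fix x v j n assume "x \<in> P" "v \<in> Gr j n" "n \<noteq> j" "unit_act x x v = v"
  then show "\<exists>f. (\<forall>y. (x, y) \<in> lt \<longrightarrow> f y \<in> X j \<and> unit_act y y (f y) = f y) \<and>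
      v = (\<Sum>y | (x, y) \<in> lt. unit_act x y (f y))"
    using mcomp_Rad Rad_row unfolding Gr_def by blast
qed

section \<open>The augmentation of the resolution and the vanishing of homology\<close>

abbreviation residue where "residue \<equiv> residue_module (IA :: ('p \<Rightarrow> 'k, _) graded_bimodule)"
abbreviation aug where "aug \<equiv> augmentation_ideal (IA :: ('p \<Rightarrow> 'k, _) graded_bimodule)"

interpretation res: graded_rring_quotient IA aug diagonal_ring diagonal "base_ring P"
  by (rule residue_quotient)

lemma residue_sel:
  "carrier residue = (\<lambda>a. aug +>\<^bsub>IA\<^esub> a) ` carrier IA"
  "\<zero>\<^bsub>residue\<^esub> = aug +>\<^bsub>IA\<^esub> \<zero>\<^bsub>IA\<^esub>"
  "\<lbrakk>a \<in> carrier IA; b \<in> carrier IA\<rbrakk> \<Longrightarrow> (aug +>\<^bsub>IA\<^esub> a) \<oplus>\<^bsub>residue\<^esub> (aug +>\<^bsub>IA\<^esub> b) = aug +>\<^bsub>IA\<^esub> (a \<oplus>\<^bsub>IA\<^esub> b)"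
  "\<lbrakk>a \<in> carrier IA; b \<in> carrier IA\<rbrakk> \<Longrightarrow> a \<odot>\<^bsub>residue\<^esub> (aug +>\<^bsub>IA\<^esub> b) = aug +>\<^bsub>IA\<^esub> (a \<otimes>\<^bsub>IA\<^esub> b)"
  "mcomp residue n = (\<lambda>a. aug +>\<^bsub>IA\<^esub> a) ` hcomp IA n"
  using res.carrier_QW res.zero_QW res.add_QW[of a b] res.mult_QW[of a b]
  by (simp_all add: residue_module_def Let_def quotient_rring_def)

text \<open>The augmentation with values in \<open>R\<close> itself in place of the classes modulo
  \<open>A\<^sub>+\<close>.\<close>

definition ev0 :: "'m \<Rightarrow> 'p \<Rightarrow> 'k" where
  "ev0 u = descend diagonal (eps u)"

definition ev where "ev F = ev0 (pr 0 F)"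

lemma eps_add: "u \<in> carrier (Q 0) \<Longrightarrow> v \<in> carrier (Q 0) \<Longrightarrow> eps (u \<oplus>\<^bsub>Q 0\<^esub> v) = eps u \<oplus>\<^bsub>residue\<^esub> eps v"
  and eps_smult: "a \<in> carrier IA \<Longrightarrow> u \<in> carrier (Q 0) \<Longrightarrow> eps (a \<odot>\<^bsub>Q 0\<^esub> u) = a \<odot>\<^bsub>residue\<^esub> eps u"
  and eps_mcomp: "u \<in> mcomp (Q 0) n \<Longrightarrow> eps u \<in> mcomp residue n"
  using eps_hom unfolding graded_left_module_hom_def left_module_hom_def by blast+

lemma eps_repr:
  assumes "u \<in> carrier (Q 0)"
  obtains a where "a \<in> carrier IA" "eps u = aug +>\<^bsub>IA\<^esub> a" "ev0 u = diagonal a"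
proof -
  have "eps u \<in> carrier residue" using eps_surj assms by blast
  then obtain a where "a \<in> carrier IA" "eps u = aug +>\<^bsub>IA\<^esub> a" unfolding residue_sel(1) by blast
  then show thesis using that res.descend_Phi[of a] by (simp add: ev0_def)
qed

lemma ev0_add:
  assumes "u \<in> carrier (Q 0)" "v \<in> carrier (Q 0)"
  shows "ev0 (u \<oplus>\<^bsub>Q 0\<^esub> v) = ev0 u + ev0 v"
proof -
  obtain a b where a: "a \<in> carrier IA" "eps u = aug +>\<^bsub>IA\<^esub> a" "ev0 u = diagonal a"
    and b: "b \<in> carrier IA" "eps v = aug +>\<^bsub>IA\<^esub> b" "ev0 v = diagonal b"
    using eps_repr assms by metis
  have ab: "a \<oplus>\<^bsub>IA\<^esub> b \<in> carrier IA" using a b by (auto simp: incidence_ring_sel)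
  have "ev0 (u \<oplus>\<^bsub>Q 0\<^esub> v) = diagonal (a \<oplus>\<^bsub>IA\<^esub> b)"
    unfolding ev0_def eps_add[OF assms] a(2) b(2) residue_sel(3)[OF a(1) b(1)] by (rule res.descend_Phi[OF ab])
  then show ?thesis using a b by (simp add: diagonal_def incidence_ring_sel fun_eq_iff)
qed

lemma ev0_smult:
  assumes "a \<in> carrier IA" "u \<in> carrier (Q 0)" "x \<in> P"
  shows "ev0 (a \<odot>\<^bsub>Q 0\<^esub> u) x = a x x * ev0 u x"
proof -
  obtain b where b: "b \<in> carrier IA" "eps u = aug +>\<^bsub>IA\<^esub> b" "ev0 u = diagonal b" using eps_repr assms by metis
  have "ev0 (a \<odot>\<^bsub>Q 0\<^esub> u) = diagonal (a \<otimes>\<^bsub>IA\<^esub> b)"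
    unfolding ev0_def eps_smult[OF assms(1,2)] b(2) residue_sel(4)[OF assms(1) b(1)]
    by (rule res.descend_Phi[OF IA_mult_closed[OF assms(1) b(1)]])
  then show ?thesis using diagonal_mult[OF assms(1) b(1) assms(3)] b(3) by (simp add: diagonal_def)
qed

lemma ev0_outside: "u \<in> carrier (Q 0) \<Longrightarrow> x \<notin> P \<Longrightarrow> ev0 u x = 0"
proof -
  assume "u \<in> carrier (Q 0)" "x \<notin> P"
  moreover from this(1) obtain a where "a \<in> carrier IA" "ev0 u = diagonal a" by (rule eps_repr)
  moreover have "(x, x) \<notin> leq" using leq_carrierD(1) \<open>x \<notin> P\<close> by blast
  ultimately show ?thesis by (simp add: diagonal_def incidence_ring_sel)
qed

lemma ev0_zero_iff: "u \<in> carrier (Q 0) \<Longrightarrow> ev0 u = 0 \<longleftrightarrow> u \<in> d 0 ` carrier (Q 1)"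
proof -
  assume u: "u \<in> carrier (Q 0)"
  obtain a where a: "a \<in> carrier IA" "eps u = aug +>\<^bsub>IA\<^esub> a" "ev0 u = diagonal a" using eps_repr[OF u] .
  have z: "\<zero>\<^bsub>IA\<^esub> \<in> carrier (IA :: ('p \<Rightarrow> 'k, _) graded_bimodule)" by (simp add: incidence_ring_sel)
  have "eps u = \<zero>\<^bsub>residue\<^esub> \<longleftrightarrow> diagonal a = diagonal \<zero>\<^bsub>IA\<^esub>"
    unfolding a(2) residue_sel(2) by (rule res.coset_eq_iff[OF a(1) z])
  also have "diagonal \<zero>\<^bsub>IA\<^esub> = (0 :: 'p \<Rightarrow> 'k)" by (simp add: diagonal_def incidence_ring_sel fun_eq_iff)
  finally show ?thesis using a(3) u exact_0 by auto
qed

lemma ev_g: "u \<in> carrier (Q 0) \<Longrightarrow> ev (g 0 u) = ev0 u"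
  by (simp add: ev_def pr_g)

lemma ev_diff: "F \<in> X 0 \<Longrightarrow> G \<in> X 0 \<Longrightarrow> ev (F - G) = ev F - ev G"
proof -
  assume "F \<in> X 0" "G \<in> X 0"
  then obtain u v where u: "u \<in> carrier (Q 0)" "F = g 0 u" and v: "v \<in> carrier (Q 0)" "G = g 0 v" by (auto simp: X_def)
  interpret M: abelian_group "Q 0" by (rule Q_group)
  have "u \<ominus>\<^bsub>Q 0\<^esub> v \<oplus>\<^bsub>Q 0\<^esub> v = u" using u v by (simp add: a_minus_def M.a_assoc M.l_neg)
  then have "ev0 u = ev0 (u \<ominus>\<^bsub>Q 0\<^esub> v) + ev0 v" using ev0_add[of "u \<ominus>\<^bsub>Q 0\<^esub> v" v] u v by simp
  moreover have "F - G = g 0 (u \<ominus>\<^bsub>Q 0\<^esub> v)" using u v g_minus by simp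
  then have "ev (F - G) = ev0 (u \<ominus>\<^bsub>Q 0\<^esub> v)" using u v ev_g by simp
  ultimately show ?thesis using u v by (simp add: ev_g)
qed

lemma ev_zero: "ev 0 = 0"
  using ev_diff[OF X_zero_aux X_zero_aux] by simp

lemma ev_unit:
  assumes "(x, y) \<in> leq" "F \<in> X 0"
  shows "ev (unit_act x y F) = (\<lambda>z. if z = x \<and> x = y then ev F z else 0)"
proof
  fix z
  obtain u where u: "u \<in> carrier (Q 0)" "F = g 0 u" using assms(2) by (auto simp: X_def)
  have "ev (unit_act x y F) = ev0 (basis_elem 1 x y \<odot>\<^bsub>Q 0\<^esub> u)"
    using g_unit[OF assms(1) u(1)] u ev_g smult_closed unit_closed[OF assms(1)] by metis
  then show "ev (unit_act x y F) z = (if z = x \<and> x = y then ev F z else 0)"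
    using ev0_smult[OF unit_closed[OF assms(1)] u(1), of z] ev0_outside[OF u(1), of z] u
      ev0_outside[OF smult_closed[OF unit_closed[OF assms(1)] u(1)], of z]
    by (cases "z \<in> P") (auto simp: ev_g basis_elem_def)
qed

lemma ev_zero_iff:
  assumes "F \<in> X 0" shows "ev F = 0 \<longleftrightarrow> F \<in> \<delta> 0 ` X 1"
proof -
  obtain u where u: "u \<in> carrier (Q 0)" "F = g 0 u" using assms by (auto simp: X_def)
  have "F \<in> \<delta> 0 ` X 1 \<longleftrightarrow> u \<in> d 0 ` carrier (Q 1)"
  proof
    assume "F \<in> \<delta> 0 ` X 1"
    then obtain w where "w \<in> carrier (Q 1)" "g 0 u = g 0 (d 0 w)" using u by (auto simp: X_def \<delta>_g)
    then show "u \<in> d 0 ` carrier (Q 1)" using g_inj[OF u(1) d_closed[of w 0]] by auto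
  next
    assume "u \<in> d 0 ` carrier (Q 1)"
    then show "F \<in> \<delta> 0 ` X 1" using u by (auto simp: X_def image_image \<delta>_g)
  qed
  then show ?thesis using ev0_zero_iff[OF u(1)] u ev_g by simp
qed

text \<open>The residue module vanishes in positive degrees, so the component of degree 0 of any
  preimage has the same value; \<open>e\<^sub>x\<^sub>,\<^sub>x\<close> then cuts it down to row
  \<open>x\<close>.\<close>

lemma ev_surj:
  assumes x: "x \<in> P"
  shows "\<exists>v\<in>Gr 0 0. unit_act x x v = v \<and> ev v = (\<lambda>z. if z = x then a else 0)"
proof -
  have xx: "(x, x) \<in> leq" using leq_refl[OF x] .
  have ax: "basis_elem a x x \<in> carrier IA" by (rule basis_elem_IA[OF xx])
  then obtain u where u: "u \<in> carrier (Q 0)" "eps u = aug +>\<^bsub>IA\<^esub> basis_elem a x x"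
    using eps_surj unfolding residue_sel(1) by (metis (no_types, lifting) imageE image_eqI)
  then have ev_u: "ev0 u = diagonal (basis_elem a x x)"
    unfolding ev0_def using res.descend_Phi[OF ax] by simp
  obtain c where c: "\<And>n. c n \<in> mcomp (Q 0) n" "finite {n. c n \<noteq> \<zero>\<^bsub>Q 0\<^esub>}"
    "u = finsum (Q 0) c {n. c n \<noteq> \<zero>\<^bsub>Q 0\<^esub>}"
    using internal_direct_sum_decompose[OF Q_sum u(1)] by blast
  let ?B = "{n. c n \<noteq> \<zero>\<^bsub>Q 0\<^esub>}"
  have "ev0 u = (\<Sum>n\<in>?B. ev0 (c n))"
    unfolding c(3) by (rule finsum_additive[OF Q_group c(2)]) (use c(1) mcomp_carrier ev0_add in blast)+
  also have "\<dots> = (\<Sum>n\<in>?B. if n = 0 then ev0 (c 0) else 0)"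
  proof (rule sum.cong[OF refl])
    fix n
    show "ev0 (c n) = (if n = 0 then ev0 (c 0) else 0)"
    proof (cases "n = 0")
      case False
      obtain b where b: "b \<in> hcomp IA n" "eps (c n) = aug +>\<^bsub>IA\<^esub> b"
        using eps_mcomp[OF c(1)[of n]] unfolding residue_sel(5) by blast
      then have bc: "b \<in> carrier IA" by (auto simp: incidence_ring_sel)
      have "ev0 (c n) = diagonal b" unfolding ev0_def b(2) by (rule res.descend_Phi[OF bc])
      also have "diagonal b = 0"
        using b(1) False il_refl leq_carrierD(1) by (fastforce simp: diagonal_def incidence_ring_sel fun_eq_iff)
      finally show ?thesis using False by simp
    qed simp
  qed
  also have "\<dots> = ev0 (c 0)"
  proof (cases "0 \<in> ?B")
    case False
    then have "g 0 (c 0) = 0" using g_zero by simp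
    then have "ev0 (c 0) = 0" using ev_g[OF mcomp_carrier[OF c(1)[of 0]]] ev_zero by simp
    then show ?thesis using False c(2) by simp
  qed (use c(2) in simp)
  finally have ev_c: "ev0 (c 0) = diagonal (basis_elem a x x)" using ev_u by simp
  have gX: "g 0 (c 0) \<in> X 0" using mcomp_carrier[OF c(1)[of 0]] unfolding X_def by blast
  let ?v = "unit_act x x (g 0 (c 0))"
  have "?v = g 0 (basis_elem 1 x x \<odot>\<^bsub>Q 0\<^esub> c 0)" using g_unit[OF xx mcomp_carrier[OF c(1)[of 0]]] by simp
  moreover have "basis_elem 1 x x \<odot>\<^bsub>Q 0\<^esub> c 0 \<in> mcomp (Q 0) 0"
    using mcomp_smult[OF unit_hcomp[OF xx] c(1)[of 0]] il_refl[OF x] by simp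
  ultimately have "?v \<in> Gr 0 0" unfolding Gr_def by blast
  moreover have "ev ?v = (\<lambda>z. if z = x then a else 0)"
    using ev_unit[OF xx gX] mcomp_carrier[OF c(1)[of 0]] ev_c
    by (auto simp: ev_g diagonal_def basis_elem_def fun_eq_iff)
  ultimately show ?thesis by (intro bexI[of _ ?v]) (simp_all add: unit_act_unit_act)
qed

text \<open>For \<open>x \<noteq> y\<close> the element \<open>e\<^sub>x\<^sub>,\<^sub>y\<close>
  acts by zero on the residue module. The augmentation thus removes the action term, and the bar
  complex with coefficients in \<open>R\<close> remains.\<close>

lemma ev_bd:
  assumes l: "l \<in> base_chains p n" and w: "\<And>l. l \<in> base_chains p (Suc n) \<Longrightarrow> w l \<in> X 0"
  shows "ev (chase.bd w l) = insertions (\<lambda>l. ev (w l)) l"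
proof -
  let ?U = "{y. (hd l, y) \<in> lt}"
  let ?f = "\<lambda>y. unit_act (hd l) y (w (y # l))"
  have 1: "insertions w l \<in> X 0 \<and> insertions (\<lambda>l. ev (w l)) l = ev (insertions w l)"
    by (rule insertions_induct[where T = ev and B = "X 0"])
      (use l w in \<open>auto simp: base_chains_def X_zero_aux X_diff_aux ev_zero ev_diff\<close>)
  have neg: "- F \<in> X 0" "ev (- F) = - ev F" if "F \<in> X 0" for F
    using X_diff_aux[OF X_zero_aux that] ev_diff[OF X_zero_aux that] ev_zero by simp_all
  have add: "F + G \<in> X 0" "ev (F + G) = ev F + ev G" if "F \<in> X 0" "G \<in> X 0" for F G
    using X_diff_aux[OF that(1) neg(1)[OF that(2)]] ev_diff[OF that(1) neg(1)[OF that(2)]] neg(2)[OF that(2)]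
    by simp_all
  have f: "?f y \<in> X 0" "ev (?f y) = 0" if "(hd l, y) \<in> lt" for y
    using unit_act_X[OF ltD(1)[OF that] w[OF base_chains_Cons[OF l that]]]
      ev_unit[OF ltD(1)[OF that] w[OF base_chains_Cons[OF l that]]] ltD(2)[OF that]
    by (auto simp: fun_eq_iff)
  have "sum ?f Z \<in> X 0 \<and> ev (sum ?f Z) = 0" if "finite Z" "Z \<subseteq> ?U" for Z
    using that by (induction Z rule: finite_induct) (auto simp: X_zero_aux ev_zero add f)
  then have "sum ?f ?U \<in> X 0" "ev (sum ?f ?U) = 0" using finite_between by auto
  then have "sg k (sum ?f ?U) \<in> X 0" "ev (sg k (sum ?f ?U)) = 0" for k
    using neg by (auto simp: sg_def)
  then show ?thesis using 1 add unfolding chase.bd_def by simp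
qed

text \<open>The values of \<open>z\<close> are lifted to degree 0 of \<open>X 0\<close>. Exactness
  at the augmentation turns the cycle condition into the hypothesis of the chase at
  \<open>j = 0\<close>, and the augmentation of the function found there bounds
  \<open>z\<close>.\<close>

theorem chain_homology_vanishes:
  fixes z :: "'p list \<Rightarrow> 'k"
  assumes p: "p \<in> P" and n: "n \<noteq> m"
    and supp: "\<And>l. l \<in> base_chains p (Suc n) \<Longrightarrow> z l \<noteq> 0 \<Longrightarrow> il p (hd l) = m"
    and cycle: "\<And>l. l \<in> base_chains p n \<Longrightarrow> insertions z l = 0"
  shows "\<exists>y. \<forall>l\<in>base_chains p (Suc n). z l = insertions y l"
proof -
  have "\<exists>v\<in>chase.GX p m 0 (hd l). ev v = (\<lambda>x. if x = hd l then z l else 0)"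
    if l: "l \<in> base_chains p (Suc n)" for l
  proof (cases "z l = 0")
    case True
    have "0 \<in> chase.GX p m 0 (hd l)" by (simp add: chase.GX_def X_zero_aux chase.Gr_zero)
    then show ?thesis using True ev_zero by (intro bexI[of _ 0]) auto
  next
    case False
    have "hd l \<in> P" using l rchain_hd by (auto simp: base_chains_def)
    then obtain v where "v \<in> Gr 0 0" "unit_act (hd l) (hd l) v = v" "ev v = (\<lambda>x. if x = hd l then z l else 0)"
      using ev_surj by blast
    then show ?thesis using supp[OF l False] chase.Gr_X by (intro bexI[of _ v]) (auto simp: chase.GX_def)
  qed
  then obtain u where u: "\<And>l. l \<in> base_chains p (Suc n) \<Longrightarrow> u l \<in> chase.GX p m 0 (hd l)"
    "\<And>l. l \<in> base_chains p (Suc n) \<Longrightarrow> ev (u l) = (\<lambda>x. if x = hd l then z l else 0)" by metis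
  have uX: "u l \<in> X 0" if "l \<in> base_chains p (Suc n)" for l using u(1)[OF that] by (simp add: chase.GX_def)
  have app: "insertions F l x = insertions (\<lambda>l. F l x) l" for F :: "'p list \<Rightarrow> 'p \<Rightarrow> 'k" and l x
  proof (induction F l rule: insertions.induct)
    case (1 F a b c)
    have sum: "(\<Sum>z\<in>Z. f z) x = (\<Sum>z\<in>Z. f z x)" for f :: "'p \<Rightarrow> 'p \<Rightarrow> 'k" and Z
      by (induction Z rule: infinite_finite_induct) auto
    have "sg k f x = sg k (f x)" for k and f :: "'p \<Rightarrow> 'k" by (simp add: sg_def)
    then show ?case using 1 by (simp add: sum)
  qed auto
  have rc: "\<lbrakk>l \<in> base_chains p k; rchain l'; last l' = last l; length l' = Suc (length l)\<rbrakk>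
    \<Longrightarrow> l' \<in> base_chains p (Suc k)" for l l' k by (simp add: base_chains_def)
  have "chase.bd u l \<in> \<delta> 0 ` X (Suc 0)" if l: "l \<in> base_chains p n" for l
  proof -
    have bX: "chase.bd u l \<in> X 0" using chase.bd_GX[OF l u(1)] by (simp add: chase.GX_def)
    have "ev (chase.bd u l) x = 0" for x
    proof -
      have "ev (chase.bd u l) x = insertions (\<lambda>l. ev (u l) x) l" using ev_bd[OF l uX] app by simp
      also have "\<dots> = insertions (\<lambda>l'. if x = hd l then z l' else 0) l"
      proof -
        have "insertions (\<lambda>l'. ev (u l') x - (if x = hd l then z l' else 0)) l \<in> {0} \<and>
          insertions (\<lambda>l'. id (ev (u l') x - (if x = hd l then z l' else 0))) l
            = id (insertions (\<lambda>l'. ev (u l') x - (if x = hd l then z l' else 0)) l)"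
          by (rule insertions_induct) (use l u(2)[OF rc[OF l]] in \<open>auto simp: base_chains_def\<close>)
        then show ?thesis
          using insertions_add[of "\<lambda>l. ev (u l) x" "\<lambda>l'. - (if x = hd l then z l' else 0)" l]
            insertions_uminus[of "\<lambda>l'. if x = hd l then z l' else 0" l] by simp
      qed
      also have "\<dots> = 0" using cycle[OF l] insertions_zero by (cases "x = hd l") auto
      finally show ?thesis .
    qed
    then have "ev (chase.bd u l) = 0" by (simp add: fun_eq_iff)
    then show ?thesis using ev_zero_iff[OF bX] by simp
  qed
  then have "\<exists>y. (\<forall>l\<in>base_chains p (Suc (Suc n)). y l \<in> chase.XE 0 (hd l)) \<and>
    (\<forall>l\<in>base_chains p (Suc n). u l - chase.bd y l \<in> \<delta> 0 ` X (Suc 0))"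
    using n u(1) by (intro chase.chase[OF p]) auto
  then obtain y where y: "\<And>l. l \<in> base_chains p (Suc (Suc n)) \<Longrightarrow> y l \<in> chase.XE 0 (hd l)"
    "\<And>l. l \<in> base_chains p (Suc n) \<Longrightarrow> u l - chase.bd y l \<in> \<delta> 0 ` X (Suc 0)"
    by blast
  have yX: "y l \<in> X 0" if "l \<in> base_chains p (Suc (Suc n))" for l using y(1)[OF that] by (simp add: chase.XE_def)
  \<comment> \<open>Insertions keep the head, so the component at \<open>hd l\<close> can be read
    off at the head of each longer chain; this makes the bounding function independent of
    \<open>l\<close>.\<close>
  have "z l = insertions (\<lambda>l'. ev (y l') (hd l')) l" if l: "l \<in> base_chains p (Suc n)" for l
  proof -
    have bX: "chase.bd y l \<in> X 0" using chase.bd_XE[OF l y(1)] by (simp add: chase.XE_def)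
    have "ev (u l - chase.bd y l) = 0" using y(2)[OF l] ev_zero_iff[OF X_diff_aux[OF uX[OF l] bX]] by simp
    then have "ev (u l) = insertions (\<lambda>l. ev (y l)) l" using ev_diff[OF uX[OF l] bX] ev_bd[OF l yX] by simp
    then have "z l = insertions (\<lambda>l'. ev (y l') (hd l)) l" using u(2)[OF l] app by (metis (mono_tags))
    also have "\<dots> = insertions (\<lambda>l'. ev (y l') (hd l')) l" by (rule insertions_cong_hd) simp
    finally show ?thesis .
  qed
  then show ?thesis by blast
qed

end


section \<open>Acyclicity off the saturated chains\<close>

context graded_poset begin

lemma koszul_homology:
  fixes z :: "'p list \<Rightarrow> 'k::field"
  assumes "koszul_ring TYPE('m) (IA :: ('p \<Rightarrow> 'k, _) graded_bimodule)"
    and "p \<in> P" "n \<noteq> m"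
    and "\<And>l. l \<in> base_chains p (Suc n) \<Longrightarrow> z l \<noteq> 0 \<Longrightarrow> il p (hd l) = m"
    and "\<And>l. l \<in> base_chains p n \<Longrightarrow> insertions z l = 0"
  shows "\<exists>y. \<forall>l\<in>base_chains p (Suc n). z l = insertions y l"
proof -
  obtain Q :: "nat \<Rightarrow> ('p \<Rightarrow> 'p \<Rightarrow> 'k, 'm) graded_module" and d eps where
    Q: "\<forall>n. graded_left_module IA (Q n) \<and> projective_left_module IA (Q n) \<and> generated_in_degree IA (Q n) n"
    and d: "\<forall>n. d n \<in> graded_left_module_hom IA (Q (Suc n)) (Q n)"
    and eps: "eps \<in> graded_left_module_hom IA (Q 0) (residue_module IA)"
      "eps ` carrier (Q 0) = carrier (residue_module (IA :: ('p \<Rightarrow> 'k, _) graded_bimodule))"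
    and exact: "d 0 ` carrier (Q 1) = {x \<in> carrier (Q 0). eps x = \<zero>\<^bsub>residue_module (IA :: ('p \<Rightarrow> 'k, _) graded_bimodule)\<^esub>}"
      "\<forall>n. d (Suc n) ` carrier (Q (Suc (Suc n))) = {x \<in> carrier (Q (Suc n)). d n x = \<zero>\<^bsub>Q n\<^esub>}"
    using assms(1) unfolding koszul_ring_def by (elim exE conjE) (rule that; assumption)
  have "\<forall>n. \<exists>g. \<exists>p. coordinates (Q n) g p"
    using Q projective_coordinates by (intro allI) auto
  then obtain g where "\<forall>n. \<exists>p. coordinates (Q n) (g n) p" by (rule choice[THEN exE])
  then obtain pr where "\<forall>n. coordinates (Q n) (g n) (pr n)" by (rule choice[THEN exE])
  then interpret koszul_resolution P leq Q d eps g pr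
    by unfold_locales (use Q d eps exact in simp_all)
  show ?thesis using chain_homology_vanishes assms(2-) by blast
qed

lemma rchain_iff: "rchain l \<longleftrightarrow> rev l \<in> chains"
proof (induction l rule: rchain.induct)
  case (3 x y c)
  have "rev (x # y # c) \<in> chains \<longleftrightarrow> rev (y # c) @ [x] \<in> pwalks P lt" by (simp add: chains_def)
  also have "\<dots> \<longleftrightarrow> rev (y # c) \<in> pwalks P lt \<and> x \<in> P \<and> (y, x) \<in> lt"
    by (subst pwalks_append) (auto simp: last_rev)
  finally show ?case using 3 ltD(4) by (auto simp: chains_def)
qed (auto simp: chains_def)

text \<open>\<open>boundary\<close> inserts every point of \<open>P\<close>,
  \<open>insertions\<close> only those strictly inside the gap; the hypothesis on \<open>G\<close>
  removes the difference.\<close>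

lemma boundary_insertions:
  assumes "\<And>a y z b. (y, z) \<notin> lt \<Longrightarrow> G (a @ y # z # b) = 0"
  shows "boundary G (rev l) = insertions (\<lambda>l. G (rev l)) l"
  using assms
proof (induction l arbitrary: G rule: rchain.induct)
  case (3 x y c)
  let ?n = "length c"
  have "boundary G (rev (x # y # c))
      = (\<Sum>i<?n. (-1) ^ i * (\<Sum>z\<in>P. G (ins i z (rev (x # y # c))))) + (-1) ^ ?n * (\<Sum>z\<in>P. G (ins ?n z (rev (x # y # c))))"
    by (simp add: boundary_def)
  also have "(\<Sum>i<?n. (-1) ^ i * (\<Sum>z\<in>P. G (ins i z (rev (x # y # c))))) = boundary (\<lambda>e. G (e @ [x])) (rev (y # c))"
    unfolding boundary_def by (rule sum.cong) (auto simp: ins_def)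
  also have "\<dots> = insertions (\<lambda>l. G (rev (x # l))) (y # c)"
    using 3(1)[of "\<lambda>e. G (e @ [x])"] 3(2) by simp
  also have "(\<Sum>z\<in>P. G (ins ?n z (rev (x # y # c)))) = (\<Sum>z\<in>P. G (rev (x # z # y # c)))"
    by (simp add: ins_def)
  also have "\<dots> = (\<Sum>z\<in>{z. (y, z) \<in> lt \<and> (z, x) \<in> lt}. G (rev (x # z # y # c)))"
  proof (rule sum.mono_neutral_right[OF finite_P])
    show "\<forall>z\<in>P - {z. (y, z) \<in> lt \<and> (z, x) \<in> lt}. G (rev (x # z # y # c)) = 0"
      using 3(2)[of y _ "rev c" "[x]"] 3(2)[of _ x "rev c @ [y]" "[]"] by auto
  qed (use ltD in blast)
  finally show ?case by (simp add: sg_def add.commute)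
qed (simp_all add: boundary_def)

text \<open>Each step has length at least one, with equality only for covering pairs.\<close>

lemma chain_length_il:
  "c \<in> chains \<Longrightarrow> length c \<le> Suc (il (hd c) (last c)) \<and> (length c = Suc (il (hd c) (last c)) \<longrightarrow> c \<in> pwalks P cov)"
proof (induction c rule: rchain.induct)
  case (3 x y c)
  then have yc: "y # c \<in> chains" and xy: "(x, y) \<in> lt" by (auto simp: chains_def)
  have "(y, last (y # c)) \<in> leq"
  proof -
    have "\<forall>z\<in>set c. (y, z) \<in> leq" using yc ltD(1) by (auto simp: chains_iff)
    then show ?thesis using ltD(4)[OF xy] leq_refl by (cases c rule: rev_cases) auto
  qed
  then have "il x (last (y # c)) = il x y + il y (last (y # c))" using il_add ltD(1)[OF xy] by blast
  moreover have "il x y > 0" using il_pos ltD[OF xy] by blast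
  ultimately show ?case using 3(1)[OF yc] xy ltD by (auto simp: cov_def)
qed (auto simp: chains_def)

text \<open>The boundary preserves both ends of a chain, so \<open>z\<close> splits into cycles
  according to \<open>\<kappa>\<close>. Off the diagonal such a piece is a boundary, and adjunction
  moves the boundary to \<open>dif F = 0\<close>; on the diagonal the chains are saturated and
  \<open>F\<close> vanishes.\<close>

lemma cycle_pairing_zero:
  fixes F z :: "'p list \<Rightarrow> 'k::field"
  assumes koszul: "koszul_ring TYPE('m) (IA :: ('p \<Rightarrow> 'k, _) graded_bimodule)"
    and F: "dif F = (\<lambda>c. 0)" "\<And>c. c \<in> pwalks P cov \<Longrightarrow> F c = 0"
    and z: "\<And>c. c \<notin> chains \<Longrightarrow> z c = 0" "\<And>c. c \<in> chains \<Longrightarrow> boundary z c = 0"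
  shows "(\<Sum>c\<in>chains. F c * z c) = 0"
proof -
  define \<kappa> where "\<kappa> c = (hd c, length c, il (hd c) (last c))" for c
  have step: "G (a @ y # w # b) = 0"
    if "(y, w) \<notin> lt" "\<And>c. c \<notin> chains \<Longrightarrow> G c = 0" for G :: "'p list \<Rightarrow> 'k" and a y w b
  proof (rule that(2))
    show "a @ y # w # b \<notin> chains"
      using that(1) by (auto simp: chains_def pwalks_def walks_def successively_append_iff)
  qed
  have bdI: "boundary G c = insertions (\<lambda>l. G (rev l)) (rev c)"
    if "\<And>c. c \<notin> chains \<Longrightarrow> G c = 0" for G :: "'p list \<Rightarrow> 'k" and c
    using boundary_insertions[of G "rev c", OF step[of _ _ G, OF _ that]] by simp
  have "(\<Sum>c\<in>{c \<in> chains. \<kappa> c = k}. F c * z c) = 0" if k: "k \<in> \<kappa> ` chains" for k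
  proof -
    obtain c0 where c0: "c0 \<in> chains" "\<kappa> c0 = k" using k by blast
    define p n m where "p = hd c0" and "n = length c0 - 1" and "m = il (hd c0) (last c0)"
    have p: "p \<in> P" using c0 by (cases c0) (auto simp: p_def chains_iff)
    have n: "length c0 = Suc n" using c0 by (cases c0) (auto simp: n_def chains_iff)
    have keq: "k = (p, Suc n, m)" using c0(2) n by (simp add: \<kappa>_def p_def m_def)
    show ?thesis
    proof (cases "n = m")
      case True
      have "F c = 0" if "c \<in> chains" "\<kappa> c = k" for c
        using chain_length_il[OF that(1)] that(2) keq True F(2) by (auto simp: \<kappa>_def)
      then show ?thesis by (intro sum.neutral) auto
    next
      case False
      \<comment> \<open>Only the degree has to be restricted here. It depends on the head alone,
        which insertions keep, so \<open>zz\<close> is still a cycle.\<close>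
      define zz where "zz l = (if il p (hd l) = m then z (rev l) else 0)" for l
      have "\<exists>y. \<forall>l\<in>base_chains p (Suc n). zz l = insertions y l"
      proof (rule koszul_homology[OF koszul p False])
        fix l assume l: "l \<in> base_chains p n"
        have "insertions zz l = insertions (\<lambda>l'. if il p (hd l) = m then z (rev l') else 0) l"
          by (rule insertions_cong_hd) (simp add: zz_def)
        also have "\<dots> = 0"
          using bdI[of z "rev l", OF z(1)] z(2)[of "rev l"] l rchain_iff[of l] insertions_zero
          by (cases "il p (hd l) = m") (auto simp: base_chains_def)
        finally show "insertions zz l = 0" .
      qed (simp add: zz_def split: if_splits)
      then obtain y where y: "\<And>l. l \<in> base_chains p (Suc n) \<Longrightarrow> zz l = insertions y l" by blast
      \<comment> \<open>With \<open>y\<close> restricted to one base point, length and degree, its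
        boundary is \<open>z\<close> on the piece \<open>k\<close> and 0 on all other
        chains.\<close>
      define y' where "y' c = (if c \<in> chains \<and> hd c = p \<and> length c = Suc (Suc n) \<and> il p (last c) = m then y (rev c) else 0)" for c
      have y'0: "y' c = 0" if "c \<notin> chains" for c using that by (simp add: y'_def)
      have bd: "boundary y' c = (if \<kappa> c = k then z c else 0)" if c: "c \<in> chains" for c
      proof -
        have rc: "rchain (rev c)" using c rchain_iff[of "rev c"] by simp
        have ne: "c \<noteq> []" using c by (auto simp: chains_def)
        have "boundary y' c = insertions (\<lambda>l. y' (rev l)) (rev c)" by (rule bdI[OF y'0])
        also have "\<dots> = (if \<kappa> c = k then z c else 0)"
        proof (cases "\<kappa> c = k")
          case True
          then have "rev c \<in> base_chains p (Suc n)" using rc ne by (auto simp: base_chains_def \<kappa>_def keq last_rev)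
          moreover have "insertions (\<lambda>l. y' (rev l)) (rev c) = insertions y (rev c)"
            using True ne by (intro insertions_cong[OF rc])
              (auto simp: y'_def \<kappa>_def keq rchain_iff hd_rev last_rev)
          ultimately show ?thesis using y[of "rev c"] True ne by (auto simp: zz_def \<kappa>_def keq hd_rev)
        next
          case False
          have "insertions (\<lambda>l. y' (rev l)) (rev c) = insertions (\<lambda>l. 0) (rev c)"
          proof (rule insertions_cong[OF rc])
            fix l assume "rchain l" "last l = last (rev c)" "hd l = hd (rev c)" "length l = Suc (length (rev c))"
            moreover then have "l \<noteq> []" by auto
            ultimately show "y' (rev l) = 0" using False ne by (auto simp: y'_def \<kappa>_def keq hd_rev last_rev)
          qed
          then show ?thesis using False insertions_zero by simp
        qed
        finally show ?thesis .
      qed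
      have "(\<Sum>c\<in>{c \<in> chains. \<kappa> c = k}. F c * z c) = (\<Sum>c\<in>chains. F c * boundary y' c)"
        by (rule sum.mono_neutral_cong_left) (auto simp: finite_chains bd)
      also have "\<dots> = (\<Sum>c\<in>chains. dif F c * y' c)" by (rule boundary_adjoint[OF y'0])
      finally show ?thesis by (simp add: F(1))
    qed
  qed
  then have "(\<Sum>k\<in>\<kappa> ` chains. \<Sum>c\<in>{c \<in> chains. \<kappa> c = k}. F c * z c) = 0" by simp
  then show ?thesis using sum.image_gen[OF finite_chains, of "\<lambda>c. F c * z c" \<kappa>] by simp
qed

text \<open>As a functional \<open>F\<close> kills the cycles, hence it factors through the boundary
  map \<open>L\<close>. Composing it with a linear \<open>h\<close> that inverts \<open>L\<close> on
  its image gives the desired \<open>G\<close>.\<close>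

lemma koszul_acyclic:
  fixes F :: "'p list \<Rightarrow> 'k::field"
  assumes koszul: "koszul_ring TYPE('m) (IA :: ('p \<Rightarrow> 'k, _) graded_bimodule)"
    and F: "F \<in> carrier chain_ring" "dif F = (\<lambda>c. 0)" "\<And>c. c \<in> pwalks P cov \<Longrightarrow> F c = 0"
  shows "\<exists>G\<in>carrier chain_ring. dif G = F"
proof -
  let ?s = "\<lambda>(a :: 'k) (f :: 'p list \<Rightarrow> 'k) c. a * f c"
  interpret V: vector_space ?s
    by unfold_locales (auto simp: fun_eq_iff algebra_simps)
  interpret VV: vector_space_pair ?s ?s by unfold_locales
  \<comment> \<open>Restricting to \<open>chains\<close> before and after the boundary makes
    \<open>L\<close> a linear endomorphism of the space of all functions on lists.\<close>
  define res where "res z c = (if c \<in> chains then z c else 0)" for z :: "'p list \<Rightarrow> 'k" and c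
  define L where "L z c = (if c \<in> chains then boundary (res z) c else 0)" for z :: "'p list \<Rightarrow> 'k" and c
  define \<phi> where "\<phi> z = (\<Sum>c\<in>chains. F c * z c)" for z :: "'p list \<Rightarrow> 'k"
  have res_lin: "res (a + b) = res a + res b" "res (?s k a) = ?s k (res a)" for a b k
    by (auto simp: res_def fun_eq_iff)
  have bd_lin: "boundary (a + b) c = boundary a c + boundary b c" "boundary (?s k a) c = k * boundary a c"
    for a b :: "'p list \<Rightarrow> 'k" and k c
    by (simp_all add: boundary_def sum.distrib algebra_simps sum_distrib_left)
  have L: "Vector_Spaces.linear ?s ?s L"
    unfolding Vector_Spaces.linear_iff
    by (intro conjI allI V.vector_space_axioms) (auto simp: L_def res_lin bd_lin fun_eq_iff)
  then obtain h where h: "Vector_Spaces.linear ?s ?s h" "\<And>v. L (h (L v)) = L v"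
    using VV.linear_exists_right_inverse_on[OF L V.subspace_UNIV] by auto
  have L_add: "L (a + b) = L a + L b" for a b by (rule VV.linear_add[OF L])
  have \<phi>_lin: "\<phi> (a - b) = \<phi> a - \<phi> b" for a b
    by (simp add: \<phi>_def algebra_simps sum_subtractf)
  have \<phi>_ker: "\<phi> z = 0" if "L z = 0" for z
  proof -
    have "(\<Sum>c\<in>chains. F c * res z c) = 0"
    proof (rule cycle_pairing_zero[OF koszul F(2,3)])
      show "boundary (res z) c = 0" if "c \<in> chains" for c
        using fun_cong[OF \<open>L z = 0\<close>, of c] that by (simp add: L_def)
    qed (auto simp: res_def)
    then show ?thesis by (simp add: \<phi>_def res_def cong: sum.cong)
  qed
  have \<phi>_h: "\<phi> (h (L v)) = \<phi> v" for v
  proof -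
    have "L (v - h (L v)) = 0" using VV.linear_diff[OF L, of v "h (L v)"] h(2) by simp
    then show ?thesis using \<phi>_ker \<phi>_lin by (metis eq_iff_diff_eq_0)
  qed
  define ind where "ind c = (\<lambda>e. if e = c then 1 else 0 :: 'k)" for c :: "'p list"
  \<comment> \<open>The functional obtained is evaluated at indicator functions, which yields the
    coefficients of a cochain.\<close>
  define G where "G c = (if c \<in> chains then \<phi> (h (ind c)) else 0)" for c
  have "dif G e = F e" for e
  proof (cases "e \<in> chains")
    case True
    have ind0: "ind e c = 0" if "c \<notin> chains" for c using True that by (auto simp: ind_def)
    have rind: "res (ind e) = ind e" using ind0 by (auto simp: res_def fun_eq_iff)
    have "dif G e = (\<Sum>c\<in>chains. dif G c * ind e c)"
      using True finite_chains by (simp add: ind_def if_distrib cong: if_cong)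
    also have "\<dots> = (\<Sum>c\<in>chains. G c * boundary (ind e) c)" by (rule boundary_adjoint[OF ind0, symmetric])
    also have "\<dots> = (\<Sum>c\<in>chains. L (ind e) c * \<phi> (h (ind c)))"
      by (rule sum.cong) (auto simp: G_def L_def rind)
    also have "\<dots> = \<phi> (h (\<Sum>c\<in>chains. ?s (L (ind e) c) (ind c)))"
    proof -
      have \<phi>_add: "\<phi> (a + b) = \<phi> a + \<phi> b" "\<phi> (?s k a) = k * \<phi> a" for a b k
        by (simp_all add: \<phi>_def algebra_simps sum.distrib sum_distrib_left)
      have \<phi>0: "\<phi> 0 = 0" using \<phi>_lin[of 0 0] by simp
      have "\<phi> (h (\<Sum>c\<in>B. ?s (f c) (ind c))) = (\<Sum>c\<in>B. f c * \<phi> (h (ind c)))" if "finite B" for B f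
        using that
      proof (induction B rule: finite_induct)
        case empty
        show ?case using VV.linear_0[OF h(1)] \<phi>0 by (simp del: zero_fun_apply)
      next
        case (insert b B)
        have "\<phi> (h (?s (f b) (ind b) + (\<Sum>c\<in>B. ?s (f c) (ind c))))
            = f b * \<phi> (h (ind b)) + \<phi> (h (\<Sum>c\<in>B. ?s (f c) (ind c)))"
          using VV.linear_add[OF h(1)] VV.linear_scale[OF h(1)] \<phi>_add by simp
        then show ?case using insert by (simp del: plus_fun_apply)
      qed
      then show ?thesis using finite_chains by simp
    qed
    also have "(\<Sum>c\<in>chains. ?s (L (ind e) c) (ind c)) = L (ind e)"
    proof
      fix x
      have "(\<Sum>c\<in>B. f c) x = (\<Sum>c\<in>B. f c x)" for f :: "'p list \<Rightarrow> 'p list \<Rightarrow> 'k" and B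
        by (induction B rule: infinite_finite_induct) auto
      then have "(\<Sum>c\<in>chains. ?s (L (ind e) c) (ind c)) x = (\<Sum>c\<in>chains. L (ind e) c * ind c x)" by simp
      also have "\<dots> = (\<Sum>c\<in>chains. if c = x then L (ind e) x else 0)"
        by (rule sum.cong) (auto simp: ind_def)
      also have "\<dots> = L (ind e) x" using finite_chains by (simp add: L_def)
      finally show "(\<Sum>c\<in>chains. ?s (L (ind e) c) (ind c)) x = L (ind e) x" .
    qed
    also have "\<phi> (h (L (ind e))) = \<phi> (ind e)" by (rule \<phi>_h)
    also have "\<dots> = F e" using True finite_chains by (simp add: \<phi>_def ind_def if_distrib cong: if_cong)
    finally show ?thesis .
  next
    case False
    then show ?thesis using F(1) by (simp add: dif_def chain_ringD)
  qed
  moreover have "G \<in> carrier chain_ring" by (auto simp: chain_ring_carrier G_def)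
  ultimately show ?thesis by blast
qed

end


section \<open>The cochain ring of the incidence ring\<close>

locale poset_over_field = graded_poset P leq for P :: "'p set" and leq :: "'p rel" +
  fixes K :: "'k::field itself"
begin

abbreviation KA :: "('p \<Rightarrow> 'k, 'p \<Rightarrow> 'p \<Rightarrow> 'k) graded_bimodule" where
  "KA \<equiv> incidence_ring P leq"

abbreviation KR :: "('p \<Rightarrow> 'k) ring" where
  "KR \<equiv> base_ring P"

sublocale br: incidence_bimodule P lt "positive_part KA"
proof
  show "finite P" by (rule finite_P)
  show "lt \<subseteq> P \<times> P" using ltD by auto
  show "carrier (positive_part KA) = {f. \<forall>x y. (x, y) \<notin> lt \<longrightarrow> f x y = 0}"
    by (simp add: positive_part_def augmentation_ideal_eq)
qed (simp_all add: positive_part_def incidence_ring_sel)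

section \<open>Cochains as functions on chains\<close>

abbreviation KB where "KB \<equiv> bar KR KA"
abbreviation cls where "cls \<equiv> tensor_class KR (positive_part KA)"
abbreviation CR :: "('p \<Rightarrow> 'k, 'p list \<Rightarrow> 'k) graded_bimodule" where "CR \<equiv> chain_ring"

lemma chain_support: "a \<in> carrier br.W \<Longrightarrow> c \<notin> chains \<Longrightarrow> br.\<Phi> a c = 0"
  using chain_ringD[OF br.Phi_closed] .

lemma KB_carrier: "carrier KB = cls ` carrier br.W"
  using br.tensor.carrier_QW by (simp add: tensor_ring_def tensor_class_def)

lemma cls_eq_iff: "a \<in> carrier br.W \<Longrightarrow> b \<in> carrier br.W \<Longrightarrow> cls a = cls b \<longleftrightarrow> br.\<Phi> a = br.\<Phi> b"
  using br.tensor.coset_eq_iff by (simp add: tensor_class_def)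

lemma KB_add: "a \<in> carrier br.W \<Longrightarrow> b \<in> carrier br.W \<Longrightarrow> cls a \<oplus>\<^bsub>KB\<^esub> cls b = cls (a + b)"
  using br.tensor.add_QW[of a b] by (simp add: tensor_ring_def tensor_class_def br.W_sel(5))

lemma KB_lact: "r \<in> carrier KR \<Longrightarrow> a \<in> carrier br.W \<Longrightarrow> lact KB r (cls a) = cls (lact br.W r a)"
  using br.tensor.lact_QW[of r a] by (simp add: tensor_ring_def tensor_class_def)

lemma KB_ract: "r \<in> carrier KR \<Longrightarrow> a \<in> carrier br.W \<Longrightarrow> ract KB (cls a) r = cls (ract br.W a r)"
  using br.tensor.ract_QW[of r a] by (simp add: tensor_ring_def tensor_class_def)

lemma KB_hcomp: "hcomp KB n = cls ` hcomp br.W n"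
  using br.tensor.hcomp_QW[of n] by (simp add: tensor_ring_def tensor_class_def)

lemma descend_cls:
  assumes "a \<in> carrier br.W" "\<And>b. b \<in> carrier br.W \<Longrightarrow> br.\<Phi> b = br.\<Phi> a \<Longrightarrow> h b = h a"
  shows "descend h (cls a) = h a"
  using br.tensor.descend_coset[of a h, OF assms] by (simp add: tensor_class_def)

lemma cls_carrier: "a \<in> carrier br.W \<Longrightarrow> cls a \<in> carrier KB"
  by (simp add: KB_carrier)

text \<open>The \<open>R\<close>-valued pairing of a cochain with an element of the bar complex. The
  component at \<open>x\<close> collects the chains that start in \<open>x\<close>, as left
  \<open>R\<close>-linearity demands.\<close>

definition pair :: "('p list \<Rightarrow> 'k) \<Rightarrow> ('p list \<Rightarrow> 'k) \<Rightarrow> 'p \<Rightarrow> 'k" where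
  "pair F G x = (\<Sum>c\<in>chains. (if hd c = x then F c else 0) * G c)"

definition cochain :: "('p list \<Rightarrow> 'k) \<Rightarrow> ('p \<Rightarrow> 'k, 'p \<Rightarrow> 'p \<Rightarrow> 'k) word_group set \<Rightarrow> 'p \<Rightarrow> 'k" where
  "cochain F = (\<lambda>v\<in>carrier KB. pair F (descend br.\<Phi> v))"

lemma cochain_cls: "a \<in> carrier br.W \<Longrightarrow> cochain F (cls a) = pair F (br.\<Phi> a)"
  by (simp add: cochain_def cls_carrier descend_cls)

lemma cochain_eqI:
  assumes "h \<in> extensional (carrier KB)" "\<And>a. a \<in> carrier br.W \<Longrightarrow> h (cls a) = pair F (br.\<Phi> a)"
  shows "h = cochain F"
proof (rule extensionalityI[OF assms(1)])
  show "cochain F \<in> extensional (carrier KB)" by (simp add: cochain_def)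
  fix v assume "v \<in> carrier KB"
  then obtain a where "a \<in> carrier br.W" "v = cls a" by (auto simp: KB_carrier)
  then show "h v = cochain F v" using assms(2) cochain_cls by simp
qed

lemma pair_closed: "pair F G \<in> carrier KR"
proof -
  have "hd c \<in> P" if "c \<in> chains" for c using that by (cases c) (auto simp: chains_iff)
  then have "pair F G x = 0" if "x \<notin> P" for x
    unfolding pair_def using that by (intro sum.neutral) auto
  then show ?thesis by (simp add: base_ring_sel)
qed

lemma pair_add: "pair F (\<lambda>c. G c + H c) x = pair F G x + pair F H x"
  by (simp add: pair_def algebra_simps sum.distrib)

lemma pair_add_left: "pair (\<lambda>c. F c + G c) H x = pair F H x + pair G H x"
  by (simp add: pair_def if_distrib[of "\<lambda>t. t * _"] algebra_simps sum.distrib[symmetric] cong: if_cong)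
    (intro sum.cong; simp add: algebra_simps)

lemma pair_delta: "c \<in> chains \<Longrightarrow> pair F (\<lambda>d. if d = c then a else 0) x = (if x = hd c then F c * a else 0)"
  using finite_chains by (auto simp: pair_def if_distrib[of "\<lambda>t. _ * t"] sum.delta cong: if_cong)

lemma Phi_path_word_chain:
  assumes "c \<in> chains" shows "br.\<Phi> (br.path_word a c) = (\<lambda>d. if d = c then a else 0)"
proof -
  have "c \<noteq> []" using assms by (auto simp: chains_def)
  then show ?thesis by (simp add: fun_eq_iff br.Phi_path_word)
qed

lemma cochain_inj:
  assumes "F \<in> carrier CR" "G \<in> carrier CR" "cochain F = cochain G"
  shows "F = G"
proof
  fix c show "F c = G c"
  proof (cases "c \<in> chains")
    case True
    have a: "br.path_word 1 c \<in> carrier br.W" using br.path_word_closed True by (simp add: chains_def)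
    show ?thesis
      using fun_cong[OF fun_cong[OF assms(3), of "cls (br.path_word 1 c)"], of "hd c"] True
      by (simp add: cochain_cls[OF a] Phi_path_word_chain pair_delta)
  qed (simp add: chain_ringD[OF assms(1)] chain_ringD[OF assms(2)])
qed

lemma cochain_closed:
  assumes F: "F \<in> carrier CR" shows "cochain F \<in> cochains KR KA"
proof -
  have "cochain F \<in> carrier KB \<rightarrow>\<^sub>E carrier KR"
    by (auto simp: cochain_def pair_closed)
  moreover have "cochain F (u \<oplus>\<^bsub>KB\<^esub> v) = cochain F u \<oplus>\<^bsub>KR\<^esub> cochain F v"
    if "u \<in> carrier KB" "v \<in> carrier KB" for u v
    using that br.W_add_closed
    by (auto simp: KB_carrier KB_add cochain_cls base_ring_sel pair_add fun_eq_iff)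
  moreover have "cochain F (lact KB s v) = s \<otimes>\<^bsub>KR\<^esub> cochain F v"
    if sv: "s \<in> carrier KR" "v \<in> carrier KB" for s v
  proof -
    obtain a where a: "a \<in> carrier br.W" "v = cls a" using sv by (auto simp: KB_carrier)
    have "pair F (\<lambda>c. s (hd c) * br.\<Phi> a c) x = s x * pair F (br.\<Phi> a) x" for x
      unfolding pair_def sum_distrib_left by (rule sum.cong) auto
    then show ?thesis
      using a sv br.W_lact_closed by (simp add: KB_lact cochain_cls br.Phi_lact path_ring_sel base_ring_sel fun_eq_iff)
  qed
  \<comment> \<open>Chains have distinct points, so none has more than \<open>card P\<close> of them
    and all higher degrees vanish.\<close>
  moreover have "cochain F v = \<zero>\<^bsub>KR\<^esub>" if n: "n > card P" and v: "v \<in> hcomp KB n" for n v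
  proof -
    obtain a where a: "a \<in> hcomp br.W n" "v = cls a" using v by (auto simp: KB_hcomp)
    then have aW: "a \<in> carrier br.W" by (auto simp: br.W_sel)
    have "br.\<Phi> a c = 0" if "c \<in> chains" for c
    proof -
      have "length c \<le> card P"
        using chains_distinct[OF that] that finite_P card_mono[of P "set c"] distinct_card[of c] by (auto simp: chains_iff)
      moreover have "br.\<Phi> a \<in> hcomp CR n" using a br.Phi_hcomp[of n] by blast
      ultimately show ?thesis using n by (auto simp: path_ring_sel)
    qed
    then show ?thesis using aW by (auto simp: a(2) cochain_cls pair_def base_ring_sel fun_eq_iff intro!: sum.neutral)
  qed
  ultimately show ?thesis unfolding cochains_def by blast
qed

text \<open>Left linearity concentrates the value of \<open>f\<close> on the walk \<open>c\<close>
  in the component at \<open>hd c\<close>, so one coefficient for each chain determines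
  \<open>f\<close>.\<close>

lemma cochain_surj:
  assumes f: "f \<in> cochains KR KA"
  shows "\<exists>F\<in>carrier CR. f = cochain F"
proof -
  have f_add: "f (u \<oplus>\<^bsub>KB\<^esub> v) = (\<lambda>x. f u x + f v x)" if "u \<in> carrier KB" "v \<in> carrier KB" for u v
    using f that by (simp add: cochains_def base_ring_sel)
  have f_lact: "f (lact KB s v) = (\<lambda>x. s x * f v x)" if "s \<in> carrier KR" "v \<in> carrier KB" for s v
    using f that by (simp add: cochains_def base_ring_sel)
  define F where "F c = (if c \<in> chains then f (cls (br.path_word 1 c)) (hd c) else 0)" for c
  have pw: "br.path_word a c \<in> carrier br.W" if "c \<in> chains" for a c
    using br.path_word_closed that by (simp add: chains_def)
  have fpw: "f (cls (br.path_word a c)) = (\<lambda>x. if x = hd c then F c * a else 0)" if c: "c \<in> chains" for a c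
  proof -
    have s: "br.scalar a (hd c) \<in> carrier KR" using br.scalar_closed br.pwalks_hd c by (simp add: chains_def)
    have "br.\<Phi> (br.path_word a c) = br.\<Phi> (lact br.W (br.scalar a (hd c)) (br.path_word 1 c))"
      using c pw[OF c, of 1]
      by (auto simp: br.Phi_lact path_ring_sel br.scalar_def Phi_path_word_chain fun_eq_iff)
    then have "cls (br.path_word a c) = lact KB (br.scalar a (hd c)) (cls (br.path_word 1 c))"
      using KB_lact[OF s pw[OF c]] cls_eq_iff[OF pw[OF c] br.W_lact_closed[OF s pw[OF c]]] by simp
    then show ?thesis
      using f_lact[OF s cls_carrier[OF pw[OF c, of 1]]] c by (auto simp: br.scalar_def F_def fun_eq_iff)
  qed
  have f0: "f (cls 0) = (\<lambda>x. 0)"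
  proof
    fix x
    have "f (cls 0) = (\<lambda>x. f (cls 0) x + f (cls 0) x)"
      using f_add[of "cls 0" "cls 0"] KB_add[OF br.W_0_closed br.W_0_closed] cls_carrier[OF br.W_0_closed]
      by simp
    then have "f (cls 0) x = f (cls 0) x + f (cls 0) x" by (rule fun_cong)
    then show "f (cls 0) x = 0" by (simp only: add_cancel_right_right)
  qed
  have fsum: "(\<Sum>c\<in>B. br.path_word (G c) c) \<in> carrier br.W \<and>
      f (cls (\<Sum>c\<in>B. br.path_word (G c) c)) = (\<lambda>x. \<Sum>c\<in>B. if x = hd c then F c * G c else 0)"
    if "finite B" "B \<subseteq> chains" for B G
    using that
  proof (induction B rule: finite_induct)
    case empty
    then show ?case using f0 br.W_0_closed by simp
  next
    case (insert c B)
    let ?S = "\<Sum>c\<in>B. br.path_word (G c) c"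
    have c: "c \<in> chains" and IH: "?S \<in> carrier br.W"
      "f (cls ?S) = (\<lambda>x. \<Sum>c\<in>B. if x = hd c then F c * G c else 0)"
      using insert by auto
    have "f (cls (br.path_word (G c) c + ?S)) = (\<lambda>x. f (cls (br.path_word (G c) c)) x + f (cls ?S) x)"
      unfolding KB_add[OF pw[OF c] IH(1), symmetric]
      by (rule f_add[OF cls_carrier[OF pw[OF c]] cls_carrier[OF IH(1)]])
    then show ?case
      using insert(1,2) by (simp add: IH fpw[OF c] br.W_add_closed[OF pw[OF c]])
  qed
  have "f = cochain F"
  proof (rule cochain_eqI)
    show "f \<in> extensional (carrier KB)" using f by (auto simp: cochains_def PiE_def)
    fix a assume a: "a \<in> carrier br.W"
    have eq: "br.\<Phi> a = br.\<Phi> (\<Sum>c\<in>chains. br.path_word (br.\<Phi> a c) c)"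
    proof
      fix d
      have "br.\<Phi> (\<Sum>c\<in>chains. br.path_word (br.\<Phi> a c) c) d = (\<Sum>c\<in>chains. if d = c then br.\<Phi> a c else 0)"
        unfolding br.Phi_sum[OF finite_chains]
        by (rule sum.cong[OF refl], rule br.Phi_path_word) (auto simp: chains_def)
      then show "br.\<Phi> a d = br.\<Phi> (\<Sum>c\<in>chains. br.path_word (br.\<Phi> a c) c) d"
        using finite_chains chain_support[OF a, of d] by simp
    qed
    have "cls a = cls (\<Sum>c\<in>chains. br.path_word (br.\<Phi> a c) c)"
      using cls_eq_iff[OF a] fsum[OF finite_chains] eq by blast
    then have "f (cls a) = (\<lambda>x. \<Sum>c\<in>chains. if x = hd c then F c * br.\<Phi> a c else 0)"
      using fsum[OF finite_chains order_refl] by simp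
    also have "\<dots> = pair F (br.\<Phi> a)"
      unfolding pair_def fun_eq_iff by (intro allI sum.cong) auto
    finally show "f (cls a) = pair F (br.\<Phi> a)" .
  qed
  moreover have "F \<in> carrier CR" by (auto simp: F_def chain_ring_carrier)
  ultimately show ?thesis by blast
qed

lemma cochains_eq: "cochains KR KA = cochain ` carrier CR"
  using cochain_closed cochain_surj by blast

lemma KR_ring: "ring KR"
  by (rule base_ring_ring)

lemma KR_finsum:
  assumes "finite B" "\<And>w. w \<in> B \<Longrightarrow> g w \<in> carrier KR"
  shows "finsum KR g B = (\<lambda>x. \<Sum>w\<in>B. g w x)"
proof -
  interpret ring KR by (rule KR_ring)
  show ?thesis
    using assms
  proof (induction B rule: finite_induct)
    case (insert b B)
    then have "finsum KR g (insert b B) = g b \<oplus>\<^bsub>KR\<^esub> finsum KR g B"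
      by (intro finsum_insert) auto
    then show ?case using insert by (simp add: base_ring_sel)
  qed (simp add: base_ring_sel)
qed

lemma KR_add_pow:
  fixes k :: int
  assumes r: "r \<in> carrier KR"
  shows "[k] \<cdot>\<^bsub>KR\<^esub> r = (\<lambda>x. of_int k * r x)"
proof -
  interpret ring KR by (rule KR_ring)
  have nat: "[n] \<cdot>\<^bsub>KR\<^esub> r = (\<lambda>x. of_nat n * r x)" for n :: nat
    by (induction n) (simp_all add: base_ring_sel add.nat_pow_Suc algebra_simps)
  have inv: "\<ominus>\<^bsub>KR\<^esub> s = (\<lambda>x. - s x)" if "s \<in> carrier KR" for s
    by (rule minus_equality) (use that in \<open>auto simp: base_ring_sel\<close>)
  show ?thesis
  proof (cases k rule: int_cases2)
    case (nonneg n)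
    then show ?thesis using nat[of n] by (simp add: add_pow_int_ge)
  next
    case (nonpos n)
    have "[k] \<cdot>\<^bsub>KR\<^esub> r = \<ominus>\<^bsub>KR\<^esub> ([n] \<cdot>\<^bsub>KR\<^esub> r)"
      using r nonpos by (simp add: add.int_pow_neg_int)
    then have "[k] \<cdot>\<^bsub>KR\<^esub> r = (\<lambda>x. - ([n] \<cdot>\<^bsub>KR\<^esub> r) x)"
      by (simp only: inv[OF add.nat_pow_closed[OF r]])
    then show ?thesis unfolding nat[of n] using nonpos by simp
  qed
qed

lemma pair_Phi: "pair F (br.\<Phi> a) x = frag_val (\<lambda>w. pair F (word_val w) x) a"
  by (simp add: pair_def br.\<Phi>_def frag_val_sum_left[OF finite_chains] frag_val_mult_left)

text \<open>A cochain given on words can be recognised there. Additivity carries the formula over to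
  all representatives, and it shows that their values depend on the class only, as
  \<open>descend\<close> requires.\<close>

lemma extend_words_cochain:
  assumes h: "\<And>w. w \<in> br.words \<Longrightarrow> h w = pair F (word_val w)"
  shows "extend_words KR KA h = cochain F"
proof (rule cochain_eqI)
  show "extend_words KR KA h \<in> extensional (carrier KB)" by (simp add: extend_words_def)
  fix a assume a: "a \<in> carrier br.W"
  let ?h = "\<lambda>c. \<Oplus>\<^bsub>KR\<^esub>w\<in>Poly_Mapping.keys c. [Poly_Mapping.lookup c w] \<cdot>\<^bsub>KR\<^esub> h w"
  have val: "?h b = pair F (br.\<Phi> b)" if b: "b \<in> carrier br.W" for b
  proof -
    have w: "h w = pair F (word_val w)" "h w \<in> carrier KR" if "w \<in> Poly_Mapping.keys b" for w
    proof -
      show 1: "h w = pair F (word_val w)" using that b by (intro h) (auto simp only: br.W_sel mem_Collect_eq)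
      show "h w \<in> carrier KR" unfolding 1 by (rule pair_closed)
    qed
    have "?h b = (\<lambda>x. \<Sum>w\<in>Poly_Mapping.keys b. ([Poly_Mapping.lookup b w] \<cdot>\<^bsub>KR\<^esub> h w) x)"
    proof (rule KR_finsum)
      fix w assume "w \<in> Poly_Mapping.keys b"
      then show "[Poly_Mapping.lookup b w] \<cdot>\<^bsub>KR\<^esub> h w \<in> carrier KR"
        using KR_add_pow[OF w(2)] w(2) by (simp add: base_ring_sel)
    qed simp
    also have "\<dots> = pair F (br.\<Phi> b)"
    proof
      fix x
      have "(\<Sum>w\<in>Poly_Mapping.keys b. ([Poly_Mapping.lookup b w] \<cdot>\<^bsub>KR\<^esub> h w) x)
          = (\<Sum>w\<in>Poly_Mapping.keys b. of_int (Poly_Mapping.lookup b w) * pair F (word_val w) x)"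
      proof (rule sum.cong[OF refl])
        fix w assume w': "w \<in> Poly_Mapping.keys b"
        show "([Poly_Mapping.lookup b w] \<cdot>\<^bsub>KR\<^esub> h w) x = of_int (Poly_Mapping.lookup b w) * pair F (word_val w) x"
          using fun_cong[OF KR_add_pow[OF w(2)[OF w']], of "Poly_Mapping.lookup b w" x] unfolding w(1)[OF w'] .
      qed
      then show "(\<Sum>w\<in>Poly_Mapping.keys b. ([Poly_Mapping.lookup b w] \<cdot>\<^bsub>KR\<^esub> h w) x) = pair F (br.\<Phi> b) x"
        by (simp add: pair_Phi frag_val_def)
    qed
    finally show ?thesis .
  qed
  have "extend_words KR KA h (cls a) = descend ?h (cls a)"
    by (simp add: extend_words_def cls_carrier[OF a])
  also have "\<dots> = ?h a" by (rule descend_cls[OF a]) (simp add: val a)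
  finally show "extend_words KR KA h (cls a) = pair F (br.\<Phi> a)" by (simp add: val a)
qed

lemma word_parts:
  assumes "(r, us) \<in> br.words"
  shows "(r, take n us) \<in> br.words" "(\<one>\<^bsub>KR\<^esub>, drop n us) \<in> br.words"
  using assms by (auto simp: base_ring_sel dest: in_set_takeD in_set_dropD)

text \<open>Multiplying the first \<open>n\<close> letters on the right by the value of the second
  cochain evaluates that value at the last point of the first chain, so only pairs of chains that
  fit together contribute. Glued, they are the chains with a cut at position \<open>n\<close>, as in
  the product of the path ring.\<close>

lemma cup_cochain:
  assumes F: "F \<in> carrier CR" and G: "G \<in> carrier CR"
  shows "cup KR KA (cochain F) (cochain G) = cochain (F \<otimes>\<^bsub>CR\<^esub> G)"
  unfolding cup_def
proof (rule extend_words_cochain)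
  fix w assume "w \<in> br.words"
  then obtain r us where w: "w = (r, us)" "(r, us) \<in> br.words" by (cases w) auto
  define N where "N = length us"
  define s where "s n = pair G (word_val (\<one>\<^bsub>KR\<^esub>, drop n us))" for n
  define t where "t n = cochain F (ract KB (cls (frag_of (r, take n us))) (cochain G (cls (frag_of (\<one>\<^bsub>KR\<^esub>, drop n us)))))" for n
  have t: "t n = pair F (\<lambda>c. word_val (r, take n us) c * s n (last c))" for n
  proof -
    have a: "frag_of (r, take n us) \<in> carrier br.W" "frag_of (\<one>\<^bsub>KR\<^esub>, drop n us) \<in> carrier br.W"
      using word_parts[OF w(2)] br.W_of_closed by blast+
    have "cochain G (cls (frag_of (\<one>\<^bsub>KR\<^esub>, drop n us))) = s n" using cochain_cls[OF a(2)] by (simp add: s_def)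
    then have "t n = cochain F (cls (ract br.W (frag_of (r, take n us)) (s n)))"
      unfolding t_def using KB_ract[OF _ a(1), of "s n"] pair_closed by (simp add: s_def)
    also have "\<dots> = pair F (br.\<Phi> (ract br.W (frag_of (r, take n us)) (s n)))"
      by (rule cochain_cls[OF br.W_ract_closed[OF _ a(1)]]) (simp add: s_def pair_closed)
    also have "br.\<Phi> (ract br.W (frag_of (r, take n us)) (s n)) = (\<lambda>c. word_val (r, take n us) c * s n (last c))"
      using br.Phi_ract[OF a(1)] by (simp add: path_ring_sel)
    finally show ?thesis .
  qed
  have tc: "t n \<in> carrier KR" for n unfolding t by (rule pair_closed)
  have "(\<Oplus>\<^bsub>KR\<^esub>n\<in>{..length us}. t n) = (\<lambda>x. \<Sum>n\<in>{..N}. t n x)"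
    unfolding N_def by (rule KR_finsum) (simp_all add: tc)
  also have "\<dots> = pair (F \<otimes>\<^bsub>CR\<^esub> G) (word_val w)"
  proof
    fix x
    let ?v = "word_val (r, us)"
    let ?g = "\<lambda>n e. F (take (Suc n) e) * G (drop n e) * ?v e"
    \<comment> \<open>Word and chain are cut at the same position, so the entries distribute over
      the two parts. The unit scalar of the second word is 1 at the cut, since that point lies in
      \<open>P\<close>.\<close>
    have split: "word_val (r, take n us) (take (Suc n) e) * word_val (\<one>\<^bsub>KR\<^esub>, drop n us) (drop n e) = ?v e"
      if e: "e \<in> chains" "n < length e" "n \<le> N" for e n
    proof -
      have "hd (drop n e) \<in> P" using e by (auto simp: chains_iff hd_drop_conv_nth)
      moreover have "steps us e = steps (take n us) (take (Suc n) e) * steps (drop n us) (drop n e)"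
        using steps_append[of "take n us" "drop n us" e] e(3) by (simp add: N_def min_def)
      moreover have "hd (take (Suc n) e) = hd e" by (cases e) auto
      ultimately show ?thesis by (simp add: word_val_def base_ring_sel)
    qed
    have tn: "t n x = (\<Sum>e\<in>{e \<in> chains. hd e = x \<and> n < length e}. ?g n e)" if n: "n \<le> N" for n
    proof -
      have "t n x = (\<Sum>c\<in>chains. \<Sum>d\<in>chains. (if hd c = x then F c else 0) * word_val (r, take n us) c *
          ((if hd d = last c then G d else 0) * word_val (\<one>\<^bsub>KR\<^esub>, drop n us) d))"
        by (simp add: t pair_def s_def sum_distrib_left mult.assoc)
      also have "\<dots> = (\<Sum>(c, d)\<in>chains \<times> chains. (if hd c = x then F c else 0) * word_val (r, take n us) c *
          ((if hd d = last c then G d else 0) * word_val (\<one>\<^bsub>KR\<^esub>, drop n us) d))"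
        by (simp add: sum.cartesian_product)
      also have "\<dots> = (\<Sum>(c, d)\<in>{(c, d) \<in> chains \<times> chains. hd c = x \<and> hd d = last c \<and> length c = Suc n}.
          F c * word_val (r, take n us) c * (G d * word_val (\<one>\<^bsub>KR\<^esub>, drop n us) d))"
      proof (rule sum.mono_neutral_cong_right)
        have len: "length c = Suc n" if "steps (take n us) c \<noteq> 0" for c :: "'p list"
          using steps_length[of "take n us" c] that n by (auto simp: N_def)
        show "\<forall>i\<in>chains \<times> chains - {(c, d) \<in> chains \<times> chains. hd c = x \<and> hd d = last c \<and> length c = Suc n}.
          (case i of (c, d) \<Rightarrow> (if hd c = x then F c else 0) * word_val (r, take n us) c *
          ((if hd d = last c then G d else 0) * word_val (\<one>\<^bsub>KR\<^esub>, drop n us) d)) = 0"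
          using len by (auto simp: word_val_def split: if_splits)
      qed (use finite_chains in auto)
      also have "\<dots> = (\<Sum>e\<in>{e \<in> chains. hd e = x \<and> n < length e}. ?g n e)"
      proof (rule sum.reindex_bij_witness[where i = "\<lambda>e. (take (Suc n) e, drop n e)" and j = "\<lambda>(c, d). c @ tl d"])
        fix a assume "a \<in> {(c, d) \<in> chains \<times> chains. hd c = x \<and> hd d = last c \<and> length c = Suc n}"
        then obtain c d where a: "a = (c, d)" "c \<in> chains" "d \<in> chains" "hd c = x" "hd d = last c" "length c = Suc n"
          by auto
        obtain y d' where d: "d = y # d'" using a(3) by (cases d) (auto simp: chains_def)
        obtain c' where c: "c = c' @ [y]" "length c' = n"
          using a(5,6) d by (cases c rule: rev_cases) auto
        have e: "take (Suc n) (c @ tl d) = c" "drop n (c @ tl d) = d" "n < length (c @ tl d)" using c d by auto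
        have ec: "c @ tl d \<in> chains" using chains_glue[OF e(3)] e a by simp
        show "(case case a of (c, d) \<Rightarrow> c @ tl d of e \<Rightarrow> (take (Suc n) e, drop n e)) = a" using a e by simp
        show "(case a of (c, d) \<Rightarrow> c @ tl d) \<in> {e \<in> chains. hd e = x \<and> n < length e}"
          using a ec e(3) c by (cases c') auto
        show "?g n (case a of (c, d) \<Rightarrow> c @ tl d)
          = (case a of (c, d) \<Rightarrow> F c * word_val (r, take n us) c * (G d * word_val (\<one>\<^bsub>KR\<^esub>, drop n us) d))"
          using split[OF ec e(3) n] e a(1) by (simp add: mult_ac)
      next
        fix e assume "e \<in> {e \<in> chains. hd e = x \<and> n < length e}"
        then have e: "e \<in> chains" "hd e = x" "n < length e" by auto
        show "(case (take (Suc n) e, drop n e) of (c, d) \<Rightarrow> c @ tl d) = e"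
          by (simp add: tl_drop drop_Suc[symmetric])
        show "(take (Suc n) e, drop n e) \<in> {(c, d) \<in> chains \<times> chains. hd c = x \<and> hd d = last c \<and> length c = Suc n}"
        proof -
          have "last (take (Suc n) e) = hd (drop n e)" "hd (take (Suc n) e) = hd e" "length (take (Suc n) e) = Suc n"
            using e(3) by (simp_all add: take_Suc_conv_app_nth hd_drop_conv_nth hd_append) (cases e; simp)+
          then show ?thesis using e chains_glue[OF e(3)] by simp
        qed
      qed
      finally show ?thesis .
    qed
    have "(\<Sum>n\<in>{..N}. t n x) = (\<Sum>n\<in>{..N}. \<Sum>e\<in>chains. if hd e = x \<and> n < length e then ?g n e else 0)"
      by (intro sum.cong refl) (simp add: tn sum.inter_filter finite_chains)
    also have "\<dots> = (\<Sum>e\<in>chains. \<Sum>n\<in>{..N}. if hd e = x \<and> n < length e then ?g n e else 0)"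
      by (rule sum.swap)
    also have "\<dots> = (\<Sum>e\<in>chains. (if hd e = x then (F \<otimes>\<^bsub>CR\<^esub> G) e else 0) * ?v e)"
    proof (rule sum.cong[OF refl])
      fix e assume "e \<in> chains"
      show "(\<Sum>n\<in>{..N}. if hd e = x \<and> n < length e then ?g n e else 0) = (if hd e = x then (F \<otimes>\<^bsub>CR\<^esub> G) e else 0) * ?v e"
      \<comment> \<open>Only chains with one point more than the word has letters count, and for
        them \<open>n < length e\<close> amounts to \<open>n \<le> N\<close>.\<close>
      proof (cases "hd e = x \<and> length e = Suc N")
        case True
        then have "(\<Sum>n\<in>{..N}. if hd e = x \<and> n < length e then ?g n e else 0) = (\<Sum>n<length e. ?g n e)"
          by (intro sum.cong) auto
        then show ?thesis using True by (simp add: path_ring_sel sum_distrib_right del: sum.lessThan_Suc)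
      next
        case False
        then have "hd e \<noteq> x \<or> ?v e = 0" using steps_length[of us e] by (auto simp: word_val_def N_def)
        then have "(\<Sum>n\<in>{..N}. if hd e = x \<and> n < length e then ?g n e else 0) = 0"
          by (intro sum.neutral) auto
        then show ?thesis using \<open>hd e \<noteq> x \<or> ?v e = 0\<close> by auto
      qed
    qed
    finally show "(\<Sum>n\<in>{..N}. t n x) = pair (F \<otimes>\<^bsub>CR\<^esub> G) (word_val w) x" by (simp add: pair_def w(1))
  qed
  finally show "(case w of (r, us) \<Rightarrow> \<Oplus>\<^bsub>KR\<^esub>n\<in>{..length us}.
       cochain F (ract KB (cls (frag_of (r, take n us))) (cochain G (cls (frag_of (\<one>\<^bsub>KR\<^esub>, drop n us))))))
     = pair (F \<otimes>\<^bsub>CR\<^esub> G) (word_val w)"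
    by (simp add: w(1) t_def)
qed

end

text \<open>The product of two incidence elements sums over the intermediate point; along a walk
  this amounts to inserting that point into the merged step. This is the origin of
  \<open>boundary\<close>.\<close>

lemma steps_ins:
  assumes "finite P"
  shows "steps (us @ (\<lambda>x y. \<Sum>z\<in>P. u x z * v z y) # vs) c = (\<Sum>z\<in>P. steps (us @ u # v # vs) (ins (length us) z c))"
proof (induction us arbitrary: c)
  case Nil
  show ?case
  proof (cases c)
    case (Cons x d)
    then show ?thesis by (cases d) (auto simp: ins_def sum_distrib_right mult.assoc)
  qed (simp add: ins_def)
next
  case (Cons w us)
  show ?case
  proof (cases c)
    case c: (Cons x d)
    show ?thesis
    proof (cases d)
      case (Cons y e)
      then show ?thesis using Cons.IH[of d] c by (simp add: ins_Suc_Cons sum_distrib_left) (simp add: ins_def sum_distrib_left)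
    qed (simp add: c ins_def)
  qed (simp add: ins_def)
qed

section \<open>The bar differential on cochains\<close>

context poset_over_field begin

lemma merge_closed:
  assumes "u \<in> carrier (positive_part KA)" "v \<in> carrier (positive_part KA)"
  shows "u \<otimes>\<^bsub>KA\<^esub> v \<in> carrier (positive_part KA)"
proof -
  have "u x z * v z y = 0" if "(x, y) \<notin> lt" for x y z
    using that assms lt_trans[of x z y] by (auto simp: br.carrier_M)
  then have "\<forall>x y. (x, y) \<notin> lt \<longrightarrow> (\<Sum>z\<in>P. u x z * v z y) = 0" by (intro allI impI sum.neutral ballI)
  then show ?thesis by (simp only: incidence_ring_sel br.carrier_M mem_Collect_eq)
qed

lemma bar_diff_word_closed:
  assumes w: "w \<in> br.words"
  shows "bar_diff_word KA w \<in> carrier br.W"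
proof -
  obtain r us where ru: "w = (r, us)" "r \<in> carrier KR" "us \<in> lists (carrier (positive_part KA))"
    using w by blast
  have t: "frag_cmul ((-1) ^ i) (frag_of (r, take i us @ [us ! i \<otimes>\<^bsub>KA\<^esub> us ! Suc i] @ drop (i + 2) us)) \<in> carrier br.W"
    if "i < length us - 1" for i
  proof -
    have "us ! i \<otimes>\<^bsub>KA\<^esub> us ! Suc i \<in> carrier (positive_part KA)"
      using ru(3) that by (intro merge_closed) auto
    then have "(r, take i us @ [us ! i \<otimes>\<^bsub>KA\<^esub> us ! Suc i] @ drop (i + 2) us) \<in> br.words"
      using ru by (auto dest: in_set_takeD in_set_dropD)
    then show ?thesis using keys_cmul by (fastforce simp: br.W_sel)
  qed
  have sumc: "sum f B \<in> carrier br.W" if "finite B" "\<And>i. i \<in> B \<Longrightarrow> f i \<in> carrier br.W"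
    for f :: "nat \<Rightarrow> _" and B
    using that by (induction B rule: finite_induct) (auto simp: br.W_0_closed br.W_add_closed)
  show ?thesis
    unfolding bar_diff_word_def ru(1) prod.case
    by (rule sumc) (simp_all only: finite_lessThan lessThan_iff t)
qed

lemma Phi_bar_diff_word:
  assumes w: "w \<in> br.words"
  shows "br.\<Phi> (bar_diff_word KA w) c = boundary (word_val w) c"
proof -
  obtain r us where ru: "w = (r, us)" by (cases w)
  let ?m = "\<lambda>i. (r, take i us @ [us ! i \<otimes>\<^bsub>KA\<^esub> us ! Suc i] @ drop (i + 2) us)"
  have "br.\<Phi> (bar_diff_word KA w) c = (\<Sum>i<length us - 1. (-1) ^ i * word_val (?m i) c)"
    unfolding bar_diff_word_def ru by (simp add: br.Phi_sum) (simp add: br.\<Phi>_def frag_val_cmul)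
  also have "\<dots> = boundary (word_val w) c"
  proof (cases "length c = length us")
    case True
    show ?thesis
      unfolding boundary_def True
    proof (rule sum.cong[OF refl])
      fix i assume i: "i \<in> {..<length us - 1}"
      then have us: "take i us @ us ! i # us ! Suc i # drop (i + 2) us = us"
        by (simp add: Cons_nth_drop_Suc id_take_nth_drop[symmetric])
      have "c \<noteq> []" using i True by auto
      then have hd: "hd (ins i z c) = hd c" for z by (rule hd_ins)
      have "steps (snd (?m i)) c = (\<Sum>z\<in>P. steps us (ins i z c))"
        using steps_ins[OF finite_P, of "take i us" "us ! i" "us ! Suc i" "drop (i + 2) us" c] us i
        by (simp add: incidence_ring_sel min_def)
      then show "(-1) ^ i * word_val (?m i) c = (-1) ^ i * (\<Sum>z\<in>P. word_val w (ins i z c))"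
        by (simp add: word_val_def ru hd sum_distrib_left)
    qed
  next
    case False
    have "steps (snd (?m i)) c = 0" if "i < length us - 1" for i
    proof (rule ccontr)
      assume "steps (snd (?m i)) c \<noteq> 0"
      then have "length c = Suc (length (snd (?m i)))" by (rule steps_length)
      then show False using False that by simp
    qed
    moreover have "steps us (ins i z c) = 0" if "i < length c - 1" for i z
    proof (rule ccontr)
      assume "steps us (ins i z c) \<noteq> 0"
      then have "length (ins i z c) = Suc (length us)" by (rule steps_length)
      then show False using False that by (simp add: ins_def)
    qed
    ultimately show ?thesis by (simp add: word_val_def ru boundary_def)
  qed
  finally show ?thesis .
qed

lemma Phi_bar_diff:
  assumes a: "a \<in> carrier br.W"
  shows "frag_extend (bar_diff_word KA) a \<in> carrier br.W"
    "br.\<Phi> (frag_extend (bar_diff_word KA) a) = boundary (br.\<Phi> a)"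
proof -
  show "frag_extend (bar_diff_word KA) a \<in> carrier br.W"
    by (rule br.W_extend_closed[OF a bar_diff_word_closed])
  show "br.\<Phi> (frag_extend (bar_diff_word KA) a) = boundary (br.\<Phi> a)"
  proof
    fix c
    have "br.\<Phi> (frag_extend (bar_diff_word KA) a) c = frag_val (\<lambda>w. boundary (word_val w) c) a"
      unfolding br.\<Phi>_def
      by (rule br.frag_extend_closed_cong[OF a]) (use Phi_bar_diff_word in \<open>simp add: br.\<Phi>_def\<close>)
    also have "\<dots> = boundary (br.\<Phi> a) c"
      by (simp add: boundary_def br.\<Phi>_def frag_val_sum_left finite_P frag_val_mult_left)
    finally show "br.\<Phi> (frag_extend (bar_diff_word KA) a) c = boundary (br.\<Phi> a) c" .
  qed
qed

text \<open>The differential is well defined on classes because its effect on \<open>\<Phi>\<close>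
  is \<open>boundary\<close>, which depends on \<open>\<Phi> a\<close> alone.\<close>

lemma bar_diff_cls:
  assumes a: "a \<in> carrier br.W"
  shows "bar_diff KR KA (cls a) = cls (frag_extend (bar_diff_word KA) a)"
  unfolding bar_diff_def
  by (rule descend_cls[OF a]) (simp add: cls_eq_iff Phi_bar_diff a)

text \<open>Deleting inner points keeps the first point, so the adjunction holds for each component
  separately.\<close>

lemma pair_boundary:
  assumes G: "\<And>c. c \<notin> chains \<Longrightarrow> G c = 0"
  shows "pair F (boundary G) x = pair (dif F) G x"
proof -
  have "dif (\<lambda>c. if hd c = x then F c else 0) = (\<lambda>c. if hd c = x then dif F c else 0)"
    by (auto simp: dif_def hd_del fun_eq_iff)
  then show ?thesis
    using boundary_adjoint[of G "\<lambda>c. if hd c = x then F c else 0", OF G] by (simp add: pair_def)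
qed

lemma coboundary_cochain: "coboundary KR KA (cochain F) = cochain (dif F)"
proof (rule cochain_eqI)
  show "coboundary KR KA (cochain F) \<in> extensional (carrier KB)" by (simp add: coboundary_def)
  fix a assume a: "a \<in> carrier br.W"
  then have "coboundary KR KA (cochain F) (cls a) = pair F (boundary (br.\<Phi> a))"
    by (simp add: coboundary_def cls_carrier bar_diff_cls Phi_bar_diff cochain_cls)
  then show "coboundary KR KA (cochain F) (cls a) = pair (dif F) (br.\<Phi> a)"
    using pair_boundary[OF chain_support[OF a]] by (simp add: fun_eq_iff)
qed

section \<open>Operations of the cochain ring, and cocycles\<close>

abbreviation CC where "CC \<equiv> cochain_ring KR KA"

lemma cochain_add: "cochain F \<oplus>\<^bsub>CC\<^esub> cochain G = cochain (\<lambda>c. F c + G c)"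
proof (rule cochain_eqI)
  show "cochain F \<oplus>\<^bsub>CC\<^esub> cochain G \<in> extensional (carrier KB)" by (simp add: cochain_ring_def)
  fix a assume a: "a \<in> carrier br.W"
  then show "(cochain F \<oplus>\<^bsub>CC\<^esub> cochain G) (cls a) = pair (\<lambda>c. F c + G c) (br.\<Phi> a)"
    by (simp add: cochain_ring_def cls_carrier cochain_cls base_ring_sel pair_add_left fun_eq_iff)
qed

lemma cochain_mult: "F \<in> carrier CR \<Longrightarrow> G \<in> carrier CR \<Longrightarrow> cochain F \<otimes>\<^bsub>CC\<^esub> cochain G = cochain (F \<otimes>\<^bsub>CR\<^esub> G)"
  using cup_cochain by (simp add: cochain_ring_def)

lemma cochain_zero: "\<zero>\<^bsub>CC\<^esub> = cochain (\<lambda>c. 0)"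
  by (rule cochain_eqI)
    (auto simp: cochain_ring_def cls_carrier pair_def base_ring_sel fun_eq_iff if_distrib[of "\<lambda>t. t * _"] cong: if_cong)

lemma cochain_one: "\<one>\<^bsub>CC\<^esub> = cochain \<one>\<^bsub>CR\<^esub>"
proof -
  have "extend_words KR KA (\<lambda>(r, us). if us = [] then r else \<zero>\<^bsub>KR\<^esub>) = cochain \<one>\<^bsub>CR\<^esub>"
  proof (rule extend_words_cochain)
    fix w assume w: "w \<in> br.words"
    obtain r us where ru: "w = (r, us)" by (cases w)
    have "pair \<one>\<^bsub>CR\<^esub> (word_val w) x = (if us = [] then r x else 0)" for x
    proof -
      have "pair \<one>\<^bsub>CR\<^esub> (word_val w) x = (\<Sum>c\<in>chains. if c = [x] then (if us = [] then r x else 0) else 0)"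
        unfolding pair_def
        by (rule sum.cong) (auto simp: path_ring_sel ru word_val_def chains_def)
      also have "\<dots> = (if us = [] then r x else 0)"
        using finite_chains w by (auto simp: ru base_ring_sel chains_def)
      finally show ?thesis .
    qed
    then show "(case w of (r, us) \<Rightarrow> if us = [] then r else \<zero>\<^bsub>KR\<^esub>) = pair \<one>\<^bsub>CR\<^esub> (word_val w)"
      by (auto simp: ru base_ring_sel fun_eq_iff)
  qed
  then show ?thesis by (simp add: cochain_ring_def)
qed

text \<open>The value at \<open>x\<close> comes from the chains that start in \<open>x\<close>, so
  multiplying values by \<open>r\<close> is multiplication at the first point. This is why the
  opposite-sided actions on cochains match those of the path ring.\<close>

lemma cochain_lact: "lact CC r (cochain F) = cochain (lact CR r F)"
proof (rule cochain_eqI)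
  show "lact CC r (cochain F) \<in> extensional (carrier KB)" by (simp add: cochain_ring_def)
  fix a assume a: "a \<in> carrier br.W"
  have "pair F G x * r x = pair (lact CR r F) G x" for G x
    unfolding pair_def sum_distrib_right by (rule sum.cong) (auto simp: path_ring_sel)
  then show "lact CC r (cochain F) (cls a) = pair (lact CR r F) (br.\<Phi> a)"
    using a by (simp add: cochain_ring_def cls_carrier cochain_cls base_ring_sel fun_eq_iff)
qed

lemma cochain_ract:
  assumes r: "r \<in> carrier KR" shows "ract CC (cochain F) r = cochain (ract CR F r)"
proof (rule cochain_eqI)
  show "ract CC (cochain F) r \<in> extensional (carrier KB)" by (simp add: cochain_ring_def)
  fix a assume a: "a \<in> carrier br.W"
  have "pair F (ract CR G r) x = pair (ract CR F r) G x" for G x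
    unfolding pair_def by (rule sum.cong) (auto simp: path_ring_sel)
  then show "ract CC (cochain F) r (cls a) = pair (ract CR F r) (br.\<Phi> a)"
    using a r by (simp add: cochain_ring_def cls_carrier KB_ract cochain_cls br.W_ract_closed br.Phi_ract fun_eq_iff)
qed

lemma CR_hcomp: "hcomp CR n = {F \<in> carrier CR. \<forall>c. F c \<noteq> 0 \<longrightarrow> length c = Suc n}"
  by (auto simp: path_ring_sel)

lemma cochain_hcomp: "hcomp CC n = cochain ` hcomp CR n"
proof (intro equalityI subsetI)
  fix f assume "f \<in> hcomp CC n"
  then have f: "f \<in> cochains KR KA" "\<And>m v. m \<noteq> n \<Longrightarrow> v \<in> hcomp KB m \<Longrightarrow> f v = \<zero>\<^bsub>KR\<^esub>"
    by (auto simp: cochain_ring_def)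
  obtain F where F: "F \<in> carrier CR" "f = cochain F" using cochain_surj[OF f(1)] by blast
  have "length c = Suc n" if nz: "F c \<noteq> 0" for c
  proof (rule ccontr)
    assume len: "length c \<noteq> Suc n"
    have c: "c \<in> chains" using nz F(1) by (auto simp: chain_ring_carrier)
    then obtain m where m: "length c = Suc m" by (cases c) (auto simp: chains_def)
    have "(\<lambda>d. if d = c then 1 else 0) \<in> hcomp CR m"
      using c m by (auto simp: CR_hcomp chain_ring_carrier)
    then obtain a where a: "a \<in> hcomp br.W m" "br.\<Phi> a = (\<lambda>d. if d = c then 1 else 0)"
      using br.Phi_hcomp[of m] by (metis (no_types, lifting) imageE)
    then have aW: "a \<in> carrier br.W" by (auto simp: br.W_sel)
    have "cls a \<in> hcomp KB m" using a by (simp add: KB_hcomp)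
    then have "cochain F (cls a) (hd c) = 0" using f(2)[of m] F(2) len m by (simp add: base_ring_sel)
    then show False using nz by (simp add: cochain_cls[OF aW] a(2) pair_delta[OF c])
  qed
  then show "f \<in> cochain ` hcomp CR n" using F by (auto simp: CR_hcomp)
next
  fix f assume "f \<in> cochain ` hcomp CR n"
  then obtain F where F: "F \<in> carrier CR" "\<And>c. F c \<noteq> 0 \<Longrightarrow> length c = Suc n" "f = cochain F"
    by (auto simp: CR_hcomp)
  have "f v = \<zero>\<^bsub>KR\<^esub>" if mn: "m \<noteq> n" and v: "v \<in> hcomp KB m" for m v
  proof -
    obtain a where a: "a \<in> hcomp br.W m" "v = cls a" using v by (auto simp: KB_hcomp)
    then have aW: "a \<in> carrier br.W" by (auto simp: br.W_sel)
    have "br.\<Phi> a \<in> hcomp CR m" using a br.Phi_hcomp[of m] by blast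
    then have "F c = 0 \<or> br.\<Phi> a c = 0" for c using F(2)[of c] mn
      by (cases "F c = 0") (auto simp: CR_hcomp)
    then have "pair F (br.\<Phi> a) x = 0" for x unfolding pair_def by (intro sum.neutral) (metis mult_zero_left mult_zero_right)
    then show ?thesis using cochain_cls[OF aW] a(2) F(3) by (simp add: base_ring_sel fun_eq_iff)
  qed
  then show "f \<in> hcomp CC n" using cochain_closed[OF F(1)] F(3) by (simp add: cochain_ring_def)
qed

lemma dif_act: "dif (lact CR r F) = lact CR r (dif F)" "dif (ract CR F r) = ract CR (dif F) r"
  by (auto simp: dif_def path_ring_sel hd_del last_del sum_distrib_left sum_distrib_right mult_ac fun_eq_iff intro!: sum.cong)

definition cyc :: "('p list \<Rightarrow> 'k) set" where
  "cyc = {F \<in> carrier CR. dif F = (\<lambda>c. 0)}"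

lemma cocycles_eq: "cocycles KR KA = cochain ` cyc"
proof -
  have z: "(\<lambda>c. 0) \<in> carrier CR" by (simp add: chain_ring_carrier)
  have "coboundary KR KA (cochain F) = \<zero>\<^bsub>CC\<^esub> \<longleftrightarrow> dif F = (\<lambda>c. 0)" if "F \<in> carrier CR" for F
    unfolding coboundary_cochain cochain_zero using cochain_inj[OF dif_closed z] by auto
  then show ?thesis unfolding cocycles_def cochains_eq cyc_def by auto
qed

lemma coboundaries_eq: "coboundary KR KA ` cochains KR KA = cochain ` dif ` carrier CR"
  unfolding cochains_eq image_image coboundary_cochain ..

lemma cyc_closed:
  "F \<in> cyc \<Longrightarrow> F \<in> carrier CR" "F \<in> cyc \<Longrightarrow> dif F = (\<lambda>c. 0)"
  "F \<in> cyc \<Longrightarrow> G \<in> cyc \<Longrightarrow> (\<lambda>c. F c + G c) \<in> cyc" "F \<in> cyc \<Longrightarrow> (\<lambda>c. - F c) \<in> cyc" "(\<lambda>c. 0) \<in> cyc"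
  "F \<in> cyc \<Longrightarrow> G \<in> cyc \<Longrightarrow> F \<otimes>\<^bsub>CR\<^esub> G \<in> cyc" "\<one>\<^bsub>CR\<^esub> \<in> cyc"
  "F \<in> cyc \<Longrightarrow> lact CR r F \<in> cyc" "F \<in> cyc \<Longrightarrow> ract CR F r \<in> cyc" "dif G \<in> cyc"
proof -
  show "F \<in> cyc \<Longrightarrow> F \<in> carrier CR" "F \<in> cyc \<Longrightarrow> dif F = (\<lambda>c. 0)" by (simp_all add: cyc_def)
  show "F \<in> cyc \<Longrightarrow> G \<in> cyc \<Longrightarrow> (\<lambda>c. F c + G c) \<in> cyc"
    using path_add_closed[of F P lt G] by (simp add: cyc_def dif_add path_ring_sel(5))
  show "F \<in> cyc \<Longrightarrow> (\<lambda>c. - F c) \<in> cyc" using path_neg_closed by (auto simp: cyc_def dif_uminus)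
  show "(\<lambda>c. 0) \<in> cyc" by (simp add: cyc_def dif_zero chain_ring_carrier)
  show "F \<in> cyc \<Longrightarrow> G \<in> cyc \<Longrightarrow> F \<otimes>\<^bsub>CR\<^esub> G \<in> cyc"
    using path_mult_closed[of F P lt G] dif_mult[of F G] by (simp add: cyc_def) (simp add: path_ring_sel)
  have "dif \<one>\<^bsub>CR\<^esub> c = 0" for c
    using length_del[of _ c] by (auto simp: dif_def path_ring_sel intro!: sum.neutral)
      (metis One_nat_def Suc_diff_Suc Suc_lessD add_2_eq_Suc' diff_Suc_1 length_Cons less_diff_conv list.size(3) not_less_eq nat.distinct(1) zero_less_Suc)
  then show "\<one>\<^bsub>CR\<^esub> \<in> cyc" using path_one_closed[OF finite_P, of lt] by (simp add: cyc_def fun_eq_iff)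
  show "F \<in> cyc \<Longrightarrow> lact CR r F \<in> cyc" "F \<in> cyc \<Longrightarrow> ract CR F r \<in> cyc"
    by (auto simp: cyc_def dif_act) (auto simp: path_ring_sel chain_ring_carrier)
  show "dif G \<in> cyc" by (simp add: cyc_def dif_closed dif_dif)
qed

end


section \<open>The shriek ring of the incidence coring\<close>

context poset_over_field begin

abbreviation KC :: "('p \<Rightarrow> 'k, 'p \<Rightarrow> 'p \<Rightarrow> 'k) graded_coring" where
  "KC \<equiv> incidence_coring P leq"

lemma KC_sel:
  "carrier KC = carrier KA" "f \<oplus>\<^bsub>KC\<^esub> g = f \<oplus>\<^bsub>KA\<^esub> g" "\<zero>\<^bsub>KC\<^esub> = \<zero>\<^bsub>KA\<^esub>" "lact KC = lact KA" "ract KC = ract KA"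
  "hcomp KC = hcomp KA"
  "comult KC f = tensor_class KR KA (\<Sum>(x, y)\<in>leq. \<Sum>z\<in>interval leq x y.
      frag_of (\<one>\<^bsub>KR\<^esub>, [basis_elem (f x y) x z, basis_elem 1 z y]))"
  by (simp_all add: incidence_coring_def graded_bimodule.defs)

sublocale sh: incidence_bimodule P cov "degree_one_part KC"
proof
  show "finite P" by (rule finite_P)
  show "cov \<subseteq> P \<times> P" using ltD cov_lt by auto
  show "carrier (degree_one_part KC) = {f. \<forall>x y. (x, y) \<notin> cov \<longrightarrow> f x y = 0}"
    by (auto simp: degree_one_part_def KC_sel incidence_ring_sel cov_def)
qed (simp_all add: degree_one_part_def KC_sel incidence_ring_sel)

text \<open>The comultiplication takes its values in the tensor square of the whole coring, before
  the projection to degree one.\<close>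

sublocale fu: incidence_bimodule P leq KA
  by unfold_locales (use finite_P leq_carrier in \<open>auto simp: incidence_ring_sel\<close>)

lemma KC_finsum:
  assumes "finite B" "\<And>n. n \<in> B \<Longrightarrow> c n \<in> carrier KC"
  shows "finsum KC c B = (\<lambda>x y. \<Sum>n\<in>B. c n x y)"
proof -
  have "abelian_group KC"
  proof (rule abelian_groupI)
    fix f assume "f \<in> carrier KC"
    then show "\<exists>g\<in>carrier KC. g \<oplus>\<^bsub>KC\<^esub> f = \<zero>\<^bsub>KC\<^esub>"
      by (intro bexI[of _ "\<lambda>x y. - f x y"]) (auto simp: KC_sel incidence_ring_sel)
  qed (auto simp: KC_sel incidence_ring_sel ac_simps)
  then interpret abelian_group KC .
  show ?thesis
    using assms
  proof (induction B rule: finite_induct)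
    case (insert b B)
    then have "finsum KC c (insert b B) = c b \<oplus>\<^bsub>KC\<^esub> finsum KC c B"
      by (intro finsum_insert) auto
    then show ?case using insert by (simp add: KC_sel incidence_ring_sel)
  qed (simp add: KC_sel incidence_ring_sel)
qed

text \<open>\<open>homogeneous_part\<close> is a definite description, so the decomposition by
  interval length has to be shown to exist and to be unique.\<close>

lemma homogeneous_part_eq:
  assumes m: "m \<in> carrier KC"
  shows "homogeneous_part KC n m = (\<lambda>x y. if il x y = n then m x y else 0)"
proof -
  let ?c = "\<lambda>n x y. if il x y = n then m x y else 0"
  have c: "?c n \<in> hcomp KC n" for n using m by (auto simp: KC_sel incidence_ring_sel)
  have hc: "hcomp KC n \<subseteq> carrier KC" for n by (auto simp: KC_sel incidence_ring_sel)
  have "{n. ?c n \<noteq> \<zero>\<^bsub>KC\<^esub>} \<subseteq> (\<lambda>(x, y). il x y) ` leq"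
  proof
    fix n assume "n \<in> {n. ?c n \<noteq> \<zero>\<^bsub>KC\<^esub>}"
    then obtain x y where "il x y = n" "m x y \<noteq> 0" by (auto simp: KC_sel incidence_ring_sel fun_eq_iff split: if_splits)
    then show "n \<in> (\<lambda>(x, y). il x y) ` leq" using m by (force simp: KC_sel incidence_ring_sel)
  qed
  then have fin: "finite {n. ?c n \<noteq> \<zero>\<^bsub>KC\<^esub>}" using finite_leq finite_surj by blast
  have dec: "c n = ?c n" if d: "homogeneous_decomposition KC (hcomp KC) m c" for c n
  proof (intro ext)
    fix x y
    have h: "c k \<in> hcomp KC k" "finite {n. c n \<noteq> \<zero>\<^bsub>KC\<^esub>}" "m = finsum KC c {n. c n \<noteq> \<zero>\<^bsub>KC\<^esub>}" for k
      using d by (auto simp: homogeneous_decomposition_def)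
    have supp: "c k x y = 0" if "k \<noteq> il x y" for k
      using h(1)[of k] that by (auto simp: KC_sel incidence_ring_sel)
    have "m = (\<lambda>x y. \<Sum>k\<in>{n. c n \<noteq> \<zero>\<^bsub>KC\<^esub>}. c k x y)"
      using h(3) KC_finsum[OF h(2)] h(1) hc by blast
    then have "m x y = (\<Sum>k\<in>{n. c n \<noteq> \<zero>\<^bsub>KC\<^esub>}. c k x y)" by meson
    also have "\<dots> = (\<Sum>k\<in>{n. c n \<noteq> \<zero>\<^bsub>KC\<^esub>}. if k = il x y then c (il x y) x y else 0)"
      by (rule sum.cong) (use supp in auto)
    also have "\<dots> = c (il x y) x y"
      using h(2) by (auto simp: KC_sel incidence_ring_sel)
    finally show "c n x y = ?c n x y" using supp by auto
  qed
  have "m = finsum KC ?c {n. ?c n \<noteq> \<zero>\<^bsub>KC\<^esub>}"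
  proof (intro ext)
    fix x y
    have "finsum KC ?c {n. ?c n \<noteq> \<zero>\<^bsub>KC\<^esub>} x y = (\<Sum>k\<in>{n. ?c n \<noteq> \<zero>\<^bsub>KC\<^esub>}. if il x y = k then m x y else 0)"
      using KC_finsum[OF fin, of ?c] c hc by (metis (no_types, lifting) subsetD)
    also have "\<dots> = (if ?c (il x y) \<noteq> \<zero>\<^bsub>KC\<^esub> then m x y else 0)"
      unfolding sum.delta'[OF fin] by simp
    also have "\<dots> = m x y"
    proof (cases "m x y = 0")
      case False
      then have "?c (il x y) x y \<noteq> 0" by simp
      then have "?c (il x y) \<noteq> \<zero>\<^bsub>KC\<^esub>" by (auto simp: KC_sel incidence_ring_sel fun_eq_iff)
      then show ?thesis by (simp only: if_True not_False_eq_True)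
    qed simp
    finally show "m x y = finsum KC ?c {n. ?c n \<noteq> \<zero>\<^bsub>KC\<^esub>} x y" by simp
  qed
  then have "homogeneous_decomposition KC (hcomp KC) m ?c"
    unfolding homogeneous_decomposition_def using c fin by blast
  then have "(THE c. homogeneous_decomposition KC (hcomp KC) m c) = ?c"
    by (rule the_equality[where P = "homogeneous_decomposition KC (hcomp KC) m"]) (rule ext, erule dec)
  then show ?thesis by (simp add: homogeneous_part_def)
qed

abbreviation proj1 where "proj1 \<equiv> frag_extend (\<lambda>(r, us). frag_of (r, map (homogeneous_part KC 1) us))"

lemma homogeneous_part_1: "m \<in> carrier KC \<Longrightarrow> homogeneous_part KC 1 m = (\<lambda>x y. if (x, y) \<in> cov then m x y else 0)"
  by (auto simp: homogeneous_part_eq cov_def KC_sel incidence_ring_sel fun_eq_iff)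

lemma steps_proj1:
  assumes "us \<in> lists (carrier KC)"
  shows "steps (map (homogeneous_part KC 1) us) c = (if successively (\<lambda>x y. (x, y) \<in> cov) c then steps us c else 0)"
  using assms
proof (induction us c rule: steps.induct)
  case (2 u us x y c)
  then show ?case by (simp add: homogeneous_part_1 del: One_nat_def)
qed auto

lemma word_proj1:
  assumes w: "(r, us) \<in> fu.words"
  shows "(r, map (homogeneous_part KC 1) us) \<in> sh.words"
    "word_val (r, map (homogeneous_part KC 1) us) c = (if c \<in> pwalks P cov then word_val (r, us) c else 0)"
proof -
  have us: "us \<in> lists (carrier KC)" using w by (simp add: KC_sel)
  show "(r, map (homogeneous_part KC 1) us) \<in> sh.words"
    using w by (auto simp: homogeneous_part_1 sh.carrier_M KC_sel simp del: One_nat_def)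
  show "word_val (r, map (homogeneous_part KC 1) us) c = (if c \<in> pwalks P cov then word_val (r, us) c else 0)"
  proof (cases "word_val (r, us) c = 0")
    case True
    then show ?thesis by (auto simp: word_val_def steps_proj1[OF us] simp del: One_nat_def)
  next
    case False
    then have "c \<in> pwalks P leq" using fu.word_val_support(1)[OF w] by blast
    then show ?thesis by (auto simp: word_val_def steps_proj1[OF us] pwalks_def walks_def simp del: One_nat_def)
  qed
qed

text \<open>On functions, projecting every letter to degree one is the restriction to walks along
  covering pairs; in particular it passes to classes.\<close>

lemma Phi_proj1:
  assumes t: "t \<in> carrier fu.W"
  shows "proj1 t \<in> carrier sh.W" "sh.\<Phi> (proj1 t) = (\<lambda>c. if c \<in> pwalks P cov then fu.\<Phi> t c else 0)"
proof -
  have keys: "Poly_Mapping.keys t \<subseteq> fu.words" using t by (simp only: fu.W_sel mem_Collect_eq)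
  have "Poly_Mapping.keys (proj1 t) \<subseteq> (\<Union>w\<in>Poly_Mapping.keys t. Poly_Mapping.keys (case w of (r, us) \<Rightarrow> frag_of (r, map (homogeneous_part KC 1) us)))"
    by (rule keys_frag_extend)
  also have "\<dots> \<subseteq> sh.words" using keys word_proj1(1) by fastforce
  finally show "proj1 t \<in> carrier sh.W" by (simp only: sh.W_sel mem_Collect_eq)
  show "sh.\<Phi> (proj1 t) = (\<lambda>c. if c \<in> pwalks P cov then fu.\<Phi> t c else 0)"
  proof
    fix c
    have "sh.\<Phi> (proj1 t) c = frag_val (\<lambda>w. (if c \<in> pwalks P cov then 1 else 0) * word_val w c) t"
      unfolding sh.\<Phi>_def
    proof (rule fu.frag_extend_closed_cong[OF t])
      fix w assume "w \<in> fu.words"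
      moreover obtain r us where ru: "w = (r, us)" by (cases w)
      ultimately have "word_val (r, map (homogeneous_part KC 1) us) c = (if c \<in> pwalks P cov then word_val (r, us) c else 0)"
        by (intro word_proj1(2)) simp
      then show "frag_val (\<lambda>w. word_val w c) (case w of (r, us) \<Rightarrow> frag_of (r, map (homogeneous_part KC 1) us)) =
          (if c \<in> pwalks P cov then 1 else 0) * word_val w c"
        by (simp add: ru del: One_nat_def)
    qed
    then show "sh.\<Phi> (proj1 t) c = (if c \<in> pwalks P cov then fu.\<Phi> t c else 0)"
      by (simp only: frag_val_mult_left) (simp add: fu.\<Phi>_def)
  qed
qed

section \<open>The tensor ring of the degree one part as functions on saturated chains\<close>

abbreviation TC where "TC \<equiv> tensor_ring KR (degree_one_part KC)"
abbreviation scls where "scls \<equiv> tensor_class KR (degree_one_part KC)"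
abbreviation D where "D \<equiv> descend sh.\<Phi>"
abbreviation SR :: "('p \<Rightarrow> 'k, 'p list \<Rightarrow> 'k) graded_bimodule" where "SR \<equiv> path_ring P cov"

lemma TC_carrier: "carrier TC = scls ` carrier sh.W"
  using sh.tensor.carrier_QW by (simp add: tensor_ring_def tensor_class_def)

lemma scls_eq_iff: "a \<in> carrier sh.W \<Longrightarrow> b \<in> carrier sh.W \<Longrightarrow> scls a = scls b \<longleftrightarrow> sh.\<Phi> a = sh.\<Phi> b"
  using sh.tensor.coset_eq_iff by (simp add: tensor_class_def)

lemma D_scls: "a \<in> carrier sh.W \<Longrightarrow> D (scls a) = sh.\<Phi> a"
  using sh.tensor.descend_Phi by (simp add: tensor_class_def)

lemma TC_ring: "ring TC"
  using sh.tensor.ring_QW by (simp add: tensor_ring_def)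

lemma D_iso: "D \<in> graded_rring_iso KR TC SR"
  using sh.tensor.descend_iso by (simp add: tensor_ring_def)

lemma D_inj: "U \<in> carrier TC \<Longrightarrow> V \<in> carrier TC \<Longrightarrow> D U = D V \<Longrightarrow> U = V"
  using D_iso by (auto simp: graded_rring_iso_def ring_iso_def bij_betw_def dest: inj_onD)

lemma D_hom:
  "U \<in> carrier TC \<Longrightarrow> D U \<in> carrier SR"
  "U \<in> carrier TC \<Longrightarrow> V \<in> carrier TC \<Longrightarrow> D (U \<oplus>\<^bsub>TC\<^esub> V) = (\<lambda>c. D U c + D V c)"
  "U \<in> carrier TC \<Longrightarrow> V \<in> carrier TC \<Longrightarrow> D (U \<otimes>\<^bsub>TC\<^esub> V) = D U \<otimes>\<^bsub>SR\<^esub> D V"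
  "D \<one>\<^bsub>TC\<^esub> = \<one>\<^bsub>SR\<^esub>"
  "r \<in> carrier KR \<Longrightarrow> U \<in> carrier TC \<Longrightarrow> D (lact TC r U) = lact SR r (D U)"
  "r \<in> carrier KR \<Longrightarrow> U \<in> carrier TC \<Longrightarrow> D (ract TC U r) = ract SR (D U) r"
  "D ` hcomp TC n = hcomp SR n" "D ` carrier TC = carrier SR"
  using D_iso
  by (auto simp: graded_rring_iso_def ring_iso_def ring_hom_def bij_betw_def path_ring_sel(5) Pi_iff)

lemma TC_act_closed:
  assumes "r \<in> carrier KR" "U \<in> carrier TC"
  shows "lact TC r U \<in> carrier TC" "ract TC U r \<in> carrier TC"
  using assms sh.tensor.lact_QW[of r] sh.tensor.ract_QW[of r] sh.W_lact_closed sh.W_ract_closed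
  by (auto simp: sh.tensor.carrier_QW tensor_ring_def)

lemma hcomp_TC: "hcomp TC n \<subseteq> carrier TC"
  using sh.tensor.hcomp_QW[of n] sh.tensor.deg(1)[of n] sh.tensor.carrier_QW by (auto simp: tensor_ring_def)

text \<open>The inverse of \<open>D\<close>, by which functions on saturated chains become elements
  of the tensor ring.\<close>

definition sig :: "('p list \<Rightarrow> 'k) \<Rightarrow> ('p \<Rightarrow> 'k, 'p \<Rightarrow> 'p \<Rightarrow> 'k) word_group set" where
  "sig F = scls (sh.path_frag F)"

lemma sig: "F \<in> carrier SR \<Longrightarrow> sig F \<in> carrier TC" "F \<in> carrier SR \<Longrightarrow> D (sig F) = F"
  using sh.path_frag_closed sh.Phi_path_frag by (auto simp: sig_def TC_carrier D_scls)

lemma sig_D: "U \<in> carrier TC \<Longrightarrow> sig (D U) = U"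
  using D_inj sig D_hom(1) by blast

lemma D_zero: "D \<zero>\<^bsub>TC\<^esub> = (\<lambda>c. 0)"
proof -
  interpret T: ring TC by (rule TC_ring)
  have "D \<zero>\<^bsub>TC\<^esub> = (\<lambda>c. D \<zero>\<^bsub>TC\<^esub> c + D \<zero>\<^bsub>TC\<^esub> c)"
    using D_hom(2)[OF T.zero_closed T.zero_closed] by (simp only: T.l_zero[OF T.zero_closed])
  then have "D \<zero>\<^bsub>TC\<^esub> c = D \<zero>\<^bsub>TC\<^esub> c + D \<zero>\<^bsub>TC\<^esub> c" for c by (rule fun_cong)
  then show ?thesis by (intro ext) (simp only: add_cancel_right_right)
qed

lemma D_minus:
  assumes "U \<in> carrier TC" "V \<in> carrier TC"
  shows "D (U \<ominus>\<^bsub>TC\<^esub> V) = (\<lambda>c. D U c - D V c)"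
proof -
  interpret T: ring TC by (rule TC_ring)
  have "U \<ominus>\<^bsub>TC\<^esub> V \<oplus>\<^bsub>TC\<^esub> V = U" using assms by (simp add: T.minus_eq T.a_assoc T.l_neg)
  then have "D U = (\<lambda>c. D (U \<ominus>\<^bsub>TC\<^esub> V) c + D V c)" using D_hom(2)[of "U \<ominus>\<^bsub>TC\<^esub> V" V] assms by simp
  then show ?thesis by (simp add: fun_eq_iff)
qed

lemma SR_CR: "F \<in> carrier SR \<Longrightarrow> F \<in> carrier CR"
proof -
  have "c \<in> pwalks P lt" if "c \<in> pwalks P cov" for c
    using that cov_lt successively_mono[of "\<lambda>x y. (x, y) \<in> cov" c "\<lambda>x y. (x, y) \<in> lt"]
    by (auto simp: pwalks_def walks_def)
  then show "F \<in> carrier SR \<Longrightarrow> F \<in> carrier CR" by (auto simp: path_ring_sel)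
qed

lemma del_not_cov:
  assumes "c \<in> chains" "i + 2 < length c" shows "del i c \<notin> pwalks P cov"
proof
  assume cov: "del i c \<in> pwalks P cov"
  let ?a = "take (Suc i) c" and ?b = "drop (i + 2) c"
  have ne: "?a \<noteq> []" "?b \<noteq> []" using assms by auto
  have "(last ?a, hd ?b) \<in> cov" using cov pwalks_append[OF ne] unfolding del_def by blast
  moreover have "last ?a = c ! i" "hd ?b = c ! Suc (Suc i)"
    using assms(2) by (simp_all add: take_Suc_conv_app_nth hd_drop_conv_nth)
  moreover have "(c ! i, c ! Suc i) \<in> lt" "(c ! Suc i, c ! Suc (Suc i)) \<in> lt"
    using assms by (auto simp: chains_iff sorted_wrt_iff_nth_less)
  ultimately show False using cov_between by metis
qed

lemma SR_cyc: "F \<in> carrier SR \<Longrightarrow> F \<in> cyc"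
  using SR_CR del_not_cov by (auto simp: cyc_def dif_def fun_eq_iff path_ring_sel intro!: sum.neutral)

text \<open>The cochain on one-step chains with the entries of \<open>f\<close>. For
  \<open>f\<close> of degree two its coboundary is
  \<open>\<Delta>\<^sub>1\<^sub>,\<^sub>1(f)\<close>.\<close>

definition ind2 :: "('p \<Rightarrow> 'p \<Rightarrow> 'k) \<Rightarrow> 'p list \<Rightarrow> 'k" where
  "ind2 f c = (if c \<in> chains \<and> length c = 2 then f (hd c) (last c) else 0)"

lemma ind2_closed: "ind2 f \<in> carrier CR"
  by (auto simp: chain_ring_carrier ind2_def)

text \<open>On a chain of three points the only deletion leaves its two ends. As \<open>f\<close>
  lives on intervals of length two, a nonzero value forces both steps to be covering pairs.\<close>

lemma dif_ind2:
  assumes f: "f \<in> hcomp KC 2"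
  shows "dif (ind2 f) c = (if c \<in> pwalks P cov \<and> length c = 3 then f (hd c) (last c) else 0)"
proof (cases "c \<in> chains \<and> length c = 3")
  case True
  then obtain x y z where c: "c = [x, y, z]" by (auto simp: numeral_eq_Suc length_Suc_conv)
  have xyz: "(x, y) \<in> lt" "(y, z) \<in> lt" using True c by (auto simp: chains_def)
  have "dif (ind2 f) c = f x z"
    using True xyz lt_trans[OF xyz] ltD(3,4) by (auto simp: dif_def c del_def ind2_def chains_def)
  moreover have "f x z = 0 \<or> c \<in> pwalks P cov"
  proof (cases "f x z = 0")
    case False
    then have "(x, z) \<in> leq" "il x z = 2" using f by (auto simp: KC_sel incidence_ring_sel)
    then show ?thesis using il_2_iff[of x z y] xyz ltD by (auto simp: c)
  qed simp
  ultimately show ?thesis using True by (auto simp: c)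
next
  case False
  have "dif (ind2 f) c = 0"
    using False length_del[of _ c] by (auto simp: dif_def ind2_def intro!: sum.neutral)
  moreover have "\<not> (c \<in> pwalks P cov \<and> length c = 3)"
  proof
    assume c: "c \<in> pwalks P cov \<and> length c = 3"
    then have "(\<lambda>d. if d = c then 1 else 0 :: 'k) \<in> carrier SR" by (auto simp: path_ring_sel)
    from SR_CR[OF this] have "c \<in> chains" by (auto simp: chain_ring_carrier)
    then show False using False c by blast
  qed
  ultimately show ?thesis by auto
qed

text \<open>On a saturated walk of two steps only the summand with \<open>z\<close> equal to its
  middle point is nonzero, so the walk gets the entry of \<open>f\<close> at its ends. This is the
  function found in \<open>dif_ind2\<close>.\<close>

lemma comult11_eq:
  assumes f: "f \<in> hcomp KC 2"
  shows "comult11 KR KC f \<in> carrier TC" "D (comult11 KR KC f) = dif (ind2 f)"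
proof -
  let ?w = "\<lambda>x y z. (\<one>\<^bsub>KR\<^esub>, [basis_elem (f x y) x z, basis_elem 1 z y])"
  define t where "t = (\<Sum>(x, y)\<in>leq. \<Sum>z\<in>interval leq x y. frag_of (?w x y z))"
  have fi: "finite (interval leq x y)" for x y
    by (rule finite_subset[OF _ finite_P]) (use leq_carrier in \<open>auto simp: interval_def\<close>)
  have w: "?w x y z \<in> fu.words" if "z \<in> interval leq x y" for x y z
    using that by (auto simp: interval_def base_ring_sel basis_elem_IA)
  have sumc: "sum h B \<in> carrier fu.W" if "finite B" "\<And>i. i \<in> B \<Longrightarrow> h i \<in> carrier fu.W"
    for h :: "'i \<Rightarrow> _" and B
    using that by (induction B rule: finite_induct) (auto simp: fu.W_0_closed fu.W_add_closed)
  have tW: "t \<in> carrier fu.W"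
    unfolding t_def using finite_leq fi w by (auto intro!: sumc fu.W_of_closed simp del: in_lists_conv_set)
  have Phi_t: "fu.\<Phi> t c = (\<Sum>(x, y)\<in>leq. \<Sum>z\<in>interval leq x y. word_val (?w x y z) c)" for c
    unfolding t_def by (simp add: fu.Phi_sum[OF finite_leq] fu.Phi_sum[OF fi] case_prod_unfold)
  have val: "fu.\<Phi> t c = (if length c = 3 then f (hd c) (last c) else 0)" if c: "c \<in> pwalks P cov" for c
  proof (cases "length c = 3")
    case True
    then obtain u v s where uvs: "c = [u, v, s]" by (auto simp: numeral_eq_Suc length_Suc_conv)
    have uv: "u \<in> P" "(u, v) \<in> leq" "(v, s) \<in> leq" using c uvs by (auto simp: cov_def)
    have us: "(u, s) \<in> leq" "v \<in> interval leq u s" using uv leq_trans by (auto simp: interval_def)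
    have "(\<Sum>z\<in>interval leq x y. word_val (?w x y z) c) = (if x = u \<and> y = s then f u s else 0)" for x y
    proof -
      have "(\<Sum>z\<in>interval leq x y. word_val (?w x y z) c)
          = (\<Sum>z\<in>interval leq x y. if z = v then (if x = u \<and> y = s then f u s else 0) else 0)"
        by (rule sum.cong) (auto simp: word_val_def uvs basis_elem_def base_ring_sel uv)
      then show ?thesis using us fi by auto
    qed
    then have "fu.\<Phi> t c = (\<Sum>p\<in>leq. if p = (u, s) then f u s else 0)"
      unfolding Phi_t by (intro sum.cong) (auto split: if_splits)
    then show ?thesis using us finite_leq by (simp add: uvs)
  next
    case False
    have "steps (snd (?w x y z)) c = 0" for x y z
    proof (rule ccontr)
      assume "steps (snd (?w x y z)) c \<noteq> 0"
      then have "length c = Suc (length (snd (?w x y z)))" by (rule steps_length)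
      then show False using False by simp
    qed
    then have "word_val (?w x y z) c = 0" for x y z by (simp add: word_val_def)
    then show ?thesis using False by (simp add: Phi_t case_prod_unfold)
  qed
  have "comult11 KR KC f = descend (\<lambda>t. scls (proj1 t)) (fu.T +>\<^bsub>fu.W\<^esub> t)"
    by (simp add: comult11_def KC_sel(7) t_def tensor_class_def[of KR KA])
  also have "\<dots> = scls (proj1 t)"
  proof (rule fu.tensor.descend_coset[OF tW])
    fix b assume b: "b \<in> carrier fu.W" "fu.\<Phi> b = fu.\<Phi> t"
    show "scls (proj1 b) = scls (proj1 t)"
      unfolding scls_eq_iff[OF Phi_proj1(1)[OF b(1)] Phi_proj1(1)[OF tW]]
        Phi_proj1(2)[OF b(1)] Phi_proj1(2)[OF tW] b(2) ..
  qed
  finally have eq: "comult11 KR KC f = scls (proj1 t)" .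
  show "comult11 KR KC f \<in> carrier TC" unfolding eq TC_carrier using Phi_proj1(1)[OF tW] by blast
  show "D (comult11 KR KC f) = dif (ind2 f)"
    unfolding eq D_scls[OF Phi_proj1(1)[OF tW]] Phi_proj1(2)[OF tW] dif_ind2[OF f, THEN ext[of "dif (ind2 f)"]]
    using val by (auto simp: fun_eq_iff dif_ind2[OF f])
qed

lemma SR_CR_mult: "F \<otimes>\<^bsub>SR\<^esub> G = F \<otimes>\<^bsub>CR\<^esub> G"
  by (simp add: path_ring_sel)

lemma twist_SR: "F \<in> carrier SR \<Longrightarrow> twist F \<in> carrier SR"
  by (auto simp: path_ring_sel twist_def)

lemma twist_twist: "twist (twist F) = F"
  by (auto simp: twist_def fun_eq_iff mult.assoc[symmetric] power_mult_distrib[symmetric])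

text \<open>A function on saturated chains is a cocycle, so one of the two Leibniz terms
  vanishes.\<close>

lemma dif_mult_SR:
  assumes X: "X \<in> carrier SR" and G: "G \<in> carrier CR"
  shows "dif (X \<otimes>\<^bsub>CR\<^esub> G) = twist X \<otimes>\<^bsub>CR\<^esub> dif G" "dif (G \<otimes>\<^bsub>CR\<^esub> X) = dif G \<otimes>\<^bsub>CR\<^esub> X"
proof -
  have 0: "dif X = (\<lambda>c. 0)" using SR_cyc[OF X] cyc_closed(2) by blast
  show "dif (X \<otimes>\<^bsub>CR\<^esub> G) = twist X \<otimes>\<^bsub>CR\<^esub> dif G"
    unfolding dif_mult[OF SR_CR[OF X] G] 0 by (simp add: path_ring_sel)
  show "dif (G \<otimes>\<^bsub>CR\<^esub> X) = dif G \<otimes>\<^bsub>CR\<^esub> X"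
    unfolding dif_mult[OF G SR_CR[OF X]] 0 by (simp add: path_ring_sel)
qed

abbreviation IS where "IS \<equiv> Idl\<^bsub>TC\<^esub> (comult11 KR KC ` hcomp KC 2)"

lemma comult11_closed: "comult11 KR KC ` hcomp KC 2 \<subseteq> carrier TC"
  using comult11_eq(1) by blast

lemma IS_ideal: "ideal IS TC"
  by (rule ring.genideal_ideal[OF TC_ring comult11_closed])

text \<open>By the Leibniz rule the classes whose function is a coboundary form an ideal, and this
  ideal contains the generating relations.\<close>

lemma IS_boundary:
  assumes "U \<in> IS"
  shows "U \<in> carrier TC" "D U \<in> dif ` carrier CR"
proof -
  interpret T: ring TC by (rule TC_ring)
  let ?J = "{U \<in> carrier TC. D U \<in> dif ` carrier CR}"
  have "ideal ?J TC"
  proof (rule idealI[OF TC_ring])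
    show "subgroup ?J (add_monoid TC)"
    proof (rule T.add.subgroupI)
      have "(\<lambda>c. 0) \<in> dif ` carrier CR"
        by (rule image_eqI[of _ _ "\<lambda>c. 0"]) (simp_all add: dif_zero chain_ring_carrier)
      then show "?J \<noteq> {}" using D_zero T.zero_closed by (metis (mono_tags, lifting) empty_iff mem_Collect_eq)
    next
      fix U assume "U \<in> ?J"
      then obtain G where U: "U \<in> carrier TC" and G: "G \<in> carrier CR" "D U = dif G" by blast
      have "D (\<ominus>\<^bsub>TC\<^esub> U) = (\<lambda>c. - D U c)"
        using D_minus[OF T.zero_closed U] U by (simp add: D_zero T.minus_eq)
      then have "D (\<ominus>\<^bsub>TC\<^esub> U) = dif (\<lambda>c. - G c)" by (simp add: G(2) dif_uminus)
      moreover have "(\<lambda>c. - G c) \<in> carrier CR" using G(1) by (rule path_neg_closed)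
      ultimately show "\<ominus>\<^bsub>TC\<^esub> U \<in> ?J" using U by blast
    next
      fix U V assume "U \<in> ?J" "V \<in> ?J"
      then obtain G H where U: "U \<in> carrier TC" "V \<in> carrier TC"
        and G: "G \<in> carrier CR" "D U = dif G" "H \<in> carrier CR" "D V = dif H" by blast
      have "D (U \<oplus>\<^bsub>TC\<^esub> V) = dif (\<lambda>c. G c + H c)"
        by (simp add: D_hom(2)[OF U] G dif_add)
      moreover have "(\<lambda>c. G c + H c) \<in> carrier CR"
        using path_add_closed[OF G(1,3)] by (simp add: path_ring_sel(5))
      ultimately show "U \<oplus>\<^bsub>TC\<^esub> V \<in> ?J" using U by blast
    qed blast
  next
    fix U X assume "U \<in> ?J" and X: "X \<in> carrier TC"
    then obtain G where U: "U \<in> carrier TC" and G: "G \<in> carrier CR" "D U = dif G" by blast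
    have DX: "D X \<in> carrier SR" by (rule D_hom(1)[OF X])
    \<comment> \<open>The sign of the Leibniz rule is put into the bounding cochain beforehand, as
      \<open>twist\<close> is an involution.\<close>
    have "D (X \<otimes>\<^bsub>TC\<^esub> U) = dif (twist (D X) \<otimes>\<^bsub>CR\<^esub> G)"
      unfolding D_hom(3)[OF X U] SR_CR_mult dif_mult_SR(1)[OF twist_SR[OF DX] G(1)] twist_twist G(2) ..
    moreover have "twist (D X) \<otimes>\<^bsub>CR\<^esub> G \<in> carrier CR"
      using path_mult_closed SR_CR twist_SR DX G(1) by blast
    ultimately show "X \<otimes>\<^bsub>TC\<^esub> U \<in> ?J" using X U by blast
    have "D (U \<otimes>\<^bsub>TC\<^esub> X) = dif (G \<otimes>\<^bsub>CR\<^esub> D X)"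
      unfolding D_hom(3)[OF U X] SR_CR_mult dif_mult_SR(2)[OF DX G(1)] G(2) ..
    moreover have "G \<otimes>\<^bsub>CR\<^esub> D X \<in> carrier CR"
      using path_mult_closed SR_CR DX G(1) by blast
    ultimately show "U \<otimes>\<^bsub>TC\<^esub> X \<in> ?J" using X U by blast
  qed
  moreover have "comult11 KR KC ` hcomp KC 2 \<subseteq> ?J"
    using comult11_eq ind2_closed by blast
  ultimately have "IS \<subseteq> ?J" by (rule T.genideal_minimal)
  then show "U \<in> carrier TC" "D U \<in> dif ` carrier CR" using assms by blast+
qed

definition res :: "('p list \<Rightarrow> 'k) \<Rightarrow> 'p list \<Rightarrow> 'k" where
  "res F c = (if c \<in> pwalks P cov then F c else 0)"

text \<open>Restriction is multiplicative because a chain is saturated if and only if both pieces of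
  a cut are.\<close>

lemma res:
  "F \<in> carrier CR \<Longrightarrow> res F \<in> carrier SR" "F \<in> carrier SR \<Longrightarrow> res F = F"
  "res (\<lambda>c. F c + G c) = (\<lambda>c. res F c + res G c)" "res (F \<otimes>\<^bsub>CR\<^esub> G) = res F \<otimes>\<^bsub>SR\<^esub> res G"
  "res \<one>\<^bsub>CR\<^esub> = \<one>\<^bsub>SR\<^esub>" "res (lact CR r F) = lact SR r (res F)" "res (ract CR F r) = ract SR (res F) r"
proof -
  show "F \<in> carrier CR \<Longrightarrow> res F \<in> carrier SR"
    by (rule path_ringI[where A = "{c. F c \<noteq> 0}"]) (auto simp: path_ring_sel res_def split: if_splits)
  show "F \<in> carrier SR \<Longrightarrow> res F = F" by (auto simp: path_ring_sel res_def fun_eq_iff)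
  show "res (F \<otimes>\<^bsub>CR\<^esub> G) = res F \<otimes>\<^bsub>SR\<^esub> res G"
  proof
    fix c
    show "res (F \<otimes>\<^bsub>CR\<^esub> G) c = (res F \<otimes>\<^bsub>SR\<^esub> res G) c"
    proof (cases "c \<in> pwalks P cov")
      case True
      then show ?thesis using pwalks_glue[of _ c P cov] by (auto simp: res_def path_ring_sel intro!: sum.cong)
    next
      case False
      have "res F (take (Suc k) c) * res G (drop k c) = 0" if "k < length c" for k
        using pwalks_glue[OF that, of P cov] False by (simp add: res_def)
      then have "(res F \<otimes>\<^bsub>SR\<^esub> res G) c = 0"
        unfolding path_ring_sel by (intro sum.neutral) simp
      then show ?thesis using False by (simp add: res_def[of "F \<otimes>\<^bsub>CR\<^esub> G"])
    qed
  qed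
qed (auto simp: res_def path_ring_sel fun_eq_iff)

lemma sig_hom:
  assumes F: "F \<in> carrier SR" and G: "G \<in> carrier SR"
  shows "sig (\<lambda>c. F c + G c) = sig F \<oplus>\<^bsub>TC\<^esub> sig G" "sig (F \<otimes>\<^bsub>SR\<^esub> G) = sig F \<otimes>\<^bsub>TC\<^esub> sig G"
    "sig (\<lambda>c. 0) = \<zero>\<^bsub>TC\<^esub>" "sig \<one>\<^bsub>SR\<^esub> = \<one>\<^bsub>TC\<^esub>"
    "r \<in> carrier KR \<Longrightarrow> sig (lact SR r F) = lact TC r (sig F)"
    "r \<in> carrier KR \<Longrightarrow> sig (ract SR F r) = ract TC (sig F) r"
proof -
  interpret T: ring TC by (rule TC_ring)
  note s = sig[OF F] sig[OF G]
  have eqI: "sig H = U" if "U \<in> carrier TC" "D U = H" for H U using sig_D[OF that(1)] that(2) by simp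
  show "sig (\<lambda>c. F c + G c) = sig F \<oplus>\<^bsub>TC\<^esub> sig G" "sig (F \<otimes>\<^bsub>SR\<^esub> G) = sig F \<otimes>\<^bsub>TC\<^esub> sig G"
    "sig (\<lambda>c. 0) = \<zero>\<^bsub>TC\<^esub>" "sig \<one>\<^bsub>SR\<^esub> = \<one>\<^bsub>TC\<^esub>"
    "r \<in> carrier KR \<Longrightarrow> sig (lact SR r F) = lact TC r (sig F)"
    "r \<in> carrier KR \<Longrightarrow> sig (ract SR F r) = ract TC (sig F) r"
    by (rule eqI; simp add: s TC_act_closed D_hom D_zero)+
qed

abbreviation delta :: "'p list \<Rightarrow> 'k \<Rightarrow> 'p list \<Rightarrow> 'k" where
  "delta e a \<equiv> \<lambda>c. if c = e then a else 0"

lemma delta_mult: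
  assumes "u \<noteq> []" "v \<noteq> []" "last u = hd v"
  shows "delta u a \<otimes>\<^bsub>CR\<^esub> delta v b = delta (u @ tl v) (a * b)"
proof
  fix c
  show "(delta u a \<otimes>\<^bsub>CR\<^esub> delta v b) c = delta (u @ tl v) (a * b) c"
  proof (cases "c = u @ tl v")
    case True
    have u: "butlast u @ [hd v] = u" using assms by (metis append_butlast_last_id)
    have v: "hd v # tl v = v" using assms(2) by simp
    have "c = butlast u @ v" using True u v by (metis append.assoc append_Cons append_Nil)
    then have d: "drop (length u - 1) c = v" by (simp add: append_eq_conv_conj[symmetric])
    have n: "length u - 1 < length c" using True assms(1) by (cases u) auto
    have t: "take (Suc k) c = u \<longleftrightarrow> k = length u - 1" if "k < length c" for k
    proof
      assume "take (Suc k) c = u"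
      then have "length u = Suc k" using that by (metis Suc_leI length_take min_absorb2)
      then show "k = length u - 1" by simp
    qed (use True assms(1) in simp)
    have "delta u a (take (Suc k) c) * delta v b (drop k c) = (if k = length u - 1 then a * b else 0)"
      if "k \<in> {..<length c}" for k
      using t[of k] that d by (cases "k = length u - 1") simp_all
    then have "(delta u a \<otimes>\<^bsub>CR\<^esub> delta v b) c = (\<Sum>k<length c. if k = length u - 1 then a * b else 0)"
      unfolding path_ring_sel by (rule sum.cong[OF refl])
    also have "\<dots> = a * b" using n by (simp only: sum.delta finite_lessThan lessThan_iff if_True)
    finally show ?thesis using True by simp
  next
    case False
    have "delta u a (take (Suc k) c) * delta v b (drop k c) = 0" for k
    proof (rule ccontr)
      assume "delta u a (take (Suc k) c) * delta v b (drop k c) \<noteq> 0"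
      then have "take (Suc k) c = u" "drop k c = v" by (auto split: if_splits)
      then have "c = u @ tl v" by (metis append_take_drop_id drop_Suc tl_drop)
      then show False using False by simp
    qed
    then have "(delta u a \<otimes>\<^bsub>CR\<^esub> delta v b) c = 0"
      unfolding path_ring_sel by (intro sum.neutral ballI)
    then show ?thesis using False by simp
  qed
qed

text \<open>If the restricted coboundary is nonzero, some saturated \<open>c\<close> arises from
  \<open>e\<close> by inserting a point, which factors \<open>e\<close> into saturated pieces around
  one step of length two. The full coboundary is then a multiple of a relation, so restricting it
  changes nothing.\<close>

lemma IS_delta:
  assumes e: "e \<in> chains"
  shows "sig (res (dif (delta e a))) \<in> IS"
proof -
  interpret T: ring TC by (rule TC_ring)
  interpret I: ideal IS TC by (rule IS_ideal)
  have z: "(\<lambda>c. 0) \<in> carrier SR" by (simp add: path_ring_sel)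
  show ?thesis
  proof (cases "res (dif (delta e a)) = (\<lambda>c. 0)")
    case True
    then show ?thesis using sig_hom(3)[OF z z] I.zero_closed by simp
  next
    case False
    then obtain c where "res (dif (delta e a)) c \<noteq> 0" by auto
    then have c: "c \<in> pwalks P cov" and nz: "dif (delta e a) c \<noteq> 0" by (auto simp: res_def split: if_splits)
    have "(\<Sum>i<length c - 2. (-1) ^ i * delta e a (del i c)) \<noteq> 0"
      using nz by (simp add: dif_def split: if_splits)
    then obtain i where "i \<in> {..<length c - 2}" "(-1) ^ i * delta e a (del i c) \<noteq> 0"
      using sum.not_neutral_contains_not_neutral by blast
    then have i: "Suc (Suc i) < length c" and ei: "e = del i c" by (auto split: if_splits)
    define u where "u = take (Suc i) c"
    define w where "w = c ! Suc i"
    define v where "v = drop (i + 2) c"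
    have ne: "u \<noteq> []" "v \<noteq> []" using i by (auto simp: u_def v_def)
    have c_eq: "c = u @ [w] @ v" using i by (simp add: u_def v_def w_def Cons_nth_drop_Suc)
    have cv: "u \<in> pwalks P cov" "v \<in> pwalks P cov" "(last u, w) \<in> cov" "(w, hd v) \<in> cov"
      using c pwalks_append[of u "w # v" P cov] pwalks_append[of "[w]" v P cov] ne unfolding c_eq by auto
    define f where "f = basis_elem (1 :: 'k) (last u) (hd v)"
    have st: "(last u, hd v) \<in> leq" "il (last u) (hd v) = 2"
      using cv(3,4) leq_trans il_add[of "last u" w "hd v"] by (auto simp: cov_def)
    then have f: "f \<in> hcomp KC 2" by (auto simp: KC_sel incidence_ring_sel f_def basis_elem_def)
    have lt: "(last u, hd v) \<in> lt" using cv(3,4) cov_lt lt_trans by blast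
    have ind: "ind2 f = delta [last u, hd v] 1"
    proof
      fix d
      show "ind2 f d = delta [last u, hd v] 1 d"
      proof (cases "length d = 2")
        case True
        then obtain x y where "d = [x, y]" by (auto simp: numeral_eq_Suc length_Suc_conv)
        then show ?thesis using lt ltD(3,4) by (auto simp: ind2_def f_def basis_elem_def chains_def)
      qed (auto simp: ind2_def)
    qed
    let ?X = "delta u a" and ?Z = "delta v 1"
    have X: "?X \<in> carrier SR" and Z: "?Z \<in> carrier SR" using cv(1,2) by (auto simp: path_ring_sel)
    have "delta e a = delta u a \<otimes>\<^bsub>CR\<^esub> delta [last u, hd v] 1 \<otimes>\<^bsub>CR\<^esub> delta v 1"
      using delta_mult[of u "[last u, hd v]" a 1] delta_mult[of "u @ [hd v]" v a 1] ne
      by (simp only: ei del_def u_def[symmetric] v_def[symmetric] mult_1_right list.sel append_assoc append_Cons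
          append_Nil hd_Cons_tl last_snoc simp_thms list.distinct append_is_Nil_conv)
    then have e_eq: "delta e a = ?X \<otimes>\<^bsub>CR\<^esub> ind2 f \<otimes>\<^bsub>CR\<^esub> ?Z" by (simp only: ind)
    have XY: "?X \<otimes>\<^bsub>CR\<^esub> ind2 f \<in> carrier CR" by (rule path_mult_closed[OF SR_CR[OF X] ind2_closed])
    have "dif (delta e a) = twist ?X \<otimes>\<^bsub>SR\<^esub> D (comult11 KR KC f) \<otimes>\<^bsub>SR\<^esub> ?Z"
      unfolding e_eq dif_mult_SR(2)[OF Z XY] dif_mult_SR(1)[OF X ind2_closed] comult11_eq(2)[OF f] SR_CR_mult ..
    also have "\<dots> = D (sig (twist ?X) \<otimes>\<^bsub>TC\<^esub> comult11 KR KC f \<otimes>\<^bsub>TC\<^esub> sig ?Z)"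
      using sig[OF twist_SR[OF X]] sig[OF Z] comult11_eq(1)[OF f] by (simp add: D_hom(3))
    finally have d: "dif (delta e a) = D (sig (twist ?X) \<otimes>\<^bsub>TC\<^esub> comult11 KR KC f \<otimes>\<^bsub>TC\<^esub> sig ?Z)" .
    have "comult11 KR KC f \<in> IS" using T.genideal_self[OF comult11_closed] f by blast
    then have IS: "sig (twist ?X) \<otimes>\<^bsub>TC\<^esub> comult11 KR KC f \<otimes>\<^bsub>TC\<^esub> sig ?Z \<in> IS"
      using I.I_l_closed I.I_r_closed sig(1)[OF twist_SR[OF X]] sig(1)[OF Z] by blast
    have "sig (res (dif (delta e a))) = sig (twist ?X) \<otimes>\<^bsub>TC\<^esub> comult11 KR KC f \<otimes>\<^bsub>TC\<^esub> sig ?Z"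
      unfolding d res(2)[OF D_hom(1)[OF IS_boundary(1)[OF IS]]] by (rule sig_D[OF IS_boundary(1)[OF IS]])
    then show ?thesis using IS by simp
  qed
qed

text \<open>The coboundaries of the single chains in \<open>G\<close> may have parts off the
  saturated chains, but their sum \<open>dif G = D U\<close> has none. Hence \<open>dif G\<close> is
  the sum of the restricted coboundaries, each of which is in the ideal by
  \<open>IS_delta\<close>.\<close>

lemma IS_iff:
  assumes U: "U \<in> carrier TC"
  shows "U \<in> IS \<longleftrightarrow> D U \<in> dif ` carrier CR"
proof
  assume "D U \<in> dif ` carrier CR"
  then obtain G where G: "G \<in> carrier CR" "D U = dif G" by blast
  interpret I: ideal IS TC by (rule IS_ideal)
  have z: "(\<lambda>c. 0) \<in> carrier SR" by (simp add: path_ring_sel)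
  let ?h = "\<lambda>e. res (dif (delta e (G e)))"
  have h: "?h e \<in> carrier SR" for e by (rule res(1)[OF dif_closed])
  have "(\<lambda>c. \<Sum>e\<in>B. ?h e c) \<in> carrier SR \<and> sig (\<lambda>c. \<Sum>e\<in>B. ?h e c) \<in> IS" if "finite B" "B \<subseteq> chains" for B
    using that
  proof (induction B rule: finite_induct)
    case empty
    then show ?case using sig_hom(3)[OF z z] I.zero_closed z by simp
  next
    case (insert e B)
    have eq: "(\<lambda>c. \<Sum>e\<in>insert e B. ?h e c) = (\<lambda>c. ?h e c + (\<Sum>e\<in>B. ?h e c))"
      using insert by (simp add: fun_eq_iff)
    have IH: "(\<lambda>c. \<Sum>e\<in>B. ?h e c) \<in> carrier SR" "sig (\<lambda>c. \<Sum>e\<in>B. ?h e c) \<in> IS"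
      using insert by auto
    show ?case
      unfolding eq sig_hom(1)[OF h IH(1)]
      using path_add_closed[OF h IH(1)] additive_subgroup.a_closed[OF ideal.axioms(1)[OF IS_ideal] IS_delta IH(2)] insert.prems
      by (simp add: path_ring_sel(5))
  qed
  from this[OF finite_chains subset_refl] have *: "sig (\<lambda>c. \<Sum>e\<in>chains. ?h e c) \<in> IS" by blast
  have "G = (\<lambda>c. \<Sum>e\<in>chains. delta e (G e) c)"
    using G(1) finite_chains by (auto simp: fun_eq_iff chain_ring_carrier sum.delta cong: if_cong)
  then have dG: "dif G = (\<lambda>c. \<Sum>e\<in>chains. dif (delta e (G e)) c)"
    using dif_sum[OF finite_chains, of "\<lambda>e. delta e (G e)"] by simp
  have "dif G = res (dif G)" using res(2)[OF D_hom(1)[OF U]] G(2) by simp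
  also have "\<dots> = (\<lambda>c. \<Sum>e\<in>chains. ?h e c)"
  proof
    fix c
    show "res (dif G) c = (\<Sum>e\<in>chains. ?h e c)"
      unfolding res_def fun_cong[OF dG, of c] by simp
  qed
  finally have "dif G = (\<lambda>c. \<Sum>e\<in>chains. ?h e c)" .
  then show "U \<in> IS" using * sig_D[OF U] G(2) by simp
qed (rule IS_boundary(2))

end


section \<open>The isomorphism\<close>

context poset_over_field begin

abbreviation SH where "SH \<equiv> shriek_ring KR KC"
abbreviation cos where "cos U \<equiv> IS +>\<^bsub>TC\<^esub> U"

lemma SH_sel:
  "carrier SH = cos ` carrier TC" "\<one>\<^bsub>SH\<^esub> = cos \<one>\<^bsub>TC\<^esub>" "\<zero>\<^bsub>SH\<^esub> = cos \<zero>\<^bsub>TC\<^esub>" "hcomp SH n = cos ` hcomp TC n"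
  "U \<in> carrier TC \<Longrightarrow> V \<in> carrier TC \<Longrightarrow> cos U \<oplus>\<^bsub>SH\<^esub> cos V = cos (U \<oplus>\<^bsub>TC\<^esub> V)"
  "U \<in> carrier TC \<Longrightarrow> V \<in> carrier TC \<Longrightarrow> cos U \<otimes>\<^bsub>SH\<^esub> cos V = cos (U \<otimes>\<^bsub>TC\<^esub> V)"
proof -
  interpret I: ideal IS TC by (rule IS_ideal)
  show "carrier SH = cos ` carrier TC"
    unfolding shriek_ring_def quotient_rring_def FactRing_def by (auto simp: A_RCOSETS_def' a_r_coset_def')
  show "\<one>\<^bsub>SH\<^esub> = cos \<one>\<^bsub>TC\<^esub>" "hcomp SH n = cos ` hcomp TC n"
    unfolding shriek_ring_def quotient_rring_def FactRing_def by simp_all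
  show "\<zero>\<^bsub>SH\<^esub> = cos \<zero>\<^bsub>TC\<^esub>"
    unfolding shriek_ring_def quotient_rring_def FactRing_def using I.a_coset_add_zero[OF I.a_subset] by simp
  show "U \<in> carrier TC \<Longrightarrow> V \<in> carrier TC \<Longrightarrow> cos U \<oplus>\<^bsub>SH\<^esub> cos V = cos (U \<oplus>\<^bsub>TC\<^esub> V)"
    unfolding shriek_ring_def quotient_rring_def FactRing_def using I.a_rcos_sum by simp
  show "U \<in> carrier TC \<Longrightarrow> V \<in> carrier TC \<Longrightarrow> cos U \<otimes>\<^bsub>SH\<^esub> cos V = cos (U \<otimes>\<^bsub>TC\<^esub> V)"
    unfolding shriek_ring_def quotient_rring_def FactRing_def using I.rcoset_mult_add by simp
qed

lemma SH_ring: "ring SH"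
proof (rule ring_of_inj_hom[where h = "\<lambda>x. x"])
  show "ring (TC Quot IS)" by (rule ideal.quotient_is_ring[OF IS_ideal])
  then interpret Q: ring "TC Quot IS" .
  have c: "carrier SH = carrier (TC Quot IS)" "a \<oplus>\<^bsub>SH\<^esub> b = a \<oplus>\<^bsub>TC Quot IS\<^esub> b"
    "a \<otimes>\<^bsub>SH\<^esub> b = a \<otimes>\<^bsub>TC Quot IS\<^esub> b" "\<zero>\<^bsub>SH\<^esub> = \<zero>\<^bsub>TC Quot IS\<^esub>" "\<one>\<^bsub>SH\<^esub> = \<one>\<^bsub>TC Quot IS\<^esub>" for a b
    by (simp_all only: shriek_ring_def quotient_rring_def graded_bimodule.simps ring_record_simps
        ring.simps monoid.simps partial_object.simps)
  show "\<And>a b. \<lbrakk>a \<in> carrier SH; b \<in> carrier SH\<rbrakk> \<Longrightarrow> a \<oplus>\<^bsub>SH\<^esub> b \<in> carrier SH"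
    "\<And>a b. \<lbrakk>a \<in> carrier SH; b \<in> carrier SH\<rbrakk> \<Longrightarrow> a \<otimes>\<^bsub>SH\<^esub> b \<in> carrier SH"
    "\<zero>\<^bsub>SH\<^esub> \<in> carrier SH" "\<one>\<^bsub>SH\<^esub> \<in> carrier SH"
    "\<And>a. a \<in> carrier SH \<Longrightarrow> a \<in> carrier (TC Quot IS)"
    "\<And>a b. \<lbrakk>a \<in> carrier SH; b \<in> carrier SH\<rbrakk> \<Longrightarrow> a \<oplus>\<^bsub>SH\<^esub> b = a \<oplus>\<^bsub>TC Quot IS\<^esub> b"
    "\<And>a b. \<lbrakk>a \<in> carrier SH; b \<in> carrier SH\<rbrakk> \<Longrightarrow> a \<otimes>\<^bsub>SH\<^esub> b = a \<otimes>\<^bsub>TC Quot IS\<^esub> b"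
    "\<zero>\<^bsub>SH\<^esub> = \<zero>\<^bsub>TC Quot IS\<^esub>" "\<one>\<^bsub>SH\<^esub> = \<one>\<^bsub>TC Quot IS\<^esub>"
    by (simp_all only: c Q.add.m_closed Q.m_closed Q.zero_closed Q.one_closed)
  show "\<exists>b\<in>carrier SH. b = \<ominus>\<^bsub>TC Quot IS\<^esub> a" if "a \<in> carrier SH" for a
    using Q.a_inv_closed[OF that[unfolded c]] unfolding c by (intro bexI[of _ "\<ominus>\<^bsub>TC Quot IS\<^esub> a"] refl)
qed simp

lemma cos_eq_iff:
  assumes "U \<in> carrier TC" "V \<in> carrier TC"
  shows "cos U = cos V \<longleftrightarrow> (\<lambda>c. D U c - D V c) \<in> dif ` carrier CR"
proof -
  interpret T: ring TC by (rule TC_ring)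
  have "cos U = cos V \<longleftrightarrow> U \<ominus>\<^bsub>TC\<^esub> V \<in> IS"
    using T.quotient_eq_iff_same_a_r_cos[OF IS_ideal assms] by blast
  then show ?thesis using assms by (simp add: IS_iff D_minus)
qed

text \<open>The actions pass to the quotient because \<open>dif\<close> commutes with them, so that
  equivalent elements stay equivalent.\<close>

lemma cos_act:
  assumes r: "r \<in> carrier KR" and U: "U \<in> carrier TC"
  shows "lact SH r (cos U) = cos (lact TC r U)" "ract SH (cos U) r = cos (ract TC U r)"
proof -
  interpret I: ideal IS TC by (rule IS_ideal)
  have self: "U \<in> cos U" using I.a_rcos_self[OF U] .
  have V: "V \<in> carrier TC \<and> (\<exists>G\<in>carrier CR. (\<lambda>c. D V c - D U c) = dif G)" if "V \<in> cos U" for V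
  proof -
    have "V \<in> carrier TC" using that I.a_r_coset_subset_G[OF I.a_subset U] by blast
    moreover have "cos V = cos U" using I.a_repr_independence[OF that U I.a_subgroup] by simp
    ultimately show ?thesis using cos_eq_iff[of V U] U by auto
  qed
  have "cos (lact TC r V) = cos (lact TC r U) \<and> cos (ract TC V r) = cos (ract TC U r)" if VU: "V \<in> cos U" for V
  proof -
    obtain G where VT: "V \<in> carrier TC" and G: "G \<in> carrier CR" "(\<lambda>c. D V c - D U c) = dif G" using V[OF VU] by blast
    have Gc: "D V c - D U c = dif G c" for c using fun_cong[OF G(2), of c] .
    have "(\<lambda>c. D (lact TC r V) c - D (lact TC r U) c) = dif (lact CR r G)"
      "(\<lambda>c. D (ract TC V r) c - D (ract TC U r) c) = dif (ract CR G r)"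
      unfolding D_hom(5)[OF r VT] D_hom(5)[OF r U] D_hom(6)[OF r VT] D_hom(6)[OF r U] dif_act
      by (simp_all add: path_ring_sel Gc[symmetric] algebra_simps)
    moreover have "lact CR r G \<in> carrier CR" "ract CR G r \<in> carrier CR"
      using G(1) by (auto simp: path_ring_sel chain_ring_carrier)
    ultimately show ?thesis
      unfolding cos_eq_iff[OF TC_act_closed(1)[OF r VT] TC_act_closed(1)[OF r U]]
        cos_eq_iff[OF TC_act_closed(2)[OF r VT] TC_act_closed(2)[OF r U]] by blast
  qed
  then show "lact SH r (cos U) = cos (lact TC r U)" "ract SH (cos U) r = cos (ract TC U r)"
    unfolding shriek_ring_def quotient_rring_def
    by (simp_all add: descend_const[OF self, of "\<lambda>x. cos (lact TC r x)"] descend_const[OF self, of "\<lambda>x. cos (ract TC x r)"])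
qed

text \<open>The isomorphism before passing to cohomology classes. It is multiplicative on all
  cochains, but its kernel consists of coboundaries only after restriction to cocycles.\<close>

definition psi :: "('p list \<Rightarrow> 'k) \<Rightarrow> ('p \<Rightarrow> 'k, 'p \<Rightarrow> 'p \<Rightarrow> 'k) word_group set set" where
  "psi F = cos (sig (res F))"

lemma psi_hom:
  assumes F: "F \<in> carrier CR" and G: "G \<in> carrier CR"
  shows "psi F \<in> carrier SH" "psi (\<lambda>c. F c + G c) = psi F \<oplus>\<^bsub>SH\<^esub> psi G" "psi (F \<otimes>\<^bsub>CR\<^esub> G) = psi F \<otimes>\<^bsub>SH\<^esub> psi G"
    "psi \<one>\<^bsub>CR\<^esub> = \<one>\<^bsub>SH\<^esub>"
    "r \<in> carrier KR \<Longrightarrow> psi (lact CR r F) = lact SH r (psi F)"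
    "r \<in> carrier KR \<Longrightarrow> psi (ract CR F r) = ract SH (psi F) r"
    "psi F = \<zero>\<^bsub>SH\<^esub> \<longleftrightarrow> res F \<in> dif ` carrier CR"
proof -
  interpret T: ring TC by (rule TC_ring)
  note rF = res(1)[OF F] and rG = res(1)[OF G]
  note s = sig(1)[OF rF] sig(1)[OF rG]
  show "psi F \<in> carrier SH" using s by (simp add: psi_def SH_sel)
  show "psi (\<lambda>c. F c + G c) = psi F \<oplus>\<^bsub>SH\<^esub> psi G"
    by (simp only: psi_def res(3) sig_hom(1)[OF rF rG] SH_sel(5)[OF s])
  show "psi (F \<otimes>\<^bsub>CR\<^esub> G) = psi F \<otimes>\<^bsub>SH\<^esub> psi G"
    by (simp only: psi_def res(4) sig_hom(2)[OF rF rG] SH_sel(6)[OF s])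
  show "psi \<one>\<^bsub>CR\<^esub> = \<one>\<^bsub>SH\<^esub>"
    by (simp only: psi_def res(5) sig_hom(4)[OF rF rG] SH_sel(2))
  show "r \<in> carrier KR \<Longrightarrow> psi (lact CR r F) = lact SH r (psi F)"
    by (simp only: psi_def res(6) sig_hom(5)[OF rF rF] cos_act(1)[OF _ s(1)])
  show "r \<in> carrier KR \<Longrightarrow> psi (ract CR F r) = ract SH (psi F) r"
    by (simp only: psi_def res(7) sig_hom(6)[OF rF rF] cos_act(2)[OF _ s(1)])
  show "psi F = \<zero>\<^bsub>SH\<^esub> \<longleftrightarrow> res F \<in> dif ` carrier CR"
    using cos_eq_iff[OF s(1) T.zero_closed] by (simp add: psi_def SH_sel(3) D_zero sig(2)[OF rF])
qed

text \<open>Functions on saturated chains are cocycles and are fixed by \<open>res\<close>, so each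
  class is reached from a cocycle, and in its own degree.\<close>

lemma psi_surj: "psi ` cyc = carrier SH" "psi ` (hcomp CR n \<inter> cyc) = hcomp SH n"
proof -
  have img: "psi ` X = cos ` Y" if X: "X \<subseteq> carrier CR" "res ` X \<subseteq> D ` Y" and Y: "Y \<subseteq> carrier TC" "D ` Y \<subseteq> X" for X Y
  proof (intro equalityI subsetI)
    fix z assume "z \<in> psi ` X"
    then obtain F where F: "F \<in> X" "z = psi F" by blast
    then obtain U where U: "U \<in> Y" "res F = D U" using X(2) by blast
    have "sig (res F) = U" unfolding U(2) using sig_D U(1) Y(1) by blast
    then show "z \<in> cos ` Y" using F(2) U(1) by (simp add: psi_def)
  next
    fix z assume "z \<in> cos ` Y"
    then obtain U where U: "U \<in> Y" "z = cos U" by blast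
    then have UT: "U \<in> carrier TC" using Y(1) by blast
    have "psi (D U) = z" unfolding psi_def res(2)[OF D_hom(1)[OF UT]] sig_D[OF UT] U(2) ..
    then show "z \<in> psi ` X" using U(1) Y(2) by blast
  qed
  have cyc: "cyc \<subseteq> carrier CR" using cyc_closed(1) by blast
  have 1: "psi ` cyc = cos ` carrier TC"
    by (rule img) (use cyc res(1) SR_cyc D_hom(1) in \<open>auto simp: D_hom(8)\<close>)
  then show "psi ` cyc = carrier SH" by (simp add: SH_sel)
  have "psi ` (hcomp CR n \<inter> cyc) = cos ` hcomp TC n"
  proof (rule img)
    show "hcomp CR n \<inter> cyc \<subseteq> carrier CR" using cyc by blast
    show "res ` (hcomp CR n \<inter> cyc) \<subseteq> D ` hcomp TC n"
    proof (rule image_subsetI)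
      fix F assume F: "F \<in> hcomp CR n \<inter> cyc"
      then have "res F \<in> carrier SR" using cyc res(1) by blast
      then show "res F \<in> D ` hcomp TC n" unfolding D_hom(7) using F by (auto simp: path_ring_sel res_def split: if_splits)
    qed
    show "hcomp TC n \<subseteq> carrier TC" by (rule hcomp_TC)
    have "hcomp SR n \<subseteq> carrier SR" "F \<in> hcomp SR n \<Longrightarrow> c \<in> pwalks P cov \<or> F c = 0" for F c by (auto simp: path_ring_sel)
    then show "D ` hcomp TC n \<subseteq> hcomp CR n \<inter> cyc"
      unfolding D_hom(7) using SR_cyc SR_CR by (auto simp: CR_hcomp) (auto simp: path_ring_sel)
  qed
  then show "psi ` (hcomp CR n \<inter> cyc) = hcomp SH n" by (simp add: SH_sel)
qed

text \<open>The difference \<open>F - res F\<close> is a cocycle that vanishes on saturated chains,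
  hence a coboundary by \<open>koszul_acyclic\<close>. This is the point where the Koszul property
  enters.\<close>

lemma res_boundary_iff:
  assumes koszul: "koszul_ring TYPE('m) KA" and F: "F \<in> cyc"
  shows "res F \<in> dif ` carrier CR \<longleftrightarrow> F \<in> dif ` carrier CR"
proof -
  have FC: "F \<in> carrier CR" "dif F = (\<lambda>c. 0)" using cyc_closed(1,2)[OF F] .
  have r: "res F \<in> cyc" by (rule SR_cyc[OF res(1)[OF FC(1)]])
  let ?E = "\<lambda>c. F c + - res F c"
  have "?E \<in> cyc" by (rule cyc_closed(3)[OF F cyc_closed(4)[OF r]])
  then have "\<exists>G\<in>carrier CR. dif G = ?E"
    by (intro koszul_acyclic[OF koszul]) (use cyc_closed(1,2) in \<open>auto simp: res_def\<close>)
  then obtain H where H: "H \<in> carrier CR" "dif H = ?E" by blast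
  have Hc: "F c = dif H c + res F c" for c using fun_cong[OF H(2), of c] by simp
  have add: "(\<lambda>c. dif A c + dif B c) \<in> dif ` carrier CR" if "A \<in> carrier CR" "B \<in> carrier CR" for A B
    using path_add_closed[OF that] unfolding dif_add[symmetric] path_ring_sel(5) by blast
  have H': "(\<lambda>c. - H c) \<in> carrier CR" using H(1) by (rule path_neg_closed)
  show ?thesis
  proof
    assume "res F \<in> dif ` carrier CR"
    then obtain B where B: "B \<in> carrier CR" "res F = dif B" by blast
    have "F = (\<lambda>c. dif H c + dif B c)" using Hc unfolding B(2) by (intro ext)
    then show "F \<in> dif ` carrier CR" using add[OF H(1) B(1)] by simp
  next
    assume "F \<in> dif ` carrier CR"
    then obtain B where B: "B \<in> carrier CR" "F = dif B" by blast
    have "res F c = dif (\<lambda>c. - H c) c + dif B c" for c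
      using Hc[of c] by (simp add: dif_uminus B(2)[symmetric])
    then have "res F = (\<lambda>c. dif (\<lambda>c. - H c) c + dif B c)" by (intro ext)
    then show "res F \<in> dif ` carrier CR" using add[OF H' B(1)] by simp
  qed
qed

definition cocycle_ring where
  "cocycle_ring = CC\<lparr>carrier := cocycles KR KA, hcomp := (\<lambda>n. hcomp CC n \<inter> cocycles KR KA)\<rparr>"

lemma cocycle_ring_sel:
  "carrier cocycle_ring = cochain ` cyc" "f \<oplus>\<^bsub>cocycle_ring\<^esub> g = f \<oplus>\<^bsub>CC\<^esub> g" "f \<otimes>\<^bsub>cocycle_ring\<^esub> g = f \<otimes>\<^bsub>CC\<^esub> g"
  "\<zero>\<^bsub>cocycle_ring\<^esub> = \<zero>\<^bsub>CC\<^esub>" "\<one>\<^bsub>cocycle_ring\<^esub> = \<one>\<^bsub>CC\<^esub>" "lact cocycle_ring = lact CC" "ract cocycle_ring = ract CC"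
  "hcomp cocycle_ring n = cochain ` (hcomp CR n \<inter> cyc)"
proof -
  have "cochain ` hcomp CR n \<inter> cochain ` cyc = cochain ` (hcomp CR n \<inter> cyc)"
    using cochain_inj cyc_closed(1) by (auto simp: CR_hcomp)
  then show "hcomp cocycle_ring n = cochain ` (hcomp CR n \<inter> cyc)"
    by (simp add: cocycle_ring_def cochain_hcomp cocycles_eq)
qed (simp_all add: cocycle_ring_def cocycles_eq)

text \<open>On cocycles \<open>psi\<close> is onto and its kernel is the set of coboundaries, so the
  first isomorphism theorem applies to the cocycle ring.\<close>

theorem ext_shriek_iso:
  assumes koszul: "koszul_ring TYPE('m) KA"
  shows "\<exists>\<phi>. \<phi> \<in> graded_rring_iso KR (ext_ring KR KA) SH"
proof -
  \<comment> \<open>Cochains correspond one to one to functions on chains, along which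
    \<open>psi\<close> is transported to the cochains themselves.\<close>
  define \<Phi> where "\<Phi> f = psi (the_inv_into (carrier CR) cochain f)" for f
  have inj: "inj_on cochain (carrier CR)" using cochain_inj by (rule inj_onI)
  have Phi: "\<Phi> (cochain F) = psi F" if "F \<in> carrier CR" for F
    by (simp only: \<Phi>_def the_inv_into_f_f[OF inj that])
  note cC = cyc_closed(1)
  have "graded_rring_quotient cocycle_ring (coboundary KR KA ` cochains KR KA) SH \<Phi> KR"
  proof (rule graded_rring_quotient.intro)
    show "abelian_group cocycle_ring"
    proof (rule abelian_groupI)
      fix f assume "f \<in> carrier cocycle_ring"
      then obtain F where "F \<in> cyc" "f = cochain F" by (auto simp: cocycle_ring_sel)
      then show "\<exists>g\<in>carrier cocycle_ring. g \<oplus>\<^bsub>cocycle_ring\<^esub> f = \<zero>\<^bsub>cocycle_ring\<^esub>"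
        using cyc_closed(4) by (intro bexI[of _ "cochain (\<lambda>c. - F c)"]) (auto simp: cocycle_ring_sel cochain_add cochain_zero)
    qed (auto simp: cocycle_ring_sel cochain_add cochain_zero cyc_closed(3,5) ac_simps)
    show "ring SH" by (rule SH_ring)
    show "\<one>\<^bsub>cocycle_ring\<^esub> \<in> carrier cocycle_ring" by (simp add: cocycle_ring_sel cochain_one cyc_closed(7))
    show "\<Phi> \<one>\<^bsub>cocycle_ring\<^esub> = \<one>\<^bsub>SH\<^esub>"
      using cC[OF cyc_closed(7)] by (simp add: cocycle_ring_sel cochain_one Phi psi_hom(4))
    show "\<Phi> ` carrier cocycle_ring = carrier SH"
      unfolding cocycle_ring_sel image_image psi_surj(1)[symmetric] by (rule image_cong) (simp_all add: Phi cC)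
    show "coboundary KR KA ` cochains KR KA = {f \<in> carrier cocycle_ring. \<Phi> f = \<zero>\<^bsub>SH\<^esub>}"
    proof -
      have "\<Phi> (cochain F) = \<zero>\<^bsub>SH\<^esub> \<longleftrightarrow> F \<in> dif ` carrier CR" if "F \<in> cyc" for F
        using Phi[OF cC[OF that]] psi_hom(7)[OF cC[OF that] cC[OF that]] res_boundary_iff[OF koszul that] by simp
      moreover have "dif ` carrier CR \<subseteq> cyc" using cyc_closed(10) by blast
      ultimately show ?thesis unfolding coboundaries_eq cocycle_ring_sel by blast
    qed
    show "hcomp cocycle_ring n \<subseteq> carrier cocycle_ring" for n
      unfolding cocycle_ring_sel by blast
    show "\<Phi> ` hcomp cocycle_ring n = hcomp SH n" for n
      unfolding cocycle_ring_sel image_image psi_surj(2)[symmetric] by (rule image_cong) (simp_all add: Phi cC)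
  next
    fix f g assume "f \<in> carrier cocycle_ring" "g \<in> carrier cocycle_ring"
    then obtain F G where fg: "f = cochain F" "g = cochain G" and F: "F \<in> cyc" and G: "G \<in> cyc"
      by (auto simp: cocycle_ring_sel)
    note FG = cC[OF F] cC[OF G]
    show "f \<otimes>\<^bsub>cocycle_ring\<^esub> g \<in> carrier cocycle_ring"
      unfolding cocycle_ring_sel fg cochain_mult[OF FG] using cyc_closed(6)[OF F G] by blast
    show "\<Phi> (f \<oplus>\<^bsub>cocycle_ring\<^esub> g) = \<Phi> f \<oplus>\<^bsub>SH\<^esub> \<Phi> g"
      unfolding cocycle_ring_sel fg cochain_add Phi[OF FG(1)] Phi[OF FG(2)] Phi[OF cC[OF cyc_closed(3)[OF F G]]]
      by (rule psi_hom(2)[OF FG])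
    show "\<Phi> (f \<otimes>\<^bsub>cocycle_ring\<^esub> g) = \<Phi> f \<otimes>\<^bsub>SH\<^esub> \<Phi> g"
      unfolding cocycle_ring_sel fg cochain_mult[OF FG] Phi[OF FG(1)] Phi[OF FG(2)] Phi[OF cC[OF cyc_closed(6)[OF F G]]]
      by (rule psi_hom(3)[OF FG])
  next
    fix r f assume r: "r \<in> carrier KR" and "f \<in> carrier cocycle_ring"
    then obtain F where f: "f = cochain F" and F: "F \<in> cyc" by (auto simp: cocycle_ring_sel)
    note FC = cC[OF F]
    show "lact cocycle_ring r f \<in> carrier cocycle_ring" "ract cocycle_ring f r \<in> carrier cocycle_ring"
      unfolding cocycle_ring_sel f cochain_lact cochain_ract[OF r] using cyc_closed(8,9)[OF F] by blast+
    show "\<Phi> (lact cocycle_ring r f) = lact SH r (\<Phi> f)"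
      unfolding cocycle_ring_sel f cochain_lact Phi[OF FC] Phi[OF cC[OF cyc_closed(8)[OF F]]]
      by (rule psi_hom(5)[OF FC FC r])
    show "\<Phi> (ract cocycle_ring f r) = ract SH (\<Phi> f) r"
      unfolding cocycle_ring_sel f cochain_ract[OF r] Phi[OF FC] Phi[OF cC[OF cyc_closed(9)[OF F]]]
      by (rule psi_hom(6)[OF FC FC r])
  qed
  from graded_rring_quotient.descend_iso[OF this] show ?thesis
    unfolding ext_ring_def cocycle_ring_def by blast
qed

end

theorem proposition3p1:
  fixes P :: "'p set" and leq :: "'p rel"
  assumes "koszul_poset TYPE('k::field) TYPE('m) P leq"
  shows "\<exists>\<phi>. \<phi> \<in> graded_rring_iso (base_ring P :: ('p \<Rightarrow> 'k) ring)
                   (ext_ring (base_ring P) (incidence_ring P leq))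
                   (shriek_ring (base_ring P) (incidence_coring P leq))"
proof -
  interpret poset_over_field P leq "TYPE('k)"
    using assms by unfold_locales (simp add: koszul_poset_def)
  have "koszul_ring TYPE('m) KA" using assms by (simp add: koszul_poset_def)
  then show ?thesis by (rule ext_shriek_iso)
qed

end
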